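(* Let $\beta>1$, $\alpha\in(0,1)$ and $f:\mathbb{N}\times\mathbb{R}_+\rightarrow \mathbb{R}$ be such that $f(1,\lambda)\asymp\lambda^\alpha$. Suppose there exist $n_k\nearrow \infty$ and $a_n=n^{1/\alpha}L(n)$ for some slowly varying $L$ such that for any $l \in\mathbb{N}$ and $\lambda>0$, \[-n_k\log\left(\mathbf{E}\left[E^\omega\left[\exp\left(-\frac{\lambda}{a_{n_k}}\eta_0\right)\right]^l\right]\right)\rightarrow f(l,\lambda)\] as $k\rightarrow \infty$. Then, as $k\rightarrow \infty$, $(S_{n_kt}/a_{n_k},X_{a_{n_k}t}/n_k)_{t\geq 0}$ converges in $\mathbb{P}$-distribution on $D_{M_1}\times D_U$ to $(\mathcal{S}_t,\upsilon_\beta\mathcal{S}^{-1}_t)_{t\geq 0}$, where $\upsilon_\beta=(\beta-1)/(\beta+1)$ and $\mathcal{S}_t$ is a Lévy process with Laplace transform \[\mathbb{E}\left[\exp\left(-\lambda\mathcal{S}_t\right)\right]=\exp\left(-t\upsilon_\beta^2\sum_{l=1}^\infty f(l,\lambda)(1-\upsilon_\beta)^{l-1}\right).\] In particular, if the displayed convergence holds along all subsequences $n_k\nearrow\infty$, then $f(l,\lambda)=g(l)\lambda^\alpha$ for some $g\not\equiv0$ and $\mathcal{S}_t$ is an $\alpha$-stable subordinator.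
   Context: One-dimensional randomly trapped random walk (RTRW). Fix a bias $\beta\geq1$ and a law $\pi$ on $(0,\infty)$-valued probability measures. The environment $\omega=(\omega_x)_{x\in\mathbb{Z}}$ has law $\mathbf{P}=\pi^{\otimes\mathbb{Z}}$. Let $(Y_k)_{k\ge0}$ be a random walk on $\mathbb{Z}$ with $Y_0=0$, stepping $-1$ with probability $(\beta+1)^{-1}$ and $+1$ otherwise (its law does not depend on $\omega$). Let $\mathcal{L}(x,n)=\sum_{k=0}^n\mathbf{1}_{\{Y_k=x\}}$. Under the quenched law $P^\omega$ (with expectation $E^\omega$), $(\eta_{x,i})_{x\in\mathbb{Z},i\ge1}$ are independent with $\eta_{x,i}\sim\omega_x$; $\eta_0$ denotes a holding time at site $0$ (law $\omega_0$). The clock process is $S_n=\sum_{x}\sum_{i=1}^{\mathcal{L}(x,n-1)}\eta_{x,i}$, with $S_t=S_{\lfloor t\rfloor}$, inverse $S^{-1}_t=\sup\{k\ge0:S_k\le t\}$, and the RTRW is $X_t=Y_{S^{-1}_t}$. $\mathbb{P}(\cdot)=\int P^\omega(\cdot)\mathbf{P}(d\omega)$ is the annealed law. $a\asymp b$ means $cb\le a\le Cb$ for constants $c,C>0$. $D_U$, $D_{J_1}$, $D_{M_1}$ denote the space of càdlàg functions $[0,\infty)\to\mathbb{R}$ with the uniform, Skorohod $J_1$ and $M_1$ topologies. *)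

theory Defs
  imports "HOL-Probability.Probability"
begin

definition step_pmf :: "real \<Rightarrow> int pmf" where
  "step_pmf \<beta> = map_pmf (\<lambda>b. if b then 1 else -1) (bernoulli_pmf (\<beta> / (\<beta> + 1)))"

definition walk_law :: "real \<Rightarrow> (nat \<Rightarrow> int) measure" where
  "walk_law \<beta> = PiM UNIV (\<lambda>_. measure_pmf (step_pmf \<beta>))"

definition walk :: "(nat \<Rightarrow> int) \<Rightarrow> nat \<Rightarrow> int" where
  "walk \<xi> k = (\<Sum>i<k. \<xi> i)"

text \<open>Annealed law of the holding times: eta x i is the (i+1)-st holding time at site x.
  Given omega, eta_{x,i} are independent with law omega_x; omega_x are i.i.d. with law pi.
  Integrating out omega, the families (eta x i)_i are i.i.d. over x with the law below.\<close>
definition hold_law :: "real measure measure \<Rightarrow> (int \<Rightarrow> nat \<Rightarrow> real) measure" where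
  "hold_law \<pi> = PiM (UNIV :: int set) (\<lambda>_. \<pi> \<bind> (\<lambda>\<mu>. PiM (UNIV :: nat set) (\<lambda>_. \<mu>)))"

definition annealed :: "real \<Rightarrow> real measure measure \<Rightarrow> ((int \<Rightarrow> nat \<Rightarrow> real) \<times> (nat \<Rightarrow> int)) measure" where
  "annealed \<beta> \<pi> = pair_measure (hold_law \<pi>) (walk_law \<beta>)"

definition clock :: "(int \<Rightarrow> nat \<Rightarrow> real) \<Rightarrow> (nat \<Rightarrow> int) \<Rightarrow> nat \<Rightarrow> real" where
  "clock \<eta> \<xi> n = (\<Sum>x\<in>walk \<xi> ` {..<n}. \<Sum>i<card {k. k < n \<and> walk \<xi> k = x}. \<eta> x i)"

definition clock_t :: "(int \<Rightarrow> nat \<Rightarrow> real) \<Rightarrow> (nat \<Rightarrow> int) \<Rightarrow> real \<Rightarrow> real" where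
  "clock_t \<eta> \<xi> t = clock \<eta> \<xi> (nat \<lfloor>t\<rfloor>)"

definition clock_inv :: "(int \<Rightarrow> nat \<Rightarrow> real) \<Rightarrow> (nat \<Rightarrow> int) \<Rightarrow> real \<Rightarrow> nat" where
  "clock_inv \<eta> \<xi> t = Sup {k. clock \<eta> \<xi> k \<le> t}"

definition rtrw :: "(int \<Rightarrow> nat \<Rightarrow> real) \<Rightarrow> (nat \<Rightarrow> int) \<Rightarrow> real \<Rightarrow> int" where
  "rtrw \<eta> \<xi> t = walk \<xi> (clock_inv \<eta> \<xi> t)"

definition rescaled :: "nat \<Rightarrow> real \<Rightarrow> (int \<Rightarrow> nat \<Rightarrow> real) \<times> (nat \<Rightarrow> int) \<Rightarrow> (real \<Rightarrow> real) \<times> (real \<Rightarrow> real)" where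
  "rescaled n a \<omega> = (\<lambda>t. clock_t (fst \<omega>) (snd \<omega>) (real n * t) / a,
                      \<lambda>t. real_of_int (rtrw (fst \<omega>) (snd \<omega>) (a * t)) / real n)"

text \<open>E[ E^omega[exp(-lam/a eta_0)]^l ], written via pi.\<close>
definition laplace_moment :: "real measure measure \<Rightarrow> real \<Rightarrow> real \<Rightarrow> nat \<Rightarrow> real" where
  "laplace_moment \<pi> a lam l = (\<integral>\<mu>. (\<integral>x. exp (- (lam / a) * x) \<partial>\<mu>) ^ l \<partial>\<pi>)"

definition slowly_varying :: "(real \<Rightarrow> real) \<Rightarrow> bool" where
  "slowly_varying L \<longleftrightarrow> L \<in> borel_measurable borel \<and> (\<forall>x>0. 0 < L x) \<and>
     (\<forall>c>0. ((\<lambda>x. L (c * x) / L x) \<longlongrightarrow> 1) at_top)"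

definition cadlag :: "(real \<Rightarrow> real) \<Rightarrow> bool" where
  "cadlag x \<longleftrightarrow> (\<forall>t\<ge>0. (x \<longlongrightarrow> x t) (at_right t)) \<and> (\<forall>t>0. \<exists>l. (x \<longlongrightarrow> l) (at_left t))"

definition left_lim :: "(real \<Rightarrow> real) \<Rightarrow> real \<Rightarrow> real" where
  "left_lim x t = (if t \<le> 0 then x 0 else Lim (at_left t) x)"

definition cgraph :: "real \<Rightarrow> (real \<Rightarrow> real) \<Rightarrow> (real \<times> real) set" where
  "cgraph T x = {(z, t). 0 \<le> t \<and> t \<le> T \<and>
      min (left_lim x t) (x t) \<le> z \<and> z \<le> max (left_lim x t) (x t)}"

definition cgraph_le :: "(real \<Rightarrow> real) \<Rightarrow> real \<times> real \<Rightarrow> real \<times> real \<Rightarrow> bool" where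
  "cgraph_le x p q \<longleftrightarrow> snd p < snd q \<or>
     (snd p = snd q \<and> \<bar>left_lim x (snd p) - fst p\<bar> \<le> \<bar>left_lim x (snd p) - fst q\<bar>)"

definition param_rep :: "real \<Rightarrow> (real \<Rightarrow> real) \<Rightarrow> (real \<Rightarrow> real) \<Rightarrow> (real \<Rightarrow> real) \<Rightarrow> bool" where
  "param_rep T x u r \<longleftrightarrow> continuous_on {0..1} u \<and> continuous_on {0..1} r \<and>
     (\<lambda>s. (u s, r s)) ` {0..1} = cgraph T x \<and>
     (\<forall>s1\<in>{0..1}. \<forall>s2\<in>{0..1}. s1 \<le> s2 \<longrightarrow> cgraph_le x (u s1, r s1) (u s2, r s2))"

definition dM1 :: "real \<Rightarrow> (real \<Rightarrow> real) \<Rightarrow> (real \<Rightarrow> real) \<Rightarrow> real" where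
  "dM1 T x y = Inf {max (Sup ((\<lambda>s. \<bar>u1 s - u2 s\<bar>) ` {0..1})) (Sup ((\<lambda>s. \<bar>r1 s - r2 s\<bar>) ` {0..1})) |
       u1 r1 u2 r2. param_rep T x u1 r1 \<and> param_rep T y u2 r2}"

definition M1_conv :: "(nat \<Rightarrow> real \<Rightarrow> real) \<Rightarrow> (real \<Rightarrow> real) \<Rightarrow> bool" where
  "M1_conv xs x \<longleftrightarrow> (\<forall>T>0. isCont x T \<longrightarrow> (\<lambda>n. dM1 T (xs n) x) \<longlonglongrightarrow> 0)"

definition U_conv :: "(nat \<Rightarrow> real \<Rightarrow> real) \<Rightarrow> (real \<Rightarrow> real) \<Rightarrow> bool" where
  "U_conv xs x \<longleftrightarrow> (\<forall>T\<ge>0. \<forall>e>0. eventually (\<lambda>n. \<forall>t\<in>{0..T}. \<bar>xs n t - x t\<bar> < e) sequentially)"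

text \<open>Continuity on D_M1 x D_U (both metrizable, so sequential continuity).\<close>
definition M1U_continuous :: "((real \<Rightarrow> real) \<times> (real \<Rightarrow> real) \<Rightarrow> real) \<Rightarrow> bool" where
  "M1U_continuous h \<longleftrightarrow> (\<forall>x y xs ys. cadlag x \<and> cadlag y \<and> (\<forall>n. cadlag (xs n) \<and> cadlag (ys n)) \<and>
      M1_conv xs x \<and> U_conv ys y \<longrightarrow> (\<lambda>n. h (xs n, ys n)) \<longlonglongrightarrow> h (x, y))"

definition path_space :: "((real \<Rightarrow> real) \<times> (real \<Rightarrow> real)) measure" where
  "path_space = pair_measure (PiM UNIV (\<lambda>_. borel)) (PiM UNIV (\<lambda>_. borel))"

definition conv_dist_M1U ::
  "(nat \<Rightarrow> 'a measure) \<Rightarrow> (nat \<Rightarrow> 'a \<Rightarrow> (real \<Rightarrow> real) \<times> (real \<Rightarrow> real)) \<Rightarrow>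
   'b measure \<Rightarrow> ('b \<Rightarrow> (real \<Rightarrow> real) \<times> (real \<Rightarrow> real)) \<Rightarrow> bool" where
  "conv_dist_M1U Ms Zs M Z \<longleftrightarrow> (\<forall>h. h \<in> borel_measurable path_space \<and> bounded (range h) \<and> M1U_continuous h \<longrightarrow>
      (\<lambda>k. \<integral>\<omega>. h (Zs k \<omega>) \<partial>Ms k) \<longlonglongrightarrow> (\<integral>\<omega>. h (Z \<omega>) \<partial>M))"

definition levy_laplace :: "'a measure \<Rightarrow> ('a \<Rightarrow> real \<Rightarrow> real) \<Rightarrow> (real \<Rightarrow> real) \<Rightarrow> bool" where
  "levy_laplace M S \<psi> \<longleftrightarrow> prob_space M \<and>
     (\<forall>t. (\<lambda>\<omega>. S \<omega> t) \<in> borel_measurable M) \<and>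
     (\<forall>\<omega>\<in>space M. S \<omega> 0 = 0 \<and> cadlag (S \<omega>)) \<and>
     (\<forall>n (t :: nat \<Rightarrow> real). 0 \<le> t 0 \<and> (\<forall>i. t i \<le> t (Suc i)) \<longrightarrow>
        prob_space.indep_vars M (\<lambda>_. borel) (\<lambda>i \<omega>. S \<omega> (t (Suc i)) - S \<omega> (t i)) {..<n}) \<and>
     (\<forall>s\<ge>0. \<forall>t\<ge>0. distr M borel (\<lambda>\<omega>. S \<omega> (t + s) - S \<omega> t) = distr M borel (\<lambda>\<omega>. S \<omega> s)) \<and>
     (\<forall>t\<ge>0. \<forall>lam>0. (\<integral>\<^sup>+\<omega>. ennreal (exp (- lam * S \<omega> t)) \<partial>M) = ennreal (exp (- t * \<psi> lam)))"

definition cont_inv :: "(real \<Rightarrow> real) \<Rightarrow> real \<Rightarrow> real" where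
  "cont_inv S t = Inf {s. 0 \<le> s \<and> t < S s}"

definition stable_subordinator :: "real \<Rightarrow> 'a measure \<Rightarrow> ('a \<Rightarrow> real \<Rightarrow> real) \<Rightarrow> bool" where
  "stable_subordinator \<alpha> M S \<longleftrightarrow> (\<exists>c>0. levy_laplace M S (\<lambda>lam. c * lam powr \<alpha>)) \<and>
     (AE \<omega> in M. mono_on {0..} (S \<omega>))"

end

theory Submission
  imports Defs
begin

text \<open>Given the walk, the annealed Laplace transform of the weighted clock factorizes over the
  visited sites. One minus the factor of a site telescopes over its visits: each visit contributes
  a difference that depends only on the later visits to the same site. Truncating the future to a
  window of bounded length makes these contributions uncorrelated at a distance, and the number of
  returns is geometric, so a second moment bound identifies the limit of the joint Laplace
  transforms of the clock at dyadic times.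

  The exponentials of the negative rescaled clock at the dyadic times form a point of an infinite
  cube, on which moments determine the convergence of expectations of continuous functions. For
  monotone paths, convergence at the dyadic times implies convergence in M1, and together with the
  law of large numbers for the walk it also implies locally uniform convergence of the walk at the
  inverse clock; an extended continuous mapping argument on the cube transfers this to
  convergence in distribution. The limit process itself is built by Kolmogorov extension over the
  dyadic times from the weak limits of the clock laws. For the last part, comparing the limits
  along multiples of n forces the scaling in lambda.\<close>

section \<open>M1 convergence of monotone paths\<close>

text \<open>Both factors \<open>\<upsilon>\<close> of the exponent have one source. A visit followed
  by j returns costs \<open>F (Suc j) c - F j c\<close> in the limit, where \<open>F\<close> extends
  f, and j returns have limiting probability \<open>\<upsilon> * r ^ j\<close> with r = 1 -
  \<upsilon>; summation by parts then produces the second factor. Only losses of order 1/n survive: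
  the expected number of pairs of visits to a common site is O(n), while a quadratic correction is
  O(n^-2) per pair. The two bounds on \<open>f 1\<close> have different tasks. The upper one makes
  the exponent vanish at 0, so that no mass of the clock escapes to infinity in the weak limits. The
  lower one makes it tend to infinity, so that the limit has strictly increasing unbounded paths.
  Strict increase gives a continuous inverse, the source of locally uniform convergence of the
  inverse clocks. The cube records only the clock. The rescaled walk is deterministic in the limit,
  so it enters as an error functional that vanishes in mean; this replaces a joint limit law of
  clock and walk. Moments on the cube are Laplace transforms with integer weights, which is why
  joint transforms at finitely many dyadic times suffice.\<close>

definition dyad :: "nat \<Rightarrow> real" where
  "dyad i = real (fst (prod_decode i)) / 2 ^ snd (prod_decode i)"

lemma dyad_nonneg: "0 \<le> dyad i"
  by (simp add: dyad_def)

lemma dyad_encode: "dyad (prod_encode (a, n)) = real a / 2 ^ n"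
  by (simp add: dyad_def)

lemma dyad_dense:
  assumes "0 \<le> x" "x < y"
  shows "\<exists>i. x < dyad i \<and> dyad i < y"
proof -
  obtain n where n: "(1/2::real) ^ n < (y - x) / 2"
    using real_arch_pow_inv[of "(y - x)/2" "1/2"] assms by auto
  define a where "a = nat \<lfloor>x * 2 ^ n\<rfloor> + 1"
  have a: "real a \<le> x * 2 ^ n + 1" "x * 2 ^ n < real a"
    using assms by (simp_all add: a_def) linarith+
  have "x < real a / 2 ^ n" using a by (simp add: field_simps)
  moreover have "real a / 2 ^ n \<le> x + (1/2) ^ n" using a by (simp add: field_simps)
  ultimately show ?thesis using n assms
    by (intro exI[of _ "prod_encode (a, n)"]) (simp add: dyad_encode)
qed

lemma left_lim_tendsto:
  assumes "cadlag x" "0 < t"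
  shows "(x \<longlongrightarrow> left_lim x t) (at_left t)"
proof -
  obtain l where "(x \<longlongrightarrow> l) (at_left t)" using assms by (auto simp: cadlag_def)
  moreover from this have "left_lim x t = l"
    using assms by (simp add: left_lim_def tendsto_Lim)
  ultimately show ?thesis by simp
qed

lemma left_lim_bounds:
  assumes "cadlag x" "mono_on {0..} x" "0 \<le> s" "s < t"
  shows "x s \<le> left_lim x t" "left_lim x t \<le> x t"
proof -
  have ev: "\<forall>\<^sub>F u in at_left t. s < u \<and> u < t"
    using assms by (intro eventually_at_leftI[of s]) auto
  have t: "(x \<longlongrightarrow> left_lim x t) (at_left t)" using assms by (intro left_lim_tendsto) auto
  show "x s \<le> left_lim x t"
    by (rule tendsto_lowerbound[OF t]) (use ev assms in \<open>auto elim!: eventually_mono intro!: mono_onD[OF assms(2)]\<close>)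
  show "left_lim x t \<le> x t"
    by (rule tendsto_upperbound[OF t]) (use ev assms in \<open>auto elim!: eventually_mono intro!: mono_onD[OF assms(2)]\<close>)
qed

lemma left_lim_le:
  assumes "cadlag x" "mono_on {0..} x" "0 \<le> t"
  shows "left_lim x t \<le> x t" "x 0 \<le> left_lim x t"
proof -
  show "left_lim x t \<le> x t"
    using left_lim_bounds(2)[OF assms(1,2), of 0 t] assms(3) by (cases "t = 0") (auto simp: left_lim_def)
  show "x 0 \<le> left_lim x t"
    using left_lim_bounds(1)[OF assms(1,2), of 0 t] assms(3) by (cases "t = 0") (auto simp: left_lim_def)
qed

text \<open>The completed graph of a monotone path is parametrized by the sum of its two coordinates,
  which makes both coordinates 1-Lipschitz.\<close>

definition graph_time :: "real \<Rightarrow> (real \<Rightarrow> real) \<Rightarrow> real \<Rightarrow> real" where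
  "graph_time T x s = Sup {t \<in> {0..T}. x t + t \<le> s}"

context
  fixes x :: "real \<Rightarrow> real" and T :: real
  assumes mono: "mono_on {0..} x" and cad: "cadlag x" and x0: "x 0 = 0" and T: "0 < T"
begin

lemma graph_time_set:
  assumes "0 \<le> s"
  shows "{t \<in> {0..T}. x t + t \<le> s} \<noteq> {}" "bdd_above {t \<in> {0..T}. x t + t \<le> s}"
  using assms T x0 by (auto intro!: exI[of _ 0] bdd_aboveI[of _ T])

lemma graph_time_le: "0 \<le> s \<Longrightarrow> graph_time T x s \<le> T"
  unfolding graph_time_def by (rule cSup_least) (use graph_time_set in auto)

lemma graph_time_ge: "0 \<le> s \<Longrightarrow> 0 \<le> t \<Longrightarrow> t \<le> T \<Longrightarrow> x t + t \<le> s \<Longrightarrow> t \<le> graph_time T x s"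
  unfolding graph_time_def by (rule cSup_upper) (use graph_time_set in auto)

lemma graph_time_nonneg: "0 \<le> s \<Longrightarrow> 0 \<le> graph_time T x s"
  using graph_time_ge[of s 0] T x0 by auto

lemma graph_time_less:
  assumes "0 \<le> s" "0 \<le> t" "t < graph_time T x s"
  shows "x t + t < s"
proof -
  obtain t' where "t' \<in> {0..T}" "x t' + t' \<le> s" "t < t'"
    using less_cSupD[OF graph_time_set(1)[OF assms(1)]] assms(3) unfolding graph_time_def by auto
  moreover have "x t \<le> x t'" using calculation assms by (intro mono_onD[OF mono]) auto
  ultimately show ?thesis by auto
qed

lemma graph_time_greater: "0 \<le> s \<Longrightarrow> graph_time T x s < t \<Longrightarrow> t \<le> T \<Longrightarrow> s < x t + t"
  using graph_time_ge[of s t] graph_time_nonneg[of s] by fastforce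

lemma graph_time_mono:
  assumes "0 \<le> s" "s \<le> s'" shows "graph_time T x s \<le> graph_time T x s'"
  unfolding graph_time_def
  by (rule cSup_subset_mono) (use graph_time_set assms in auto)

text \<open>Since \<open>x\<close> is monotone, \<open>x t + t\<close> grows at rate at least 1, so
  its generalized inverse grows at rate at most 1.\<close>

lemma graph_time_lipschitz:
  assumes "0 \<le> s" "s \<le> s'" shows "graph_time T x s' \<le> graph_time T x s + (s' - s)"
proof (rule ccontr)
  assume "\<not> ?thesis"
  then obtain t where t: "t < graph_time T x s'" "graph_time T x s + (s' - s) < t"
    using dense by (metis not_le)
  have g0: "0 \<le> graph_time T x s" using assms graph_time_nonneg by auto
  obtain t0 where t0: "graph_time T x s < t0" "t0 < t - (s' - s)" using t dense by (metis less_diff_eq)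
  have tT: "t \<le> T" using t(1) graph_time_le[of s'] assms by auto
  have "s < x t0 + t0" using t0 tT assms by (intro graph_time_greater) auto
  moreover have "x t + t < s'" using t g0 assms by (intro graph_time_less) auto
  moreover have "x t0 \<le> x t" using t0 g0 assms by (intro mono_onD[OF mono]) auto
  ultimately show False using t0 by auto
qed

lemma graph_time_abs:
  assumes "0 \<le> s" "0 \<le> s'" shows "\<bar>graph_time T x s - graph_time T x s'\<bar> \<le> \<bar>s - s'\<bar>"
  using graph_time_lipschitz[of s s'] graph_time_lipschitz[of s' s] graph_time_mono[of s s'] graph_time_mono[of s' s] assms
  by (cases "s \<le> s'") auto

text \<open>Before the crossing time \<open>r\<close> the sum \<open>x t + t\<close> is at most
  \<open>s\<close>, after it at least \<open>s\<close>; one-sided limits at \<open>r\<close> place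
  \<open>s - r\<close> between the left limit and the value. The end \<open>r = T\<close> is where
  \<open>s \<le> x T + T\<close> enters.\<close>

lemma graph_time_cgraph:
  assumes "0 \<le> s" "s \<le> x T + T"
  defines "r \<equiv> graph_time T x s"
  shows "left_lim x r \<le> s - r" "s - r \<le> x r"
proof -
  have r: "0 \<le> r" "r \<le> T" using assms graph_time_le graph_time_nonneg by auto
  show "left_lim x r \<le> s - r"
  proof (cases "r = 0")
    case True then show ?thesis using x0 assms by (simp add: left_lim_def)
  next
    case False
    then have rp: "0 < r" using r by auto
    have "((\<lambda>t. x t + t) \<longlongrightarrow> left_lim x r + r) (at_left r)"
      by (intro tendsto_intros left_lim_tendsto cad rp)
    moreover have "\<forall>\<^sub>F t in at_left r. x t + t \<le> s"
      using rp graph_time_less[OF assms(1)] by (intro eventually_at_leftI[of 0]) (auto simp: r_def intro: less_imp_le)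
    ultimately have "left_lim x r + r \<le> s" by (rule tendsto_upperbound) auto
    then show ?thesis by simp
  qed
  show "s - r \<le> x r"
  proof (cases "r = T")
    case True then show ?thesis using assms by simp
  next
    case False
    then have rp: "r < T" using r by auto
    have "((\<lambda>t. x t + t) \<longlongrightarrow> x r + r) (at_right r)"
      using cad r by (intro tendsto_intros) (auto simp: cadlag_def)
    moreover have "\<forall>\<^sub>F t in at_right r. s \<le> x t + t"
      using rp graph_time_greater[OF assms(1)] by (intro eventually_at_rightI[of r T]) (auto simp: r_def intro: less_imp_le)
    ultimately have "s \<le> x r + r" by (rule tendsto_lowerbound) auto
    then show ?thesis by simp
  qed
qed

text \<open>Surjectivity of the parametrization: a point of the completed graph is reached at the
  sum of its coordinates.\<close>

lemma graph_time_eq: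
  assumes "0 \<le> t" "t \<le> T" "left_lim x t \<le> z" "z \<le> x t"
  shows "graph_time T x (z + t) = t" "0 \<le> z + t" "z + t \<le> x T + T"
proof -
  have z0: "0 \<le> z" using left_lim_le(2)[OF cad mono assms(1)] assms x0 by auto
  then show s: "0 \<le> z + t" using assms by auto
  show "z + t \<le> x T + T" using assms mono_onD[OF mono, of t T] by auto
  have "t' \<le> graph_time T x (z + t)" if "0 \<le> t'" "t' < t" for t'
    using left_lim_bounds(1)[OF cad mono that] that assms s by (intro graph_time_ge) auto
  then have "t \<le> graph_time T x (z + t)"
    using graph_time_nonneg[OF s] by (meson dense leD leI less_imp_le order_le_less_trans)
  moreover have "graph_time T x (z + t) \<le> t"
  proof (rule ccontr)
    assume *: "\<not> ?thesis"
    then obtain t' where t': "t < t'" "t' < graph_time T x (z + t)" using dense by (metis not_le)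
    have "x t' + t' < z + t" using t' assms s by (intro graph_time_less) auto
    moreover have "x t \<le> x t'" using t' assms by (intro mono_onD[OF mono]) auto
    ultimately show False using t' assms by auto
  qed
  ultimately show "graph_time T x (z + t) = t" by auto
qed

lemma param_rep_graph_time:
  defines "l \<equiv> x T + T"
  shows "param_rep T x (\<lambda>s. s * l - graph_time T x (s * l)) (\<lambda>s. graph_time T x (s * l))"
proof -
  have xT: "0 \<le> x T" using mono_onD[OF mono, of 0 T] x0 T by auto
  then have l: "0 < l" using T by (auto simp: l_def)
  have sl: "0 \<le> s * l" "s * l \<le> l" if "s \<in> {0..1}" for s using that l by (auto simp: mult_left_le_one_le)
  have ll: "min (left_lim x t) (x t) = left_lim x t" "max (left_lim x t) (x t) = x t" if "0 \<le> t" for t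
    using left_lim_le[OF cad mono that] by auto
  have c: "continuous_on {0..1} (\<lambda>s. graph_time T x (s * l))"
    unfolding continuous_on_iff
  proof (intro ballI allI impI)
    fix s e :: real assume *: "s \<in> {0..1}" "0 < e"
    have "dist (graph_time T x (s' * l)) (graph_time T x (s * l)) < e" if "s' \<in> {0..1}" "dist s' s < e / l" for s'
    proof -
      have "\<bar>graph_time T x (s' * l) - graph_time T x (s * l)\<bar> \<le> \<bar>s' * l - s * l\<bar>"
        using sl that * by (intro graph_time_abs) auto
      also have "\<dots> = \<bar>s' - s\<bar> * l" using l by (simp add: abs_mult flip: left_diff_distrib)
      also have "\<dots> < e" using that l by (simp add: dist_real_def field_simps)
      finally show ?thesis by (simp add: dist_real_def)
    qed
    then show "\<exists>d>0. \<forall>x'\<in>{0..1}. dist x' s < d \<longrightarrow> dist (graph_time T x (x' * l)) (graph_time T x (s * l)) < e"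
      using l * by (intro exI[of _ "e / l"]) auto
  qed
  have im: "(\<lambda>s. (s * l - graph_time T x (s * l), graph_time T x (s * l))) ` {0..1} = cgraph T x" (is "?h ` _ = _")
  proof (intro equalityI subsetI)
    fix p assume "p \<in> ?h ` {0..1}"
    then obtain s where s: "s \<in> {0..1}" "p = ?h s" by auto
    show "p \<in> cgraph T x"
      using graph_time_cgraph[of "s * l"] sl[OF s(1)] graph_time_le graph_time_nonneg
      by (auto simp: cgraph_def s(2) ll l_def)
  next
    fix p assume "p \<in> cgraph T x"
    then obtain z t where p: "p = (z, t)" "0 \<le> t" "t \<le> T" "left_lim x t \<le> z" "z \<le> x t"
      by (auto simp: cgraph_def ll)
    note e = graph_time_eq[OF p(2-5)]
    have "p = ?h ((z + t) / l)" using e l p by simp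
    moreover have "(z + t) / l \<in> {0..1}" using e l by (simp add: l_def)
    ultimately show "p \<in> ?h ` {0..1}" by blast
  qed
  \<comment> \<open>On a vertical segment the time is constant, so the space coordinate grows with
    the parameter and starts above the left limit; this is the order required there.\<close>
  have ord: "cgraph_le x (?h s1) (?h s2)" if s: "s1 \<in> {0..1}" "s2 \<in> {0..1}" "s1 \<le> s2" for s1 s2
  proof -
    have le: "s1 * l \<le> s2 * l" using s l by simp
    have "left_lim x (graph_time T x (s1 * l)) \<le> s1 * l - graph_time T x (s1 * l)"
      using graph_time_cgraph[of "s1 * l"] sl[OF s(1)] by (auto simp: l_def)
    then show ?thesis
      using graph_time_mono[OF sl(1)[OF s(1)] le] le by (auto simp: cgraph_le_def)
  qed
  show ?thesis unfolding param_rep_def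
    using c im ord by (auto intro!: continuous_intros)
qed

end

section \<open>The M1 distance of two monotone paths\<close>

lemma dM1_le:
  assumes p: "param_rep T x u1 r1" "param_rep T y u2 r2"
    and e: "\<And>s. s \<in> {0..1} \<Longrightarrow> \<bar>u1 s - u2 s\<bar> \<le> e" "\<And>s. s \<in> {0..1} \<Longrightarrow> \<bar>r1 s - r2 s\<bar> \<le> e"
  shows "0 \<le> dM1 T x y" "dM1 T x y \<le> e"
proof -
  let ?m = "\<lambda>u1 u2 r1 r2 :: real \<Rightarrow> real. max (Sup ((\<lambda>s. \<bar>u1 s - u2 s\<bar>) ` {0..1})) (Sup ((\<lambda>s. \<bar>r1 s - r2 s\<bar>) ` {0..1}))"
  have nn: "0 \<le> ?m u1 u2 r1 r2" if "param_rep T x u1 r1" "param_rep T y u2 r2" for u1 u2 r1 r2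
  proof -
    \<comment> \<open>\<open>Sup\<close> on the reals bounds its elements only for bounded sets;
      continuity on the compact parameter interval provides this. Nonnegativity of all candidates in
      turn bounds the outer \<open>Inf\<close> from below.\<close>
    have "compact ((\<lambda>s. \<bar>u1 s - u2 s\<bar>) ` {0..1})"
      using that by (intro compact_continuous_image continuous_intros) (auto simp: param_rep_def)
    then have "bdd_above ((\<lambda>s. \<bar>u1 s - u2 s\<bar>) ` {0..1})"
      by (intro bounded_imp_bdd_above compact_imp_bounded)
    then have "\<bar>u1 0 - u2 0\<bar> \<le> Sup ((\<lambda>s. \<bar>u1 s - u2 s\<bar>) ` {0..1})"
      by (intro cSup_upper) auto
    then show ?thesis by linarith
  qed
  let ?A = "{?m u1 u2 r1 r2 | u1 r1 u2 r2. param_rep T x u1 r1 \<and> param_rep T y u2 r2}"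
  have A: "?m u1 u2 r1 r2 \<in> ?A" using p by blast
  have nnA: "0 \<le> z" if "z \<in> ?A" for z
    using that nn by (auto simp del: max.bounded_iff)
  show "0 \<le> dM1 T x y" unfolding dM1_def
    by (rule cInf_greatest) (use A nnA in \<open>blast+\<close>)
  have "dM1 T x y \<le> ?m u1 u2 r1 r2" unfolding dM1_def
    by (rule cInf_lower[OF A]) (rule bdd_belowI[OF nnA])
  also have "\<dots> \<le> e"
    by (rule max.boundedI; rule cSUP_least) (use e in auto)
  finally show "dM1 T x y \<le> e" .
qed

text \<open>Closeness at one point of every window of length \<open>e\<close> moves the crossing
  time of a common level by at most \<open>2 * e\<close>. The two parametrizations run over lengths
  \<open>y T + T\<close> and \<open>x T + T\<close>, which costs one more \<open>e\<close> by the
  Lipschitz bound; the space coordinate is the level minus the time and costs a fourth.\<close>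

lemma dM1_close:
  assumes x: "mono_on {0..} x" "cadlag x" "x 0 = 0" and y: "mono_on {0..} y" "cadlag y" "y 0 = 0"
    and T: "0 < T" and e: "0 < e"
    and net: "\<And>a. 0 \<le> a \<Longrightarrow> a + e \<le> T \<Longrightarrow> \<exists>q. a < q \<and> q < a + e \<and> \<bar>y q - x q\<bar> < e"
    and yT: "\<bar>y T - x T\<bar> < e"
  shows "0 \<le> dM1 T y x" "dM1 T y x \<le> 4 * e"
proof -
  have d: "\<bar>graph_time T y s - graph_time T x s\<bar> \<le> 2 * e"
    if s: "0 \<le> s" and x: "mono_on {0..} x" "cadlag x" "x 0 = 0" and y: "mono_on {0..} y" "cadlag y" "y 0 = 0"
    and net: "\<And>a. 0 \<le> a \<Longrightarrow> a + e \<le> T \<Longrightarrow> \<exists>q. a < q \<and> q < a + e \<and> \<bar>y q - x q\<bar> < e" for s x y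
  proof -
    \<comment> \<open>A later crossing of \<open>y\<close> is impossible: just after the crossing of
      \<open>x\<close> a net point \<open>q\<close> has \<open>s < x q + q < y q + q + e\<close>,
      and any \<open>t > q + e\<close> then satisfies \<open>s < y t + t\<close>.\<close>
    have *: "graph_time T y s \<le> graph_time T x s + 2 * e"
      if x: "mono_on {0..} x" "cadlag x" "x 0 = 0" and y: "mono_on {0..} y" "cadlag y" "y 0 = 0"
      and net: "\<And>a. 0 \<le> a \<Longrightarrow> a + e \<le> T \<Longrightarrow> \<exists>q. a < q \<and> q < a + e \<and> \<bar>y q - x q\<bar> < e" for x y
    proof (rule ccontr)
      assume "\<not> ?thesis"
      then obtain t where t: "t < graph_time T y s" "graph_time T x s + 2 * e < t"
        using dense by (metis not_le)
      have g: "0 \<le> graph_time T x s" by (rule graph_time_nonneg[OF x T s])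
      have tT: "t \<le> T" using t graph_time_le[OF y T s] by auto
      obtain q where q: "graph_time T x s < q" "q < graph_time T x s + e" "\<bar>y q - x q\<bar> < e"
        using net[of "graph_time T x s"] g t tT e by auto
      have "s < x q + q" using q t tT e by (intro graph_time_greater[OF x T s]) auto
      moreover have "y q \<le> y t" using q g t e by (intro mono_onD[OF y(1)]) auto
      moreover have "y t + t < s" using t g e by (intro graph_time_less[OF y T s]) auto
      ultimately show False using q t by auto
    qed
    show ?thesis using *[OF x y net] *[OF y x] net by (fastforce simp: abs_minus_commute)
  qed
  let ?lx = "x T + T" and ?ly = "y T + T"
  have l0: "0 \<le> ?lx" "0 \<le> ?ly" using mono_onD[OF x(1), of 0 T] mono_onD[OF y(1), of 0 T] x y T by auto
  have r: "\<bar>graph_time T y (s * ?ly) - graph_time T x (s * ?lx)\<bar> \<le> 3 * e" and l: "\<bar>s * ?ly - s * ?lx\<bar> \<le> e"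
    if s: "s \<in> {0..1}" for s
  proof -
    have "\<bar>s * ?ly - s * ?lx\<bar> = s * \<bar>y T - x T\<bar>" using s by (simp add: abs_mult flip: right_diff_distrib)
    also have "\<dots> \<le> 1 * \<bar>y T - x T\<bar>" using s by (intro mult_right_mono) auto
    finally show l: "\<bar>s * ?ly - s * ?lx\<bar> \<le> e" using yT by simp
    have "\<bar>graph_time T y (s * ?ly) - graph_time T y (s * ?lx)\<bar> \<le> \<bar>s * ?ly - s * ?lx\<bar>"
      using s l0 by (intro graph_time_abs[OF y T]) auto
    moreover have "\<bar>graph_time T y (s * ?lx) - graph_time T x (s * ?lx)\<bar> \<le> 2 * e"
      using s l0 net by (intro d x y) auto
    ultimately show "\<bar>graph_time T y (s * ?ly) - graph_time T x (s * ?lx)\<bar> \<le> 3 * e" using l by linarith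
  qed
  have u: "\<bar>(s * ?ly - graph_time T y (s * ?ly)) - (s * ?lx - graph_time T x (s * ?lx))\<bar> \<le> 4 * e"
    if s: "s \<in> {0..1}" for s
    using r[OF s] l[OF s] by linarith
  have r': "\<bar>graph_time T y (s * ?ly) - graph_time T x (s * ?lx)\<bar> \<le> 4 * e" if s: "s \<in> {0..1}" for s
    using r[OF s] e by linarith
  show "0 \<le> dM1 T y x" "dM1 T y x \<le> 4 * e"
    using dM1_le[OF param_rep_graph_time[OF y T] param_rep_graph_time[OF x T] u r'] by blast+
qed

section \<open>Inverse clocks\<close>

lemma dyadic_net:
  assumes "0 < e"
  obtains N where "\<And>a. 0 \<le> a \<Longrightarrow> a < dyad (prod_encode (nat \<lfloor>a * 2 ^ N\<rfloor> + 1, N)) \<and>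
    dyad (prod_encode (nat \<lfloor>a * 2 ^ N\<rfloor> + 1, N)) < a + e"
proof -
  obtain N where N: "(1/2::real) ^ N < e"
    using real_arch_pow_inv[of e "1/2"] assms by auto
  show thesis
  proof (rule that[of N])
    fix a :: real assume a0: "0 \<le> a"
    define k where "k = nat \<lfloor>a * 2 ^ N\<rfloor> + 1"
    have k: "real k \<le> a * 2 ^ N + 1" "a * 2 ^ N < real k"
      using a0 by (simp_all add: k_def) linarith+
    have "real k / 2 ^ N \<le> a + (1/2) ^ N" using k by (simp add: field_simps)
    moreover have "a < real k / 2 ^ N" using k by (simp add: field_simps)
    ultimately show "a < dyad (prod_encode (nat \<lfloor>a * 2 ^ N\<rfloor> + 1, N)) \<and>
      dyad (prod_encode (nat \<lfloor>a * 2 ^ N\<rfloor> + 1, N)) < a + e"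
      using N unfolding dyad_encode k_def[symmetric] by linarith
  qed
qed

text \<open>The dyadic points of one level up to the horizon are finitely many, so pointwise
  convergence at them is uniform and serves all \<open>a\<close> at once.\<close>

lemma eventually_dyadic_net:
  fixes xs :: "nat \<Rightarrow> real \<Rightarrow> real"
  assumes conv: "\<And>i. (\<lambda>n. xs n (dyad i)) \<longlonglongrightarrow> x (dyad i)" and e: "0 < e"
  shows "\<forall>\<^sub>F n in sequentially. \<forall>a\<in>{0..T}. \<exists>q. a < q \<and> q < a + e \<and> \<bar>xs n q - x q\<bar> < e"
proof -
  obtain N where N: "\<And>a. 0 \<le> a \<Longrightarrow> a < dyad (prod_encode (nat \<lfloor>a * 2 ^ N\<rfloor> + 1, N)) \<and>
    dyad (prod_encode (nat \<lfloor>a * 2 ^ N\<rfloor> + 1, N)) < a + e"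
    using dyadic_net[OF e] by metis
  define K where "K = nat \<lfloor>T * 2 ^ N\<rfloor> + 1"
  have "\<forall>\<^sub>F n in sequentially. \<forall>i\<in>(\<lambda>k. prod_encode (k, N)) ` {..K}. \<bar>xs n (dyad i) - x (dyad i)\<bar> < e"
    by (intro eventually_ball_finite ballI) (use conv e in \<open>auto simp: tendsto_iff dist_real_def\<close>)
  then show ?thesis
  proof eventually_elim
    case (elim n)
    show ?case
    proof
      fix a assume a: "a \<in> {0..T}"
      then have "\<lfloor>a * 2 ^ N\<rfloor> \<le> \<lfloor>T * 2 ^ N\<rfloor>" by (intro floor_mono) auto
      then have "nat \<lfloor>a * 2 ^ N\<rfloor> + 1 \<le> K" by (simp add: K_def nat_mono)
      then show "\<exists>q. a < q \<and> q < a + e \<and> \<bar>xs n q - x q\<bar> < e"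
        using N[of a] a elim by (intro exI[of _ "dyad (prod_encode (nat \<lfloor>a * 2 ^ N\<rfloor> + 1, N))"]) auto
    qed
  qed
qed

text \<open>Monotonicity squeezes \<open>xs n T\<close> between the values at dyadic points on
  either side of \<open>T\<close>, where the limit path is already within \<open>e / 2\<close> of
  \<open>x T\<close>.\<close>

lemma tendsto_at_continuity_point:
  fixes xs :: "nat \<Rightarrow> real \<Rightarrow> real"
  assumes xs: "\<And>n. mono_on {0..} (xs n)"
    and conv: "\<And>i. (\<lambda>n. xs n (dyad i)) \<longlonglongrightarrow> x (dyad i)" and T: "0 < T" "isCont x T"
  shows "(\<lambda>n. xs n T) \<longlonglongrightarrow> x T"
  unfolding tendsto_iff
proof (intro allI impI)
  fix e :: real assume e: "0 < e"
  then obtain d where d: "0 < d" "\<And>u. \<bar>u - T\<bar> < d \<Longrightarrow> \<bar>x u - x T\<bar> < e / 2"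
    using T(2) unfolding continuous_at_eps_delta dist_real_def by (metis half_gt_zero)
  obtain i where i: "max 0 (T - d) < dyad i" "dyad i < T" using dyad_dense[of "max 0 (T - d)" T] T d by auto
  obtain j where j: "T < dyad j" "dyad j < T + d" using dyad_dense[of T "T + d"] T d by auto
  have "\<forall>\<^sub>F n in sequentially. dist (xs n (dyad i)) (x (dyad i)) < e / 2"
    "\<forall>\<^sub>F n in sequentially. dist (xs n (dyad j)) (x (dyad j)) < e / 2"
    using tendstoD[OF conv half_gt_zero[OF e]] by blast+
  then show "\<forall>\<^sub>F n in sequentially. dist (xs n T) (x T) < e"
  proof eventually_elim
    case (elim n)
    have "xs n (dyad i) \<le> xs n T" "xs n T \<le> xs n (dyad j)"
      using i j T by (auto intro!: mono_onD[OF xs])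
    moreover have "\<bar>x (dyad i) - x T\<bar> < e / 2" "\<bar>x (dyad j) - x T\<bar> < e / 2"
      using i j by (intro d(2); simp)+
    ultimately show ?case using elim by (simp add: dist_real_def) argo
  qed
qed

lemma M1_conv_monotone:
  assumes xs: "\<And>n. mono_on {0..} (xs n)" "\<And>n. cadlag (xs n)" "\<And>n. xs n 0 = 0"
    and x: "mono_on {0..} x" "cadlag x" "x 0 = 0"
    and conv: "\<And>i. (\<lambda>n. xs n (dyad i)) \<longlonglongrightarrow> x (dyad i)"
  shows "M1_conv xs x"
  unfolding M1_conv_def
proof (intro allI impI)
  fix T :: real assume T: "0 < T" "isCont x T"
  show "(\<lambda>n. dM1 T (xs n) x) \<longlonglongrightarrow> 0"
    unfolding tendsto_iff
  proof (intro allI impI)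
    fix e :: real assume e: "0 < e"
    \<comment> \<open>\<open>dM1_close\<close> loses a factor 4, and a fifth of \<open>e\<close>
      leaves the final inequality strict.\<close>
    then have e5: "0 < e / 5" by simp
    have "\<forall>\<^sub>F n in sequentially. dist (xs n T) (x T) < e / 5"
      using tendsto_at_continuity_point[OF xs(1) conv T] e5 unfolding tendsto_iff by blast
    with eventually_dyadic_net[of xs x, OF conv e5, of T]
    show "\<forall>\<^sub>F n in sequentially. dist (dM1 T (xs n) x) 0 < e"
    proof eventually_elim
      case (elim n)
      have net: "\<exists>q. a < q \<and> q < a + e / 5 \<and> \<bar>xs n q - x q\<bar> < e / 5" if "0 \<le> a" "a + e / 5 \<le> T" for a
        using elim(1) that e by auto
      have "\<bar>xs n T - x T\<bar> < e / 5" using elim(2) by (simp add: dist_real_def)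
      note dM1_close[OF x xs T(1) e5 net this]
      then show ?case using e by simp
    qed
  qed
qed

text \<open>Below \<open>t\<close> only finitely many values occur, and from the point where the
  largest is attained the function is constant up to \<open>t\<close>.\<close>

lemma mono_nat_left_const:
  fixes N :: "real \<Rightarrow> nat"
  assumes N: "mono_on {0..} N" and t: "0 < t"
  shows "\<exists>m. \<forall>\<^sub>F u in at_left t. N u = m"
proof -
  have fin: "finite (N ` {0..<t})"
    by (rule finite_subset[of _ "{..N t}"]) (auto intro!: mono_onD[OF N])
  have "Max (N ` {0..<t}) \<in> N ` {0..<t}" using fin t by (intro Max_in) auto
  then obtain s where s: "Max (N ` {0..<t}) = N s" "0 \<le> s" "s < t" by auto
  have "N u = N s" if "s < u" "u < t" for u
  proof (rule antisym)
    have "N u \<le> Max (N ` {0..<t})" using s that fin by (intro Max_ge) auto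
    then show "N u \<le> N s" using s by simp
    show "N s \<le> N u" using s that by (auto intro!: mono_onD[OF N])
  qed
  then show ?thesis using s by (intro exI[of _ "N s"] eventually_at_leftI[of s]) auto
qed

text \<open>Serves both coordinates of the rescaled process: the clock is read at a floor, the walk
  at an inverse clock, and any function \<open>F\<close> of an integer step path is cadlag.\<close>

lemma cadlag_compose_nat:
  fixes N :: "real \<Rightarrow> nat"
  assumes N: "mono_on {0..} N" "\<And>t. 0 \<le> t \<Longrightarrow> \<forall>\<^sub>F u in at_right t. N u = N t"
  shows "cadlag (\<lambda>t. F (N t))"
  unfolding cadlag_def
proof (intro conjI allI impI)
  fix t :: real assume "0 \<le> t"
  from N(2)[OF this] show "((\<lambda>t. F (N t)) \<longlongrightarrow> F (N t)) (at_right t)"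
    by (intro tendsto_eventually) (auto elim: eventually_mono)
next
  fix t :: real assume "0 < t"
  from mono_nat_left_const[OF N(1) this] obtain m where m: "\<forall>\<^sub>F u in at_left t. N u = m" by auto
  then show "\<exists>l. ((\<lambda>t. F (N t)) \<longlongrightarrow> l) (at_left t)"
    by (intro exI[of _ "F m"] tendsto_eventually) (auto elim: eventually_mono)
qed

lemma floor_right_const:
  fixes n t :: real
  assumes "0 \<le> n"
  shows "\<forall>\<^sub>F u in at_right t. \<lfloor>n * u\<rfloor> = \<lfloor>n * t\<rfloor>"
proof (cases "n = 0")
  case False
  then have n: "0 < n" using assms by auto
  have "\<lfloor>n * u\<rfloor> = \<lfloor>n * t\<rfloor>" if "t < u" "u < (\<lfloor>n * t\<rfloor> + 1) / n" for u
  proof -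
    have "n * t < n * u" "n * u < \<lfloor>n * t\<rfloor> + 1" using that n by (auto simp: field_simps)
    then show ?thesis by linarith
  qed
  moreover have "n * t < \<lfloor>n * t\<rfloor> + 1" by linarith
  then have "t < (\<lfloor>n * t\<rfloor> + 1) / n" using n by (simp add: field_simps)
  ultimately show ?thesis by (intro eventually_at_rightI[of t "(\<lfloor>n * t\<rfloor> + 1) / n"]) auto
qed auto

lemma nat_floor_mono: "0 \<le> n \<Longrightarrow> mono_on {0..} (\<lambda>t::real. nat \<lfloor>n * t\<rfloor>)"
  by (intro mono_onI nat_mono floor_mono mult_left_mono) auto

section \<open>Inverses of discrete clocks and of strictly increasing paths\<close>

locale unbounded_clock =
  fixes c :: "nat \<Rightarrow> real"
  assumes c0: "c 0 = 0" and c_mono: "mono c" and c_unbounded: "\<And>M. \<exists>j. M < c j"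
begin

definition "cinv t = Sup {j. c j \<le> t}"

text \<open>\<open>Sup\<close> of a set of naturals is its maximum only when the set is finite,
  which unboundedness of the clock guarantees. The equivalence then carries all later reasoning
  about \<open>cinv\<close>.\<close>

lemma le_cinv_iff:
  assumes "0 \<le> t"
  shows "j \<le> cinv t \<longleftrightarrow> c j \<le> t"
proof -
  obtain J where J: "t < c J" using c_unbounded by blast
  have fin: "finite {j. c j \<le> t}"
  proof (rule finite_subset[of _ "{..J}"])
    show "{j. c j \<le> t} \<subseteq> {..J}"
      using J monoD[OF c_mono, of J] by (auto intro!: leI dest: less_imp_le) (meson dual_order.strict_trans1 less_imp_le not_le)
  qed auto
  moreover have ne: "{j. c j \<le> t} \<noteq> {}" using assms c0 by (auto intro!: exI[of _ 0])
  ultimately have "cinv t = Max {j. c j \<le> t}" by (simp only: cinv_def Sup_nat_def if_False)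
  moreover from fin ne have "Max {j. c j \<le> t} \<in> {j. c j \<le> t}" by (rule Max_in)
  ultimately have "c (cinv t) \<le> t" by simp
  moreover have "j \<le> cinv t" if "c j \<le> t" for j
    using fin that by (simp add: \<open>cinv t = _\<close> Max_ge)
  ultimately show ?thesis using monoD[OF c_mono, of j "cinv t"] by auto
qed

lemma cinv_mono: "mono_on {0..} cinv"
proof (rule mono_onI)
  fix s t :: real assume "s \<in> {0..}" "t \<in> {0..}" "s \<le> t"
  then show "cinv s \<le> cinv t" using le_cinv_iff[of s "cinv s"] by (subst le_cinv_iff) auto
qed

lemma cinv_right_const:
  assumes "0 \<le> t"
  shows "\<forall>\<^sub>F u in at_right t. cinv u = cinv t"
proof -
  have t: "t < c (Suc (cinv t))" using le_cinv_iff[OF assms, of "Suc (cinv t)"] by auto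
  have "cinv u = cinv t" if "t < u" "u < c (Suc (cinv t))" for u
  proof (rule antisym)
    show "cinv t \<le> cinv u" using that assms by (intro mono_onD[OF cinv_mono]) auto
    show "cinv u \<le> cinv t" using that assms le_cinv_iff[of u "Suc (cinv t)"] by auto
  qed
  then show ?thesis using t by (intro eventually_at_rightI[of t "c (Suc (cinv t))"]) auto
qed

lemma cadlag_cinv:
  assumes "0 < a"
  shows "cadlag (\<lambda>t. F (cinv (a * t)))"
proof (rule cadlag_compose_nat)
  show "mono_on {0..} (\<lambda>t. cinv (a * t))"
    using assms by (intro mono_onI mono_onD[OF cinv_mono]) auto
  fix t :: real assume t: "0 \<le> t"
  have "filterlim (\<lambda>u. a * u) (at_right (a * t)) (at_right t)"
    using assms by (auto simp: filterlim_at intro!: tendsto_eq_intros eventually_at_rightI[of t "t + 1"])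
  then show "\<forall>\<^sub>F u in at_right t. cinv (a * u) = cinv (a * t)"
    using cinv_right_const[of "a * t"] t assms by (auto simp: filterlim_iff)
qed

end

text \<open>Strict increase excludes flat pieces, which inversion would turn into jumps;
  unboundedness keeps the set under \<open>Inf\<close> in \<open>cont_inv\<close> nonempty. Almost
  every path of the limit process has both properties.\<close>

locale increasing_path =
  fixes s :: "real \<Rightarrow> real"
  assumes s_strict: "\<And>u v. 0 \<le> u \<Longrightarrow> u < v \<Longrightarrow> s u < s v" and s0: "s 0 = 0"
    and s_unbounded: "\<And>M. \<exists>t\<ge>0. M < s t"
begin

lemma s_mono: "mono_on {0..} s"
  using s_strict by (intro mono_onI) (auto simp: le_less)

lemma cont_inv_set:
  "{u. 0 \<le> u \<and> t < s u} \<noteq> {}" "bdd_below {u. 0 \<le> u \<and> t < s u}"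
  using s_unbounded[of t] by (auto intro!: bdd_belowI[of _ 0])

lemma cont_inv_nonneg: "0 \<le> cont_inv s t"
  unfolding cont_inv_def by (rule cInf_greatest) (use cont_inv_set in auto)

lemma less_cont_invD: "0 \<le> u \<Longrightarrow> u < cont_inv s t \<Longrightarrow> s u \<le> t"
  using cInf_lower[OF _ cont_inv_set(2), of u t] unfolding cont_inv_def by fastforce

lemma cont_inv_lessD:
  assumes "cont_inv s t < u" shows "t < s u"
proof -
  obtain v where "0 \<le> v" "t < s v" "v < u"
    using cInf_lessD[OF cont_inv_set(1)] assms unfolding cont_inv_def by blast
  then show ?thesis using s_strict[of v u] by auto
qed

lemma cont_inv_le: "0 \<le> u \<Longrightarrow> t < s u \<Longrightarrow> cont_inv s t \<le> u"
  by (meson less_cont_invD not_le)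

lemma cont_inv_ge: "0 \<le> u \<Longrightarrow> s u \<le> t \<Longrightarrow> u \<le> cont_inv s t"
  by (meson cont_inv_lessD not_le)

lemma cont_inv_mono: "t \<le> t' \<Longrightarrow> cont_inv s t \<le> cont_inv s t'"
  unfolding cont_inv_def[of s t] cont_inv_def[of s t']
  by (rule cInf_superset_mono) (use cont_inv_set in auto)

lemma continuous_cont_inv:
  assumes "0 \<le> t"
  shows "isCont (cont_inv s) t"
  unfolding continuous_at_eps_delta
proof (intro allI impI)
  fix e :: real assume e: "0 < e"
  define v where "v = cont_inv s t"
  have v0: "0 \<le> v" by (simp add: v_def cont_inv_nonneg)
  have up: "t < s (v + e/2)" using e by (intro cont_inv_lessD) (auto simp: v_def)
  have "\<exists>d>0. \<forall>t'. t - d < t' \<longrightarrow> v - e/2 \<le> cont_inv s t'"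
  proof (cases "v - e/2 < 0")
    case True
    then have "v - e/2 \<le> cont_inv s t'" for t' using cont_inv_nonneg[of t'] by linarith
    then show ?thesis by (intro exI[of _ 1]) auto
  next
    case False
    \<comment> \<open>The detour through \<open>v - e/4\<close> turns a weak inequality with
      \<open>t\<close> into the strict \<open>s (v - e/2) < t\<close>, and this gap is the
      admissible distance below \<open>t\<close>.\<close>
    have "s (v - e/2) < s (v - e/4)" using e False by (intro s_strict) auto
    moreover have "s (v - e/4) \<le> t" using e False by (intro less_cont_invD) (auto simp: v_def)
    ultimately show ?thesis using False
      by (intro exI[of _ "t - s (v - e/2)"]) (auto intro!: cont_inv_ge)
  qed
  then obtain d where d: "0 < d" "\<And>t'. t - d < t' \<Longrightarrow> v - e/2 \<le> cont_inv s t'" by blast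
  show "\<exists>d>0. \<forall>x'. dist x' t < d \<longrightarrow> dist (cont_inv s x') (cont_inv s t) < e"
  proof (intro exI[of _ "min d (s (v + e/2) - t)"] conjI allI impI)
    fix t' assume *: "dist t' t < min d (s (v + e/2) - t)"
    have "v - e/2 \<le> cont_inv s t'" using * by (intro d) (auto simp: dist_real_def)
    moreover have "cont_inv s t' \<le> v + e/2" using * v0 e by (intro cont_inv_le) (auto simp: dist_real_def)
    ultimately show "dist (cont_inv s t') (cont_inv s t) < e"
      using e by (simp add: dist_real_def flip: v_def)
  qed (use d up in auto)
qed

lemma cadlag_cont_inv: "cadlag (\<lambda>t. b * cont_inv s t)"
  unfolding cadlag_def
proof (intro conjI allI impI)
  fix t :: real assume "0 \<le> t"
  then have "isCont (\<lambda>t. b * cont_inv s t) t" by (intro continuous_intros continuous_cont_inv)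
  then show "((\<lambda>t. b * cont_inv s t) \<longlongrightarrow> b * cont_inv s t) (at_right t)"
    by (auto simp: isCont_def intro: tendsto_within_subset)
next
  fix t :: real assume "0 < t"
  then have "isCont (\<lambda>t. b * cont_inv s t) t" by (intro continuous_intros continuous_cont_inv) auto
  then show "\<exists>l. ((\<lambda>t. b * cont_inv s t) \<longlongrightarrow> l) (at_left t)"
    by (auto simp: isCont_def intro: tendsto_within_subset)
qed

text \<open>By strict increase the limit path gains at least some \<open>\<delta> > 0\<close> over
  each of finitely many grid cells. A clock within \<open>\<delta>\<close> of it at the grid points
  therefore crosses a level at most a few cells away.\<close>

lemma clock_inv_approx:
  assumes conv: "\<And>i. (\<lambda>k. c k (nat \<lfloor>real (n k) * dyad i\<rfloor>) / a k) \<longlonglongrightarrow> s (dyad i)"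
    and c: "\<And>k. unbounded_clock (c k)" and n: "filterlim n at_top sequentially"
    and a: "\<And>k. 0 < a k" and e: "0 < e"
  shows "\<forall>\<^sub>F k in sequentially. \<forall>t\<in>{0..T}.
    \<bar>real (unbounded_clock.cinv (c k) (a k * t)) / real (n k) - cont_inv s t\<bar> < e"
proof -
  \<comment> \<open>The lower estimate loses four cells: two by the shift to \<open>i'\<close>, one
    by rounding \<open>v\<close> down to the grid, one by \<open>1 / n k\<close>.\<close>
  obtain N where N: "(1/2::real) ^ N < e / 4"
    using real_arch_pow_inv[of "e / 4" "1/2"] e by auto
  define h where "h = (1/2::real) ^ N"
  have h: "0 < h" "4 * h < e" using N by (auto simp: h_def)
  \<comment> \<open>The last cell met is that of \<open>cont_inv s T\<close>, and the upper
    comparison reaches two cells further.\<close>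
  define K where "K = nat \<lfloor>cont_inv s T / h\<rfloor> + 2"
  define \<delta> where "\<delta> = Min ((\<lambda>i. s (real (Suc i) * h) - s (real i * h)) ` {..K})"
  have \<delta>: "\<delta> \<le> s (real (Suc i) * h) - s (real i * h)" if "i \<le> K" for i
    using that by (auto simp: \<delta>_def intro!: Min_le)
  have "0 < \<delta>" unfolding \<delta>_def using h by (subst Min_gr_iff) (auto intro!: s_strict)
  have dy: "dyad (prod_encode (i, N)) = real i * h" for i
    by (simp add: dyad_encode h_def power_divide)
  have ev1: "\<forall>\<^sub>F k in sequentially. \<forall>i\<in>{..K}. \<bar>c k (nat \<lfloor>real (n k) * (real i * h)\<rfloor>) / a k - s (real i * h)\<bar> < \<delta>"
    by (intro eventually_ball_finite ballI)
      (use conv[of "prod_encode (_, N)"] \<open>0 < \<delta>\<close> in \<open>auto simp: dy tendsto_iff dist_real_def\<close>)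
  have "\<forall>\<^sub>F k in sequentially. nat \<lceil>1 / h\<rceil> + 1 \<le> n k" using n by (simp add: filterlim_at_top)
  with ev1 show ?thesis
  proof eventually_elim
    case (elim k)
    interpret unbounded_clock "c k" by (rule c)
    have nk: "0 < real (n k)" "1 / real (n k) < h"
    proof -
      have n1: "1 / h < real (n k)" using elim(2) by linarith
      show nk: "0 < real (n k)" using n1 h by (meson divide_pos_pos less_trans zero_less_one)
      show "1 / real (n k) < h" using n1 h nk by (auto simp: field_simps)
    qed
    show ?case
    proof
      fix t assume t: "t \<in> {0..T}"
      define v where "v = cont_inv s t"
      define i where "i = nat \<lfloor>v / h\<rfloor>"
      define M where "M = cinv (a k * t)"
      have v0: "0 \<le> v" by (simp add: v_def cont_inv_nonneg)
      have i: "real i * h \<le> v" "v < real (Suc i) * h"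
      proof -
        have "0 \<le> v / h" using v0 h by auto
        then have "real i \<le> v / h" "v / h < real i + 1" unfolding i_def by linarith+
        then show "real i * h \<le> v" "v < real (Suc i) * h" using h by (auto simp: field_simps)
      qed
      have iK: "i + 2 \<le> K"
        using t h by (auto simp: i_def K_def v_def intro!: nat_mono floor_mono divide_right_mono cont_inv_mono)
      have Miff: "j \<le> M \<longleftrightarrow> c k j / a k \<le> t" for j
        using t a[of k] by (simp add: M_def le_cinv_iff pos_divide_le_eq mult.commute)
      have up: "real M / real (n k) < v + 3 * h"
      proof -
        let ?j = "nat \<lfloor>real (n k) * (real (i + 2) * h)\<rfloor>"
        have "t < s (real (Suc i) * h)" using i by (intro cont_inv_lessD) (auto simp: v_def)
        also have "\<dots> \<le> s (real (i + 2) * h) - \<delta>" using \<delta>[of "Suc i"] iK by (simp add: algebra_simps)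
        also have "\<dots> < c k ?j / a k" using bspec[OF elim(1), of "i + 2"] iK by auto
        finally have "M < ?j" using Miff[of ?j] by auto
        then have "real M < real (n k) * (real (i + 2) * h)" by linarith
        then have "real M / real (n k) < real (i + 2) * h" using nk by (simp add: field_simps)
        then show ?thesis using i h by (simp add: algebra_simps)
      qed
      have lo: "v - 4 * h < real M / real (n k)"
      proof (cases "i < 2")
        case True
        then have "v - 4 * h < 0" using i h by (auto simp: less_2_cases_iff algebra_simps)
        also have "0 \<le> real M / real (n k)" by simp
        finally show ?thesis .
      next
        case False
        then obtain i' where i': "i = i' + 2" by (metis add.commute le_iff_add not_less)
        let ?j = "nat \<lfloor>real (n k) * (real i' * h)\<rfloor>"
        have "c k ?j / a k < s (real i' * h) + \<delta>" using bspec[OF elim(1), of i'] iK i' by auto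
        also have "\<dots> \<le> s (real (Suc i') * h)" using \<delta>[of i'] iK i' by auto
        also have "\<dots> \<le> t" using i i' h by (intro less_cont_invD) (auto simp: v_def algebra_simps)
        finally have "?j \<le> M" using Miff by auto
        then have "real (n k) * (real i' * h) - 1 \<le> real M" using h by linarith
        then have "(real (n k) * (real i' * h) - 1) / real (n k) \<le> real M / real (n k)"
          by (rule divide_right_mono) simp
        then have "real i' * h - 1 / real (n k) \<le> real M / real (n k)" using nk by (simp add: diff_divide_distrib)
        then show ?thesis using i i' nk by (simp add: algebra_simps)
      qed
      show "\<bar>real (cinv (a k * t)) / real (n k) - cont_inv s t\<bar> < e"
        using up lo h by (auto simp flip: M_def v_def)
    qed
  qed
qed

end

text \<open>The walk moves by at most one per step, so convergence on a finite dyadic net controls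
  all times in between.\<close>

lemma walk_uniform:
  fixes W :: "nat \<Rightarrow> nat \<Rightarrow> int"
  assumes conv: "\<And>i. (\<lambda>k. real_of_int (W k (nat \<lfloor>real (n k) * dyad i\<rfloor>)) / real (n k)) \<longlonglongrightarrow> b * dyad i"
    and W: "\<And>k i j. \<bar>W k i - W k j\<bar> \<le> \<bar>int i - int j\<bar>" and n: "filterlim n at_top sequentially" and e: "0 < e"
  shows "\<forall>\<^sub>F k in sequentially. \<forall>m. real m \<le> T * real (n k) \<longrightarrow>
    \<bar>real_of_int (W k m) / real (n k) - b * (real m / real (n k))\<bar> < e"
proof -
  \<comment> \<open>The errors are below \<open>2 * h\<close> for moving to the net point,
    \<open>h\<close> at the net point and at most \<open>\<bar>b\<bar> * h\<close> for the linear
    limit, together less than \<open>(4 + \<bar>b\<bar>) * h\<close>.\<close>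
  define h where "h = e / (4 + \<bar>b\<bar>)"
  have h: "0 < h" "(4 + \<bar>b\<bar>) * h = e" using e by (auto simp: h_def field_simps add_pos_nonneg)
  have "\<forall>\<^sub>F k in sequentially. nat \<lceil>1 / h\<rceil> + 1 \<le> n k" using n by (simp add: filterlim_at_top)
  with eventually_dyadic_net[of "\<lambda>k u. real_of_int (W k (nat \<lfloor>real (n k) * u\<rfloor>)) / real (n k)" "\<lambda>u. b * u", OF conv h(1), of T]
  show ?thesis
  proof eventually_elim
    case (elim k)
    have n1: "1 / h < real (n k)" using elim(2) by linarith
    have nk: "0 < real (n k)" using n1 h by (meson divide_pos_pos less_trans zero_less_one)
    then have nk: "0 < real (n k)" "1 / real (n k) < h" using n1 h by (auto simp: field_simps)
    show ?case
    proof (intro allI impI)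
      fix m :: nat assume m: "real m \<le> T * real (n k)"
      define u where "u = real m / real (n k)"
      have u: "0 \<le> u" "u \<le> T" "real m = real (n k) * u" using m nk by (auto simp: u_def field_simps)
      obtain q where q: "u < q" "q < u + h"
        "\<bar>real_of_int (W k (nat \<lfloor>real (n k) * q\<rfloor>)) / real (n k) - b * q\<bar> < h"
        using bspec[OF elim(1), of u] u by (meson atLeastAtMost_iff)
      let ?j = "nat \<lfloor>real (n k) * q\<rfloor>"
      have "real (n k) * u \<le> real (n k) * q" "real (n k) * q \<le> real (n k) * (u + h)"
        using q nk by (auto intro!: mult_left_mono)
      moreover have "0 \<le> real (n k) * u" using nk u by simp
      moreover from calculation have "real ?j \<le> real (n k) * q" "real (n k) * q - 1 < real ?j" by linarith+
      ultimately have "\<bar>real m - real ?j\<bar> \<le> real (n k) * h + 1"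
        unfolding u(3) abs_le_iff distrib_left by linarith
      moreover have "\<bar>real_of_int (W k m) - real_of_int (W k ?j)\<bar> \<le> \<bar>real m - real ?j\<bar>"
        using W[of k m ?j] by linarith
      ultimately have "\<bar>real_of_int (W k m) - real_of_int (W k ?j)\<bar> / real (n k) \<le> (real (n k) * h + 1) / real (n k)"
        using nk by (intro divide_right_mono) auto
      also have "\<dots> < 2 * h" using nk by (simp add: add_divide_distrib)
      finally have 1: "\<bar>real_of_int (W k m) / real (n k) - real_of_int (W k ?j) / real (n k)\<bar> < 2 * h"
        using nk by (simp add: abs_divide flip: diff_divide_distrib)
      have "\<bar>b * q - b * u\<bar> = \<bar>b\<bar> * (q - u)" using q by (simp add: abs_mult flip: right_diff_distrib)
      also have "\<dots> \<le> \<bar>b\<bar> * h" using q by (intro mult_left_mono) auto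
      finally have 2: "\<bar>b * q - b * u\<bar> \<le> \<bar>b\<bar> * h" .
      have "\<bar>real_of_int (W k m) / real (n k) - b * u\<bar> < 3 * h + \<bar>b\<bar> * h"
        using 1 2 q(3) by linarith
      also have "\<dots> \<le> e" using h by (simp add: algebra_simps)
      finally show "\<bar>real_of_int (W k m) / real (n k) - b * (real m / real (n k))\<bar> < e"
        by (simp add: u_def)
    qed
  qed
qed

lemma (in increasing_path) U_conv_inverse:
  fixes W :: "nat \<Rightarrow> nat \<Rightarrow> int"
  assumes conv: "\<And>i. (\<lambda>k. c k (nat \<lfloor>real (n k) * dyad i\<rfloor>) / a k) \<longlonglongrightarrow> s (dyad i)"
    and c: "\<And>k. unbounded_clock (c k)" and n: "filterlim n at_top sequentially"
    and a: "\<And>k. 0 < a k"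
    and convW: "\<And>i. (\<lambda>k. real_of_int (W k (nat \<lfloor>real (n k) * dyad i\<rfloor>)) / real (n k)) \<longlonglongrightarrow> b * dyad i"
    and W: "\<And>k i j. \<bar>W k i - W k j\<bar> \<le> \<bar>int i - int j\<bar>"
  shows "U_conv (\<lambda>k t. real_of_int (W k (Sup {j. c k j \<le> a k * t})) / real (n k)) (\<lambda>t. b * cont_inv s t)"
  unfolding U_conv_def
proof (intro allI impI)
  fix T e :: real assume T: "0 \<le> T" and e: "0 < e"
  \<comment> \<open>The cap at 1 keeps the inverse clock below \<open>cont_inv s T + 1\<close>, the
    horizon on which the walk is controlled; the other bound leaves \<open>e / 2\<close> for the
    linear map.\<close>
  define h where "h = min 1 (e / (2 * (1 + \<bar>b\<bar>)))"
  have h: "0 < h" "h \<le> 1" using e by (auto simp: h_def)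
  have "\<bar>b\<bar> * h \<le> \<bar>b\<bar> * (e / (2 * (1 + \<bar>b\<bar>)))" by (intro mult_left_mono) (auto simp: h_def)
  also have "\<dots> \<le> e / 2" using e by (simp add: field_simps)
  finally have bh: "\<bar>b\<bar> * h \<le> e / 2" .
  have "\<forall>\<^sub>F k in sequentially. 1 \<le> n k" using n by (simp add: filterlim_at_top)
  with clock_inv_approx[of c n a, OF conv c n a h(1), of T]
    walk_uniform[of W n b, OF convW W n half_gt_zero[OF e], of "cont_inv s T + 1"]
  show "\<forall>\<^sub>F k in sequentially. \<forall>t\<in>{0..T}.
      \<bar>real_of_int (W k (Sup {j. c k j \<le> a k * t})) / real (n k) - b * cont_inv s t\<bar> < e"
  proof (eventually_elim)
    case (elim k)
    interpret unbounded_clock "c k" by (rule c)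
    show ?case
    proof
      fix t assume t: "t \<in> {0..T}"
      define M where "M = cinv (a k * t)"
      have M: "\<bar>real M / real (n k) - cont_inv s t\<bar> < h" using elim(1) t by (auto simp: M_def)
      have "real M / real (n k) \<le> cont_inv s T + 1" using M h cont_inv_mono[of t T] t by auto
      then have "real M \<le> (cont_inv s T + 1) * real (n k)" using elim(3) by (simp add: field_simps)
      then have 1: "\<bar>real_of_int (W k M) / real (n k) - b * (real M / real (n k))\<bar> < e / 2"
        using elim(2) by auto
      have "\<bar>b * (real M / real (n k)) - b * cont_inv s t\<bar> = \<bar>b\<bar> * \<bar>real M / real (n k) - cont_inv s t\<bar>"
        by (simp only: abs_mult flip: right_diff_distrib)
      also have "\<dots> \<le> \<bar>b\<bar> * h" using M by (intro mult_left_mono) auto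
      finally have "\<bar>b * (real M / real (n k)) - b * cont_inv s t\<bar> \<le> e / 2" using bh by simp
      with 1 have "\<bar>real_of_int (W k M) / real (n k) - b * cont_inv s t\<bar> < e" by argo
      then show "\<bar>real_of_int (W k (Sup {j. c k j \<le> a k * t})) / real (n k) - b * cont_inv s t\<bar> < e"
        by (simp add: M_def cinv_def)
    qed
  qed
qed

section \<open>Moments on the cube\<close>

definition cube :: "(nat \<Rightarrow> real) set" where
  "cube = {x. \<forall>i. x i \<in> {0..1}}"

lemma cube_eq_PiE: "cube = PiE UNIV (\<lambda>_. {0..1})"
  by (auto simp: cube_def PiE_iff)

lemma compact_cube: "compact cube"
proof -
  have "compactin (product_topology (\<lambda>_::nat. euclidean) UNIV) (PiE UNIV (\<lambda>_. {0..1::real}))"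
    unfolding compactin_PiE by auto
  then show ?thesis by (simp add: euclidean_product_topology cube_eq_PiE)
qed

text \<open>Polynomials in finitely many coordinates, the subalgebra for Stone-Weierstrass on the
  cube. The base case is a whole monomial because mixed moments are what is known to converge;
  closure under products is proved afterwards.\<close>

inductive coord_poly :: "((nat \<Rightarrow> real) \<Rightarrow> real) \<Rightarrow> bool" where
  monom: "coord_poly (\<lambda>x. c * (\<Prod>i<N. x i ^ e i))"
| add: "coord_poly f \<Longrightarrow> coord_poly g \<Longrightarrow> coord_poly (\<lambda>x. f x + g x)"

lemma coord_poly_const: "coord_poly (\<lambda>x. c)"
  using monom[of c "\<lambda>_. 0" 0] by simp

lemma coord_poly_coord: "coord_poly (\<lambda>x. x i)"
proof -
  have "(\<Prod>j<Suc i. x j ^ (if j = i then 1 else 0)) = x i" for x :: "nat \<Rightarrow> real"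
    by (simp add: prod.If_cases if_distrib cong: if_cong)
  then show ?thesis using monom[of 1 "\<lambda>j. if j = i then 1 else 0" "Suc i"] by simp
qed

lemma monom_extend:
  fixes x :: "nat \<Rightarrow> real"
  assumes "N \<le> M"
  shows "(\<Prod>i<N. x i ^ e i) = (\<Prod>i<M. x i ^ (if i < N then e i else 0))"
proof -
  have "(\<Prod>i<M. x i ^ (if i < N then e i else 0)) = (\<Prod>i<N. x i ^ (if i < N then e i else 0))"
    by (rule prod.mono_neutral_right) (use assms in auto)
  then show ?thesis by simp
qed

lemma coord_poly_mult:
  assumes "coord_poly f" "coord_poly g"
  shows "coord_poly (\<lambda>x. f x * g x)"
  using assms
proof (induction f)
  case (monom c e N)
  from monom show ?case
  proof (induction g)
    case (monom c' e' N')
    let ?M = "max N N'"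
    let ?a = "\<lambda>i. if i < N then e i else 0" and ?b = "\<lambda>i. if i < N' then e' i else 0"
    have "c * (\<Prod>i<N. x i ^ e i) * (c' * (\<Prod>i<N'. x i ^ e' i)) =
      c * c' * (\<Prod>i<?M. x i ^ (?a i + ?b i))" for x
    proof -
      have "(\<Prod>i<?M. x i ^ (?a i + ?b i)) = (\<Prod>i<?M. x i ^ ?a i) * (\<Prod>i<?M. x i ^ ?b i)"
        by (simp only: power_add prod.distrib)
      then show ?thesis
        using monom_extend[of N ?M x e] monom_extend[of N' ?M x e'] by simp
    qed
    moreover have "coord_poly (\<lambda>x. c * c' * (\<Prod>i<?M. x i ^ (?a i + ?b i)))" by (rule coord_poly.monom)
    ultimately show ?case by (simp only:)
  next
    case (add f g)
    then show ?case by (simp add: distrib_left coord_poly.add)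
  qed
next
  case (add f g)
  then show ?case by (simp add: distrib_right coord_poly.add)
qed

lemma coord_poly_continuous: "coord_poly f \<Longrightarrow> continuous_on S f"
proof (induction rule: coord_poly.induct)
  case (monom c e N)
  show ?case
    by (intro continuous_intros) (auto intro: continuous_on_subset[OF continuous_on_product_coordinates])
qed (auto intro: continuous_intros)

lemma coord_poly_dense:
  assumes "continuous_on cube \<phi>" "0 < \<epsilon>"
  shows "\<exists>g. coord_poly g \<and> (\<forall>x\<in>cube. \<bar>\<phi> x - g x\<bar> < \<epsilon>)"
proof (rule Stone_Weierstrass_HOL[OF compact_cube])
  fix x y :: "nat \<Rightarrow> real" assume "x \<in> cube \<and> y \<in> cube \<and> x \<noteq> y"
  then obtain i where "x i \<noteq> y i" by auto
  then show "\<exists>f. coord_poly f \<and> f x \<noteq> f y" by (intro exI[of _ "\<lambda>x. x i"]) (auto simp: coord_poly_coord)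
qed (use assms in \<open>auto intro: coord_poly_const coord_poly_continuous coord_poly_mult coord_poly.add\<close>)

text \<open>Membership in the cube is only almost sure because holding times are positive only
  almost surely.\<close>

definition cube_rv :: "'a measure \<Rightarrow> ('a \<Rightarrow> nat \<Rightarrow> real) \<Rightarrow> bool" where
  "cube_rv M A \<longleftrightarrow> prob_space M \<and> (\<forall>i. (\<lambda>\<omega>. A \<omega> i) \<in> borel_measurable M) \<and> (AE \<omega> in M. A \<omega> \<in> cube)"

lemma cube_rv_measurable: "cube_rv M A \<Longrightarrow> A \<in> borel_measurable M"
  by (auto simp: cube_rv_def intro: measurable_coordinatewise_then_product)

lemma cube_rv_integrable:
  assumes "cube_rv M A" "continuous_on UNIV \<phi>"
  shows "integrable M (\<lambda>\<omega>. \<phi> (A \<omega>) :: real)"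
proof -
  interpret prob_space M using assms by (simp add: cube_rv_def)
  have "compact (\<phi> ` cube)"
    by (rule compact_continuous_image[OF continuous_on_subset[OF assms(2)] compact_cube]) auto
  then obtain B where B: "\<And>x. x \<in> cube \<Longrightarrow> norm (\<phi> x) \<le> B"
    using compact_imp_bounded bounded_iff by (metis image_eqI)
  show ?thesis
  proof (rule integrable_const_bound[of _ B])
    show "AE \<omega> in M. norm (\<phi> (A \<omega>)) \<le> B" using assms(1) B by (auto simp: cube_rv_def elim: eventually_mono)
    show "(\<lambda>\<omega>. \<phi> (A \<omega>)) \<in> borel_measurable M"
      by (rule measurable_compose[OF cube_rv_measurable[OF assms(1)] borel_measurable_continuous_onI[OF assms(2)]])
  qed
qed

text \<open>Moment convergence extends linearly to \<open>coord_poly\<close>; a uniform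
  approximation of the test function on the cube costs a third of the error under each of the two
  laws.\<close>

lemma cube_moments_conv:
  fixes \<phi> :: "(nat \<Rightarrow> real) \<Rightarrow> real"
  assumes A: "\<And>k. cube_rv (M k) (A k)" "cube_rv M0 A0"
    and mom: "\<And>N e. (\<lambda>k. \<integral>\<omega>. (\<Prod>i<N. A k \<omega> i ^ e i) \<partial>M k) \<longlonglongrightarrow> (\<integral>\<omega>. (\<Prod>i<N. A0 \<omega> i ^ e i) \<partial>M0)"
    and \<phi>: "continuous_on UNIV \<phi>"
  shows "(\<lambda>k. \<integral>\<omega>. \<phi> (A k \<omega>) \<partial>M k) \<longlonglongrightarrow> (\<integral>\<omega>. \<phi> (A0 \<omega>) \<partial>M0)"
proof -
  have poly: "(\<lambda>k. \<integral>\<omega>. g (A k \<omega>) \<partial>M k) \<longlonglongrightarrow> (\<integral>\<omega>. g (A0 \<omega>) \<partial>M0)" if "coord_poly g" for g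
    using that
  proof (induction rule: coord_poly.induct)
    case (monom c e N)
    then show ?case using tendsto_mult_left[OF mom[of e N], of c] by simp
  next
    case (add f g)
    have "integrable (M k) (\<lambda>\<omega>. f (A k \<omega>))" "integrable (M k) (\<lambda>\<omega>. g (A k \<omega>))"
      "integrable M0 (\<lambda>\<omega>. f (A0 \<omega>))" "integrable M0 (\<lambda>\<omega>. g (A0 \<omega>))" for k
      using cube_rv_integrable[OF A(1) coord_poly_continuous] cube_rv_integrable[OF A(2) coord_poly_continuous] add
      by blast+
    then show ?case using tendsto_add[OF add.IH] by simp
  qed
  have close: "\<bar>(\<integral>\<omega>. \<phi> (A \<omega>) \<partial>M) - (\<integral>\<omega>. g (A \<omega>) \<partial>M)\<bar> \<le> \<epsilon>"
    if A: "cube_rv M A" and g: "coord_poly g" "\<And>x. x \<in> cube \<Longrightarrow> \<bar>\<phi> x - g x\<bar> < \<epsilon>" for M :: "'z measure" and A g \<epsilon>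
  proof -
    interpret prob_space M using A by (simp add: cube_rv_def)
    have i: "integrable M (\<lambda>\<omega>. \<phi> (A \<omega>))" "integrable M (\<lambda>\<omega>. g (A \<omega>))"
      using cube_rv_integrable[OF A \<phi>] cube_rv_integrable[OF A coord_poly_continuous[OF g(1)]] by auto
    have "\<bar>(\<integral>\<omega>. \<phi> (A \<omega>) \<partial>M) - (\<integral>\<omega>. g (A \<omega>) \<partial>M)\<bar> \<le> (\<integral>\<omega>. \<bar>\<phi> (A \<omega>) - g (A \<omega>)\<bar> \<partial>M)"
      using integral_abs_bound[of M "\<lambda>\<omega>. \<phi> (A \<omega>) - g (A \<omega>)"]
      unfolding Bochner_Integration.integral_diff[OF i] .
    also have "\<dots> \<le> (\<integral>\<omega>. \<epsilon> \<partial>M)"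
      using i A g(2) by (intro integral_mono_AE) (auto simp: cube_rv_def elim!: eventually_mono intro: less_imp_le)
    also have "\<dots> = \<epsilon>" by (simp add: prob_space)
    finally show ?thesis .
  qed
  show ?thesis unfolding tendsto_iff
  proof (intro allI impI)
    fix \<epsilon> :: real assume "0 < \<epsilon>"
    then obtain g where g: "coord_poly g" "\<And>x. x \<in> cube \<Longrightarrow> \<bar>\<phi> x - g x\<bar> < \<epsilon> / 3"
      using coord_poly_dense[of \<phi> "\<epsilon> / 3"] continuous_on_subset[OF \<phi>] by auto
    have "\<forall>\<^sub>F k in sequentially. dist (\<integral>\<omega>. g (A k \<omega>) \<partial>M k) (\<integral>\<omega>. g (A0 \<omega>) \<partial>M0) < \<epsilon> / 3"
      by (rule tendstoD[OF poly[OF g(1)]]) (use \<open>0 < \<epsilon>\<close> in simp)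
    then show "\<forall>\<^sub>F k in sequentially. dist (\<integral>\<omega>. \<phi> (A k \<omega>) \<partial>M k) (\<integral>\<omega>. \<phi> (A0 \<omega>) \<partial>M0) < \<epsilon>"
    proof eventually_elim
      case (elim k)
      with close[OF A(1)[of k] g] close[OF A(2) g] show ?case unfolding dist_real_def by linarith
    qed
  qed
qed

text \<open>Moments fix the integrals of continuous functions; these approximate indicators of open
  sets, an intersection-stable generator of the Borel sets.\<close>

lemma cube_moments_unique:
  assumes A: "cube_rv M A" and B: "cube_rv M' B"
    and mom: "\<And>N e. (\<integral>\<omega>. (\<Prod>i<N. A \<omega> i ^ e i) \<partial>M) = (\<integral>\<omega>. (\<Prod>i<N. B \<omega> i ^ e i) \<partial>M')"
  shows "distr M borel A = distr M' borel B"
proof -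
  have cont: "(\<integral>\<omega>. \<phi> (A \<omega>) \<partial>M) = (\<integral>\<omega>. \<phi> (B \<omega>) \<partial>M')" if "continuous_on UNIV \<phi>" for \<phi> :: "_ \<Rightarrow> real"
  proof -
    \<comment> \<open>Equality of integrals is read off from the convergence lemma applied to a
      constant sequence.\<close>
    have "(\<lambda>k::nat. \<integral>\<omega>. \<phi> (A \<omega>) \<partial>M) \<longlonglongrightarrow> (\<integral>\<omega>. \<phi> (B \<omega>) \<partial>M')"
      by (rule cube_moments_conv[OF A B _ that]) (simp add: mom)
    then show ?thesis using LIMSEQ_unique tendsto_const by blast
  qed
  interpret M: prob_space M using A by (simp add: cube_rv_def)
  interpret M': prob_space M' using B by (simp add: cube_rv_def)
  note rv[measurable] = cube_rv_measurable[OF A] cube_rv_measurable[OF B]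
  interpret D: prob_space "distr M borel A" by (rule M.prob_space_distr) simp
  interpret D': prob_space "distr M' borel B" by (rule M'.prob_space_distr) simp
  have open_eq: "emeasure (distr M borel A) U = emeasure (distr M' borel B) U" if U: "open U" for U
  \<comment> \<open>\<open>infdist\<close> to the empty set is 0, so the approximation by distances
    to the complement has to exclude \<open>UNIV\<close>.\<close>
  proof (cases "U = UNIV")
    case True
    then show ?thesis using D.emeasure_space_1 D'.emeasure_space_1 by simp
  next
    case False
    define \<phi> where "\<phi> n x = min 1 (real n * infdist x (- U))" for n x
    have c: "continuous_on UNIV (\<phi> n)" for n
      unfolding \<phi>_def by (intro continuous_intros)
    have lim: "(\<lambda>n. \<phi> n x) \<longlonglongrightarrow> indicat_real U x" for x
    proof (cases "x \<in> U")
      case True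
      have "infdist x (- U) \<noteq> 0"
        using in_closed_iff_infdist_zero[of "- U" x] U False True by (auto simp: closed_Compl)
      then have p: "0 < infdist x (- U)" using infdist_nonneg[of x "- U"] by linarith
      obtain n0 where n0: "1 / infdist x (- U) < real n0" using reals_Archimedean2 by blast
      have "\<phi> n x = 1" if "n \<ge> n0" for n
      proof -
        have "1 / infdist x (- U) < real n" using n0 that by linarith
        then show ?thesis using p by (simp add: \<phi>_def field_simps)
      qed
      then have "\<forall>\<^sub>F n in sequentially. \<phi> n x = 1" by (auto simp: eventually_sequentially)
      then show ?thesis using True by (simp add: tendsto_eventually)
    next
      case False
      then show ?thesis by (simp add: \<phi>_def)
    qed
    have I: "(\<lambda>n. \<integral>\<omega>. \<phi> n (A \<omega>) \<partial>M) \<longlonglongrightarrow> (\<integral>\<omega>. indicat_real U (A \<omega>) \<partial>M)"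
      if "prob_space M" "A \<in> borel_measurable M" for M :: "'z measure" and A
    proof -
      interpret prob_space M by fact
      note that(2)[measurable]
      note borel_measurable_continuous_onI[OF c, measurable]
      note borel_open[OF U, measurable]
      have b: "\<bar>\<phi> n x\<bar> \<le> 1" for n x by (auto simp: \<phi>_def infdist_nonneg)
      show ?thesis
      proof (rule integral_dominated_convergence[where w = "\<lambda>_. 1"])
        show "AE x in M. (\<lambda>n. \<phi> n (A x)) \<longlonglongrightarrow> indicat_real U (A x)" using lim by (intro AE_I2) blast
        show "AE x in M. norm (\<phi> n (A x)) \<le> 1" for n using b by simp
      qed measurable
    qed
    have "(\<lambda>n. \<integral>\<omega>. \<phi> n (A \<omega>) \<partial>M) \<longlonglongrightarrow> (\<integral>\<omega>. indicat_real U (B \<omega>) \<partial>M')"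
      unfolding cont[OF c] by (rule I[OF M'.prob_space_axioms rv(2)])
    then have "(\<integral>\<omega>. indicat_real U (A \<omega>) \<partial>M) = (\<integral>\<omega>. indicat_real U (B \<omega>) \<partial>M')"
      by (rule LIMSEQ_unique[OF I[OF M.prob_space_axioms rv(1)]])
    moreover have ind: "(\<integral>\<omega>. indicat_real U (A \<omega>) \<partial>M) = measure (distr M borel A) U"
      if "A \<in> borel_measurable M" for M :: "'z measure" and A
    proof -
      have "(\<integral>\<omega>. indicat_real U (A \<omega>) \<partial>M) = (\<integral>x. indicat_real U x \<partial>distr M borel A)"
        using that U by (intro integral_distr[symmetric]) auto
      also have "\<dots> = measure (distr M borel A) U" by simp
      finally show ?thesis .
    qed
    ultimately have "measure (distr M borel A) U = measure (distr M' borel B) U"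
      using ind[OF rv(1)] ind[OF rv(2)] by simp
    then show ?thesis by (simp add: D.emeasure_eq_measure D'.emeasure_eq_measure)
  qed
  show ?thesis
  proof (rule measure_eqI_generator_eq[where E = "{S. open S}" and \<Omega> = UNIV and A = "\<lambda>_::nat. UNIV"])
    show "Int_stable {S :: (nat \<Rightarrow> real) set. open S}" by (auto simp: Int_stable_def)
    show "emeasure (distr M borel A) UNIV \<noteq> \<infinity>" by (simp add: D.emeasure_eq_measure)
    show "emeasure (distr M borel A) X = emeasure (distr M' borel B) X" if "X \<in> {S. open S}" for X
      using that open_eq by blast
  qed (simp_all add: sets_borel)
qed

text \<open>The penalized supremum in the proof is a Lipschitz upper envelope of all
  functionals with index at least j; it turns convergence of moments into convergence of
  functionals that are only asymptotically continuous.\<close>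

lemma asymptotic_continuous_mapping_upper:
  fixes G e :: "nat \<Rightarrow> 'a \<Rightarrow> real" and G0 :: "'b \<Rightarrow> real" and M :: "nat \<Rightarrow> 'a measure"
  assumes A: "\<And>k. cube_rv (M k) (A k)" "cube_rv M0 A0"
    and mom: "\<And>N e. (\<lambda>k. \<integral>\<omega>. (\<Prod>i<N. A k \<omega> i ^ e i) \<partial>M k) \<longlonglongrightarrow> (\<integral>\<omega>. (\<Prod>i<N. A0 \<omega> i ^ e i) \<partial>M0)"
    and e: "\<And>k. e k \<in> borel_measurable (M k)" "\<And>k \<omega>. 0 \<le> e k \<omega>" "\<And>k \<omega>. e k \<omega> \<le> 1"
      "(\<lambda>k. \<integral>\<omega>. e k \<omega> \<partial>M k) \<longlonglongrightarrow> 0"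
    and G: "\<And>k. G k \<in> borel_measurable (M k)" "\<And>k \<omega>. \<bar>G k \<omega>\<bar> \<le> B"
      "G0 \<in> borel_measurable M0" "\<And>\<omega>. \<bar>G0 \<omega>\<bar> \<le> B"
    and good: "\<And>k. AE \<omega> in M k. good k \<omega>" "AE \<omega> in M0. good0 \<omega>"
    and key: "\<And>r w v. good0 v \<Longrightarrow> (\<And>j. j \<le> r j) \<Longrightarrow> (\<And>j. good (r j) (w j)) \<Longrightarrow>
      (\<lambda>j. A (r j) (w j)) \<longlonglongrightarrow> A0 v \<Longrightarrow> (\<lambda>j. e (r j) (w j)) \<longlonglongrightarrow> 0 \<Longrightarrow>
      (\<lambda>j. G (r j) (w j)) \<longlonglongrightarrow> G0 v"
    and \<epsilon>: "0 < \<epsilon>"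
  shows "\<forall>\<^sub>F k in sequentially. (\<integral>\<omega>. G k \<omega> \<partial>M k) < (\<integral>\<omega>. G0 \<omega> \<partial>M0) + \<epsilon>"
proof -
  have B: "0 \<le> B" using G(4) abs_ge_zero order_trans by blast
  \<comment> \<open>The inserted \<open>- B\<close> keeps the set nonempty and its supremum at least
    \<open>- B\<close>. The growing penalty forces near-maximizers at a given code to have codes
    close to it and small errors \<open>e\<close>.\<close>
  define E where "E j a = insert (- B) {G m w - real j * (dist a (A m w) + e m w) | m w. j \<le> m \<and> good m w}" for j a
  define \<phi> where "\<phi> j a = Sup (E j a)" for j a
  have E_le: "x \<le> B" if "x \<in> E j a" for x j a
  proof -
    have "G m w - real j * (dist a (A m w) + e m w) \<le> B" for m w
    proof -
      have "0 \<le> real j * (dist a (A m w) + e m w)" using e(2)[of m w] by simp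
      then show ?thesis using G(2)[of m w] by linarith
    qed
    then show ?thesis using that B by (auto simp: E_def)
  qed
  have bdd: "bdd_above (E j a)" for j a by (rule bdd_aboveI[OF E_le])
  have ne: "E j a \<noteq> {}" for j a by (simp add: E_def)
  have \<phi>B: "\<phi> j a \<le> B" "- B \<le> \<phi> j a" for j a
    unfolding \<phi>_def by (rule cSup_least[OF ne E_le], assumption) (rule cSup_upper[OF _ bdd], simp add: E_def)
  have \<phi>_ub: "G m w - real j * (dist a (A m w) + e m w) \<le> \<phi> j a" if "j \<le> m" "good m w" for j m w a
    unfolding \<phi>_def by (rule cSup_upper[OF _ bdd]) (use that in \<open>unfold E_def, blast\<close>)
  have lip: "\<phi> j a \<le> \<phi> j b + real j * dist a b" for j a b
    unfolding \<phi>_def[of j a]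
  proof (rule cSup_least[OF ne])
    fix x assume "x \<in> E j a"
    then consider "x = - B" | m w where "x = G m w - real j * (dist a (A m w) + e m w)" "j \<le> m" "good m w"
      by (auto simp: E_def)
    then show "x \<le> \<phi> j b + real j * dist a b"
    proof cases
      case 1
      then show ?thesis using \<phi>B(2)[of j b] by (simp add: add_increasing2)
    next
      case 2
      have "real j * dist b (A m w) \<le> real j * (dist a b + dist a (A m w))"
        using dist_triangle[of b "A m w" a] by (intro mult_left_mono) (simp_all add: dist_commute)
      then show ?thesis using 2 \<phi>_ub[OF 2(2,3), of b] by (simp add: algebra_simps)
    qed
  qed
  have cont: "continuous_on UNIV (\<phi> j)" for j
    unfolding continuous_on_iff
  proof (intro ballI allI impI)
    fix a :: "nat \<Rightarrow> real" and \<delta> :: real assume "0 < \<delta>"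
    have "dist (\<phi> j b) (\<phi> j a) < \<delta>" if "dist b a < \<delta> / (real j + 1)" for b
    proof -
      have "\<bar>\<phi> j b - \<phi> j a\<bar> \<le> real j * dist b a"
        using lip[of j a b] lip[of j b a] by (simp add: abs_le_iff dist_commute)
      also have "\<dots> \<le> (real j + 1) * dist b a" by (intro mult_right_mono) auto
      also have "\<dots> < \<delta>" using that by (simp add: field_simps)
      finally show ?thesis by (simp add: dist_real_def)
    qed
    then show "\<exists>d>0. \<forall>x'\<in>UNIV. dist x' a < d \<longrightarrow> dist (\<phi> j x') (\<phi> j a) < \<delta>"
      using \<open>0 < \<delta>\<close> by (intro exI[of _ "\<delta> / (real j + 1)"]) auto
  qed
  have dec: "\<phi> j' a \<le> \<phi> j a" if "j \<le> j'" for j j' a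
    unfolding \<phi>_def[of j' a]
  proof (rule cSup_least[OF ne])
    fix x assume "x \<in> E j' a"
    then consider "x = - B" | m w where "x = G m w - real j' * (dist a (A m w) + e m w)" "j' \<le> m" "good m w"
      by (auto simp: E_def)
    then show "x \<le> \<phi> j a"
    proof cases
      case 1
      then show ?thesis using \<phi>B(2)[of j a] by simp
    next
      case 2
      have "real j * (dist a (A m w) + e m w) \<le> real j' * (dist a (A m w) + e m w)"
        using that e(2) by (intro mult_right_mono) auto
      moreover have "G m w - real j * (dist a (A m w) + e m w) \<le> \<phi> j a"
        using 2 that by (intro \<phi>_ub) auto
      ultimately show ?thesis using 2 by linarith
    qed
  qed
  have lim: "\<forall>\<^sub>F j in sequentially. \<phi> j (A0 v) < G0 v + \<delta>" if v: "good0 v" and \<delta>: "0 < \<delta>" for v \<delta>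
  proof (rule ccontr)
    assume "\<not> ?thesis"
    then have "\<exists>j'\<ge>j. G0 v + \<delta> \<le> \<phi> j' (A0 v)" for j
      by (auto simp: eventually_sequentially not_less)
    then have ge: "G0 v + \<delta> \<le> \<phi> j (A0 v)" for j using dec order_trans by blast
    \<comment> \<open>A near-maximizer cannot be the inserted value, since
      \<open>- B \<le> G0 v\<close>. The sequence of near-maximizers is then fed to
      \<open>key\<close>, which contradicts the gap \<open>\<delta> / 2\<close>.\<close>
    have "\<exists>m w. j \<le> m \<and> good m w \<and> G0 v + \<delta> / 2 < G m w - real j * (dist (A0 v) (A m w) + e m w)" for j
    proof -
      have "G0 v + \<delta> / 2 < \<phi> j (A0 v)" using ge[of j] \<delta> by linarith
      then obtain x where x: "x \<in> E j (A0 v)" "G0 v + \<delta> / 2 < x"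
        unfolding \<phi>_def using less_cSupD[OF ne] by blast
      moreover have "x \<noteq> - B" using x(2) G(4)[of v] \<delta> by auto
      ultimately show ?thesis by (auto simp: E_def)
    qed
    then obtain r w where rw: "\<And>j. j \<le> r j" "\<And>j. good (r j) (w j)"
      "\<And>j. G0 v + \<delta> / 2 < G (r j) (w j) - real j * (dist (A0 v) (A (r j) (w j)) + e (r j) (w j))"
      by metis
    define s where "s j = dist (A0 v) (A (r j) (w j)) + e (r j) (w j)" for j
    have s0: "0 \<le> s j" for j by (simp add: s_def e)
    have "real j * s j \<le> 2 * B" for j
      using rw(3)[of j] G(2)[of "r j" "w j"] G(4)[of v] \<delta> by (simp add: s_def abs_le_iff)
    then have sb: "s j \<le> 2 * B / real j" if "0 < j" for j using that by (simp add: field_simps)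
    have "s \<longlonglongrightarrow> 0"
    proof (rule tendsto_sandwich[of "\<lambda>_. 0" s sequentially "\<lambda>j. 2 * B / real j"])
      show "\<forall>\<^sub>F n in sequentially. s n \<le> 2 * B / real n"
        using eventually_gt_at_top[of 0] by eventually_elim (rule sb)
    qed (auto simp: s0 intro!: tendsto_divide_0 filterlim_real_sequentially tendsto_const filterlim_at_top_imp_at_infinity)
    moreover have "dist (A (r j) (w j)) (A0 v) \<le> s j" "e (r j) (w j) \<le> s j" for j
      using e(2)[of "r j" "w j"] by (simp_all add: s_def dist_commute)
    ultimately have "(\<lambda>j. dist (A (r j) (w j)) (A0 v)) \<longlonglongrightarrow> 0" "(\<lambda>j. e (r j) (w j)) \<longlonglongrightarrow> 0"
      using e(2) by (auto intro: tendsto_sandwich[of "\<lambda>_. 0" _ sequentially s])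
    then have "(\<lambda>j. G (r j) (w j)) \<longlonglongrightarrow> G0 v"
      using key[OF v rw(1,2)] tendsto_dist_iff[of "\<lambda>j. A (r j) (w j)" "A0 v"] by blast
    moreover have "G0 v + \<delta> / 2 \<le> G (r j) (w j)" for j
    proof -
      have "0 \<le> real j * s j" using s0 by simp
      then show ?thesis using rw(3)[of j] unfolding s_def by linarith
    qed
    ultimately have "G0 v + \<delta> / 2 \<le> G0 v" by (intro tendsto_lowerbound[of _ _ sequentially]) auto
    then show False using \<delta> by simp
  qed
  interpret M0: prob_space M0 using A by (simp add: cube_rv_def)
  have i0: "integrable M0 (\<lambda>v. \<phi> j (A0 v))" for j by (rule cube_rv_integrable[OF A(2) cont])
  \<comment> \<open>Only an upper bound on the limit of \<open>\<phi> j (A0 v)\<close> is available;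
    the maximum with \<open>G0 v\<close> turns it into pointwise convergence, so dominated
    convergence applies.\<close>
  have "(\<lambda>j. \<integral>v. max (\<phi> j (A0 v)) (G0 v) \<partial>M0) \<longlonglongrightarrow> (\<integral>v. G0 v \<partial>M0)"
  proof (rule integral_dominated_convergence[where w = "\<lambda>_. B"])
    show "AE v in M0. (\<lambda>j. max (\<phi> j (A0 v)) (G0 v)) \<longlonglongrightarrow> G0 v"
      using good(2)
    proof eventually_elim
      case (elim v)
      show ?case unfolding tendsto_iff
      proof (intro allI impI)
        fix \<delta> :: real assume "0 < \<delta>"
        from lim[OF elim this] show "\<forall>\<^sub>F j in sequentially. dist (max (\<phi> j (A0 v)) (G0 v)) (G0 v) < \<delta>"
          by eventually_elim (use \<open>0 < \<delta>\<close> in \<open>auto simp: dist_real_def\<close>)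
      qed
    qed
    have "\<bar>max (\<phi> j (A0 v)) (G0 v)\<bar> \<le> B" for j v
      using \<phi>B[of j "A0 v"] G(4)[of v] by (auto simp: abs_le_iff max_def)
    then show "AE v in M0. norm (max (\<phi> j (A0 v)) (G0 v)) \<le> B" for j by simp
    show "(\<lambda>v. max (\<phi> j (A0 v)) (G0 v)) \<in> borel_measurable M0" for j
      using i0[of j] G(3) by (intro borel_measurable_max) auto
  qed (use G(3) in auto)
  then have "\<forall>\<^sub>F j in sequentially. (\<integral>v. max (\<phi> j (A0 v)) (G0 v) \<partial>M0) < (\<integral>v. G0 v \<partial>M0) + \<epsilon> / 2"
    using \<epsilon> by (intro order_tendstoD(2)) auto
  then obtain j where j: "(\<integral>v. max (\<phi> j (A0 v)) (G0 v) \<partial>M0) < (\<integral>v. G0 v \<partial>M0) + \<epsilon> / 2"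
    by (auto simp: eventually_sequentially)
  have iG0: "integrable M0 G0" by (rule M0.integrable_const_bound[of _ B]) (use G in auto)
  have "(\<integral>v. \<phi> j (A0 v) \<partial>M0) \<le> (\<integral>v. max (\<phi> j (A0 v)) (G0 v) \<partial>M0)"
    using i0 iG0 by (intro integral_mono) auto
  with j have j2: "(\<integral>v. \<phi> j (A0 v) \<partial>M0) < (\<integral>v. G0 v \<partial>M0) + \<epsilon> / 2" by linarith
  have "(\<lambda>k. (\<integral>\<omega>. \<phi> j (A k \<omega>) \<partial>M k) + real j * (\<integral>\<omega>. e k \<omega> \<partial>M k)) \<longlonglongrightarrow> (\<integral>v. \<phi> j (A0 v) \<partial>M0) + real j * 0"
    by (intro tendsto_intros cube_moments_conv[OF A mom cont] e)
  then have "\<forall>\<^sub>F k in sequentially. (\<integral>\<omega>. \<phi> j (A k \<omega>) \<partial>M k) + real j * (\<integral>\<omega>. e k \<omega> \<partial>M k) < (\<integral>v. G0 v \<partial>M0) + \<epsilon>"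
    using \<epsilon> j2 by (intro order_tendstoD(2)) auto
  with eventually_ge_at_top[of j] show ?thesis
  proof eventually_elim
    case (elim k)
    interpret prob_space "M k" using A(1)[of k] by (simp add: cube_rv_def)
    have i: "integrable (M k) (\<lambda>\<omega>. \<phi> j (A k \<omega>))" "integrable (M k) (e k)" "integrable (M k) (G k)"
    proof -
      show "integrable (M k) (\<lambda>\<omega>. \<phi> j (A k \<omega>))" by (rule cube_rv_integrable[OF A(1) cont])
      show "integrable (M k) (e k)" by (rule integrable_const_bound[of _ 1]) (use e in auto)
      show "integrable (M k) (G k)" by (rule integrable_const_bound[of _ B]) (use G in auto)
    qed
    have "G k \<omega> \<le> \<phi> j (A k \<omega>) + real j * e k \<omega>" if "good k \<omega>" for \<omega>
      using \<phi>_ub[OF elim(1) that, of "A k \<omega>"] by simp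
    then have "(\<integral>\<omega>. G k \<omega> \<partial>M k) \<le> (\<integral>\<omega>. \<phi> j (A k \<omega>) + real j * e k \<omega> \<partial>M k)"
      using i good(1)[of k] by (intro integral_mono_AE) (auto elim!: eventually_mono)
    also have "\<dots> = (\<integral>\<omega>. \<phi> j (A k \<omega>) \<partial>M k) + real j * (\<integral>\<omega>. e k \<omega> \<partial>M k)"
      using i by simp
    finally show ?case using elim(2) by linarith
  qed
qed

text \<open>The one-sided bound for \<open>G\<close> and for \<open>- G\<close>. The code
  \<open>A\<close> need not determine \<open>G\<close>; what it misses is controlled through
  \<open>e\<close>, which vanishes in mean.\<close>

lemma asymptotic_continuous_mapping:
  fixes G e :: "nat \<Rightarrow> 'a \<Rightarrow> real" and G0 :: "'b \<Rightarrow> real" and M :: "nat \<Rightarrow> 'a measure"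
  assumes A: "\<And>k. cube_rv (M k) (A k)" "cube_rv M0 A0"
    and mom: "\<And>N e. (\<lambda>k. \<integral>\<omega>. (\<Prod>i<N. A k \<omega> i ^ e i) \<partial>M k) \<longlonglongrightarrow> (\<integral>\<omega>. (\<Prod>i<N. A0 \<omega> i ^ e i) \<partial>M0)"
    and e: "\<And>k. e k \<in> borel_measurable (M k)" "\<And>k \<omega>. 0 \<le> e k \<omega>" "\<And>k \<omega>. e k \<omega> \<le> 1"
      "(\<lambda>k. \<integral>\<omega>. e k \<omega> \<partial>M k) \<longlonglongrightarrow> 0"
    and G: "\<And>k. G k \<in> borel_measurable (M k)" "\<And>k \<omega>. \<bar>G k \<omega>\<bar> \<le> B"
      "G0 \<in> borel_measurable M0" "\<And>\<omega>. \<bar>G0 \<omega>\<bar> \<le> B"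
    and good: "\<And>k. AE \<omega> in M k. good k \<omega>" "AE \<omega> in M0. good0 \<omega>"
    and key: "\<And>r w v. good0 v \<Longrightarrow> (\<And>j. j \<le> r j) \<Longrightarrow> (\<And>j. good (r j) (w j)) \<Longrightarrow>
      (\<lambda>j. A (r j) (w j)) \<longlonglongrightarrow> A0 v \<Longrightarrow> (\<lambda>j. e (r j) (w j)) \<longlonglongrightarrow> 0 \<Longrightarrow>
      (\<lambda>j. G (r j) (w j)) \<longlonglongrightarrow> G0 v"
  shows "(\<lambda>k. \<integral>\<omega>. G k \<omega> \<partial>M k) \<longlonglongrightarrow> (\<integral>\<omega>. G0 \<omega> \<partial>M0)"
  unfolding tendsto_iff
proof (intro allI impI)
  fix \<epsilon> :: real assume \<epsilon>: "0 < \<epsilon>"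
  have "\<forall>\<^sub>F k in sequentially. (\<integral>\<omega>. G k \<omega> \<partial>M k) < (\<integral>\<omega>. G0 \<omega> \<partial>M0) + \<epsilon>"
    by (rule asymptotic_continuous_mapping_upper[OF A mom e G good key \<epsilon>])
  moreover have "\<forall>\<^sub>F k in sequentially. (\<integral>\<omega>. - G k \<omega> \<partial>M k) < (\<integral>\<omega>. - G0 \<omega> \<partial>M0) + \<epsilon>"
  proof (rule asymptotic_continuous_mapping_upper[OF A mom e _ _ _ _ good _ \<epsilon>, where B = B])
    show "(\<lambda>j. - G (r j) (w j)) \<longlonglongrightarrow> - G0 v"
      if "good0 v" "\<And>j. j \<le> r j" "\<And>j. good (r j) (w j)"
        "(\<lambda>j. A (r j) (w j)) \<longlonglongrightarrow> A0 v" "(\<lambda>j. e (r j) (w j)) \<longlonglongrightarrow> 0" for r w v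
      by (rule tendsto_minus[OF key[OF that]])
  qed (simp_all add: G)
  ultimately show "\<forall>\<^sub>F k in sequentially. dist (\<integral>\<omega>. G k \<omega> \<partial>M k) (\<integral>\<omega>. G0 \<omega> \<partial>M0) < \<epsilon>"
    by eventually_elim (simp add: dist_real_def abs_less_iff)
qed

section \<open>The biased walk\<close>

lemma measurable_sum_count_space:
  fixes f :: "'i \<Rightarrow> 'a \<Rightarrow> 'b::{countable, comm_monoid_add}"
  assumes "\<And>i. i \<in> I \<Longrightarrow> f i \<in> measurable M (count_space UNIV)"
  shows "(\<lambda>x. \<Sum>i\<in>I. f i x) \<in> measurable M (count_space UNIV)"
  using assms
proof (induction I rule: infinite_finite_induct)
  case (insert i I)
  have [measurable]: "f i \<in> measurable M (count_space UNIV)" "(\<lambda>x. \<Sum>i\<in>I. f i x) \<in> measurable M (count_space UNIV)"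
    using insert by auto
  have "(\<lambda>x. f i x + (\<Sum>i\<in>I. f i x)) \<in> measurable M (count_space UNIV)"
    by measurable
  then show ?case using insert by simp
qed auto

lemma ennreal_combination:
  "0 \<le> a \<Longrightarrow> 0 \<le> b \<Longrightarrow> 0 \<le> c \<Longrightarrow> 0 \<le> d \<Longrightarrow>
    ennreal a * ennreal b + ennreal c * ennreal d = ennreal (a * b + c * d)"
  by (simp add: ennreal_mult ennreal_plus)

locale biased_walk =
  fixes \<beta> :: real
  assumes \<beta>: "1 < \<beta>"
begin

definition "\<upsilon> = (\<beta> - 1) / (\<beta> + 1)"
text \<open>The probability of ever returning to the starting point: a step right followed by a
  return of probability 1/\<beta>, or a step left followed by a certain return. Hence
  \<open>\<upsilon>\<close> is both the speed and the escape probability.\<close>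

definition "r = 2 / (\<beta> + 1)"

lemma \<upsilon>_eq: "\<upsilon> = 1 - r"
  using \<beta> by (simp add: \<upsilon>_def r_def field_simps)

lemma \<upsilon>_bounds: "0 < \<upsilon>" "\<upsilon> < 1" "0 < r" "r < 1"
  using \<beta> by (auto simp: \<upsilon>_def r_def field_simps)

abbreviation "W \<equiv> walk_law \<beta>"

sublocale sequence_space "measure_pmf (step_pmf \<beta>)"
  by unfold_locales

sublocale W: prob_space W
  unfolding walk_law_def by (rule prob_space_axioms)

lemma space_W[simp]: "space W = UNIV"
  by (auto simp: walk_law_def space_PiM)

lemma emeasure_W_UNIV[simp]: "emeasure W UNIV = 1" and prob_W_UNIV[simp]: "W.prob UNIV = 1"
  using W.emeasure_space_1 W.prob_space by simp_all

lemma UNIV_sets_W[simp]: "UNIV \<in> sets W"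
  using sets.top[of W] by simp

lemma measurable_step[measurable]: "(\<lambda>\<xi>. \<xi> i) \<in> measurable W (count_space UNIV)"
proof -
  have "(\<lambda>\<xi>. \<xi> i) \<in> measurable W (measure_pmf (step_pmf \<beta>))"
    unfolding walk_law_def by (rule measurable_component_singleton) simp
  then show ?thesis by simp
qed

lemma measurable_into_W:
  assumes "\<And>i. (\<lambda>x. f x i) \<in> measurable M (count_space UNIV)"
  shows "f \<in> measurable M W"
  unfolding walk_law_def
  by (rule measurable_PiM_single') (use assms in \<open>auto simp: measurable_pmf_measure2\<close>)

lemma measurable_case_nat_W: "(\<lambda>\<xi>. case_nat s \<xi>) \<in> measurable W W"
proof (rule measurable_into_W)
  fix i show "(\<lambda>\<xi>. case_nat s \<xi> i) \<in> measurable W (count_space UNIV)"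
    by (cases i) auto
qed

lemma measurable_shift: "(\<lambda>\<xi> i. \<xi> (m + i)) \<in> measurable W W"
  by (rule measurable_into_W) auto

lemma measurable_walk[measurable]: "(\<lambda>\<xi>. walk \<xi> k) \<in> measurable W (count_space UNIV)"
  unfolding walk_def by (rule measurable_sum_count_space) auto

lemma measurable_real_walk[measurable]: "(\<lambda>\<xi>. real_of_int (walk \<xi> k)) \<in> borel_measurable W"
  by (rule measurable_compose[OF measurable_walk]) simp

lemma walk_0[simp]: "walk \<xi> 0 = 0"
  by (simp add: walk_def)

lemma walk_case_nat[simp]: "walk (case_nat s \<xi>) (Suc g) = s + walk \<xi> g"
  by (simp add: walk_def sum.lessThan_Suc_shift del: sum.lessThan_Suc)

lemma walk_shift: "walk \<xi> (m + g) = walk \<xi> m + walk (\<lambda>i. \<xi> (m + i)) g"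
  by (induction g) (simp_all add: walk_def)

text \<open>The Markov property at time 1, from splitting the sequence space into its first
  coordinate and the rest.\<close>

lemma nn_integral_first_step:
  assumes f[measurable]: "f \<in> borel_measurable W"
  shows "(\<integral>\<^sup>+\<xi>. f \<xi> \<partial>W) = ennreal (\<beta> / (\<beta> + 1)) * (\<integral>\<^sup>+\<xi>. f (case_nat 1 \<xi>) \<partial>W) +
    ennreal (1 / (\<beta> + 1)) * (\<integral>\<^sup>+\<xi>. f (case_nat (-1) \<xi>) \<partial>W)"
proof -
  let ?M = "measure_pmf (step_pmf \<beta>)"
  have m: "(\<lambda>(s, \<xi>). case_nat s \<xi>) \<in> measurable (?M \<Otimes>\<^sub>M W) W"
    unfolding walk_law_def by measurable
  have mf: "(\<lambda>(s, \<xi>). f (case_nat s \<xi>)) \<in> borel_measurable (?M \<Otimes>\<^sub>M W)"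
    using measurable_compose[OF m f] by (simp add: split_beta')
  have "(\<integral>\<^sup>+\<xi>. f \<xi> \<partial>W) = (\<integral>\<^sup>+\<xi>. f \<xi> \<partial>distr (?M \<Otimes>\<^sub>M W) W (\<lambda>(s, \<xi>). case_nat s \<xi>))"
    unfolding walk_law_def by (subst PiM_iter) simp
  also have "\<dots> = (\<integral>\<^sup>+p. f (case p of (s, \<xi>) \<Rightarrow> case_nat s \<xi>) \<partial>(?M \<Otimes>\<^sub>M W))"
    by (subst nn_integral_distr[OF m]) simp_all
  also have "\<dots> = (\<integral>\<^sup>+p. (\<lambda>(s, \<xi>). f (case_nat s \<xi>)) p \<partial>(?M \<Otimes>\<^sub>M W))"
    by (simp add: split_beta')
  also have "\<dots> = (\<integral>\<^sup>+s. \<integral>\<^sup>+\<xi>. f (case_nat s \<xi>) \<partial>W \<partial>?M)"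
    by (subst W.nn_integral_fst[symmetric, OF mf]) simp
  also have "\<dots> = (\<integral>\<^sup>+b. \<integral>\<^sup>+\<xi>. f (case_nat (if b then 1 else -1) \<xi>) \<partial>W \<partial>measure_pmf (bernoulli_pmf (\<beta> / (\<beta> + 1))))"
    by (simp add: step_pmf_def)
  also have "\<dots> = ennreal (\<beta> / (\<beta> + 1)) * (\<integral>\<^sup>+\<xi>. f (case_nat 1 \<xi>) \<partial>W) +
    ennreal (1 / (\<beta> + 1)) * (\<integral>\<^sup>+\<xi>. f (case_nat (-1) \<xi>) \<partial>W)"
  proof -
    have "1 - \<beta> / (\<beta> + 1) = 1 / (\<beta> + 1)" using \<beta> by (simp add: field_simps)
    then show ?thesis
      using \<beta> by (subst nn_integral_bernoulli_pmf) (auto simp: mult.commute)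
  qed
  finally show ?thesis .
qed

lemma prob_first_step:
  assumes Q: "Measurable.pred W Q"
  shows "W.prob {\<xi>. Q \<xi>} = \<beta> / (\<beta> + 1) * W.prob {\<xi>. Q (case_nat 1 \<xi>)} +
    1 / (\<beta> + 1) * W.prob {\<xi>. Q (case_nat (-1) \<xi>)}"
proof -
  note Q[measurable]
  have s: "{\<xi>. Q (h \<xi>)} \<in> W.events" if "h \<in> measurable W W" for h
    using measurable_sets[OF measurable_compose[OF that Q], of "{True}"] by (simp add: vimage_def)
  have e: "(\<integral>\<^sup>+\<xi>. indicator {\<xi>. Q \<xi>} (h \<xi>) \<partial>W) = ennreal (W.prob {\<xi>. Q (h \<xi>)})" if "h \<in> measurable W W" for h
  proof -
    have "(\<integral>\<^sup>+\<xi>. indicator {\<xi>. Q \<xi>} (h \<xi>) \<partial>W) = (\<integral>\<^sup>+\<xi>. indicator {\<xi>. Q (h \<xi>)} \<xi> \<partial>W)"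
      by (intro nn_integral_cong) (auto simp: indicator_def)
    then show ?thesis using s[OF that] by (simp add: W.emeasure_eq_measure)
  qed
  have "ennreal (W.prob {\<xi>. Q \<xi>}) = (\<integral>\<^sup>+\<xi>. indicator {\<xi>. Q \<xi>} \<xi> \<partial>W)"
    using e[of "\<lambda>\<xi>. \<xi>"] by simp
  also have "\<dots> = ennreal (\<beta> / (\<beta> + 1)) * ennreal (W.prob {\<xi>. Q (case_nat 1 \<xi>)}) +
    ennreal (1 / (\<beta> + 1)) * ennreal (W.prob {\<xi>. Q (case_nat (-1) \<xi>)})"
    using s[of "\<lambda>\<xi>. \<xi>"] by (subst nn_integral_first_step) (auto simp: e measurable_case_nat_W)
  also have "\<dots> = ennreal (\<beta> / (\<beta> + 1) * W.prob {\<xi>. Q (case_nat 1 \<xi>)} + 1 / (\<beta> + 1) * W.prob {\<xi>. Q (case_nat (-1) \<xi>)})"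
    using \<beta> by (intro ennreal_combination) auto
  finally show ?thesis using \<beta> by (subst (asm) ennreal_inj) auto
qed

text \<open>The free offset \<open>x\<close> absorbs the first step and makes the induction close;
  \<open>1 - \<upsilon>\<^sup>2\<close> is the variance of one step.\<close>

lemma second_moment:
  "(\<integral>\<^sup>+\<xi>. ennreal ((x + real_of_int (walk \<xi> n) - \<upsilon> * real n)\<^sup>2) \<partial>W) = ennreal (x\<^sup>2 + real n * (1 - \<upsilon>\<^sup>2))"
proof (induction n arbitrary: x)
  case 0
  then show ?case by (simp add: W.emeasure_space_1)
next
  case (Suc n)
  have nn: "0 \<le> 1 - \<upsilon>\<^sup>2" using \<upsilon>_bounds by (simp add: power_le_one)
  have m: "(\<lambda>\<xi>. ennreal ((x + real_of_int (walk \<xi> (Suc n)) - \<upsilon> * real (Suc n))\<^sup>2)) \<in> borel_measurable W"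
    by measurable
  have shift: "x + real_of_int (s + walk \<xi> n) - \<upsilon> * real (Suc n) =
      (x + real_of_int s - \<upsilon>) + real_of_int (walk \<xi> n) - \<upsilon> * real n" for s \<xi>
    by (simp add: algebra_simps)
  have "(\<integral>\<^sup>+\<xi>. ennreal ((x + real_of_int (walk \<xi> (Suc n)) - \<upsilon> * real (Suc n))\<^sup>2) \<partial>W) =
    ennreal (\<beta> / (\<beta> + 1)) * (\<integral>\<^sup>+\<xi>. ennreal (((x + real_of_int 1 - \<upsilon>) + real_of_int (walk \<xi> n) - \<upsilon> * real n)\<^sup>2) \<partial>W) +
    ennreal (1 / (\<beta> + 1)) * (\<integral>\<^sup>+\<xi>. ennreal (((x + real_of_int (-1) - \<upsilon>) + real_of_int (walk \<xi> n) - \<upsilon> * real n)\<^sup>2) \<partial>W)"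
    unfolding nn_integral_first_step[OF m] walk_case_nat shift ..
  also have "\<dots> = ennreal (\<beta> / (\<beta> + 1)) * ennreal ((x + 1 - \<upsilon>)\<^sup>2 + real n * (1 - \<upsilon>\<^sup>2)) +
    ennreal (1 / (\<beta> + 1)) * ennreal ((x - 1 - \<upsilon>)\<^sup>2 + real n * (1 - \<upsilon>\<^sup>2))"
    by (simp only: Suc.IH) simp
  also have "\<dots> = ennreal (\<beta> / (\<beta> + 1) * ((x + 1 - \<upsilon>)\<^sup>2 + real n * (1 - \<upsilon>\<^sup>2)) +
    1 / (\<beta> + 1) * ((x - 1 - \<upsilon>)\<^sup>2 + real n * (1 - \<upsilon>\<^sup>2)))"
    using \<beta> nn by (intro ennreal_combination) auto
  also have "\<beta> / (\<beta> + 1) * ((x + 1 - \<upsilon>)\<^sup>2 + real n * (1 - \<upsilon>\<^sup>2)) +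
    1 / (\<beta> + 1) * ((x - 1 - \<upsilon>)\<^sup>2 + real n * (1 - \<upsilon>\<^sup>2)) = x\<^sup>2 + real (Suc n) * (1 - \<upsilon>\<^sup>2)"
  proof -
    define p where "p = \<beta> / (\<beta> + 1)"
    have q: "1 / (\<beta> + 1) = 1 - p" and u: "\<upsilon> = 2 * p - 1" using \<beta> by (auto simp: p_def \<upsilon>_def field_simps)
    show ?thesis unfolding p_def[symmetric] q u by (simp add: power2_eq_square algebra_simps)
  qed
  finally show ?case .
qed

lemma prob_deviation:
  assumes "0 < d"
  shows "W.prob {\<xi>. d \<le> \<bar>real_of_int (walk \<xi> n) - \<upsilon> * real n\<bar>} \<le> real n / d\<^sup>2"
proof -
  let ?u = "\<lambda>\<xi>. ennreal ((real_of_int (walk \<xi> n) - \<upsilon> * real n)\<^sup>2)"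
  have "emeasure W {\<xi>\<in>space W. 1 \<le> ennreal (1 / d\<^sup>2) * ?u \<xi>} \<le> ennreal (1 / d\<^sup>2) * (\<integral>\<^sup>+\<xi>. ?u \<xi> \<partial>W)"
    by (rule order_trans[OF nn_integral_Markov_inequality]) auto
  also have "\<dots> = ennreal (1 / d\<^sup>2 * (real n * (1 - \<upsilon>\<^sup>2)))"
  proof -
    have "(\<integral>\<^sup>+\<xi>. ?u \<xi> \<partial>W) = ennreal (real n * (1 - \<upsilon>\<^sup>2))" using second_moment[of 0 n] by simp
    then show ?thesis by (simp only:) (rule ennreal_mult'[symmetric], simp)
  qed
  also have "\<dots> \<le> ennreal (real n / d\<^sup>2)"
    using assms \<upsilon>_bounds by (intro ennreal_leI) (auto simp: field_simps mult_left_le)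
  finally have "emeasure W {\<xi>\<in>space W. 1 \<le> ennreal (1 / d\<^sup>2) * ?u \<xi>} \<le> ennreal (real n / d\<^sup>2)" .
  moreover have "{\<xi>\<in>space W. 1 \<le> ennreal (1 / d\<^sup>2) * ?u \<xi>} = {\<xi>. d \<le> \<bar>real_of_int (walk \<xi> n) - \<upsilon> * real n\<bar>}"
  proof -
    have "1 \<le> ennreal (1 / d\<^sup>2) * ennreal (y\<^sup>2) \<longleftrightarrow> d \<le> \<bar>y\<bar>" for y
    proof -
      have "1 \<le> ennreal (1 / d\<^sup>2) * ennreal (y\<^sup>2) \<longleftrightarrow> 1 \<le> 1 / d\<^sup>2 * y\<^sup>2"
        by (simp flip: ennreal_mult ennreal_1)
      also have "\<dots> \<longleftrightarrow> d\<^sup>2 \<le> y\<^sup>2" using assms by (simp add: field_simps)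
      also have "\<dots> \<longleftrightarrow> d \<le> \<bar>y\<bar>" using assms by (metis abs_le_square_iff abs_of_pos)
      finally show ?thesis .
    qed
    then show ?thesis by simp
  qed
  ultimately show ?thesis by (simp add: W.emeasure_eq_measure)
qed

lemma prob_walk_less_tendsto: "(\<lambda>R. W.prob {\<xi>. x + walk \<xi> R < K}) \<longlonglongrightarrow> 0"
proof (rule tendsto_sandwich[of "\<lambda>_. 0" _ _ "\<lambda>R. (4 / \<upsilon>\<^sup>2) / real R"])
  \<comment> \<open>From this \<open>R\<close> on, half of the mean displacement exceeds
    \<open>K - x\<close>, so staying below \<open>K\<close> is a deviation of at least
    \<open>\<upsilon> * R / 2\<close>.\<close>
  obtain R0 where R0: "2 * real_of_int (K - x) / \<upsilon> < real R0" using reals_Archimedean2 by blast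
  show "\<forall>\<^sub>F R in sequentially. W.prob {\<xi>. x + walk \<xi> R < K} \<le> 4 / \<upsilon>\<^sup>2 / real R"
    using eventually_ge_at_top[of "Suc R0"]
  proof eventually_elim
    case (elim R)
    then have R: "0 < real R" "2 * real_of_int (K - x) / \<upsilon> < real R" using R0 by auto
    have d: "0 < \<upsilon> * real R / 2" using R \<upsilon>_bounds by auto
    have "W.prob {\<xi>. x + walk \<xi> R < K} \<le> W.prob {\<xi>. \<upsilon> * real R / 2 \<le> \<bar>real_of_int (walk \<xi> R) - \<upsilon> * real R\<bar>}"
    proof (rule W.finite_measure_mono)
      show "{\<xi>. x + walk \<xi> R < K} \<subseteq> {\<xi>. \<upsilon> * real R / 2 \<le> \<bar>real_of_int (walk \<xi> R) - \<upsilon> * real R\<bar>}"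
      proof safe
        fix \<xi> assume "x + walk \<xi> R < K"
        then have "real_of_int (walk \<xi> R) < real_of_int (K - x)" by linarith
        also have "\<dots> < \<upsilon> * real R / 2" using R(2) \<upsilon>_bounds(1) by (simp add: pos_divide_less_eq mult.commute)
        finally show "\<upsilon> * real R / 2 \<le> \<bar>real_of_int (walk \<xi> R) - \<upsilon> * real R\<bar>" by linarith
      qed
      have "{\<xi>\<in>space W. \<upsilon> * real R / 2 \<le> \<bar>real_of_int (walk \<xi> R) - \<upsilon> * real R\<bar>} \<in> W.events" by measurable
      then show "{\<xi>. \<upsilon> * real R / 2 \<le> \<bar>real_of_int (walk \<xi> R) - \<upsilon> * real R\<bar>} \<in> W.events" by simp
    qed
    also have "\<dots> \<le> real R / (\<upsilon> * real R / 2)\<^sup>2" by (rule prob_deviation[OF d])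
    also have "\<dots> = 4 / \<upsilon>\<^sup>2 / real R" using R \<upsilon>_bounds by (simp add: field_simps power2_eq_square)
    finally show ?case .
  qed
  show "(\<lambda>R. 4 / \<upsilon>\<^sup>2 / real R) \<longlonglongrightarrow> 0" by (rule lim_const_over_n)
qed auto

section \<open>The number of returns to the starting point\<close>

definition visits :: "int \<Rightarrow> nat \<Rightarrow> (nat \<Rightarrow> int) \<Rightarrow> nat" where
  "visits x R \<xi> = (\<Sum>g\<le>R. of_bool (x + walk \<xi> g = 0))"

lemma measurable_visits[measurable]: "visits x R \<in> measurable W (count_space UNIV)"
  unfolding visits_def[abs_def] by (rule measurable_sum_count_space) auto

lemma visits_0[simp]: "visits x 0 \<xi> = of_bool (x = 0)"
  by (simp add: visits_def)

text \<open>The start \<open>x\<close> is a parameter of \<open>visits\<close> so that a first step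
  merely shifts it; every induction on the horizon below rests on this recursion.\<close>

lemma visits_case_nat: "visits x (Suc R) (case_nat s \<xi>) = of_bool (x = 0) + visits (x + s) R \<xi>"
  by (simp add: visits_def sum.atMost_Suc_shift add.assoc del: sum.atMost_Suc)

text \<open>Gambler's ruin: the probability that the walk started at \<open>x\<close> ever visits
  0.\<close>

definition hit :: "int \<Rightarrow> real" where
  "hit x = (if x \<le> 0 then 1 else (1 / \<beta>) ^ nat x)"

lemma hit_nonneg: "0 \<le> hit x" and hit_le_1: "hit x \<le> 1" and hit_0[simp]: "hit 0 = 1"
  using \<beta> by (auto simp: hit_def power_le_one)

text \<open>A hitting probability is harmonic off the target; at the target its one-step average is
  the return probability \<open>r\<close>.\<close>

lemma hit_harmonic:
  "\<beta> / (\<beta> + 1) * hit (x + 1) + 1 / (\<beta> + 1) * hit (x - 1) = (if x = 0 then r else hit x)"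
proof -
  consider "x < 0" | "x = 0" | "0 < x" by linarith
  then show ?thesis
  proof cases
    case 1
    then show ?thesis using \<beta> by (simp add: hit_def flip: add_divide_distrib)
  next
    case 2
    then show ?thesis using \<beta> by (simp add: hit_def r_def field_simps)
  next
    case 3
    then obtain k where k: "x = int (Suc k)" by (metis pos_int_cases Suc_pred)
    have "nat (1 + int (Suc k)) = Suc (Suc k)" "nat (int (Suc k) - 1) = k" by auto
    then have "hit (x + 1) = (1 / \<beta>) ^ Suc (Suc k)" "hit x = (1 / \<beta>) ^ Suc k" "hit (x - 1) = (1 / \<beta>) ^ k"
      using k by (auto simp: hit_def nat_add_distrib)
    moreover have "\<beta> / (\<beta> + 1) * (1 / \<beta>) ^ Suc (Suc k) + 1 / (\<beta> + 1) * (1 / \<beta>) ^ k = (1 / \<beta>) ^ Suc k"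
      using \<beta> by (simp add: divide_simps)
    ultimately show ?thesis using 3 by simp
  qed
qed

lemma prob_visits_Suc:
  "W.prob {\<xi>. j \<le> visits x (Suc R) \<xi>} = \<beta> / (\<beta> + 1) * W.prob {\<xi>. j \<le> of_bool (x = 0) + visits (x + 1) R \<xi>} +
    1 / (\<beta> + 1) * W.prob {\<xi>. j \<le> of_bool (x = 0) + visits (x - 1) R \<xi>}"
  by (subst prob_first_step) (simp_all add: visits_case_nat)

text \<open>The bound reproduces itself under one step by \<open>hit_harmonic\<close>. At the origin
  one visit is spent, and the lost power of the return probability is the value \<open>r\<close> of
  the average there.\<close>

lemma prob_visits_le:
  "W.prob {\<xi>. Suc j \<le> visits x R \<xi>} \<le> r ^ j * hit x"
proof (induction R arbitrary: x j)
  case 0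
  show ?case using \<upsilon>_bounds hit_nonneg by (cases j) (auto simp: W.prob_space)
next
  case (Suc R)
  show ?case
  proof (cases "x = 0 \<and> j = 0")
    case True
    then show ?thesis by simp
  next
    case False
    define j' where "j' = (if x = 0 then j - 1 else j)"
    have j': "(Suc j \<le> of_bool (x = 0) + n) = (Suc j' \<le> n)" for n using False by (auto simp: j'_def)
    have "W.prob {\<xi>. Suc j \<le> visits x (Suc R) \<xi>} \<le>
      \<beta> / (\<beta> + 1) * (r ^ j' * hit (x + 1)) + 1 / (\<beta> + 1) * (r ^ j' * hit (x - 1))"
      unfolding prob_visits_Suc j' using \<beta> by (intro add_mono mult_left_mono Suc.IH) auto
    also have "\<dots> = r ^ j' * (if x = 0 then r else hit x)"
      unfolding hit_harmonic[of x, symmetric] by (simp add: algebra_simps)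
    also have "\<dots> = r ^ j * hit x"
      using False by (cases j) (auto simp: j'_def)
    finally show ?thesis .
  qed
qed

text \<open>The same recursion from below. At horizon 0 the missing mass is paid by the walk lying
  below \<open>K\<close>, or by \<open>hit K\<close> if it starts above; the first error vanishes as
  the horizon grows, the second as \<open>K\<close> grows.\<close>

lemma prob_visits_ge:
  assumes K: "1 \<le> K"
  shows "r ^ j * hit x \<le> W.prob {\<xi>. Suc j \<le> visits x R \<xi>} + W.prob {\<xi>. x + walk \<xi> R < K} + hit K"
proof (induction R arbitrary: x j)
  case 0
  have rj: "0 \<le> r ^ j" "r ^ j \<le> 1" using \<upsilon>_bounds by (auto simp: power_le_one)
  show ?case
  proof (cases "x < K")
    case True
    have "r ^ j * hit x \<le> 1 * 1" using rj hit_nonneg hit_le_1 by (intro mult_mono) auto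
    then show ?thesis using True hit_nonneg[of K] W.prob_space by (simp add: add_increasing)
  next
    case False
    have "hit x \<le> hit K"
      using False K \<beta> by (auto simp: hit_def intro!: power_decreasing nat_mono)
    then have "r ^ j * hit x \<le> 1 * hit K" using rj hit_nonneg by (intro mult_mono) auto
    then show ?thesis by (simp add: add_increasing)
  qed
next
  case (Suc R)
  show ?case
  proof (cases "x = 0 \<and> j = 0")
    case True
    have "{\<xi>. Suc 0 \<le> visits 0 (Suc R) \<xi>} = UNIV"
      by (auto simp: visits_def sum.atMost_Suc_shift simp del: sum.atMost_Suc)
    then show ?thesis using True hit_nonneg[of K] W.prob_space by (simp add: add_increasing2)
  next
    case False
    define j' where "j' = (if x = 0 then j - 1 else j)"
    have j': "(Suc j \<le> of_bool (x = 0) + n) = (Suc j' \<le> n)" for n using False by (auto simp: j'_def)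
    have w: "W.prob {\<xi>. x + walk \<xi> (Suc R) < K} = \<beta> / (\<beta> + 1) * W.prob {\<xi>. x + 1 + walk \<xi> R < K} +
      1 / (\<beta> + 1) * W.prob {\<xi>. x - 1 + walk \<xi> R < K}"
      by (subst prob_first_step) (simp_all add: algebra_simps)
    have h: "hit K = \<beta> / (\<beta> + 1) * hit K + 1 / (\<beta> + 1) * hit K"
    proof -
      have "\<beta> / (\<beta> + 1) + 1 / (\<beta> + 1) = 1" using \<beta> by (simp flip: add_divide_distrib)
      then show ?thesis by (metis distrib_right mult_1)
    qed
    have "r ^ j * hit x = r ^ j' * (if x = 0 then r else hit x)"
      using False by (cases j) (auto simp: j'_def)
    also have "\<dots> = \<beta> / (\<beta> + 1) * (r ^ j' * hit (x + 1)) + 1 / (\<beta> + 1) * (r ^ j' * hit (x - 1))"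
      unfolding hit_harmonic[of x, symmetric] by (simp add: algebra_simps)
    also have "\<dots> \<le> \<beta> / (\<beta> + 1) * (W.prob {\<xi>. Suc j' \<le> visits (x + 1) R \<xi>} + W.prob {\<xi>. x + 1 + walk \<xi> R < K} + hit K)
      + 1 / (\<beta> + 1) * (W.prob {\<xi>. Suc j' \<le> visits (x - 1) R \<xi>} + W.prob {\<xi>. x - 1 + walk \<xi> R < K} + hit K)"
      using \<beta> by (intro add_mono[OF mult_left_mono mult_left_mono] Suc.IH) auto
    also have "\<dots> = W.prob {\<xi>. Suc j \<le> visits x (Suc R) \<xi>} + W.prob {\<xi>. x + walk \<xi> (Suc R) < K} + hit K"
      unfolding prob_visits_Suc j' w by (subst (3) h) (simp add: algebra_simps)
    finally show ?thesis .
  qed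
qed

definition returns :: "nat \<Rightarrow> (nat \<Rightarrow> int) \<Rightarrow> nat" where
  "returns R \<xi> = card {g\<in>{1..R}. walk \<xi> g = 0}"

lemma visits_eq_returns: "visits 0 R \<xi> = Suc (returns R \<xi>)"
proof -
  have "returns R \<xi> = (\<Sum>g\<in>{1..R}. of_bool (walk \<xi> g = 0))"
    by (simp add: returns_def Int_def)
  moreover have "visits 0 R \<xi> = of_bool (walk \<xi> 0 = 0) + (\<Sum>g\<in>{1..R}. of_bool (walk \<xi> g = 0))"
    unfolding visits_def atMost_atLeast0 by (subst sum.atLeast_Suc_atMost) auto
  ultimately show ?thesis by simp
qed

lemma measurable_returns[measurable]: "returns R \<in> measurable W (count_space UNIV)"
proof -
  have "returns R = (\<lambda>\<xi>. visits 0 R \<xi> - 1)" by (simp add: visits_eq_returns fun_eq_iff)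
  then show ?thesis by simp
qed

lemma prob_returns_le: "W.prob {\<xi>. j \<le> returns R \<xi>} \<le> r ^ j"
  using prob_visits_le[of j 0 R] by (simp add: visits_eq_returns)

lemma prob_returns_tendsto: "(\<lambda>R. W.prob {\<xi>. j \<le> returns R \<xi>}) \<longlonglongrightarrow> r ^ j"
proof (rule LIMSEQ_I)
  fix \<epsilon> :: real assume \<epsilon>: "0 < \<epsilon>"
  \<comment> \<open>\<open>K\<close> is chosen before the horizon: first \<open>hit K\<close> is
    made small, then the probability of being below this fixed \<open>K\<close>.\<close>
  obtain k where k: "(1 / \<beta>) ^ k < \<epsilon> / 2" using real_arch_pow_inv[of "\<epsilon> / 2" "1 / \<beta>"] \<epsilon> \<beta> by auto
  define K where "K = int (Suc k)"
  have "hit K \<le> (1 / \<beta>) ^ k" using \<beta> by (auto simp: hit_def K_def nat_add_distrib mult_left_le_one_le field_simps)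
  then have hK: "hit K < \<epsilon> / 2" using k by linarith
  have "\<forall>\<^sub>F R in sequentially. W.prob {\<xi>. 0 + walk \<xi> R < K} < \<epsilon> / 2"
    by (rule order_tendstoD(2)[OF prob_walk_less_tendsto]) (use \<epsilon> in simp)
  then obtain R0 where R0: "\<And>R. R0 \<le> R \<Longrightarrow> W.prob {\<xi>. 0 + walk \<xi> R < K} < \<epsilon> / 2"
    by (auto simp: eventually_sequentially)
  have "norm (W.prob {\<xi>. j \<le> returns R \<xi>} - r ^ j) < \<epsilon>" if "R0 \<le> R" for R
    using prob_visits_ge[of K j 0 R] R0[OF that] hK prob_returns_le[of j R]
    by (simp add: visits_eq_returns K_def abs_less_iff)
  then show "\<exists>no. \<forall>n\<ge>no. norm (W.prob {\<xi>. j \<le> returns n \<xi>} - r ^ j) < \<epsilon>" by blast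
qed

end

section \<open>Weak dependence of the return counts\<close>

context biased_walk
begin

lemma W_comb_seq: "distr (W \<Otimes>\<^sub>M W) W (\<lambda>(\<omega>, \<omega>'). comb_seq m \<omega> \<omega>') = W"
  unfolding walk_law_def by (rule PiM_comb_seq)

lemma measurable_comb_seq_W: "(\<lambda>(\<omega>, \<omega>'). comb_seq m \<omega> \<omega>') \<in> measurable (W \<Otimes>\<^sub>M W) W"
  unfolding walk_law_def by (rule measurable_comb_seq)

lemma shift_comb_seq: "(\<lambda>i. comb_seq m \<omega> \<omega>' (m + i)) = \<omega>'"
  by (simp add: comb_seq_def fun_eq_iff)

lemma distr_shift: "distr W W (\<lambda>\<xi> i. \<xi> (m + i)) = W"
proof -
  interpret WW: pair_prob_space W W ..
  have "distr W W (\<lambda>\<xi> i. \<xi> (m + i)) =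
    distr (distr (W \<Otimes>\<^sub>M W) W (\<lambda>(\<omega>, \<omega>'). comb_seq m \<omega> \<omega>')) W (\<lambda>\<xi> i. \<xi> (m + i))"
    by (simp only: W_comb_seq)
  also have "\<dots> = distr (W \<Otimes>\<^sub>M W) W snd"
    by (subst distr_distr[OF measurable_shift measurable_comb_seq_W])
      (simp add: comp_def split_beta' shift_comb_seq)
  also have "\<dots> = distr (W \<Otimes>\<^sub>M W) W fst"
    by (subst WW.distr_pair_swap) (simp add: distr_distr comp_def split_beta')
  also have "\<dots> = W" by (rule W.distr_pair_fst)
  finally show ?thesis .
qed

lemma integral_shift:
  fixes f :: "(nat \<Rightarrow> int) \<Rightarrow> real"
  assumes "f \<in> borel_measurable W"
  shows "(\<integral>\<xi>. f (\<lambda>i. \<xi> (m + i)) \<partial>W) = (\<integral>\<xi>. f \<xi> \<partial>W)"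
  using integral_distr[OF measurable_shift assms, of m] by (simp add: distr_shift)

text \<open>\<open>comb_seq\<close> glues the first \<open>m\<close> steps of one copy to a second
  copy, under the same law; a function of the past sees only the first copy, the shifted one only
  the second.\<close>

lemma integral_past_future:
  fixes f g :: "(nat \<Rightarrow> int) \<Rightarrow> real"
  assumes f: "f \<in> borel_measurable W" "\<And>\<xi>. \<bar>f \<xi>\<bar> \<le> B" and g: "g \<in> borel_measurable W" "\<And>\<xi>. \<bar>g \<xi>\<bar> \<le> B"
    and past: "\<And>\<xi> \<xi>'. (\<And>i. i < m \<Longrightarrow> \<xi> i = \<xi>' i) \<Longrightarrow> f \<xi> = f \<xi>'"
  shows "(\<integral>\<xi>. f \<xi> * g (\<lambda>i. \<xi> (m + i)) \<partial>W) = (\<integral>\<xi>. f \<xi> \<partial>W) * (\<integral>\<xi>. g \<xi> \<partial>W)"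
proof -
  interpret WW: pair_prob_space W W ..
  note [measurable] = f(1) g(1)
  have gm[measurable]: "(\<lambda>\<xi>. g (\<lambda>i. \<xi> (m + i))) \<in> borel_measurable W"
    by (rule measurable_compose[OF measurable_shift g(1)])
  have B: "0 \<le> B" using f(2) abs_ge_zero order_trans by blast
  have fc: "f (comb_seq m \<omega> \<omega>') = f \<omega>" for \<omega> \<omega>'
    by (rule past) (simp add: comb_seq_def)
  have "(\<integral>\<xi>. f \<xi> * g (\<lambda>i. \<xi> (m + i)) \<partial>W) =
    (\<integral>\<xi>. f \<xi> * g (\<lambda>i. \<xi> (m + i)) \<partial>distr (W \<Otimes>\<^sub>M W) W (\<lambda>(\<omega>, \<omega>'). comb_seq m \<omega> \<omega>'))"
    by (simp only: W_comb_seq)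
  also have "\<dots> = (\<integral>p. f (fst p) * g (snd p) \<partial>(W \<Otimes>\<^sub>M W))"
    by (subst integral_distr[OF measurable_comb_seq_W]) (simp_all add: split_beta' fc shift_comb_seq)
  also have "\<dots> = (\<integral>\<omega>. \<integral>\<omega>'. f \<omega> * g \<omega>' \<partial>W \<partial>W)"
  proof -
    have "\<bar>f (fst p) * g (snd p)\<bar> \<le> B * B" for p
      unfolding abs_mult using f(2) g(2) B by (intro mult_mono) auto
    then have "integrable (W \<Otimes>\<^sub>M W) (\<lambda>p. f (fst p) * g (snd p))"
      by (intro WW.P.integrable_const_bound[of _ "B * B"]) auto
    then show ?thesis
      using WW.integral_fst'[of "\<lambda>p. f (fst p) * g (snd p)"] by simp
  qed
  also have "\<dots> = (\<integral>\<xi>. f \<xi> \<partial>W) * (\<integral>\<xi>. g \<xi> \<partial>W)" by simp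
  finally show ?thesis .
qed

lemma returns_cong:
  assumes "\<And>i. i < R \<Longrightarrow> \<xi> i = \<xi>' i" shows "returns R \<xi> = returns R \<xi>'"
proof -
  have "walk \<xi> g = walk \<xi>' g" if "g \<le> R" for g
    unfolding walk_def using that assms by (intro sum.cong) auto
  then have "{g \<in> {1..R}. walk \<xi> g = 0} = {g \<in> {1..R}. walk \<xi>' g = 0}" by auto
  then show ?thesis by (simp add: returns_def)
qed

lemma returns_le: "returns R \<xi> \<le> R"
proof -
  have "returns R \<xi> \<le> card {1..R}" unfolding returns_def by (rule card_mono) auto
  then show ?thesis by simp
qed

text \<open>The centred count from time m depends on the steps from m to m + R - 1, so covariances
  vanish at distance at least \<open>R\<close>. Each row of the covariance matrix keeps at most 2R +
  1 entries, each at most \<open>\<delta>\<^sup>2\<close>, and the first absolute moment is bounded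
  by the root of the second.\<close>

lemma window_sum_deviation:
  fixes F :: "nat \<Rightarrow> nat \<Rightarrow> real"
  assumes F: "\<And>m j. 0 \<le> F m j" "\<And>m j. F m j \<le> \<delta>"
  shows "(\<integral>\<xi>. \<bar>(\<Sum>m<N. F m (returns R (\<lambda>i. \<xi> (m + i)))) - (\<Sum>m<N. \<integral>\<xi>. F m (returns R \<xi>) \<partial>W)\<bar> \<partial>W)
    \<le> \<delta> * sqrt (real N * (2 * real R + 1))"
proof -
  define E where "E m = (\<integral>\<xi>. F m (returns R \<xi>) \<partial>W)" for m
  define z where "z m \<xi> = F m (returns R \<xi>) - E m" for m \<xi>
  define Z where "Z m \<xi> = z m (\<lambda>i. \<xi> (m + i))" for m \<xi>
  have \<delta>: "0 \<le> \<delta>" using F order_trans by blast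
  have Fm[measurable]: "(\<lambda>\<xi>. F m (returns R \<xi>)) \<in> borel_measurable W" for m
    by (rule measurable_compose[OF measurable_returns]) simp
  have Fi: "integrable W (\<lambda>\<xi>. F m (returns R \<xi>))" for m
    by (rule W.integrable_const_bound[of _ \<delta>]) (use F in auto)
  have E: "0 \<le> E m" "E m \<le> \<delta>" for m
    unfolding E_def using F by (auto intro!: integral_nonneg_AE W.integral_le_const Fi)
  have zm[measurable]: "z m \<in> borel_measurable W" for m unfolding z_def by measurable
  have zb: "\<bar>z m \<xi>\<bar> \<le> \<delta>" for m \<xi>
    using F(1)[of m "returns R \<xi>"] F(2)[of m "returns R \<xi>"] E[of m] unfolding z_def by linarith
  have z0: "(\<integral>\<xi>. z m \<xi> \<partial>W) = 0" for m
    unfolding z_def using Fi by (simp add: E_def)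
  have Zm[measurable]: "Z m \<in> borel_measurable W" for m
    unfolding Z_def by (rule measurable_compose[OF measurable_shift zm])
  have Zb: "\<bar>Z m \<xi>\<bar> \<le> \<delta>" for m \<xi> by (simp add: Z_def zb)
  have ZZb: "\<bar>Z m \<xi> * Z m' \<xi>\<bar> \<le> \<delta>\<^sup>2" for m m' \<xi>
    unfolding abs_mult power2_eq_square using Zb \<delta> by (intro mult_mono) auto
  have ZZi: "integrable W (\<lambda>\<xi>. Z m \<xi> * Z m' \<xi>)" for m m'
    by (rule W.integrable_const_bound[of _ "\<delta>\<^sup>2"]) (use ZZb in auto)
  have un: "(\<integral>\<xi>. Z m \<xi> * Z m' \<xi> \<partial>W) = 0" if "m + R \<le> m'" for m m'
  proof -
    have "(\<integral>\<xi>. Z m \<xi> * Z m' \<xi> \<partial>W) = (\<integral>\<xi>. Z m \<xi> * z m' (\<lambda>i. \<xi> (m' + i)) \<partial>W)"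
      by (simp add: Z_def)
    also have "\<dots> = (\<integral>\<xi>. Z m \<xi> \<partial>W) * (\<integral>\<xi>. z m' \<xi> \<partial>W)"
    proof (rule integral_past_future[where B = \<delta>])
      fix \<xi> \<xi>' :: "nat \<Rightarrow> int" assume "\<And>i. i < m' \<Longrightarrow> \<xi> i = \<xi>' i"
      then have "returns R (\<lambda>i. \<xi> (m + i)) = returns R (\<lambda>i. \<xi>' (m + i))"
        using that by (intro returns_cong) auto
      then show "Z m \<xi> = Z m \<xi>'" by (simp add: Z_def z_def)
    qed (use Zb zb in auto)
    finally show ?thesis by (simp add: z0)
  qed
  have cov: "(\<integral>\<xi>. Z m \<xi> * Z m' \<xi> \<partial>W) \<le> \<delta>\<^sup>2 * of_bool (m' < m + R \<and> m < m' + R \<or> m = m')" for m m'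
  proof -
    have "(\<integral>\<xi>. Z m \<xi> * Z m' \<xi> \<partial>W) \<le> \<delta>\<^sup>2"
      using ZZb by (intro W.integral_le_const[OF ZZi]) (auto simp: abs_le_iff)
    moreover have "(\<integral>\<xi>. Z m \<xi> * Z m' \<xi> \<partial>W) = 0" if "\<not> (m' < m + R \<and> m < m' + R)"
      using that un[of m m'] un[of m' m] by (auto simp: not_less mult.commute)
    ultimately show ?thesis by (auto simp: of_bool_def)
  qed
  define Y where "Y \<xi> = (\<Sum>m<N. Z m \<xi>)" for \<xi>
  have Ym[measurable]: "Y \<in> borel_measurable W" unfolding Y_def by measurable
  have Yb: "\<bar>Y \<xi>\<bar> \<le> real N * \<delta>" for \<xi>
    unfolding Y_def using sum_mono[of "{..<N}" "\<lambda>m. \<bar>Z m \<xi>\<bar>" "\<lambda>_. \<delta>"] Zb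
    by (auto intro: order_trans[OF sum_abs])
  have Yi: "integrable W Y" by (rule W.integrable_const_bound[of _ "real N * \<delta>"]) (use Yb in auto)
  have Y2: "(\<lambda>\<xi>. \<bar>Y \<xi>\<bar>\<^sup>2) = (\<lambda>\<xi>. \<Sum>m<N. \<Sum>m'<N. Z m \<xi> * Z m' \<xi>)"
    by (simp add: Y_def power2_eq_square sum_product)
  have Y2i: "integrable W (\<lambda>\<xi>. \<bar>Y \<xi>\<bar>\<^sup>2)" unfolding Y2 using ZZi by auto
  have "(\<integral>\<xi>. \<bar>Y \<xi>\<bar>\<^sup>2 \<partial>W) = (\<Sum>m<N. \<Sum>m'<N. \<integral>\<xi>. Z m \<xi> * Z m' \<xi> \<partial>W)"
    unfolding Y2 using ZZi by simp
  also have "\<dots> \<le> (\<Sum>m<N. \<Sum>m'<N. \<delta>\<^sup>2 * of_bool (m' < m + R \<and> m < m' + R \<or> m = m'))"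
    by (intro sum_mono cov)
  also have "\<dots> \<le> (\<Sum>m<N. \<delta>\<^sup>2 * (2 * real R + 1))"
  proof (rule sum_mono)
    fix m
    have "(\<Sum>m'<N. of_bool (m' < m + R \<and> m < m' + R \<or> m = m') :: real) =
        card ({..<N} \<inter> {m'. m' < m + R \<and> m < m' + R \<or> m = m'})"
    proof -
      have "(\<Sum>m'<N. of_bool (P m') :: real) = card ({..<N} \<inter> {m'. P m'})" for P by simp
      then show ?thesis .
    qed
    also have "\<dots> \<le> card ({m - R..<m + R} \<union> {m})"
      by (intro of_nat_mono card_mono) auto
    also have "\<dots> \<le> 2 * real R + 1"
    proof -
      have "card ({m - R..<m + R} \<union> {m}) \<le> card {m - R..<m + R} + card {m}" by (rule card_Un_le)
      then show ?thesis by simp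
    qed
    finally show "(\<Sum>m'<N. \<delta>\<^sup>2 * of_bool (m' < m + R \<and> m < m' + R \<or> m = m')) \<le> \<delta>\<^sup>2 * (2 * real R + 1)"
      unfolding sum_distrib_left[symmetric] by (intro mult_left_mono) auto
  qed
  also have "\<dots> = \<delta>\<^sup>2 * (real N * (2 * real R + 1))" by simp
  finally have V: "(\<integral>\<xi>. \<bar>Y \<xi>\<bar>\<^sup>2 \<partial>W) \<le> \<delta>\<^sup>2 * (real N * (2 * real R + 1))" .
  have "(\<integral>\<xi>. \<bar>Y \<xi>\<bar> \<partial>W)\<^sup>2 \<le> (\<integral>\<xi>. \<bar>Y \<xi>\<bar>\<^sup>2 \<partial>W)"
    using W.variance_eq[of "\<lambda>\<xi>. \<bar>Y \<xi>\<bar>", OF integrable_abs[OF Yi] Y2i] W.variance_positive[of "\<lambda>\<xi>. \<bar>Y \<xi>\<bar>"]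
    by linarith
  then have "(\<integral>\<xi>. \<bar>Y \<xi>\<bar> \<partial>W) \<le> sqrt (\<delta>\<^sup>2 * (real N * (2 * real R + 1)))"
    using V by (intro real_le_rsqrt) linarith
  also have "\<dots> = \<delta> * sqrt (real N * (2 * real R + 1))"
    using \<delta> by (simp add: real_sqrt_mult)
  finally have "(\<integral>\<xi>. \<bar>Y \<xi>\<bar> \<partial>W) \<le> \<delta> * sqrt (real N * (2 * real R + 1))" .
  moreover have "Y \<xi> = (\<Sum>m<N. F m (returns R (\<lambda>i. \<xi> (m + i)))) - (\<Sum>m<N. E m)" for \<xi>
    by (simp add: Y_def Z_def z_def sum_subtractf)
  ultimately show ?thesis by (simp add: E_def)
qed

section \<open>Return probabilities and expected meetings\<close>

definition "ret g = W.prob {\<xi>. walk \<xi> g = 0}"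

lemma ret_eq: "(\<integral>\<xi>. of_bool (walk \<xi> g = 0) \<partial>W) = ret g"
proof -
  have "{\<xi>\<in>space W. walk \<xi> g = 0} \<in> W.events" by measurable
  then have "(\<integral>\<xi>. indicat_real {\<xi>. walk \<xi> g = 0} \<xi> \<partial>W) = ret g" by (simp add: ret_def)
  then show ?thesis by (simp add: indicator_def)
qed

lemma measurable_of_bool_walk[measurable]:
  "(\<lambda>\<xi>. of_bool (walk \<xi> g = 0) :: real) \<in> borel_measurable W"
  by (rule measurable_compose[OF measurable_walk]) simp

text \<open>The expected number of returns, written as the sum of its tails, is dominated by the
  geometric series r + r^2 + ...\<close>

lemma sum_ret_le: "(\<Sum>g\<in>{1..R}. ret g) \<le> r / (1 - r)"
proof -
  have ev: "{\<xi>. j \<le> returns R \<xi>} \<in> W.events" for j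
  proof -
    have "{\<xi>\<in>space W. j \<le> returns R \<xi>} \<in> W.events" by measurable
    then show ?thesis by simp
  qed
  have "(\<Sum>g\<in>{1..R}. ret g) = (\<integral>\<xi>. (\<Sum>g\<in>{1..R}. of_bool (walk \<xi> g = 0)) \<partial>W)"
    unfolding ret_eq[symmetric]
    by (subst Bochner_Integration.integral_sum) (auto intro!: W.integrable_const_bound[of _ 1])
  also have "\<dots> = (\<integral>\<xi>. (\<Sum>j\<in>{1..R}. indicat_real {\<xi>. j \<le> returns R \<xi>} \<xi>) \<partial>W)"
  proof (rule Bochner_Integration.integral_cong)
    fix \<xi>
    have "(\<Sum>j\<in>{1..R}. indicat_real {\<xi>. j \<le> returns R \<xi>} \<xi>) = real (card {j\<in>{1..R}. j \<le> returns R \<xi>})"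
      by (simp add: indicator_def Int_def)
    also have "{j\<in>{1..R}. j \<le> returns R \<xi>} = {1..returns R \<xi>}" using returns_le[of R \<xi>] by auto
    finally show "(\<Sum>g\<in>{1..R}. of_bool (walk \<xi> g = 0)) = (\<Sum>j\<in>{1..R}. indicat_real {\<xi>. j \<le> returns R \<xi>} \<xi>)"
      by (simp add: returns_def Int_def)
  qed simp
  also have "\<dots> = (\<Sum>j\<in>{1..R}. W.prob {\<xi>. j \<le> returns R \<xi>})"
    using ev by (subst Bochner_Integration.integral_sum) (auto intro!: W.integrable_const_bound[of _ 1])
  also have "\<dots> \<le> (\<Sum>j\<in>{1..R}. r ^ j)" by (intro sum_mono prob_returns_le)
  also have "\<dots> \<le> r / (1 - r)"
  proof -
    have "(\<Sum>j\<in>{1..R}. r ^ j) = (\<Sum>j<R. r * r ^ j)"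
      by (rule sum.reindex_bij_witness[of _ Suc "\<lambda>j. j - 1"]) (auto simp flip: power_Suc)
    also have "\<dots> = r * ((1 - r ^ R) / (1 - r))"
      using \<upsilon>_bounds by (simp add: sum_distrib_left[symmetric] sum_gp_strict)
    also have "\<dots> \<le> r / (1 - r)" using \<upsilon>_bounds by (simp add: divide_right_mono mult_left_le)
    finally show ?thesis .
  qed
  finally show ?thesis .
qed

lemma ret_nonneg: "0 \<le> ret g" by (simp add: ret_def)

lemma summable_ret: "summable (\<lambda>g. ret (Suc g))"
proof (rule bounded_imp_summable)
  fix n
  have "(\<Sum>k\<le>n. ret (Suc k)) = (\<Sum>g\<in>{1..Suc n}. ret g)"
    by (rule sum.reindex_bij_witness[of _ "\<lambda>j. j - 1" Suc]) auto
  then show "(\<Sum>k\<le>n. ret (Suc k)) \<le> r / (1 - r)" using sum_ret_le[of "Suc n"] by (simp only:)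
qed (rule ret_nonneg)

text \<open>A tail of the convergent series of return probabilities; it bounds the chance of a
  return after more than \<open>R\<close> steps.\<close>

definition "late R = (\<Sum>g. ret (Suc (g + R)))"

lemma late_tendsto: "late \<longlonglongrightarrow> 0"
  unfolding late_def using summable_ret by (rule suminf_exist_split2)

lemma sum_ret_late: "(\<Sum>g\<in>{R<..N}. ret g) \<le> late R"
proof -
  have s: "summable (\<lambda>g. ret (Suc (g + R)))" using summable_ret by (simp add: summable_iff_shift[of "\<lambda>g. ret (Suc g)"])
  have "(\<Sum>g\<in>{R<..N}. ret g) = (\<Sum>g<N - R. ret (Suc (g + R)))"
    by (rule sum.reindex_bij_witness[of _ "\<lambda>g. Suc (g + R)" "\<lambda>g. g - Suc R"]) auto
  also have "\<dots> \<le> late R" unfolding late_def by (rule sum_le_suminf[OF s]) (auto simp: ret_nonneg)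
  finally show ?thesis .
qed

lemma prob_meet: "(\<integral>\<xi>. of_bool (walk \<xi> (m + g) = walk \<xi> m) \<partial>W) = ret g"
  using integral_shift[OF measurable_of_bool_walk[of g], of m] by (simp add: walk_shift ret_eq)

lemma measurable_meet[measurable]:
  "(\<lambda>\<xi>. of_bool (walk \<xi> k = walk \<xi> m) :: real) \<in> borel_measurable W"
  by measurable

lemma late_returns:
  "(\<integral>\<xi>. (\<Sum>m<N. of_bool (\<exists>k. m + R < k \<and> k < N \<and> walk \<xi> k = walk \<xi> m)) \<partial>W) \<le> real N * late R"
proof -
  have i: "integrable W (\<lambda>\<xi>. of_bool (walk \<xi> (m + g) = walk \<xi> m) :: real)" for m g
    by (rule W.integrable_const_bound[of _ 1]) auto
  have "(\<integral>\<xi>. (\<Sum>m<N. of_bool (\<exists>k. m + R < k \<and> k < N \<and> walk \<xi> k = walk \<xi> m) :: real) \<partial>W) \<le>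
    (\<integral>\<xi>. (\<Sum>m<N. \<Sum>g\<in>{R<..N}. of_bool (walk \<xi> (m + g) = walk \<xi> m)) \<partial>W)"
  proof (rule integral_mono)
    show "integrable W (\<lambda>\<xi>. \<Sum>m<N. of_bool (\<exists>k. m + R < k \<and> k < N \<and> walk \<xi> k = walk \<xi> m) :: real)"
      by (intro Bochner_Integration.integrable_sum W.integrable_const_bound[of _ 1]) auto
    show "integrable W (\<lambda>\<xi>. \<Sum>m<N. \<Sum>g\<in>{R<..N}. of_bool (walk \<xi> (m + g) = walk \<xi> m) :: real)"
      by (intro Bochner_Integration.integrable_sum i)
    fix \<xi>
    show "(\<Sum>m<N. of_bool (\<exists>k. m + R < k \<and> k < N \<and> walk \<xi> k = walk \<xi> m) :: real) \<le>
      (\<Sum>m<N. \<Sum>g\<in>{R<..N}. of_bool (walk \<xi> (m + g) = walk \<xi> m))"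
    proof (rule sum_mono)
      fix m
      show "of_bool (\<exists>k. m + R < k \<and> k < N \<and> walk \<xi> k = walk \<xi> m) \<le>
        (\<Sum>g\<in>{R<..N}. of_bool (walk \<xi> (m + g) = walk \<xi> m) :: real)"
      proof (cases "\<exists>k. m + R < k \<and> k < N \<and> walk \<xi> k = walk \<xi> m")
        case True
        then obtain k where k: "m + R < k" "k < N" "walk \<xi> k = walk \<xi> m" by auto
        have "of_bool (walk \<xi> (m + (k - m)) = walk \<xi> m) \<le> (\<Sum>g\<in>{R<..N}. of_bool (walk \<xi> (m + g) = walk \<xi> m) :: real)"
          using k by (intro member_le_sum) auto
        then show ?thesis using k by simp
      next
        case False
        then show ?thesis by (simp only: of_bool_eq) (simp add: sum_nonneg)
      qed
    qed
  qed
  also have "\<dots> = (\<Sum>m<N. \<Sum>g\<in>{R<..N}. ret g)"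
    by (simp only: Bochner_Integration.integral_sum[OF Bochner_Integration.integrable_sum[OF i]]
      Bochner_Integration.integral_sum[OF i] prob_meet)
  also have "\<dots> \<le> real N * late R"
    using sum_ret_late by (auto intro: mult_left_mono)
  finally show ?thesis .
qed

text \<open>Each time meets itself once and, in mean, at most r/(1 - r) earlier and as many later
  times. The bound is linear in \<open>N\<close>, hence negligible against a squared loss of order
  N^-2.\<close>

lemma expected_meets:
  "(\<integral>\<xi>. (\<Sum>m<N. \<Sum>k<N. of_bool (walk \<xi> k = walk \<xi> m)) \<partial>W) \<le> real N * (1 + 2 * (r / (1 - r)))"
proof -
  have i: "integrable W (\<lambda>\<xi>. of_bool (walk \<xi> k = walk \<xi> m) :: real)" for m k
    by (rule W.integrable_const_bound[of _ 1]) auto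
  have i2: "integrable W (\<lambda>\<xi>. \<Sum>k<N. of_bool (walk \<xi> k = walk \<xi> m) :: real)" for m
    by (intro Bochner_Integration.integrable_sum i)
  have e: "(\<integral>\<xi>. of_bool (walk \<xi> k = walk \<xi> m) \<partial>W) = (if m \<le> k then ret (k - m) else ret (m - k))" for k m
    using prob_meet[of m "k - m"] prob_meet[of k "m - k"] by (auto simp: eq_commute)
  have ret0: "ret 0 \<le> 1" by (simp add: ret_def)
  have "(\<integral>\<xi>. (\<Sum>m<N. \<Sum>k<N. of_bool (walk \<xi> k = walk \<xi> m)) \<partial>W) = (\<Sum>m<N. \<Sum>k<N. if m \<le> k then ret (k - m) else ret (m - k))"
    by (simp only: Bochner_Integration.integral_sum[OF i2] Bochner_Integration.integral_sum[OF i] e)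
  also have "\<dots> \<le> (\<Sum>m<N. 1 + 2 * (r / (1 - r)))"
  proof (rule sum_mono)
    fix m assume m: "m \<in> {..<N}"
    have split: "{..<N} = {..<m} \<union> ({m} \<union> {m<..<N})" using m by auto
    have "(\<Sum>k<N. if m \<le> k then ret (k - m) else ret (m - k)) =
      (\<Sum>k<m. ret (m - k)) + (ret 0 + (\<Sum>k\<in>{m<..<N}. ret (k - m)))"
      unfolding split by (subst sum.union_disjoint, auto simp: disjoint_iff)+
    also have "(\<Sum>k<m. ret (m - k)) = (\<Sum>g\<in>{1..m}. ret g)"
      by (rule sum.reindex_bij_witness[of _ "\<lambda>g. m - g" "\<lambda>k. m - k"]) auto
    also have "(\<Sum>k\<in>{m<..<N}. ret (k - m)) = (\<Sum>g\<in>{1..N - m - 1}. ret g)"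
      by (rule sum.reindex_bij_witness[of _ "\<lambda>g. g + m" "\<lambda>k. k - m"]) auto
    finally show "(\<Sum>k<N. if m \<le> k then ret (k - m) else ret (m - k)) \<le> 1 + 2 * (r / (1 - r))"
      using sum_ret_le[of m] sum_ret_le[of "N - m - 1"] ret0 by linarith
  qed
  finally show ?thesis by simp
qed

text \<open>Convergence at all dyadic times packed into one bounded functional: the truncation and
  the summable weights allow convergence in mean to be proved term by term, and a small value
  controls every single term.\<close>

definition walk_error :: "nat \<Rightarrow> (nat \<Rightarrow> int) \<Rightarrow> real" where
  "walk_error n \<xi> = (\<Sum>i. (1/2) ^ Suc i * min 1 \<bar>real_of_int (walk \<xi> (nat \<lfloor>real n * dyad i\<rfloor>)) / real n - \<upsilon> * dyad i\<bar>)"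

lemma walk_error_terms:
  fixes f :: "nat \<Rightarrow> real"
  shows "summable (\<lambda>i. (1/2) ^ Suc i * min 1 \<bar>f i\<bar>)" "(1/2) ^ Suc i * min 1 \<bar>f i\<bar> \<le> (\<Sum>i. (1/2) ^ Suc i * min 1 \<bar>f i\<bar>)"
    "0 \<le> (\<Sum>i. (1/2) ^ Suc i * min 1 \<bar>f i\<bar>)" "(\<Sum>i. (1/2) ^ Suc i * min 1 \<bar>f i\<bar>) \<le> 1"
proof -
  have g: "(\<lambda>i. (1/2) ^ Suc i :: real) sums 1" by (rule power_half_series)
  have le: "(1/2) ^ Suc i * min 1 \<bar>f i\<bar> \<le> (1/2) ^ Suc i" for i by (rule mult_left_le) auto
  show s: "summable (\<lambda>i. (1/2) ^ Suc i * min 1 \<bar>f i\<bar>)"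
    by (rule summable_comparison_test'[OF sums_summable[OF g]]) (use le in auto)
  show "0 \<le> (\<Sum>i. (1/2) ^ Suc i * min 1 \<bar>f i\<bar>)" by (rule suminf_nonneg[OF s]) auto
  show "(\<Sum>i. (1/2) ^ Suc i * min 1 \<bar>f i\<bar>) \<le> 1"
    using suminf_le[OF le s sums_summable[OF g]] sums_unique[OF g] by simp
  have "(\<Sum>i\<in>{i}. (1/2) ^ Suc i * min 1 \<bar>f i\<bar>) \<le> (\<Sum>i. (1/2) ^ Suc i * min 1 \<bar>f i\<bar>)"
    by (rule sum_le_suminf[OF s]) auto
  then show "(1/2) ^ Suc i * min 1 \<bar>f i\<bar> \<le> (\<Sum>i. (1/2) ^ Suc i * min 1 \<bar>f i\<bar>)" by simp
qed

lemma measurable_walk_error[measurable]: "walk_error n \<in> borel_measurable W"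
  unfolding walk_error_def[abs_def] by measurable

lemma walk_at_dyad_tendsto:
  assumes n: "filterlim n at_top sequentially" and q: "0 \<le> q"
  shows "(\<lambda>k. \<integral>\<xi>. min 1 \<bar>real_of_int (walk \<xi> (nat \<lfloor>real (n k) * q\<rfloor>)) / real (n k) - \<upsilon> * q\<bar> \<partial>W) \<longlonglongrightarrow> 0"
proof (rule LIMSEQ_I)
  fix \<epsilon> :: real assume \<epsilon>: "0 < \<epsilon>"
  define e where "e = \<epsilon> / 4"
  have e: "0 < e" "e + e + e < \<epsilon>" using \<epsilon> by (auto simp: e_def)
  \<comment> \<open>\<open>1 / e\<close> makes the rounding of \<open>real m * q\<close> cost at
    most \<open>e\<close>; \<open>q / e ^ 3\<close> makes Chebyshev's bound
    \<open>q / (e\<^sup>2 * m)\<close> at most \<open>e\<close>.\<close>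
  obtain n0 :: nat where n0: "max (1 / e) (q / e ^ 3) < real n0" using reals_Archimedean2 by blast
  have "\<forall>\<^sub>F k in sequentially. n0 \<le> n k" using n by (simp add: filterlim_at_top)
  moreover have "norm ((\<integral>\<xi>. min 1 \<bar>real_of_int (walk \<xi> (nat \<lfloor>real m * q\<rfloor>)) / real m - \<upsilon> * q\<bar> \<partial>W) - 0) < \<epsilon>"
    if m: "n0 \<le> m" for m
  proof -
    have mm: "1 / e < real m" "q / e ^ 3 < real m" using n0 m by auto
    then have m0: "0 < real m" using e by (meson divide_pos_pos less_trans zero_less_one)
    define N where "N = nat \<lfloor>real m * q\<rfloor>"
    have N: "real N \<le> real m * q" "real m * q - 1 < real N" using m0 q unfolding N_def by (auto simp: mult_nonneg_nonneg)
    let ?f = "\<lambda>\<xi>. min 1 \<bar>real_of_int (walk \<xi> N) / real m - \<upsilon> * q\<bar>"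
    let ?A = "{\<xi>. e * real m \<le> \<bar>real_of_int (walk \<xi> N) - \<upsilon> * real N\<bar>}"
    have A: "?A \<in> W.events"
    proof -
      have "{\<xi>\<in>space W. e * real m \<le> \<bar>real_of_int (walk \<xi> N) - \<upsilon> * real N\<bar>} \<in> W.events" by measurable
      then show ?thesis by simp
    qed
    have le: "?f \<xi> \<le> 2 * e + indicat_real ?A \<xi>" for \<xi>
    proof (cases "\<xi> \<in> ?A")
      case False
      then have "\<bar>real_of_int (walk \<xi> N) - \<upsilon> * real N\<bar> / real m < e" using m0 by (simp add: field_simps)
      then have 1: "\<bar>real_of_int (walk \<xi> N) / real m - \<upsilon> * (real N / real m)\<bar> < e"
        using m0 by (simp add: abs_divide flip: diff_divide_distrib)
      have "(real m * q - 1) / real m \<le> real N / real m" "real N / real m \<le> real m * q / real m"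
        using N m0 by (auto intro!: divide_right_mono simp: pos_divide_le_eq mult.commute)
      then have "\<bar>real N / real m - q\<bar> \<le> 1 / real m" using m0 by (simp add: diff_divide_distrib)
      also have "\<dots> < e" using mm e m0 by (simp add: field_simps)
      finally have "\<upsilon> * \<bar>real N / real m - q\<bar> \<le> 1 * e" using \<upsilon>_bounds by (intro mult_mono) auto
      then have 2: "\<bar>\<upsilon> * (real N / real m) - \<upsilon> * q\<bar> \<le> e"
        using \<upsilon>_bounds(1) by (simp add: abs_mult right_diff_distrib[symmetric] del: times_divide_eq_right)
      from 1 2 have "\<bar>real_of_int (walk \<xi> N) / real m - \<upsilon> * q\<bar> \<le> 2 * e" by linarith
      then show ?thesis using False by simp
    qed (use e in auto)
    have fm: "?f \<in> borel_measurable W" by measurable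
    have fi: "integrable W ?f" by (rule W.integrable_const_bound[of _ 1]) (use fm in auto)
    have iA: "integrable W (indicat_real ?A)" using A by (intro W.integrable_const_bound[of _ 1]) auto
    have "(\<integral>\<xi>. ?f \<xi> \<partial>W) \<le> (\<integral>\<xi>. 2 * e + indicat_real ?A \<xi> \<partial>W)"
    proof (rule integral_mono[OF fi])
      show "integrable W (\<lambda>\<xi>. 2 * e + indicat_real ?A \<xi>)"
        by (intro Bochner_Integration.integrable_add W.integrable_const iA)
    qed (rule le)
    also have "\<dots> = 2 * e + W.prob ?A"
      using A by (subst Bochner_Integration.integral_add[OF W.integrable_const iA]) simp
    also have "W.prob ?A \<le> real N / (e * real m)\<^sup>2" using e m0 by (intro prob_deviation) auto
    also have "\<dots> \<le> real m * q / (e * real m)\<^sup>2" using N by (intro divide_right_mono) auto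
    also have "\<dots> = (q / e ^ 3) * e / real m" using m0 e by (simp add: field_simps power2_eq_square power3_eq_cube)
    also have "\<dots> \<le> real m * e / real m" using mm e m0 by (intro divide_right_mono mult_right_mono) auto
    also have "\<dots> = e" using m0 by simp
    finally have "(\<integral>\<xi>. ?f \<xi> \<partial>W) \<le> 2 * e + e" by simp
    moreover have "0 \<le> (\<integral>\<xi>. ?f \<xi> \<partial>W)" by (intro integral_nonneg_AE) auto
    ultimately show ?thesis using e unfolding N_def by simp
  qed
  ultimately show "\<exists>no. \<forall>k\<ge>no. norm ((\<integral>\<xi>. min 1 \<bar>real_of_int (walk \<xi> (nat \<lfloor>real (n k) * q\<rfloor>)) / real (n k) - \<upsilon> * q\<bar> \<partial>W) - 0) < \<epsilon>"
    unfolding eventually_sequentially by blast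
qed

text \<open>Tannery's theorem: every term tends to 0 and is dominated by the geometric
  weight.\<close>

lemma walk_error_tendsto:
  assumes n: "filterlim n at_top sequentially"
  shows "(\<lambda>k. \<integral>\<xi>. walk_error (n k) \<xi> \<partial>W) \<longlonglongrightarrow> 0"
proof -
  let ?f = "\<lambda>k i \<xi>. (1/2) ^ Suc i * min 1 \<bar>real_of_int (walk \<xi> (nat \<lfloor>real (n k) * dyad i\<rfloor>)) / real (n k) - \<upsilon> * dyad i\<bar>"
  have le: "norm (?f k i \<xi>) \<le> (1/2) ^ Suc i" for k i \<xi>
    by (simp add: abs_mult)
  have fi: "integrable W (?f k i)" for k i
    by (rule W.integrable_const_bound[of _ "(1/2) ^ Suc i"]) (use le in auto)
  have g: "summable (\<lambda>i. (1/2) ^ Suc i :: real)" using power_half_series sums_summable by blast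
  have Il: "norm (\<integral>\<xi>. ?f k i \<xi> \<partial>W) \<le> (1/2) ^ Suc i" for k i
  proof -
    have "norm (\<integral>\<xi>. ?f k i \<xi> \<partial>W) \<le> (\<integral>\<xi>. norm (?f k i \<xi>) \<partial>W)" by (rule integral_norm_bound)
    also have "\<dots> \<le> (1/2) ^ Suc i" using le fi by (intro W.integral_le_const) auto
    finally show ?thesis .
  qed
  have eq: "(\<integral>\<xi>. walk_error (n k) \<xi> \<partial>W) = (\<Sum>i. \<integral>\<xi>. ?f k i \<xi> \<partial>W)" for k
    unfolding walk_error_def
  proof (rule integral_suminf[OF fi])
    show "AE \<xi> in W. summable (\<lambda>i. norm (?f k i \<xi>))"
      by (intro AE_I2 summable_comparison_test'[OF g, of 0]) (use le in auto)
    show "summable (\<lambda>i. \<integral>\<xi>. norm (?f k i \<xi>) \<partial>W)"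
    proof (rule summable_comparison_test'[OF g, of 0])
      fix i
      show "norm (\<integral>\<xi>. norm (?f k i \<xi>) \<partial>W) \<le> (1/2) ^ Suc i"
        using Il[of i k] by simp
    qed
  qed
  have lim: "(\<lambda>k. \<integral>\<xi>. ?f k i \<xi> \<partial>W) \<longlonglongrightarrow> 0" for i
    using tendsto_mult_left[OF walk_at_dyad_tendsto[OF n dyad_nonneg[of i]], of "(1/2) ^ Suc i"] by simp
  have "((\<lambda>k. \<Sum>i. \<integral>\<xi>. ?f k i \<xi> \<partial>W) \<longlongrightarrow> (\<Sum>i. 0)) sequentially"
  proof (rule conjunct2[OF conjunct2[OF tannerys_theorem[OF lim _ g]]])
    show "\<forall>\<^sub>F (i, k) in sequentially \<times>\<^sub>F sequentially. norm (\<integral>\<xi>. ?f k i \<xi> \<partial>W) \<le> (1/2) ^ Suc i"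
      by (rule always_eventually, safe) (rule Il)
  qed simp
  then show ?thesis by (simp add: eq)
qed

text \<open>The point masses converge to \<open>r ^ j - r ^ Suc j\<close>, that is to the geometric
  law, and are dominated by \<open>r ^ j\<close> uniformly in the horizon, so Tannery's theorem
  applies.\<close>

lemma expectation_returns_tendsto:
  assumes b: "\<And>j. \<bar>G j\<bar> \<le> C"
  shows "(\<lambda>R. \<Sum>j\<le>R. W.prob {\<xi>. returns R \<xi> = j} * G j) \<longlonglongrightarrow> (\<Sum>j. \<upsilon> * r ^ j * G j)"
proof -
  have ev: "{\<xi>. j \<le> returns R \<xi>} \<in> W.events" "{\<xi>. returns R \<xi> = j} \<in> W.events" for j R
  proof -
    have "{\<xi>\<in>space W. j \<le> returns R \<xi>} \<in> W.events" "{\<xi>\<in>space W. returns R \<xi> = j} \<in> W.events" by measurable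
    then show "{\<xi>. j \<le> returns R \<xi>} \<in> W.events" "{\<xi>. returns R \<xi> = j} \<in> W.events" by simp_all
  qed
  have p: "W.prob {\<xi>. returns R \<xi> = j} = W.prob {\<xi>. j \<le> returns R \<xi>} - W.prob {\<xi>. Suc j \<le> returns R \<xi>}" for j R
  proof -
    have "{\<xi>. returns R \<xi> = j} = {\<xi>. j \<le> returns R \<xi>} - {\<xi>. Suc j \<le> returns R \<xi>}" by auto
    then show ?thesis using ev by (simp add: W.finite_measure_Diff Collect_mono)
  qed
  have ple: "W.prob {\<xi>. returns R \<xi> = j} \<le> r ^ j" for j R
    using prob_returns_le[of j R] measure_nonneg[of W "{\<xi>. Suc j \<le> returns R \<xi>}"] unfolding p by linarith
  have p0: "W.prob {\<xi>. returns R \<xi> = j} = 0" if "R < j" for R j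
  proof -
    have "returns R \<xi> \<noteq> j" for \<xi> using returns_le[of R \<xi>] that by linarith
    then show ?thesis by simp
  qed
  have "(\<lambda>R. W.prob {\<xi>. returns R \<xi> = j} * G j) \<longlonglongrightarrow> (r ^ j - r ^ Suc j) * G j" for j
    unfolding p by (intro tendsto_intros prob_returns_tendsto)
  then have lim: "(\<lambda>R. W.prob {\<xi>. returns R \<xi> = j} * G j) \<longlonglongrightarrow> \<upsilon> * r ^ j * G j" for j
    by (simp add: \<upsilon>_eq algebra_simps)
  have s: "summable (\<lambda>j. r ^ j * C)" using \<upsilon>_bounds by (intro summable_mult2 summable_geometric) auto
  have bd: "norm (W.prob {\<xi>. returns R \<xi> = j} * G j) \<le> r ^ j * C" for j R
    unfolding real_norm_def abs_mult using ple b \<upsilon>_bounds by (intro mult_mono) auto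
  have "(\<lambda>R. \<Sum>j. W.prob {\<xi>. returns R \<xi> = j} * G j) \<longlonglongrightarrow> (\<Sum>j. \<upsilon> * r ^ j * G j)"
  proof (intro conjunct2[OF conjunct2[OF tannerys_theorem[OF lim _ s]]])
    show "\<forall>\<^sub>F (j, R) in sequentially \<times>\<^sub>F sequentially. norm (W.prob {\<xi>. returns R \<xi> = j} * G j) \<le> r ^ j * C"
      by (rule always_eventually, safe) (rule bd)
  qed simp
  moreover have "(\<Sum>j. W.prob {\<xi>. returns R \<xi> = j} * G j) = (\<Sum>j\<le>R. W.prob {\<xi>. returns R \<xi> = j} * G j)" for R
    by (rule suminf_finite) (auto simp: p0 not_le)
  ultimately show ?thesis by simp
qed

lemma expectation_returns:
  "(\<integral>\<xi>. G (returns R \<xi>) \<partial>W) = (\<Sum>j\<le>R. W.prob {\<xi>. returns R \<xi> = j} * G j)"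
proof -
  have ev: "{\<xi>. returns R \<xi> = j} \<in> W.events" for j
  proof -
    have "{\<xi>\<in>space W. returns R \<xi> = j} \<in> W.events" by measurable
    then show ?thesis by simp
  qed
  have eq: "G (returns R \<xi>) = (\<Sum>j\<le>R. indicat_real {\<xi>. returns R \<xi> = j} \<xi> * G j)" for \<xi>
  proof -
    have "(\<Sum>j\<le>R. indicat_real {\<xi>. returns R \<xi> = j} \<xi> * G j) = (\<Sum>j\<in>{returns R \<xi>}. indicat_real {\<xi>. returns R \<xi> = j} \<xi> * G j)"
      using returns_le[of R \<xi>] by (intro sum.mono_neutral_right) auto
    then show ?thesis by simp
  qed
  have i: "integrable W (\<lambda>\<xi>. indicat_real {\<xi>. returns R \<xi> = j} \<xi> * G j)" for j
    using ev by (intro integrable_mult_left W.integrable_const_bound[of _ 1]) auto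
  show ?thesis unfolding eq Bochner_Integration.integral_sum[OF i] using ev by simp
qed

end

section \<open>The trap environment\<close>

lemma (in product_prob_space) nn_integral_PiM_prod:
  assumes J: "finite J" "J \<subseteq> I" and f: "\<And>i. i \<in> J \<Longrightarrow> f i \<in> borel_measurable (M i)"
  shows "(\<integral>\<^sup>+x. (\<Prod>i\<in>J. f i (x i)) \<partial>PiM I M) = (\<Prod>i\<in>J. \<integral>\<^sup>+x. f i x \<partial>M i)"
proof -
  have m: "(\<lambda>x. \<Prod>i\<in>J. f i (x i)) \<in> borel_measurable (PiM J M)"
    using f by (intro borel_measurable_prod_ennreal measurable_compose[OF measurable_component_singleton]) auto
  have "(\<integral>\<^sup>+x. (\<Prod>i\<in>J. f i (x i)) \<partial>PiM I M) = (\<integral>\<^sup>+x. (\<Prod>i\<in>J. f i (restrict x J i)) \<partial>PiM I M)"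
    by (intro nn_integral_cong prod.cong) auto
  also have "\<dots> = (\<integral>\<^sup>+x. (\<Prod>i\<in>J. f i (x i)) \<partial>distr (PiM I M) (PiM J M) (\<lambda>x. restrict x J))"
    using m J by (intro nn_integral_distr[symmetric] measurable_restrict_subset) auto
  also have "\<dots> = (\<Prod>i\<in>J. \<integral>\<^sup>+x. f i x \<partial>M i)"
    unfolding distr_PiM_restrict_finite[OF J] by (rule product_nn_integral_prod) (use J f in auto)
  finally show ?thesis .
qed

lemma card_visits_Suc:
  fixes Y :: "nat \<Rightarrow> int"
  shows "card {k. k < Suc n \<and> Y k = x} = card {k. k < n \<and> Y k = x} + of_bool (Y n = x)"
proof -
  have "{k. k < Suc n \<and> Y k = x} = {k. k < n \<and> Y k = x} \<union> (if Y n = x then {n} else {})"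
    by (auto simp: less_Suc_eq)
  then show ?thesis by (auto simp: card_insert_if)
qed

text \<open>The sum over sites regrouped by time: the step at time \<open>m\<close> consumes the
  holding time whose index is the number of earlier visits to the current site.\<close>

lemma clock_eq_sum:
  "clock \<eta> \<xi> n = (\<Sum>m<n. \<eta> (walk \<xi> m) (card {k. k < m \<and> walk \<xi> k = walk \<xi> m}))"
proof -
  have "(\<Sum>x\<in>X. \<Sum>i<card {k. k < n \<and> walk \<xi> k = x}. \<eta> x i) =
      (\<Sum>m<n. \<eta> (walk \<xi> m) (card {k. k < m \<and> walk \<xi> k = walk \<xi> m}))"
    if "finite X" "walk \<xi> ` {..<n} \<subseteq> X" for X
    using that
  proof (induction n)
    case (Suc n)
    let ?c = "\<lambda>x. card {k. k < n \<and> walk \<xi> k = x}"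
    have "(\<Sum>x\<in>X. \<Sum>i<card {k. k < Suc n \<and> walk \<xi> k = x}. \<eta> x i) =
        (\<Sum>x\<in>X. (\<Sum>i<?c x. \<eta> x i) + of_bool (x = walk \<xi> n) * \<eta> x (?c x))"
      unfolding card_visits_Suc by (intro sum.cong) auto
    also have "\<dots> = (\<Sum>x\<in>X. \<Sum>i<?c x. \<eta> x i) + \<eta> (walk \<xi> n) (?c (walk \<xi> n))"
    proof -
      have "(\<Sum>x\<in>X. of_bool (x = walk \<xi> n) * \<eta> x (?c x)) = (\<Sum>x\<in>{walk \<xi> n}. of_bool (x = walk \<xi> n) * \<eta> x (?c x))"
        using Suc.prems by (intro sum.mono_neutral_right) auto
      then show ?thesis by (simp add: sum.distrib)
    qed
    also have "(\<Sum>x\<in>X. \<Sum>i<?c x. \<eta> x i) = (\<Sum>m<n. \<eta> (walk \<xi> m) (card {k. k < m \<and> walk \<xi> k = walk \<xi> m}))"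
      using Suc.prems by (intro Suc.IH) auto
    finally show ?case by simp
  qed simp
  from this[of "walk \<xi> ` {..<n}"] show ?thesis by (simp add: clock_def)
qed

text \<open>Distinct visits to one site use distinct holding times, which is what makes their joint
  law given the trap a product.\<close>

lemma visit_index_inj:
  fixes Y :: "nat \<Rightarrow> 'b"
  shows "inj_on (\<lambda>m. card {k. k < m \<and> Y k = Y m}) {m. m < N \<and> Y m = x}"
proof -
  have less: "card {k. k < m \<and> Y k = Y m} < card {k. k < m' \<and> Y k = Y m'}" if "m < m'" "Y m = Y m'" for m m' :: nat
  proof (rule psubset_card_mono)
    show "{k. k < m \<and> Y k = Y m} \<subset> {k. k < m' \<and> Y k = Y m'}" using that by auto
  qed simp
  show ?thesis
  proof (rule inj_onI)
    fix m m' :: nat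
    assume "m \<in> {m. m < N \<and> Y m = x}" "m' \<in> {m. m < N \<and> Y m = x}"
      "card {k. k < m \<and> Y k = Y m} = card {k. k < m' \<and> Y k = Y m'}"
    then show "m = m'" using less[of m m'] less[of m' m] by (cases m m' rule: linorder_cases) auto
  qed
qed

section \<open>Averaging over the random traps\<close>

locale trap_env =
  fixes \<pi> :: "real measure measure"
  assumes sets_\<pi>: "sets \<pi> = sets (prob_algebra borel)" and prob_\<pi>: "prob_space \<pi>"
    and pos: "AE \<mu> in \<pi>. emeasure \<mu> {..0} = 0"
begin

sublocale prob_space \<pi> by (rule prob_\<pi>)

lemma space_\<pi>: "\<mu> \<in> space \<pi> \<longleftrightarrow> prob_space \<mu> \<and> sets \<mu> = sets borel"
  using sets_eq_imp_space_eq[OF sets_\<pi>] by (auto simp: space_prob_algebra)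

lemma ident_subprob: "(\<lambda>\<mu>. \<mu>) \<in> measurable \<pi> (subprob_algebra borel)"
  by (rule measurable_prob_algebraD, rule measurable_ident_sets[OF sets_\<pi>])

abbreviation "hold_seqs \<equiv> PiM (UNIV :: nat set) (\<lambda>_. borel :: real measure)"

definition seq_law :: "real measure \<Rightarrow> (nat \<Rightarrow> real) measure" where
  "seq_law \<mu> = PiM UNIV (\<lambda>_. \<mu>)"

lemma sets_seq_law: "\<mu> \<in> space \<pi> \<Longrightarrow> sets (seq_law \<mu>) = sets hold_seqs"
  unfolding seq_law_def by (rule sets_PiM_cong) (auto simp: space_\<pi>)

lemma prob_seq_law: "\<mu> \<in> space \<pi> \<Longrightarrow> prob_space (seq_law \<mu>)"
  unfolding seq_law_def by (rule prob_space_PiM) (auto simp: space_\<pi>)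

text \<open>Needed for the bind that averages over the trap. Cylinders generate the product space,
  and on a cylinder the measure is a finite product of evaluations of \<open>\<mu>\<close>.\<close>

lemma measurable_seq_law: "seq_law \<in> measurable \<pi> (prob_algebra hold_seqs)"
proof (rule measurable_prob_algebra_generated)
  show "sets hold_seqs = sigma_sets (\<Pi>\<^sub>E i\<in>UNIV. space borel) (prod_algebra UNIV (\<lambda>_. borel))" by (rule sets_PiM)
  show "Int_stable (prod_algebra (UNIV :: nat set) (\<lambda>_. borel :: real measure))" by (rule Int_stable_prod_algebra)
  show "prod_algebra (UNIV :: nat set) (\<lambda>_. borel :: real measure) \<subseteq> Pow (\<Pi>\<^sub>E i\<in>UNIV. space borel)"
    by (rule prod_algebra_sets_into_space)
  show "prob_space (seq_law \<mu>)" "sets (seq_law \<mu>) = sets hold_seqs" if "\<mu> \<in> space \<pi>" for \<mu>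
    by (rule prob_seq_law[OF that], rule sets_seq_law[OF that])
  fix A assume "A \<in> prod_algebra (UNIV :: nat set) (\<lambda>_. borel :: real measure)"
  then obtain J E where A: "A = prod_emb UNIV (\<lambda>_. borel) J (\<Pi>\<^sub>E j\<in>J. E j)" and J: "finite J"
    "\<And>i. i \<in> J \<Longrightarrow> E i \<in> sets (borel :: real measure)"
    by (rule prod_algebraE) auto
  have "emeasure (seq_law \<mu>) A = (\<Prod>j\<in>J. emeasure \<mu> (E j))" if \<mu>: "\<mu> \<in> space \<pi>" for \<mu>
  proof -
    interpret \<mu>: prob_space \<mu> using \<mu> by (simp add: space_\<pi>)
    interpret K: product_prob_space "\<lambda>_::nat. \<mu>" UNIV ..
    have sp: "space \<mu> = UNIV" using \<mu> by (auto simp: space_\<pi> dest: sets_eq_imp_space_eq)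
    have "A = prod_emb UNIV (\<lambda>_. \<mu>) J (\<Pi>\<^sub>E j\<in>J. E j)" by (simp add: A prod_emb_def sp)
    then show ?thesis
      using J \<mu> by (simp add: seq_law_def K.emeasure_PiM_emb space_\<pi>)
  qed
  moreover have "(\<lambda>\<mu>. \<Prod>j\<in>J. emeasure \<mu> (E j)) \<in> borel_measurable \<pi>"
    using J by (intro borel_measurable_prod_ennreal measurable_compose[OF ident_subprob measurable_emeasure_subprob_algebra]) auto
  ultimately show "(\<lambda>\<mu>. emeasure (seq_law \<mu>) A) \<in> borel_measurable \<pi>"
    by (subst measurable_cong)
qed

definition "site_law = \<pi> \<bind> seq_law"

lemma hold_law_eq: "hold_law \<pi> = PiM (UNIV :: int set) (\<lambda>_. site_law)"
  by (simp add: hold_law_def site_law_def seq_law_def[abs_def])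

lemma sets_site_law: "sets site_law = sets hold_seqs"
  unfolding site_law_def
  by (rule sets_bind) (use sets_seq_law not_empty in auto)

lemma prob_site_law: "prob_space site_law"
  unfolding site_law_def
  by (rule prob_space_bind[OF _ measurable_prob_algebraD[OF measurable_seq_law]]) (use prob_seq_law in auto)

sublocale site: product_prob_space "\<lambda>_. site_law" "UNIV :: int set"
  using prob_site_law by (simp add: product_prob_space_def product_sigma_finite_def prob_space_imp_sigma_finite product_prob_space_axioms_def)

sublocale hold: prob_space "hold_law \<pi>"
  unfolding hold_law_eq by (rule prob_space_PiM) (rule prob_site_law)

lemma measurable_hold: "(\<lambda>\<eta>. \<eta> x i) \<in> borel_measurable (hold_law \<pi>)"
proof -
  have "(\<lambda>\<eta>. \<eta> x) \<in> measurable (hold_law \<pi>) hold_seqs"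
    unfolding hold_law_eq measurable_cong_sets[OF refl sets_site_law[symmetric]]
    by (rule measurable_component_singleton) simp
  then show ?thesis
    by (rule measurable_compose) (rule measurable_component_singleton, simp)
qed

definition lap :: "real measure \<Rightarrow> real \<Rightarrow> real" where
  "lap \<mu> c = (\<integral>x. exp (- c * x) \<partial>\<mu>)"

lemma measurable_lap[measurable]: "(\<lambda>\<mu>. lap \<mu> c) \<in> borel_measurable \<pi>"
proof -
  have "lap \<mu> c = enn2real (\<integral>\<^sup>+x. ennreal (exp (- c * x)) \<partial>\<mu>)" if "\<mu> \<in> space \<pi>" for \<mu>
  proof -
    have [measurable_cong]: "sets \<mu> = sets borel" using that by (simp add: space_\<pi>)
    have "(\<lambda>x. exp (- c * x)) \<in> borel_measurable \<mu>" by measurable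
    then show ?thesis unfolding lap_def by (rule integral_eq_nn_integral) simp
  qed
  moreover have "(\<lambda>\<mu>. enn2real (\<integral>\<^sup>+x. ennreal (exp (- c * x)) \<partial>\<mu>)) \<in> borel_measurable \<pi>"
    by (intro measurable_compose[OF ident_subprob] measurable_compose[OF nn_integral_measurable_subprob_algebra]) auto
  ultimately show ?thesis by (subst measurable_cong)
qed

definition "pos_law \<mu> \<longleftrightarrow> \<mu> \<in> space \<pi> \<and> emeasure \<mu> {..0} = 0"

lemma AE_pos_law: "AE \<mu> in \<pi>. pos_law \<mu>"
  using pos AE_space by eventually_elim (simp add: pos_law_def)

context
  fixes \<mu> assumes \<mu>: "pos_law \<mu>"
begin

lemma pos_AE: "AE x in \<mu>. 0 < x"
proof -
  have s: "sets \<mu> = sets borel" using \<mu> by (simp add: pos_law_def space_\<pi>)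
  have "{..0} \<in> null_sets \<mu>" using \<mu> s by (intro null_setsI) (simp_all add: pos_law_def)
  from AE_not_in[OF this] show ?thesis by eventually_elim auto
qed

lemma lap_integrable:
  assumes "0 \<le> c" shows "integrable \<mu> (\<lambda>x. exp (- c * x))"
proof -
  have [measurable_cong]: "sets \<mu> = sets borel" using \<mu> by (simp add: pos_law_def space_\<pi>)
  interpret \<mu>: prob_space \<mu> using \<mu> by (simp add: pos_law_def space_\<pi>)
  show ?thesis
  proof (rule \<mu>.integrable_const_bound[of _ 1])
    show "AE x in \<mu>. norm (exp (- c * x)) \<le> 1" using pos_AE assms by (auto elim!: eventually_mono)
  qed measurable
qed

lemma nn_integral_lap: "0 \<le> c \<Longrightarrow> (\<integral>\<^sup>+x. ennreal (exp (- c * x)) \<partial>\<mu>) = ennreal (lap \<mu> c)"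
  unfolding lap_def by (rule nn_integral_eq_integral[OF lap_integrable]) simp_all

lemma lap_mono: "0 \<le> c \<Longrightarrow> c \<le> c' \<Longrightarrow> lap \<mu> c' \<le> lap \<mu> c"
  unfolding lap_def using pos_AE
  by (intro integral_mono_AE lap_integrable) (auto elim!: eventually_mono)

lemma lap_0: "lap \<mu> 0 = 1"
proof -
  interpret \<mu>: prob_space \<mu> using \<mu> by (simp add: pos_law_def space_\<pi>)
  show ?thesis by (simp add: lap_def \<mu>.prob_space)
qed

lemma lap_bounds: "0 \<le> c \<Longrightarrow> 0 \<le> lap \<mu> c" "0 \<le> c \<Longrightarrow> lap \<mu> c \<le> 1"
  using lap_mono[of 0 c] by (simp_all add: lap_0) (simp add: lap_def integral_nonneg_AE)

end

text \<open>Here V is the set of times at which a fixed site is visited, and c m is the weight of the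
  visit at time m.\<close>

definition "mom c V = (\<integral>\<mu>. (\<Prod>m\<in>V. lap \<mu> (c m)) \<partial>\<pi>)"

lemma mom_integrand:
  fixes c :: "nat \<Rightarrow> real"
  assumes "\<And>m. 0 \<le> c m" "pos_law \<mu>"
  shows "0 \<le> (\<Prod>m\<in>V. lap \<mu> (c m))" "(\<Prod>m\<in>V. lap \<mu> (c m)) \<le> 1"
  using assms lap_bounds by (auto intro!: prod_nonneg prod_le_1)

lemma mom_integrable:
  fixes c :: "nat \<Rightarrow> real"
  assumes "\<And>m. 0 \<le> c m"
  shows "integrable \<pi> (\<lambda>\<mu>. \<Prod>m\<in>V. lap \<mu> (c m))"
proof (rule integrable_const_bound[of _ 1])
  show "AE \<mu> in \<pi>. norm (\<Prod>m\<in>V. lap \<mu> (c m)) \<le> 1"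
    using AE_pos_law by eventually_elim (use mom_integrand[OF assms] in auto)
qed (intro borel_measurable_prod measurable_lap)

lemma mom_bounds:
  fixes c :: "nat \<Rightarrow> real"
  assumes "\<And>m. 0 \<le> c m"
  shows "0 \<le> mom c V" "mom c V \<le> 1" "mom c {} = 1"
proof -
  show "0 \<le> mom c V" unfolding mom_def
    by (rule integral_nonneg_AE) (use AE_pos_law in eventually_elim, use mom_integrand[OF assms] in auto)
  have "mom c V \<le> (\<integral>\<mu>. 1 \<partial>\<pi>)" unfolding mom_def
    by (rule integral_mono_AE[OF mom_integrable[OF assms]])
      (simp, use AE_pos_law in eventually_elim, use mom_integrand[OF assms] in auto)
  then show "mom c V \<le> 1" by (simp add: prob_space)
  show "mom c {} = 1" by (simp add: mom_def prob_space)
qed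

text \<open>One more visit multiplies an integrand in [0, 1] by \<open>lap \<mu> (c m)\<close>, so
  at most \<open>1 - lap \<mu> w\<close> is lost. The bound does not depend on \<open>V\<close>, and
  in the application it is of order 1/n.\<close>

lemma mom_decrease:
  fixes c :: "nat \<Rightarrow> real"
  assumes c: "\<And>m. 0 \<le> c m" and V: "finite V" "m \<notin> V" and w: "c m \<le> w"
  shows "0 \<le> mom c V - mom c (insert m V)" "mom c V - mom c (insert m V) \<le> 1 - (\<integral>\<mu>. lap \<mu> w \<partial>\<pi>)"
proof -
  have w0: "0 \<le> w" using c[of m] w by simp
  have i: "integrable \<pi> (\<lambda>\<mu>. lap \<mu> w)" using mom_integrable[of "\<lambda>_. w" "{0}"] w0 by simp
  have e: "mom c V - mom c (insert m V) = (\<integral>\<mu>. (\<Prod>m\<in>V. lap \<mu> (c m)) - (\<Prod>m\<in>insert m V. lap \<mu> (c m)) \<partial>\<pi>)"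
    unfolding mom_def by (rule Bochner_Integration.integral_diff[symmetric]; rule mom_integrable[OF c])
  have *: "AE \<mu> in \<pi>. 0 \<le> (\<Prod>m\<in>V. lap \<mu> (c m)) - (\<Prod>m\<in>insert m V. lap \<mu> (c m)) \<and>
     (\<Prod>m\<in>V. lap \<mu> (c m)) - (\<Prod>m\<in>insert m V. lap \<mu> (c m)) \<le> 1 - lap \<mu> w"
    using AE_pos_law
  proof eventually_elim
    case (elim \<mu>)
    define P where "P = (\<Prod>m\<in>V. lap \<mu> (c m))"
    have P: "0 \<le> P" "P \<le> 1" unfolding P_def using mom_integrand[OF c elim] by auto
    have l: "lap \<mu> w \<le> lap \<mu> (c m)" "lap \<mu> (c m) \<le> 1"
      using lap_mono[OF elim c w] lap_bounds[OF elim c] by auto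
    have "P - (\<Prod>m\<in>insert m V. lap \<mu> (c m)) = P * (1 - lap \<mu> (c m))"
      using V by (simp add: P_def algebra_simps)
    moreover have "P * (1 - lap \<mu> (c m)) \<le> 1 * (1 - lap \<mu> w)" using P l by (intro mult_mono) auto
    moreover have "0 \<le> P * (1 - lap \<mu> (c m))" using P l by simp
    ultimately show ?case by (simp add: P_def)
  qed
  show "0 \<le> mom c V - mom c (insert m V)"
    unfolding e by (rule integral_nonneg_AE) (use * in eventually_elim, simp)
  have "mom c V - mom c (insert m V) \<le> (\<integral>\<mu>. 1 - lap \<mu> w \<partial>\<pi>)"
    unfolding e using * i by (intro integral_mono_AE Bochner_Integration.integrable_diff mom_integrable c)
      (auto elim: eventually_mono)
  also have "\<dots> = 1 - (\<integral>\<mu>. lap \<mu> w \<partial>\<pi>)" using i by (simp add: prob_space)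
  finally show "mom c V - mom c (insert m V) \<le> 1 - (\<integral>\<mu>. lap \<mu> w \<partial>\<pi>)" .
qed

lemma mom_const:
  assumes "\<And>m. m \<in> V \<Longrightarrow> c m = w"
  shows "mom c V = (\<integral>\<mu>. lap \<mu> w ^ card V \<partial>\<pi>)"
  using assms by (simp add: mom_def)

lemma laplace_moment_eq: "laplace_moment \<pi> a lam l = (\<integral>\<mu>. lap \<mu> (lam / a) ^ l \<partial>\<pi>)"
  by (simp add: laplace_moment_def lap_def)

lemma nn_integral_seq_law:
  fixes c :: "nat \<Rightarrow> real" and idx :: "nat \<Rightarrow> nat"
  assumes c: "\<And>m. 0 \<le> c m" and V: "finite V" "inj_on idx V" and \<mu>: "pos_law \<mu>"
  shows "(\<integral>\<^sup>+\<zeta>. (\<Prod>m\<in>V. ennreal (exp (- c m * \<zeta> (idx m)))) \<partial>seq_law \<mu>) = ennreal (\<Prod>m\<in>V. lap \<mu> (c m))"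
proof -
  interpret \<mu>: prob_space \<mu> using \<mu> by (simp add: pos_law_def space_\<pi>)
  interpret K: product_prob_space "\<lambda>_::nat. \<mu>" UNIV ..
  have [measurable_cong]: "sets \<mu> = sets borel" using \<mu> by (simp add: pos_law_def space_\<pi>)
  \<comment> \<open>Injectivity of \<open>idx\<close> on \<open>V\<close> moves the weights from the
    visits to the coordinates of the holding sequence.\<close>
  define d where "d i = c (the_inv_into V idx i)" for i
  have d: "d (idx m) = c m" if "m \<in> V" for m using that V by (simp add: d_def the_inv_into_f_f)
  have d0: "0 \<le> d i" for i using c by (simp add: d_def)
  have r: "(\<Prod>m\<in>V. ennreal (exp (- c m * \<zeta> (idx m)))) = (\<Prod>i\<in>idx ` V. ennreal (exp (- d i * \<zeta> i)))" for \<zeta>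
    using V by (simp add: prod.reindex d)
  have "(\<integral>\<^sup>+\<zeta>. (\<Prod>m\<in>V. ennreal (exp (- c m * \<zeta> (idx m)))) \<partial>seq_law \<mu>) =
    (\<Prod>i\<in>idx ` V. \<integral>\<^sup>+x. ennreal (exp (- d i * x)) \<partial>\<mu>)"
    unfolding r seq_law_def using V by (intro K.nn_integral_PiM_prod) auto
  also have "\<dots> = (\<Prod>i\<in>idx ` V. ennreal (lap \<mu> (d i)))"
    using nn_integral_lap[OF \<mu> d0] by simp
  also have "\<dots> = (\<Prod>m\<in>V. ennreal (lap \<mu> (c m)))"
    using V by (simp add: prod.reindex d)
  finally show ?thesis using lap_bounds[OF \<mu> c] by (simp add: prod_ennreal)
qed

lemma nn_integral_site_law:
  fixes c :: "nat \<Rightarrow> real" and idx :: "nat \<Rightarrow> nat"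
  assumes c: "\<And>m. 0 \<le> c m" and V: "finite V" "inj_on idx V"
  shows "(\<integral>\<^sup>+\<zeta>. (\<Prod>m\<in>V. ennreal (exp (- c m * \<zeta> (idx m)))) \<partial>site_law) = ennreal (mom c V)"
proof -
  have "(\<integral>\<^sup>+\<zeta>. (\<Prod>m\<in>V. ennreal (exp (- c m * \<zeta> (idx m)))) \<partial>site_law) =
    (\<integral>\<^sup>+\<mu>. \<integral>\<^sup>+\<zeta>. (\<Prod>m\<in>V. ennreal (exp (- c m * \<zeta> (idx m)))) \<partial>seq_law \<mu> \<partial>\<pi>)"
    unfolding site_law_def
    by (rule nn_integral_bind[where B = hold_seqs]) (auto intro: measurable_prob_algebraD[OF measurable_seq_law])
  also have "\<dots> = (\<integral>\<^sup>+\<mu>. ennreal (\<Prod>m\<in>V. lap \<mu> (c m)) \<partial>\<pi>)"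
    by (rule nn_integral_cong_AE) (use AE_pos_law in eventually_elim, rule nn_integral_seq_law[OF c V])
  also have "\<dots> = ennreal (mom c V)"
    unfolding mom_def using mom_integrand[OF c] AE_pos_law
    by (intro nn_integral_eq_integral mom_integrable c) (auto elim: eventually_mono)
  finally show ?thesis .
qed

text \<open>For a fixed walk the sites are independent, and given its trap the holding times of a
  site are independent; averaging over the trap turns the product over the visits of a site into
  \<open>mom\<close>.\<close>

lemma nn_integral_hold_law:
  fixes c :: "nat \<Rightarrow> real"
  assumes c: "\<And>m. 0 \<le> c m"
  shows "(\<integral>\<^sup>+\<eta>. ennreal (exp (- (\<Sum>m<N. c m * \<eta> (walk \<xi> m) (card {k. k < m \<and> walk \<xi> k = walk \<xi> m})))) \<partial>hold_law \<pi>) =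
    ennreal (\<Prod>x\<in>walk \<xi> ` {..<N}. mom c {m. m < N \<and> walk \<xi> m = x})"
proof -
  let ?idx = "\<lambda>m. card {k. k < m \<and> walk \<xi> k = walk \<xi> m}"
  let ?V = "\<lambda>x. {m. m < N \<and> walk \<xi> m = x}"
  let ?X = "walk \<xi> ` {..<N}"
  have V: "{m \<in> {..<N}. walk \<xi> m = x} = ?V x" for x by auto
  have "ennreal (exp (- (\<Sum>m<N. c m * \<eta> (walk \<xi> m) (?idx m)))) =
    (\<Prod>x\<in>?X. \<Prod>m\<in>?V x. ennreal (exp (- c m * \<eta> x (?idx m))))" for \<eta> :: "int \<Rightarrow> nat \<Rightarrow> real"
  proof -
    have "exp (- (\<Sum>m<N. c m * \<eta> (walk \<xi> m) (?idx m))) = (\<Prod>m<N. exp (- c m * \<eta> (walk \<xi> m) (?idx m)))"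
      by (simp add: exp_sum flip: sum_negf)
    also have "\<dots> = (\<Prod>x\<in>?X. \<Prod>m\<in>?V x. exp (- c m * \<eta> (walk \<xi> m) (?idx m)))"
      by (subst prod.image_gen[of _ _ "walk \<xi>"]) (simp_all add: V)
    also have "\<dots> = (\<Prod>x\<in>?X. \<Prod>m\<in>?V x. exp (- c m * \<eta> x (?idx m)))"
      by (intro prod.cong) auto
    finally show ?thesis by (simp add: prod_ennreal prod_nonneg)
  qed
  then have "(\<integral>\<^sup>+\<eta>. ennreal (exp (- (\<Sum>m<N. c m * \<eta> (walk \<xi> m) (?idx m)))) \<partial>hold_law \<pi>) =
    (\<integral>\<^sup>+\<eta>. (\<Prod>x\<in>?X. (\<lambda>x \<zeta>. \<Prod>m\<in>?V x. ennreal (exp (- c m * \<zeta> (?idx m)))) x (\<eta> x)) \<partial>hold_law \<pi>)"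
    by simp
  also have "\<dots> = (\<Prod>x\<in>?X. \<integral>\<^sup>+\<zeta>. (\<Prod>m\<in>?V x. ennreal (exp (- c m * \<zeta> (?idx m)))) \<partial>site_law)"
    unfolding hold_law_eq
  proof (rule site.nn_integral_PiM_prod)
    fix x
    have "(\<lambda>\<zeta>. \<Prod>m\<in>?V x. ennreal (exp (- c m * \<zeta> (?idx m)))) \<in> borel_measurable hold_seqs" by measurable
    then show "(\<lambda>\<zeta>. \<Prod>m\<in>?V x. ennreal (exp (- c m * \<zeta> (?idx m)))) \<in> borel_measurable site_law"
      by (simp only: measurable_cong_sets[OF sets_site_law refl])
  qed auto
  also have "\<dots> = (\<Prod>x\<in>?X. ennreal (mom c (?V x)))"
    by (intro prod.cong refl nn_integral_site_law c visit_index_inj) auto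
  also have "\<dots> = ennreal (\<Prod>x\<in>?X. mom c (?V x))"
    using mom_bounds(1)[OF c] by (simp add: prod_ennreal)
  finally show ?thesis .
qed

lemma AE_hold_pos: "AE \<eta> in hold_law \<pi>. \<forall>x i. 0 < \<eta> x i"
proof -
  have K: "AE \<zeta> in seq_law \<mu>. 0 < \<zeta> i" if \<mu>: "pos_law \<mu>" for \<mu> and i :: nat
  proof -
    interpret \<mu>: prob_space \<mu> using \<mu> by (simp add: pos_law_def space_\<pi>)
    show ?thesis unfolding seq_law_def
      by (rule AE_PiM_component) (use pos_AE[OF \<mu>] \<mu>.prob_space_axioms in auto)
  qed
  have S: "AE \<zeta> in site_law. 0 < \<zeta> i" for i :: nat
    unfolding site_law_def
  proof (subst AE_bind[OF measurable_prob_algebraD[OF measurable_seq_law]])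
    show "Measurable.pred hold_seqs (\<lambda>\<zeta>. 0 < \<zeta> i)" by measurable
    show "AE \<mu> in \<pi>. AE \<zeta> in seq_law \<mu>. 0 < \<zeta> i" using AE_pos_law K by (auto elim: eventually_mono)
  qed
  have "AE \<eta> in hold_law \<pi>. 0 < \<eta> x i" for x i
    unfolding hold_law_eq by (rule AE_PiM_component[of _ _ x "\<lambda>\<zeta>. 0 < \<zeta> i"]) (use S prob_site_law in auto)
  then show ?thesis by (simp add: AE_all_countable)
qed

end

section \<open>Joint Laplace transforms of the clock\<close>

text \<open>The elements are removed in increasing order, so that \<open>m\<close> is removed from
  exactly the set of elements not below it. The term at \<open>m\<close> thus looks only at larger
  elements.\<close>

lemma telescope_finite_set:
  fixes g :: "nat set \<Rightarrow> real"
  assumes "finite V"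
  shows "g {} - g V = (\<Sum>m\<in>V. g {k\<in>V. m < k} - g (insert m {k\<in>V. m < k}))"
  using assms
proof (induction V rule: finite_linorder_min_induct)
  case (insert b A)
  have b: "{k \<in> insert b A. b < k} = A" using insert.hyps by auto
  have m: "{k \<in> insert b A. m < k} = {k \<in> A. m < k}" if "m \<in> A" for m using insert.hyps that by auto
  define h where "h m = g {k\<in>insert b A. m < k} - g (insert m {k\<in>insert b A. m < k})" for m
  have "b \<notin> A" using insert.hyps by auto
  then have "sum h (insert b A) = h b + sum h A" using insert.hyps by simp
  moreover have "h b = g A - g (insert b A)" by (simp only: h_def b)
  moreover have "sum h A = (\<Sum>m\<in>A. g {k\<in>A. m < k} - g (insert m {k\<in>A. m < k}))"
    by (intro sum.cong refl) (simp only: h_def m)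
  moreover have "(\<Sum>m\<in>insert b A. g {k\<in>insert b A. m < k} - g (insert m {k\<in>insert b A. m < k})) = sum h (insert b A)"
    by (intro sum.cong refl) (simp only: h_def)
  ultimately have "(\<Sum>m\<in>insert b A. g {k\<in>insert b A. m < k} - g (insert m {k\<in>insert b A. m < k})) =
    g A - g (insert b A) + (\<Sum>m\<in>A. g {k\<in>A. m < k} - g (insert m {k\<in>A. m < k}))"
    by simp
  then show ?case using insert.IH by simp
qed simp

lemma exp_minus_bounds:
  fixes x :: real
  assumes "0 \<le> x"
  shows "1 - x \<le> exp (- x)" "exp (- x) \<le> 1 - x + x\<^sup>2"
proof -
  show "1 - x \<le> exp (- x)" using exp_ge_add_one_self[of "- x"] by simp
  have "exp (- x) = 1 / exp x" by (simp add: exp_minus field_simps)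
  also have "\<dots> \<le> 1 / (1 + x)" using assms exp_ge_add_one_self[of x] by (intro divide_left_mono) auto
  also have "\<dots> \<le> 1 - x + x\<^sup>2"
  proof -
    have "1 \<le> (1 - x + x\<^sup>2) * (1 + x)" using assms by (simp add: algebra_simps power2_eq_square)
    then show ?thesis using assms by (simp add: divide_le_eq)
  qed
  finally show "exp (- x) \<le> 1 - x + x\<^sup>2" .
qed

lemma prod_exp_diff:
  fixes d :: "'i \<Rightarrow> real"
  assumes "\<And>i. i \<in> I \<Longrightarrow> 0 \<le> d i" "\<And>i. i \<in> I \<Longrightarrow> d i \<le> 1"
  shows "\<bar>(\<Prod>i\<in>I. 1 - d i) - exp (- (\<Sum>i\<in>I. d i))\<bar> \<le> (\<Sum>i\<in>I. (d i)\<^sup>2)"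
proof (cases "finite I")
  case True
  have "\<bar>(\<Prod>i\<in>I. 1 - d i) - (\<Prod>i\<in>I. exp (- d i))\<bar> \<le> (\<Sum>i\<in>I. \<bar>(1 - d i) - exp (- d i)\<bar>)"
    using norm_prod_diff[of I "\<lambda>i. 1 - d i" "\<lambda>i. exp (- d i)"] assms by (auto simp: abs_le_iff)
  also have "\<dots> \<le> (\<Sum>i\<in>I. (d i)\<^sup>2)"
  proof (rule sum_mono)
    fix i assume "i \<in> I"
    then show "\<bar>(1 - d i) - exp (- d i)\<bar> \<le> (d i)\<^sup>2"
      using exp_minus_bounds[OF assms(1), of i] unfolding abs_le_iff by auto
  qed
  finally show ?thesis using True by (simp add: exp_sum flip: sum_negf)
qed auto

lemma exp_minus_lipschitz:
  fixes x y :: real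
  assumes "0 \<le> x" "0 \<le> y"
  shows "\<bar>exp (- x) - exp (- y)\<bar> \<le> \<bar>x - y\<bar>"
proof -
  have *: "exp (- x) - exp (- y) \<le> y - x" if "0 \<le> x" "x \<le> y" for x y :: real
  proof -
    have "exp (- x) - exp (- y) = exp (- x) * (1 - exp (- (y - x)))" by (simp add: algebra_simps flip: exp_add)
    also have "\<dots> \<le> 1 * (y - x)" using that exp_minus_bounds(1)[of "y - x"] by (intro mult_mono) auto
    finally show ?thesis by simp
  qed
  show ?thesis using *[of x y] *[of y x] assms by (cases "x \<le> y") (auto simp: abs_le_iff)
qed

lemma walk_cong: "(\<And>i. i < k \<Longrightarrow> \<xi> i = \<xi>' i) \<Longrightarrow> walk \<xi> k = walk \<xi>' k"
  unfolding walk_def by (intro sum.cong) auto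

text \<open>A function of finitely many integer steps factors through a list, a countable type, and
  is therefore measurable whatever its form.\<close>

lemma (in biased_walk) measurable_window:
  assumes dep: "\<And>\<xi> \<xi>'. (\<And>i. i < N \<Longrightarrow> \<xi> i = \<xi>' i) \<Longrightarrow> g \<xi> = g \<xi>'" and sp: "space M' = UNIV"
  shows "g \<in> measurable W M'"
proof -
  have map: "(\<lambda>\<xi>. map \<xi> [0..<N]) \<in> measurable W (count_space UNIV)" for N
  proof (induction N)
    case (Suc N)
    have "(\<lambda>\<xi>. (\<lambda>l \<xi>. l @ [\<xi> N]) (map \<xi> [0..<N]) \<xi>) \<in> measurable W (count_space UNIV)"
    proof (rule measurable_compose_countable[OF _ Suc.IH])
      fix l show "(\<lambda>\<xi>. l @ [\<xi> N]) \<in> measurable W (count_space UNIV)"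
        by (rule measurable_compose[OF measurable_step]) simp
    qed
    then show ?case by simp
  qed simp
  define h where "h l = g (\<lambda>i. l ! i)" for l
  have "(\<lambda>\<xi>. h (map \<xi> [0..<N])) \<in> measurable W M'"
    by (rule measurable_compose[OF map]) (simp add: sp)
  moreover have "h (map \<xi> [0..<N]) = g \<xi>" for \<xi>
    unfolding h_def by (rule dep) simp
  ultimately show ?thesis by simp
qed

locale rtrw_env = biased_walk \<beta> + trap_env \<pi> for \<beta> \<pi>
begin

sublocale HW: pair_prob_space "hold_law \<pi>" "walk_law \<beta>" ..

lemma annealed_eq: "annealed \<beta> \<pi> = hold_law \<pi> \<Otimes>\<^sub>M W"
  by (simp add: annealed_def)

sublocale ann: prob_space "annealed \<beta> \<pi>"
  unfolding annealed_eq by (rule HW.prob_space_axioms)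

lemma measurable_ann_W: "g \<in> measurable W M' \<Longrightarrow> (\<lambda>\<omega>. g (snd \<omega>)) \<in> measurable (annealed \<beta> \<pi>) M'"
  unfolding annealed_eq by (rule measurable_compose[OF measurable_snd])

definition visit_time :: "(int \<Rightarrow> nat \<Rightarrow> real) \<Rightarrow> (nat \<Rightarrow> int) \<Rightarrow> nat \<Rightarrow> real" where
  "visit_time \<eta> \<xi> m = \<eta> (walk \<xi> m) (card {k. k < m \<and> walk \<xi> k = walk \<xi> m})"

lemma clock_visit_time: "clock \<eta> \<xi> n = (\<Sum>m<n. visit_time \<eta> \<xi> m)"
  by (simp add: clock_eq_sum visit_time_def)

lemma measurable_visit_time: "(\<lambda>\<omega>. visit_time (fst \<omega>) (snd \<omega>) m) \<in> borel_measurable (annealed \<beta> \<pi>)"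
proof -
  define g where "g \<xi> = (walk \<xi> m, card {k. k < m \<and> walk \<xi> k = walk \<xi> m})" for \<xi> :: "nat \<Rightarrow> int"
  have "g \<in> measurable W (count_space UNIV)"
  proof (rule measurable_window[where N = m])
    fix \<xi> \<xi>' :: "nat \<Rightarrow> int" assume *: "\<And>i. i < m \<Longrightarrow> \<xi> i = \<xi>' i"
    have "walk \<xi> k = walk \<xi>' k" if "k \<le> m" for k using that * by (intro walk_cong) auto
    then have "walk \<xi> m = walk \<xi>' m" "{k. k < m \<and> walk \<xi> k = walk \<xi> m} = {k. k < m \<and> walk \<xi>' k = walk \<xi>' m}" by auto
    then show "g \<xi> = g \<xi>'" by (simp add: g_def)
  qed simp
  then have g: "(\<lambda>\<omega>. g (snd \<omega>)) \<in> measurable (annealed \<beta> \<pi>) (count_space UNIV)" by (rule measurable_ann_W)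
  have f: "(\<lambda>\<omega>. fst \<omega> x i) \<in> borel_measurable (annealed \<beta> \<pi>)" for x i
    unfolding annealed_eq by (rule measurable_compose[OF measurable_fst measurable_hold])
  have "(\<lambda>\<omega>. fst \<omega> (fst (g (snd \<omega>))) (snd (g (snd \<omega>)))) \<in> borel_measurable (annealed \<beta> \<pi>)"
    by (rule measurable_compose_countable[where f = "\<lambda>p \<omega>. fst \<omega> (fst p) (snd p)", OF f g])
  then show ?thesis by (simp add: g_def visit_time_def)
qed

lemma measurable_clock: "(\<lambda>\<omega>. clock (fst \<omega>) (snd \<omega>) n) \<in> borel_measurable (annealed \<beta> \<pi>)"
  unfolding clock_visit_time by (intro borel_measurable_sum measurable_visit_time)

definition site_prod :: "(nat \<Rightarrow> real) \<Rightarrow> nat \<Rightarrow> (nat \<Rightarrow> int) \<Rightarrow> real" where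
  "site_prod w N \<xi> = (\<Prod>x\<in>walk \<xi> ` {..<N}. mom w {m. m < N \<and> walk \<xi> m = x})"

text \<open>The first-order exponent: \<open>site_prod\<close> is close to
  \<open>exp (- site_sum)\<close> when every factor is close to 1.\<close>

definition site_sum :: "(nat \<Rightarrow> real) \<Rightarrow> nat \<Rightarrow> (nat \<Rightarrow> int) \<Rightarrow> real" where
  "site_sum w N \<xi> = (\<Sum>x\<in>walk \<xi> ` {..<N}. 1 - mom w {m. m < N \<and> walk \<xi> m = x})"

lemma window_visits:
  assumes "\<And>i. i < N \<Longrightarrow> \<xi> i = \<xi>' i"
  shows "walk \<xi> ` {..<N} = walk \<xi>' ` {..<N}" "{m. m < N \<and> walk \<xi> m = x} = {m. m < N \<and> walk \<xi>' m = x}"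
proof -
  have w: "walk \<xi> k = walk \<xi>' k" if "k < N" for k using that assms by (intro walk_cong) auto
  show "walk \<xi> ` {..<N} = walk \<xi>' ` {..<N}" using w by (intro image_cong) auto
  show "{m. m < N \<and> walk \<xi> m = x} = {m. m < N \<and> walk \<xi>' m = x}" using w by auto
qed

lemma measurable_site_prod[measurable]: "site_prod w N \<in> borel_measurable W"
proof (rule measurable_window[where N = N])
  fix \<xi> \<xi>' :: "nat \<Rightarrow> int" assume "\<And>i. i < N \<Longrightarrow> \<xi> i = \<xi>' i"
  note window_visits[OF this]
  then show "site_prod w N \<xi> = site_prod w N \<xi>'" unfolding site_prod_def by presburger
qed simp

context
  fixes w :: "nat \<Rightarrow> real" assumes w: "\<And>m. 0 \<le> w m"
begin

lemma site_prod_bounds: "0 \<le> site_prod w N \<xi>" "site_prod w N \<xi> \<le> 1"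
  unfolding site_prod_def using mom_bounds[OF w] by (auto intro!: prod_nonneg prod_le_1)

lemma site_sum_nonneg: "0 \<le> site_sum w N \<xi>"
  unfolding site_sum_def using mom_bounds[OF w] by (auto intro!: sum_nonneg)

lemma annealed_laplace:
  "(\<integral>\<^sup>+\<omega>. ennreal (exp (- (\<Sum>m<N. w m * visit_time (fst \<omega>) (snd \<omega>) m))) \<partial>annealed \<beta> \<pi>) =
    ennreal (\<integral>\<xi>. site_prod w N \<xi> \<partial>W)"
proof -
  have m: "(\<lambda>\<omega>. ennreal (exp (- (\<Sum>m<N. w m * visit_time (fst \<omega>) (snd \<omega>) m)))) \<in> borel_measurable (hold_law \<pi> \<Otimes>\<^sub>M W)"
    using measurable_visit_time unfolding annealed_eq
    by (intro measurable_compose[OF _ measurable_ennreal] borel_measurable_exp borel_measurable_uminus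
        borel_measurable_sum borel_measurable_times borel_measurable_const) auto
  have "(\<integral>\<^sup>+\<omega>. ennreal (exp (- (\<Sum>m<N. w m * visit_time (fst \<omega>) (snd \<omega>) m))) \<partial>annealed \<beta> \<pi>) =
    (\<integral>\<^sup>+\<xi>. \<integral>\<^sup>+\<eta>. ennreal (exp (- (\<Sum>m<N. w m * visit_time \<eta> \<xi> m))) \<partial>hold_law \<pi> \<partial>W)"
    unfolding annealed_eq using HW.nn_integral_snd[OF m] by simp
  also have "\<dots> = (\<integral>\<^sup>+\<xi>. ennreal (site_prod w N \<xi>) \<partial>W)"
    unfolding visit_time_def site_prod_def nn_integral_hold_law[OF w] ..
  also have "\<dots> = ennreal (\<integral>\<xi>. site_prod w N \<xi> \<partial>W)"
    by (intro nn_integral_eq_integral W.integrable_const_bound[of _ 1]) (use site_prod_bounds in auto)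
  finally show ?thesis .
qed

end

lemma annealed_clock_pos: "AE \<omega> in annealed \<beta> \<pi>. \<forall>m. 0 < visit_time (fst \<omega>) (snd \<omega>) m"
proof -
  have ev: "{\<omega> \<in> space (hold_law \<pi> \<Otimes>\<^sub>M W). \<forall>x i. 0 < fst \<omega> x i} \<in> sets (hold_law \<pi> \<Otimes>\<^sub>M W)"
  proof -
    have [measurable]: "(\<lambda>\<omega>. fst \<omega> x i) \<in> borel_measurable (hold_law \<pi> \<Otimes>\<^sub>M W)" for x i
      by (rule measurable_compose[OF measurable_fst measurable_hold])
    show ?thesis by measurable
  qed
  have "AE \<omega> in hold_law \<pi> \<Otimes>\<^sub>M W. \<forall>x i. 0 < fst \<omega> x i"
    by (rule HW.AE_pair_measure[OF ev]) (use AE_hold_pos in simp)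
  then show ?thesis unfolding annealed_eq by eventually_elim (simp add: visit_time_def)
qed

end

section \<open>Blocks of times on a grid\<close>

lemma sum_blocks:
  fixes g :: "nat \<Rightarrow> real" and t :: "nat \<Rightarrow> nat"
  assumes "mono t" "t 0 = 0"
  shows "(\<Sum>m<t B. g m) = (\<Sum>b<B. \<Sum>m\<in>{t b..<t (Suc b)}. g m)"
proof (induction B)
  case (Suc B)
  have "{..<t (Suc B)} = {..<t B} \<union> {t B..<t (Suc B)}" using monoD[OF assms(1), of B "Suc B"] by auto
  then have "(\<Sum>m<t (Suc B). g m) = (\<Sum>m<t B. g m) + (\<Sum>m\<in>{t B..<t (Suc B)}. g m)"
    by (simp add: sum.union_disjoint disjoint_iff)
  then show ?case by (simp add: Suc.IH)
qed (simp add: assms)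

text \<open>A time m lies in the half-open block from grid n d b to grid n d (b + 1) for b = block n d m.\<close>

definition "grid n d b = (n * b) div d" for n d b :: nat
definition "block n d m = (d * m + d - 1) div n" for n d m :: nat

lemma grid_mono: "mono (grid n d)"
  unfolding grid_def by (intro monoI div_le_mono) simp

lemma grid_0[simp]: "grid n d 0 = 0"
  by (simp add: grid_def)

text \<open>Over the integers \<open>d * m + d - 1 < n * (b + 1)\<close> says the same as
  \<open>d * (m + 1) \<le> n * (b + 1)\<close>; the shift by \<open>d - 1\<close> replaces a
  ceiling.\<close>

lemma block_le_iff:
  assumes "0 < n" "0 < d" shows "block n d m \<le> b \<longleftrightarrow> m < grid n d (Suc b)"
proof -
  have "m < grid n d (Suc b) \<longleftrightarrow> Suc m \<le> (n * Suc b) div d" by (simp add: grid_def Suc_le_eq)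
  also have "\<dots> \<longleftrightarrow> Suc m * d \<le> n * Suc b" using assms by (simp add: less_eq_div_iff_mult_less_eq)
  also have "\<dots> \<longleftrightarrow> d * m + d - 1 < Suc b * n" using assms by (auto simp: algebra_simps)
  also have "\<dots> \<longleftrightarrow> (d * m + d - 1) div n < Suc b" using assms by (simp add: div_less_iff_less_mult)
  finally show ?thesis by (simp add: block_def less_Suc_eq_le)
qed

lemma block_mono: "m \<le> m' \<Longrightarrow> block n d m \<le> block n d m'"
  unfolding block_def by (intro div_le_mono diff_le_mono add_mono mult_le_mono) auto

lemma block_eq:
  assumes "0 < n" "0 < d" "m \<in> {grid n d b..<grid n d (Suc b)}" shows "block n d m = b"
proof (cases b)
  case 0
  then show ?thesis using block_le_iff[OF assms(1,2), of m 0] assms(3) by auto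
next
  case (Suc b')
  then show ?thesis using block_le_iff[OF assms(1,2), of m b] block_le_iff[OF assms(1,2), of m b'] assms(3) by auto
qed

lemma sum_over_blocks:
  fixes h :: "nat \<Rightarrow> nat \<Rightarrow> real"
  assumes "0 < n" "0 < d"
  shows "(\<Sum>m<grid n d B. h (block n d m) m) = (\<Sum>b<B. \<Sum>m\<in>{grid n d b..<grid n d (Suc b)}. h b m)"
  unfolding sum_blocks[OF grid_mono grid_0]
  by (intro sum.cong refl) (simp add: block_eq[OF assms])

lemma grid_real:
  assumes "0 < d"
  shows "real (grid n d b) \<le> real n * (real b / real d)" "real n * (real b / real d) - 1 \<le> real (grid n d b)"
proof -
  have "real (n * b) = real (grid n d b) * real d + real ((n * b) mod d)"
    unfolding grid_def by (metis div_mult_mod_eq of_nat_add of_nat_mult)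
  moreover have "real ((n * b) mod d) < real d" using assms by simp
  ultimately show "real (grid n d b) \<le> real n * (real b / real d)" "real n * (real b / real d) - 1 \<le> real (grid n d b)"
    using assms by (auto simp: field_simps)
qed

lemma grid_eq_floor: "0 < d \<Longrightarrow> nat \<lfloor>real n * (real b / real d)\<rfloor> = grid n d b"
  by (simp add: grid_def floor_divide_of_nat_eq flip: of_nat_mult)

lemma block_length_tendsto:
  assumes n: "filterlim n at_top sequentially" and d: "0 < d"
  shows "(\<lambda>k. real (grid (n k) d (Suc b) - grid (n k) d b) / real (n k)) \<longlonglongrightarrow> 1 / real d"
proof -
  have g: "(\<lambda>k. real (grid (n k) d b) / real (n k)) \<longlonglongrightarrow> real b / real d" for b
  proof (rule tendsto_sandwich)
    have nr: "filterlim (\<lambda>k. real (n k)) at_top sequentially"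
      by (rule filterlim_compose[OF filterlim_real_sequentially n])
    then have "(\<lambda>k. 1 / real (n k)) \<longlonglongrightarrow> 0"
      by (intro tendsto_divide_0[OF tendsto_const] filterlim_at_top_imp_at_infinity)
    then have "(\<lambda>k. real b / real d - 1 / real (n k)) \<longlonglongrightarrow> real b / real d - 0" by (intro tendsto_intros)
    then show "(\<lambda>k. real b / real d - 1 / real (n k)) \<longlonglongrightarrow> real b / real d" by simp
    have pos: "\<forall>\<^sub>F k in sequentially. 0 < n k" using n[unfolded filterlim_at_top, rule_format, of 1] by eventually_elim simp
    show "\<forall>\<^sub>F k in sequentially. real b / real d - 1 / real (n k) \<le> real (grid (n k) d b) / real (n k)"
      using pos
    proof eventually_elim
      case (elim k)
      have "(real (n k) * (real b / real d) - 1) / real (n k) \<le> real (grid (n k) d b) / real (n k)"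
        by (rule divide_right_mono[OF grid_real(2)[OF d]]) simp
      then show ?case using elim by (simp add: diff_divide_distrib)
    qed
    show "\<forall>\<^sub>F k in sequentially. real (grid (n k) d b) / real (n k) \<le> real b / real d"
      using pos
    proof eventually_elim
      case (elim k)
      have "real (grid (n k) d b) / real (n k) \<le> real (n k) * (real b / real d) / real (n k)"
        by (rule divide_right_mono[OF grid_real(1)[OF d]]) simp
      then show ?case using elim by simp
    qed
  qed simp
  have "(\<lambda>k. real (grid (n k) d (Suc b)) / real (n k) - real (grid (n k) d b) / real (n k)) \<longlonglongrightarrow>
      real (Suc b) / real d - real b / real d"
    by (intro tendsto_diff g)
  moreover have "real (grid (n k) d (Suc b) - grid (n k) d b) / real (n k) =
      real (grid (n k) d (Suc b)) / real (n k) - real (grid (n k) d b) / real (n k)" for k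
    using monoD[OF grid_mono, of b "Suc b" "n k" d] by (simp add: of_nat_diff diff_divide_distrib)
  moreover have "real (Suc b) / real d - real b / real d = 1 / real d"
    by (simp flip: diff_divide_distrib)
  ultimately show ?thesis by (simp only:)
qed

section \<open>An explicit error bound for the product over sites\<close>

context rtrw_env
begin

definition "lapm s l = (\<integral>\<mu>. lap \<mu> s ^ l \<partial>\<pi>)"

lemma lapm_mom: "lapm s l = mom (\<lambda>_. s) {..<l}"
  by (simp add: mom_const[where w = s] lapm_def)

lemma lapm_bounds: "0 \<le> s \<Longrightarrow> 0 \<le> lapm s l" "0 \<le> s \<Longrightarrow> lapm s l \<le> 1" "lapm s 0 = 1"
  using mom_bounds[of "\<lambda>_. s"] by (auto simp: lapm_mom) (simp add: mom_def prob_space)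

lemma lapm_decrease:
  assumes "0 \<le> s" "s \<le> s'"
  shows "0 \<le> lapm s l - lapm s (Suc l)" "lapm s l - lapm s (Suc l) \<le> 1 - lapm s' 1"
  using mom_decrease[of "\<lambda>_. s" "{..<l}" l s'] assms
  by (simp_all add: lapm_mom[of s] lessThan_Suc) (simp add: lapm_def)

context
  fixes n d B R :: nat and c :: "nat \<Rightarrow> real" and C a :: real
  assumes n: "0 < n" and d: "0 < d" and a: "0 < a" and c: "\<And>b. 0 \<le> c b" "\<And>b. c b \<le> C"
begin

abbreviation (input) "wt \<equiv> \<lambda>m. c (block n d m) / a"
abbreviation (input) "hor \<equiv> grid n d B"
abbreviation (input) "dl \<equiv> 1 - lapm (C / a) 1"

lemma wt: "0 \<le> wt m" "wt m \<le> C / a"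
  using c a by (auto intro: divide_right_mono)

lemma dl: "0 \<le> dl" "dl \<le> 1"
  using lapm_bounds(1,2)[of "C / a" 1] c a order_trans[OF c(1)[of 0] c(2)[of 0]] by auto

definition "fut \<xi> m = {k. m < k \<and> k < hor \<and> walk \<xi> k = walk \<xi> m}"
definition "drop_at \<xi> m = mom wt (fut \<xi> m) - mom wt (insert m (fut \<xi> m))"

lemma drop_bounds: "0 \<le> drop_at \<xi> m" "drop_at \<xi> m \<le> dl"
proof -
  have f: "finite (fut \<xi> m)" "m \<notin> fut \<xi> m" by (auto simp: fut_def)
  show "0 \<le> drop_at \<xi> m" "drop_at \<xi> m \<le> dl"
    unfolding drop_at_def using mom_decrease[OF wt(1) f wt(2)] by (auto simp: lapm_def)
qed

text \<open>Telescoping over the visits to one site; the elements after \<open>m\<close> in that set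
  are the later visits before the horizon.\<close>

lemma one_minus_mom:
  "1 - mom wt {m. m < hor \<and> walk \<xi> m = x} = (\<Sum>m | m < hor \<and> walk \<xi> m = x. drop_at \<xi> m)"
proof -
  let ?V = "{m. m < hor \<and> walk \<xi> m = x}"
  have fut: "{k \<in> ?V. m < k} = fut \<xi> m" if "m \<in> ?V" for m using that by (auto simp: fut_def)
  have "mom wt {} - mom wt ?V = (\<Sum>m\<in>?V. mom wt {k\<in>?V. m < k} - mom wt (insert m {k\<in>?V. m < k}))"
    by (rule telescope_finite_set) simp
  also have "\<dots> = (\<Sum>m\<in>?V. drop_at \<xi> m)"
    by (intro sum.cong refl) (simp only: fut drop_at_def)
  finally show ?thesis using mom_bounds(3)[OF wt(1)] by simp
qed

lemma sites_image:
  fixes g :: "nat \<Rightarrow> real"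
  shows "(\<Sum>x\<in>walk \<xi> ` {..<hor}. \<Sum>m | m < hor \<and> walk \<xi> m = x. g m) = (\<Sum>m<hor. g m)"
  by (subst (2) sum.image_gen[of _ _ "walk \<xi>"]) (simp_all add: lessThan_def)

lemma site_sum_drop: "site_sum wt hor \<xi> = (\<Sum>m<hor. drop_at \<xi> m)"
  unfolding site_sum_def one_minus_mom by (rule sites_image)

text \<open>A site with v visits has defect at most \<open>dl * v\<close>, and the quadratic error
  of the exponential is the square of the defect. Summed over sites, v^2 counts the ordered pairs of
  times at a common site.\<close>

lemma site_prod_approx:
  "\<bar>site_prod wt hor \<xi> - exp (- site_sum wt hor \<xi>)\<bar> \<le> dl\<^sup>2 * (\<Sum>m<hor. \<Sum>k<hor. of_bool (walk \<xi> k = walk \<xi> m))"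
proof -
  let ?V = "\<lambda>x. {m. m < hor \<and> walk \<xi> m = x}"
  let ?X = "walk \<xi> ` {..<hor}"
  have le: "1 - mom wt (?V x) \<le> dl * real (card (?V x))" for x
    unfolding one_minus_mom using sum_mono[of "?V x" "drop_at \<xi>" "\<lambda>_. dl"] drop_bounds by (simp add: mult.commute)
  have b: "0 \<le> 1 - mom wt (?V x)" "1 - mom wt (?V x) \<le> 1" for x
    using mom_bounds(1,2)[OF wt(1)] by auto
  have "\<bar>site_prod wt hor \<xi> - exp (- site_sum wt hor \<xi>)\<bar> \<le> (\<Sum>x\<in>?X. (1 - mom wt (?V x))\<^sup>2)"
    using prod_exp_diff[of ?X "\<lambda>x. 1 - mom wt (?V x)"] b by (simp add: site_prod_def site_sum_def)
  also have "\<dots> \<le> (\<Sum>x\<in>?X. dl\<^sup>2 * (\<Sum>m\<in>?V x. \<Sum>k<hor. of_bool (walk \<xi> k = walk \<xi> m)))"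
  proof (rule sum_mono)
    fix x
    have "(\<Sum>k<hor. of_bool (walk \<xi> k = walk \<xi> m) :: real) = real (card (?V x))" if "m \<in> ?V x" for m
    proof -
      have "{..<hor} \<inter> {k. walk \<xi> k = walk \<xi> m} = ?V x" using that by auto
      then show ?thesis by simp
    qed
    then have "(\<Sum>m\<in>?V x. \<Sum>k<hor. of_bool (walk \<xi> k = walk \<xi> m) :: real) = (\<Sum>m\<in>?V x. real (card (?V x)))"
      by (intro sum.cong) auto
    also have "\<dots> = (real (card (?V x)))\<^sup>2" by (simp add: power2_eq_square)
    finally have e: "(\<Sum>m\<in>?V x. \<Sum>k<hor. of_bool (walk \<xi> k = walk \<xi> m) :: real) = (real (card (?V x)))\<^sup>2" .
    show "(1 - mom wt (?V x))\<^sup>2 \<le> dl\<^sup>2 * (\<Sum>m\<in>?V x. \<Sum>k<hor. of_bool (walk \<xi> k = walk \<xi> m))"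
      unfolding e power_mult_distrib[symmetric] using le b(1) by (intro power_mono) auto
  qed
  also have "\<dots> = dl\<^sup>2 * (\<Sum>m<hor. \<Sum>k<hor. of_bool (walk \<xi> k = walk \<xi> m))"
    unfolding sum_distrib_left[symmetric] sites_image ..
  finally show ?thesis .
qed

text \<open>The loss caused by a visit in block \<open>b\<close> when exactly \<open>j\<close> later
  visits to the site follow and all of them lie in the same block, hence carry the same
  weight.\<close>

definition "gain b j = lapm (c b / a) j - lapm (c b / a) (Suc j)"

lemma gain_bounds: "0 \<le> gain b j" "gain b j \<le> dl"
  unfolding gain_def using lapm_decrease[of "c b / a" "C / a" j] c a by (simp_all add: divide_right_mono)

lemma gain_le_1: "gain b j \<le> 1"
  using gain_bounds(2) dl(2) by (rule order_trans)

text \<open>Without late returns all later visits fall in the window; if the window stays inside its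
  block they share one weight, and \<open>mom\<close> depends only on their number.\<close>

lemma drop_at_window:
  assumes m: "m < hor" and late: "\<not> (\<exists>k. m + R < k \<and> k < hor \<and> walk \<xi> k = walk \<xi> m)"
    and bd: "m + R < grid n d (Suc (block n d m))"
  shows "drop_at \<xi> m = gain (block n d m) (returns R (\<lambda>i. \<xi> (m + i)))"
proof -
  let ?b = "block n d m"
  have "\<not> B \<le> ?b"
  proof
    assume "B \<le> ?b"
    then show False using block_le_iff[OF n d, of m "B - 1"] m by (cases B) auto
  qed
  \<comment> \<open>The block of \<open>m\<close> ends before the horizon, so a window inside the
    block is not cut off by it.\<close>
  then have hor: "grid n d (Suc ?b) \<le> hor" by (intro monoD[OF grid_mono]) auto
  have f: "fut \<xi> m = {k \<in> {m<..m + R}. walk \<xi> k = walk \<xi> m}"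
    using late bd hor unfolding fut_def by (auto simp: not_less)
  have bl: "block n d k = ?b" if "k \<in> {m..m + R}" for k
  proof (rule antisym)
    show "block n d k \<le> ?b" using that bd by (subst block_le_iff[OF n d]) auto
    show "?b \<le> block n d k" using that by (intro block_mono) auto
  qed
  have card: "card (fut \<xi> m) = returns R (\<lambda>i. \<xi> (m + i))"
    unfolding returns_def
  proof (rule bij_betw_same_card[of "\<lambda>k. k - m"])
    have w: "walk (\<lambda>i. \<xi> (m + i)) g = 0 \<longleftrightarrow> walk \<xi> (m + g) = walk \<xi> m" for g
      using walk_shift[of \<xi> m g] by auto
    show "bij_betw (\<lambda>k. k - m) (fut \<xi> m) {g \<in> {1..R}. walk (\<lambda>i. \<xi> (m + i)) g = 0}"
      unfolding f w by (rule bij_betwI[where g = "\<lambda>g. m + g"]) auto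
  qed
  have fin: "finite (fut \<xi> m)" "m \<notin> fut \<xi> m" by (auto simp: fut_def)
  have fb: "wt k = c ?b / a" if "k \<in> insert m (fut \<xi> m)" for k
  proof -
    have "k \<in> {m..m + R}" using that unfolding f by auto
    then show ?thesis by (simp only: bl[of k])
  qed
  have "mom wt (fut \<xi> m) = lapm (c ?b / a) (card (fut \<xi> m))"
    unfolding lapm_def by (rule mom_const) (rule fb, simp)
  moreover have "mom wt (insert m (fut \<xi> m)) = lapm (c ?b / a) (card (insert m (fut \<xi> m)))"
    unfolding lapm_def by (rule mom_const) (rule fb)
  ultimately show ?thesis using fin by (simp add: drop_at_def gain_def card)
qed

text \<open>A window can leave its block only from one of the last \<open>R\<close> times of that
  block.\<close>

lemma block_end_count:
  "(\<Sum>m<hor. of_bool (grid n d (Suc (block n d m)) \<le> m + R) :: real) \<le> real (B * R)"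
proof -
  let ?A = "{m. m < hor \<and> grid n d (Suc (block n d m)) \<le> m + R}"
  have "?A \<subseteq> (\<Union>b<B. {grid n d (Suc b) - R..<grid n d (Suc b)})"
  proof
    fix m assume m: "m \<in> ?A"
    have "m < grid n d (Suc (block n d m))" using block_le_iff[OF n d, of m "block n d m"] by simp
    moreover have "block n d m < B"
      using block_le_iff[OF n d, of m "B - 1"] m by (cases B) auto
    ultimately show "m \<in> (\<Union>b<B. {grid n d (Suc b) - R..<grid n d (Suc b)})"
      using m by (intro UN_I[of "block n d m"]) auto
  qed
  then have "card ?A \<le> card (\<Union>b<B. {grid n d (Suc b) - R..<grid n d (Suc b)})"
    by (intro card_mono) auto
  also have "\<dots> \<le> (\<Sum>b<B. card {grid n d (Suc b) - R..<grid n d (Suc b)})" by (rule card_UN_le) simp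
  also have "\<dots> \<le> (\<Sum>b<B. R)" by (intro sum_mono) simp
  finally have "card ?A \<le> B * R" by simp
  moreover have "(\<Sum>m<hor. of_bool (grid n d (Suc (block n d m)) \<le> m + R) :: real) = real (card ?A)"
    by (simp add: lessThan_def Int_def)
  ultimately show ?thesis by (simp only: of_nat_le_iff)
qed

text \<open>The two summands agree except at times with a late return or near a block end; there
  both lie between 0 and \<open>dl\<close>.\<close>

lemma site_sum_window:
  "\<bar>site_sum wt hor \<xi> - (\<Sum>m<hor. gain (block n d m) (returns R (\<lambda>i. \<xi> (m + i))))\<bar> \<le>
    dl * ((\<Sum>m<hor. of_bool (\<exists>k. m + R < k \<and> k < hor \<and> walk \<xi> k = walk \<xi> m)) + real (B * R))"
proof -
  let ?g = "\<lambda>m. gain (block n d m) (returns R (\<lambda>i. \<xi> (m + i)))"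
  let ?l = "\<lambda>m. \<exists>k. m + R < k \<and> k < hor \<and> walk \<xi> k = walk \<xi> m"
  let ?e = "\<lambda>m. grid n d (Suc (block n d m)) \<le> m + R"
  have "\<bar>site_sum wt hor \<xi> - (\<Sum>m<hor. ?g m)\<bar> \<le> (\<Sum>m<hor. \<bar>drop_at \<xi> m - ?g m\<bar>)"
    unfolding site_sum_drop sum_subtractf[symmetric] by (rule sum_abs)
  also have "\<dots> \<le> (\<Sum>m<hor. dl * (of_bool (?l m) + of_bool (?e m)))"
  proof (rule sum_mono)
    fix m assume m: "m \<in> {..<hor}"
    have le: "\<bar>drop_at \<xi> m - ?g m\<bar> \<le> dl"
      using drop_bounds[of \<xi> m] gain_bounds[of "block n d m" "returns R (\<lambda>i. \<xi> (m + i))"] by linarith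
    show "\<bar>drop_at \<xi> m - ?g m\<bar> \<le> dl * (of_bool (?l m) + of_bool (?e m))"
    proof (cases "?l m \<or> ?e m")
      case True
      then have "1 \<le> (of_bool (?l m) + of_bool (?e m) :: real)" by (simp only: of_bool_def) auto
      then have "dl * 1 \<le> dl * (of_bool (?l m) + of_bool (?e m))" using dl by (intro mult_left_mono) auto
      then show ?thesis using le by simp
    next
      case False
      then have "drop_at \<xi> m = ?g m" using m by (intro drop_at_window) (auto simp: not_le)
      then show ?thesis using dl by simp
    qed
  qed
  also have "\<dots> = dl * ((\<Sum>m<hor. of_bool (?l m)) + (\<Sum>m<hor. of_bool (?e m)))"
    by (simp only: sum_distrib_left[symmetric] sum.distrib)
  also have "\<dots> \<le> dl * ((\<Sum>m<hor. of_bool (?l m)) + real (B * R))"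
    using dl block_end_count by (intro mult_left_mono add_left_mono) auto
  finally show ?thesis .
qed

definition "mean_sum = (\<Sum>b<B. real (grid n d (Suc b) - grid n d b) * (\<Sum>j\<le>R. W.prob {\<xi>. returns R \<xi> = j} * gain b j))"

lemma window_mean: "(\<Sum>m<hor. \<integral>\<xi>. gain (block n d m) (returns R \<xi>) \<partial>W) = mean_sum"
  unfolding expectation_returns mean_sum_def
  by (subst sum_over_blocks[OF n d, of "\<lambda>b _. \<Sum>j\<le>R. W.prob {\<xi>. returns R \<xi> = j} * gain b j"]) simp

text \<open>The terms are, in order: replacing the product by an exponential, late returns together
  with block ends, fluctuation of the window sum about its mean, and the distance of that mean from
  the target exponent.\<close>

lemma site_prod_error:
  assumes L: "0 \<le> L"
  shows "\<bar>(\<integral>\<xi>. site_prod wt hor \<xi> \<partial>W) - exp (- L)\<bar> \<le>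
    dl\<^sup>2 * (real hor * (1 + 2 * (r / (1 - r)))) + dl * (real hor * late R + real (B * R)) +
    dl * sqrt (real hor * (2 * real R + 1)) + \<bar>mean_sum - L\<bar>"
proof -
  let ?S1 = "\<lambda>\<xi>. (\<Sum>m<hor. \<Sum>k<hor. of_bool (walk \<xi> k = walk \<xi> m)) :: real"
  let ?S2 = "\<lambda>\<xi>. (\<Sum>m<hor. of_bool (\<exists>k. m + R < k \<and> k < hor \<and> walk \<xi> k = walk \<xi> m)) :: real"
  let ?G = "\<lambda>\<xi>. (\<Sum>m<hor. gain (block n d m) (returns R (\<lambda>i. \<xi> (m + i))))"
  have Gm: "(\<lambda>\<xi>. gain (block n d m) (returns R (\<lambda>i. \<xi> (m + i)))) \<in> borel_measurable W" for m
    by (rule measurable_compose[OF measurable_shift measurable_compose[OF measurable_returns]]) simp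
  have Gi: "integrable W ?G"
    using gain_bounds(1) gain_le_1 Gm
    by (intro Bochner_Integration.integrable_sum W.integrable_const_bound[of _ 1]) auto
  have S1i: "integrable W ?S1"
    by (intro Bochner_Integration.integrable_sum W.integrable_const_bound[of _ 1]) auto
  have S2i: "integrable W ?S2"
    by (intro Bochner_Integration.integrable_sum W.integrable_const_bound[of _ 1]) auto
  have Pi: "integrable W (site_prod wt hor)"
    using site_prod_bounds[OF wt(1)] by (intro W.integrable_const_bound[of _ 1]) auto
  have D: "\<bar>site_prod wt hor \<xi> - exp (- L)\<bar> \<le> dl\<^sup>2 * ?S1 \<xi> + dl * (?S2 \<xi> + real (B * R)) + \<bar>?G \<xi> - mean_sum\<bar> + \<bar>mean_sum - L\<bar>" for \<xi>
  proof -
    have "\<bar>exp (- site_sum wt hor \<xi>) - exp (- L)\<bar> \<le> \<bar>site_sum wt hor \<xi> - L\<bar>"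
      using site_sum_nonneg[OF wt(1)] L by (intro exp_minus_lipschitz) auto
    then show ?thesis using site_prod_approx[of \<xi>] site_sum_window[of \<xi>] by linarith
  qed
  have "\<bar>(\<integral>\<xi>. site_prod wt hor \<xi> \<partial>W) - exp (- L)\<bar> = \<bar>\<integral>\<xi>. site_prod wt hor \<xi> - exp (- L) \<partial>W\<bar>"
    using Pi by (simp add: W.prob_space)
  also have "\<dots> \<le> (\<integral>\<xi>. \<bar>site_prod wt hor \<xi> - exp (- L)\<bar> \<partial>W)" by (rule integral_abs_bound)
  also have "\<dots> \<le> (\<integral>\<xi>. dl\<^sup>2 * ?S1 \<xi> + dl * (?S2 \<xi> + real (B * R)) + \<bar>?G \<xi> - mean_sum\<bar> + \<bar>mean_sum - L\<bar> \<partial>W)"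
    using D Pi by (intro integral_mono integrable_abs Bochner_Integration.integrable_add Bochner_Integration.integrable_diff
        integrable_mult_right S1i S2i Gi W.integrable_const) auto
  also have "\<dots> = dl\<^sup>2 * (\<integral>\<xi>. ?S1 \<xi> \<partial>W) + dl * ((\<integral>\<xi>. ?S2 \<xi> \<partial>W) + real (B * R)) +
    (\<integral>\<xi>. \<bar>?G \<xi> - mean_sum\<bar> \<partial>W) + \<bar>mean_sum - L\<bar>"
  proof -
    define s1 s2 g where "s1 = ?S1" and "s2 = ?S2" and "g = (\<lambda>\<xi>. \<bar>?G \<xi> - mean_sum\<bar>)"
    have "integrable W s1" "integrable W s2" "integrable W g"
      unfolding s1_def s2_def g_def by (rule S1i, rule S2i, intro integrable_abs Bochner_Integration.integrable_diff Gi W.integrable_const)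
    then have "(\<integral>\<xi>. dl\<^sup>2 * s1 \<xi> + dl * (s2 \<xi> + real (B * R)) + g \<xi> + \<bar>mean_sum - L\<bar> \<partial>W) =
      dl\<^sup>2 * (\<integral>\<xi>. s1 \<xi> \<partial>W) + dl * ((\<integral>\<xi>. s2 \<xi> \<partial>W) + real (B * R)) + (\<integral>\<xi>. g \<xi> \<partial>W) + \<bar>mean_sum - L\<bar>"
      by (simp add: W.prob_space)
    then show ?thesis by (simp only: s1_def s2_def g_def)
  qed
  also have "\<dots> \<le> dl\<^sup>2 * (real hor * (1 + 2 * (r / (1 - r)))) + dl * (real hor * late R + real (B * R)) +
    dl * sqrt (real hor * (2 * real R + 1)) + \<bar>mean_sum - L\<bar>"
  proof (intro add_mono mult_left_mono order_refl expected_meets late_returns)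
    show "(\<integral>\<xi>. \<bar>?G \<xi> - mean_sum\<bar> \<partial>W) \<le> dl * sqrt (real hor * (2 * real R + 1))"
      unfolding window_mean[symmetric]
      by (rule window_sum_deviation) (use gain_bounds in auto)
  qed (use dl in auto)
  finally show ?thesis .
qed

end

end

lemma grid_ratio_tendsto:
  assumes n: "filterlim n at_top sequentially" and d: "0 < d"
  shows "(\<lambda>k. real (grid (n k) d b) / real (n k)) \<longlonglongrightarrow> real b / real d"
proof (induction b)
  case (Suc b)
  have "(\<lambda>k. real (grid (n k) d b) / real (n k) + real (grid (n k) d (Suc b) - grid (n k) d b) / real (n k)) \<longlonglongrightarrow>
      real b / real d + 1 / real d"
    by (intro tendsto_add Suc.IH block_length_tendsto n d)
  moreover have "real (grid (n k) d b) / real (n k) + real (grid (n k) d (Suc b) - grid (n k) d b) / real (n k) =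
      real (grid (n k) d (Suc b)) / real (n k)" for k
    using monoD[OF grid_mono, of b "Suc b" "n k" d] by (simp add: of_nat_diff flip: add_divide_distrib)
  moreover have "real b / real d + 1 / real d = real (Suc b) / real d" by (simp add: add_divide_distrib)
  ultimately show ?case by (simp only:)
qed simp

context rtrw_env
begin

text \<open>Positivity keeps the argument of the logarithm in the hypothesis away from 0, so that
  exponentiating it recovers the transform.\<close>

lemma lap_pos:
  assumes \<mu>: "pos_law \<mu>" and s: "0 \<le> s" shows "0 < lap \<mu> s"
proof -
  interpret \<mu>: prob_space \<mu> using \<mu> by (simp add: pos_law_def space_\<pi>)
  have "lap \<mu> s \<noteq> 0"
  proof
    assume "lap \<mu> s = 0"
    then have "AE x in \<mu>. exp (- s * x) = 0"
      unfolding lap_def by (subst (asm) integral_nonneg_eq_0_iff_AE[OF lap_integrable[OF \<mu> s]]) auto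
    then have "AE x in \<mu>. False" by eventually_elim simp
    then show False by simp
  qed
  then show ?thesis using lap_bounds(1)[OF \<mu> s] by simp
qed

lemma lapm_pos:
  assumes s: "0 \<le> s" shows "0 < lapm s l"
proof -
  have i: "integrable \<pi> (\<lambda>\<mu>. lap \<mu> s ^ l)" using mom_integrable[of "\<lambda>_. s" "{..<l}"] s by simp
  have "lapm s l \<noteq> 0"
  proof
    assume "lapm s l = 0"
    moreover have "AE \<mu> in \<pi>. 0 \<le> lap \<mu> s ^ l"
      using AE_pos_law by eventually_elim (simp add: lap_bounds(1)[OF _ s])
    ultimately have "AE \<mu> in \<pi>. lap \<mu> s ^ l = 0"
      unfolding lapm_def by (simp only: integral_nonneg_eq_0_iff_AE[OF i])
    with AE_pos_law have "AE \<mu> in \<pi>. False"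
      by eventually_elim (use lap_pos[OF _ s] in force)
    then show False by simp
  qed
  then show ?thesis using lapm_bounds(1)[OF s, of l] by simp
qed

end

section \<open>The limit exponent\<close>

locale rtrw_limit = rtrw_env \<beta> \<pi> for \<beta> \<pi> +
  fixes n :: "nat \<Rightarrow> nat" and a :: "nat \<Rightarrow> real" and f :: "nat \<Rightarrow> real \<Rightarrow> real"
  assumes n_top: "filterlim n at_top sequentially" and n_pos: "\<And>k. 0 < n k" and a_pos: "\<And>k. 0 < a k"
    and f_lim: "\<And>l lam. 1 \<le> l \<Longrightarrow> 0 < lam \<Longrightarrow>
      (\<lambda>k. - real (n k) * ln (laplace_moment \<pi> (a k) lam l)) \<longlonglongrightarrow> f l lam"
begin

text \<open>Extends \<open>f\<close> to zero visits, so that the first increment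
  \<open>F 1 c - F 0 c\<close> makes sense, and to zero weight, so that blocks with weight 0 are
  allowed.\<close>

definition "F l c = (if l = 0 \<or> c = 0 then 0 else f l c)"

lemma n_real_top: "filterlim (\<lambda>k. real (n k)) at_top sequentially"
  by (rule filterlim_compose[OF filterlim_real_sequentially n_top])

lemma over_n_tendsto: "X \<longlonglongrightarrow> x \<Longrightarrow> (\<lambda>k. X k / real (n k)) \<longlonglongrightarrow> 0"
  by (intro tendsto_divide_0 filterlim_at_top_imp_at_infinity n_real_top)

text \<open>With \<open>x = - ln p\<close>, the quantities \<open>n * x\<close> and
  \<open>n * (1 - p)\<close> differ by at most \<open>(n * x)\<^sup>2 / n\<close>, which vanishes
  because \<open>n * x\<close> converges.\<close>

lemma F_lim:
  assumes c: "0 \<le> c"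
  shows "(\<lambda>k. real (n k) * (1 - lapm (c / a k) l)) \<longlonglongrightarrow> F l c"
proof (cases "l = 0 \<or> c = 0")
  case True
  have "lapm 0 l = 1"
  proof -
    have "lapm 0 l = (\<integral>\<mu>. 1 \<partial>\<pi>)" unfolding lapm_def
      by (rule integral_cong_AE) (use AE_pos_law in \<open>auto elim!: eventually_mono simp: lap_0\<close>)
    then show ?thesis by (simp add: prob_space)
  qed
  then have "lapm (c / a k) l = 1" for k using True lapm_bounds(3) by auto
  then show ?thesis using True by (auto simp: F_def)
next
  case False
  then have l: "1 \<le> l" and c: "0 < c" using c by auto
  have s: "0 \<le> c / a k" for k using c a_pos[of k] by simp
  define x where "x k = - ln (lapm (c / a k) l)" for k
  have m: "lapm (c / a k) l = exp (- x k)" for k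
    using lapm_pos[OF s] by (simp add: x_def)
  have x0: "0 \<le> x k" for k
    using lapm_pos[OF s, of k l] lapm_bounds(2)[OF s, of k l] by (simp add: x_def)
  have lim: "(\<lambda>k. real (n k) * x k) \<longlonglongrightarrow> f l c"
    using f_lim[OF l c] by (simp add: x_def laplace_moment_eq lapm_def)
  have "(\<lambda>k. real (n k) * x k - (real (n k) * x k)\<^sup>2 / real (n k)) \<longlonglongrightarrow> f l c - 0"
    by (intro tendsto_diff lim over_n_tendsto[OF tendsto_power[OF lim]])
  then have low: "(\<lambda>k. real (n k) * x k - (real (n k) * x k)\<^sup>2 / real (n k)) \<longlonglongrightarrow> f l c" by simp
  have "(\<lambda>k. real (n k) * (1 - lapm (c / a k) l)) \<longlonglongrightarrow> f l c"
  proof (rule tendsto_sandwich[OF _ _ low lim]; intro always_eventually allI)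
    fix k
    have "real (n k) * (x k - (x k)\<^sup>2) \<le> real (n k) * (1 - exp (- x k))"
      using exp_minus_bounds(2)[OF x0[of k]] by (intro mult_left_mono) auto
    moreover have "(real (n k) * x k)\<^sup>2 / real (n k) = real (n k) * (x k)\<^sup>2"
      using n_pos[of k] by (simp add: power2_eq_square)
    ultimately show "real (n k) * x k - (real (n k) * x k)\<^sup>2 / real (n k) \<le> real (n k) * (1 - lapm (c / a k) l)"
      unfolding m by (simp add: right_diff_distrib)
    show "real (n k) * (1 - lapm (c / a k) l) \<le> real (n k) * x k"
      unfolding m using exp_minus_bounds(1)[OF x0[of k]] by (intro mult_left_mono) auto
  qed
  then show ?thesis using False by (simp add: F_def)
qed

lemma gain_lim:
  assumes c: "0 \<le> c"
  shows "(\<lambda>k. real (n k) * (lapm (c / a k) j - lapm (c / a k) (Suc j))) \<longlonglongrightarrow> F (Suc j) c - F j c"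
  using tendsto_diff[OF F_lim[OF c, of "Suc j"] F_lim[OF c, of j]] by (simp add: algebra_simps)

text \<open>Limits of the corresponding bounds for transforms with one visit more, after
  multiplication by \<open>n k\<close>.\<close>

lemma F_increment:
  assumes c: "0 \<le> c" "c \<le> C"
  shows "0 \<le> F (Suc j) c - F j c" "F (Suc j) c - F j c \<le> F 1 C"
proof -
  have s: "0 \<le> c / a k" "c / a k \<le> C / a k" for k using c a_pos[of k] by (auto intro: divide_right_mono)
  show "0 \<le> F (Suc j) c - F j c"
    by (rule tendsto_lowerbound[OF gain_lim[OF c(1)]])
      (use lapm_decrease[OF s] in \<open>auto intro!: always_eventually mult_nonneg_nonneg\<close>)
  show "F (Suc j) c - F j c \<le> F 1 C"
  proof (rule tendsto_le[OF _ F_lim gain_lim[OF c(1)]])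
    show "\<forall>\<^sub>F k in sequentially. real (n k) * (lapm (c / a k) j - lapm (c / a k) (Suc j)) \<le> real (n k) * (1 - lapm (C / a k) 1)"
      using lapm_decrease(2)[OF s] by (intro always_eventually allI mult_left_mono) auto
  qed (use c in auto)
qed

lemma F_bounds:
  assumes c: "0 \<le> c" shows "0 \<le> F l c" "F l c \<le> real l * F 1 c"
proof -
  show "0 \<le> F l c"
  proof (induction l)
    case (Suc l) then show ?case using F_increment(1)[OF c order_refl, of l] by linarith
  qed (simp add: F_def)
  show "F l c \<le> real l * F 1 c"
  proof (induction l)
    case (Suc l) then show ?case using F_increment(2)[OF c order_refl, of l] by (simp add: algebra_simps)
  qed (simp add: F_def)
qed

text \<open>The mean limiting loss of one visit when the number of later visits has the geometric
  law with weights \<open>\<upsilon> * r ^ j\<close>.\<close>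

definition "Psi c = (\<Sum>j. \<upsilon> * r ^ j * (F (Suc j) c - F j c))"

lemma summable_F:
  assumes c: "0 \<le> c" shows "summable (\<lambda>j. r ^ j * F (Suc j) c)"
proof (rule summable_comparison_test')
  have "summable (\<lambda>j. real (Suc j) * r ^ j)"
    using geometric_deriv_sums[of r] \<upsilon>_bounds sums_summable by auto
  then show "summable (\<lambda>j. F 1 c * (real (Suc j) * r ^ j))" by (rule summable_mult)
  fix j
  have "r ^ j * F (Suc j) c \<le> r ^ j * (real (Suc j) * F 1 c)"
    using F_bounds(2)[OF c, of "Suc j"] \<upsilon>_bounds by (intro mult_left_mono) auto
  then show "norm (r ^ j * F (Suc j) c) \<le> F 1 c * (real (Suc j) * r ^ j)"
    using F_bounds(1)[OF c, of "Suc j"] \<upsilon>_bounds by (simp add: mult_ac)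
qed

text \<open>Summation by parts moves the difference from \<open>F\<close> to the weights;
  \<open>r ^ j - r ^ Suc j\<close> contributes the second factor \<open>\<upsilon> = 1 - r\<close>,
  and the boundary term is \<open>F 0 c = 0\<close>.\<close>

lemma Psi_eq:
  assumes c: "0 \<le> c" shows "Psi c = \<upsilon>\<^sup>2 * (\<Sum>j. F (Suc j) c * r ^ j)"
proof -
  note s = summable_F[OF c]
  have s': "summable (\<lambda>j. r ^ j * F j c)"
  proof -
    have "summable (\<lambda>j. r * (r ^ j * F (Suc j) c))" by (rule summable_mult[OF s])
    then have "summable (\<lambda>j. r ^ Suc j * F (Suc j) c)" by (simp add: mult.assoc)
    then show ?thesis by (rule iffD1[OF summable_Suc_iff])
  qed
  have "(\<Sum>j. r ^ j * F j c) = r * (\<Sum>j. r ^ j * F (Suc j) c)"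
  proof -
    have "(\<Sum>j. r ^ j * F j c) = (\<Sum>j. r ^ Suc j * F (Suc j) c)"
      using suminf_split_head[OF s'] by (simp add: F_def)
    also have "\<dots> = (\<Sum>j. r * (r ^ j * F (Suc j) c))" by (simp add: mult.assoc)
    also have "\<dots> = r * (\<Sum>j. r ^ j * F (Suc j) c)" by (rule suminf_mult[OF s])
    finally show ?thesis .
  qed
  moreover have "Psi c = (\<Sum>j. \<upsilon> * (r ^ j * F (Suc j) c - r ^ j * F j c))"
    unfolding Psi_def by (simp add: algebra_simps)
  moreover have "\<dots> = \<upsilon> * ((\<Sum>j. r ^ j * F (Suc j) c) - (\<Sum>j. r ^ j * F j c))"
    using suminf_mult[OF summable_diff[OF s s'], of \<upsilon>] suminf_diff[OF s s'] by simp
  ultimately have "Psi c = \<upsilon> * ((1 - r) * (\<Sum>j. r ^ j * F (Suc j) c))" by (simp add: algebra_simps)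
  then show ?thesis by (simp add: \<upsilon>_eq power2_eq_square mult_ac)
qed

lemma Psi_nonneg: "0 \<le> c \<Longrightarrow> 0 \<le> Psi c"
  unfolding Psi_eq using F_bounds(1) \<upsilon>_bounds summable_F[of c]
  by (auto intro!: mult_nonneg_nonneg suminf_nonneg simp: mult.commute)

lemma Psi_0[simp]: "Psi 0 = 0"
  by (simp add: Psi_def F_def)

lemma site_prod_tendsto:
  assumes d: "0 < d" and c: "\<And>b. 0 \<le> c b" "\<And>b. c b \<le> C"
  shows "(\<lambda>k. \<integral>\<xi>. site_prod (\<lambda>m. c (block (n k) d m) / a k) (grid (n k) d B) \<xi> \<partial>W)
    \<longlonglongrightarrow> exp (- ((\<Sum>b<B. Psi (c b)) / real d))"
proof -
  define L where "L = (\<Sum>b<B. Psi (c b)) / real d"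
  define LR where "LR R = (\<Sum>b<B. 1 / real d * (\<Sum>j\<le>R. W.prob {\<xi>. returns R \<xi> = j} * (F (Suc j) (c b) - F j (c b))))" for R
  \<comment> \<open>What remains of the error bound when \<open>k\<close> tends to infinity at fixed
    window \<open>R\<close>: late returns and the truncation of the return law. It vanishes as
    \<open>R\<close> grows, so \<open>R\<close> is fixed before \<open>k\<close>.\<close>
  define V where "V R = F 1 C * (real B / real d * late R) + \<bar>LR R - L\<bar>" for R
  have C: "0 \<le> C" using c order_trans by blast
  have L0: "0 \<le> L" unfolding L_def using Psi_nonneg c d by (auto intro!: divide_nonneg_nonneg sum_nonneg)
  have "LR \<longlonglongrightarrow> (\<Sum>b<B. 1 / real d * Psi (c b))"
    unfolding LR_def Psi_def
  proof (intro tendsto_sum tendsto_mult_left expectation_returns_tendsto)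
    show "\<bar>F (Suc j) (c b) - F j (c b)\<bar> \<le> F 1 C" for b j using F_increment[OF c] by simp
  qed
  then have "LR \<longlonglongrightarrow> L" by (simp add: L_def sum_divide_distrib)
  then have "V \<longlonglongrightarrow> F 1 C * (real B / real d * 0) + \<bar>L - L\<bar>"
    unfolding V_def by (intro tendsto_intros late_tendsto)
  then have V: "V \<longlonglongrightarrow> 0" by simp
  show ?thesis unfolding L_def[symmetric]
  proof (rule LIMSEQ_I)
    fix \<epsilon> :: real assume "0 < \<epsilon>"
    then have "\<forall>\<^sub>F R in sequentially. V R < \<epsilon>" using V by (intro order_tendstoD(2)) auto
    then obtain R where R: "V R < \<epsilon>" by (auto simp: eventually_sequentially)
    let ?N = "\<lambda>k. grid (n k) d B"
    let ?D = "\<lambda>k. 1 - lapm (C / a k) 1"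
    let ?E = "\<lambda>k. (?D k)\<^sup>2 * (real (?N k) * (1 + 2 * (r / (1 - r)))) + ?D k * (real (?N k) * late R + real (B * R)) +
      ?D k * sqrt (real (?N k) * (2 * real R + 1)) + \<bar>mean_sum (n k) d B R c (a k) - L\<bar>"
    define D where "D k = real (n k) * ?D k" for k
    define q where "q k = real (?N k) / real (n k)" for k
    have D: "D \<longlonglongrightarrow> F 1 C" unfolding D_def by (rule F_lim[OF C])
    have q: "q \<longlonglongrightarrow> real B / real d" unfolding q_def by (rule grid_ratio_tendsto[OF n_top d])
    have mean: "(\<lambda>k. mean_sum (n k) d B R c (a k)) \<longlonglongrightarrow> LR R"
    proof -
      have "mean_sum (n k) d B R c (a k) = (\<Sum>b<B. real (grid (n k) d (Suc b) - grid (n k) d b) / real (n k) *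
          (\<Sum>j\<le>R. W.prob {\<xi>. returns R \<xi> = j} * (real (n k) * (lapm (c b / a k) j - lapm (c b / a k) (Suc j)))))" for k
      proof -
        have "x * (\<Sum>j\<le>R. p j * y j) = x / real (n k) * (\<Sum>j\<le>R. p j * (real (n k) * y j))" for x :: real and p y :: "nat \<Rightarrow> real"
          using n_pos[of k] by (simp add: sum_distrib_left mult_ac)
        then show ?thesis
          unfolding mean_sum_def[OF n_pos d a_pos c] gain_def[OF n_pos d a_pos c] by (intro sum.cong refl)
      qed
      then show ?thesis unfolding LR_def
        by (simp only:) (intro tendsto_intros block_length_tendsto n_top d gain_lim c)
    qed
    \<comment> \<open>With \<open>dl = D / n\<close> and horizon \<open>q * n\<close>, where
      \<open>D\<close> and \<open>q\<close> converge, each term becomes a convergent factor or a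
      convergent factor over a power of \<open>n\<close>; the square root term decays like
      n^(-1/2).\<close>
    have E: "?E k = (D k)\<^sup>2 * q k * (1 + 2 * (r / (1 - r))) / real (n k) +
      (D k * (q k * late R) + D k * real (B * R) / real (n k)) +
      D k * sqrt (q k * (2 * real R + 1) / real (n k)) + \<bar>mean_sum (n k) d B R c (a k) - L\<bar>" for k
    proof -
      have np: "0 < real (n k)" using n_pos by simp
      have N: "real (?N k) = q k * real (n k)" and Dk: "?D k = D k / real (n k)" using np by (simp_all add: q_def D_def)
      have "sqrt (real (?N k) * (2 * real R + 1)) = real (n k) * sqrt (q k * (2 * real R + 1) / real (n k))"
      proof -
        have "real (?N k) * (2 * real R + 1) = (real (n k))\<^sup>2 * (q k * (2 * real R + 1) / real (n k))"
          using np by (simp add: N power2_eq_square field_simps)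
        then show ?thesis using np by (simp only: real_sqrt_mult) simp
      qed
      then show ?thesis unfolding Dk using np by (simp only: N) (simp add: power2_eq_square field_simps)
    qed
    have z: "(\<lambda>k. q k * (2 * real R + 1) / real (n k)) \<longlonglongrightarrow> 0"
      by (rule over_n_tendsto[OF tendsto_mult[OF q tendsto_const]])
    have "?E \<longlonglongrightarrow> 0 + (F 1 C * (real B / real d * late R) + 0) + F 1 C * sqrt 0 + \<bar>LR R - L\<bar>"
      unfolding E by (intro tendsto_add tendsto_rabs tendsto_diff tendsto_mult tendsto_real_sqrt z
        tendsto_const D q mean over_n_tendsto[OF tendsto_mult[OF tendsto_mult[OF tendsto_power[OF D] q] tendsto_const]]
        over_n_tendsto[OF tendsto_mult[OF D tendsto_const]])
    then have "?E \<longlonglongrightarrow> V R" by (simp add: V_def)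
    then have "\<forall>\<^sub>F k in sequentially. ?E k < \<epsilon>" using R by (intro order_tendstoD(2)) auto
    then obtain K where K: "\<And>k. K \<le> k \<Longrightarrow> ?E k < \<epsilon>" by (auto simp: eventually_sequentially)
    have "norm ((\<integral>\<xi>. site_prod (\<lambda>m. c (block (n k) d m) / a k) (?N k) \<xi> \<partial>W) - exp (- L)) < \<epsilon>" if "K \<le> k" for k
      unfolding real_norm_def
      by (rule order.strict_trans1[OF site_prod_error[where c = c and B = B and R = R, OF n_pos d a_pos c L0] K[OF that]])
    then show "\<exists>no. \<forall>k\<ge>no. norm ((\<integral>\<xi>. site_prod (\<lambda>m. c (block (n k) d m) / a k) (?N k) \<xi> \<partial>W) - exp (- L)) < \<epsilon>"
      by blast
  qed
qed

lemma clock_laplace_tendsto: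
  assumes d: "0 < d" and c: "\<And>b. 0 \<le> c b" "\<And>b. c b \<le> C"
  shows "(\<lambda>k. \<integral>\<omega>. exp (- (\<Sum>b<B. c b * ((clock (fst \<omega>) (snd \<omega>) (grid (n k) d (Suc b)) -
      clock (fst \<omega>) (snd \<omega>) (grid (n k) d b)) / a k))) \<partial>annealed \<beta> \<pi>)
    \<longlonglongrightarrow> exp (- ((\<Sum>b<B. Psi (c b)) / real d))"
proof -
  let ?w = "\<lambda>k m. c (block (n k) d m) / a k"
  have eq: "(\<Sum>b<B. c b * ((clock \<eta> \<xi> (grid (n k) d (Suc b)) - clock \<eta> \<xi> (grid (n k) d b)) / a k)) =
    (\<Sum>m<grid (n k) d B. ?w k m * visit_time \<eta> \<xi> m)" for k \<eta> \<xi>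
  proof -
    have "(\<Sum>m<grid (n k) d B. ?w k m * visit_time \<eta> \<xi> m) =
      (\<Sum>b<B. \<Sum>m\<in>{grid (n k) d b..<grid (n k) d (Suc b)}. c b / a k * visit_time \<eta> \<xi> m)"
      by (rule sum_over_blocks[OF n_pos d, of "\<lambda>b m. c b / a k * visit_time \<eta> \<xi> m"])
    also have "\<dots> = (\<Sum>b<B. c b / a k * (clock \<eta> \<xi> (grid (n k) d (Suc b)) - clock \<eta> \<xi> (grid (n k) d b)))"
    proof (intro sum.cong refl)
      fix b
      have g: "grid (n k) d b \<le> grid (n k) d (Suc b)" by (rule monoD[OF grid_mono]) simp
      have "clock \<eta> \<xi> (grid (n k) d (Suc b)) - clock \<eta> \<xi> (grid (n k) d b) =
        (\<Sum>m\<in>{grid (n k) d b..<grid (n k) d (Suc b)}. visit_time \<eta> \<xi> m)"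
        unfolding clock_visit_time lessThan_atLeast0 by (rule sum_diff_nat_ivl[OF _ g]) simp
      then show "(\<Sum>m\<in>{grid (n k) d b..<grid (n k) d (Suc b)}. c b / a k * visit_time \<eta> \<xi> m) =
        c b / a k * (clock \<eta> \<xi> (grid (n k) d (Suc b)) - clock \<eta> \<xi> (grid (n k) d b))"
        by (simp add: sum_distrib_left)
    qed
    finally show ?thesis by simp
  qed
  have "(\<integral>\<omega>. exp (- (\<Sum>m<grid (n k) d B. ?w k m * visit_time (fst \<omega>) (snd \<omega>) m)) \<partial>annealed \<beta> \<pi>) =
    (\<integral>\<xi>. site_prod (?w k) (grid (n k) d B) \<xi> \<partial>W)" for k
  proof -
    have w: "0 \<le> ?w k m" for m using c a_pos[of k] by simp
    have "(\<lambda>\<omega>. exp (- (\<Sum>m<grid (n k) d B. ?w k m * visit_time (fst \<omega>) (snd \<omega>) m))) \<in> borel_measurable (annealed \<beta> \<pi>)"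
      using measurable_visit_time
      by (intro measurable_compose[OF _ borel_measurable_exp] borel_measurable_uminus borel_measurable_sum
        borel_measurable_times borel_measurable_const) auto
    then have "(\<integral>\<omega>. exp (- (\<Sum>m<grid (n k) d B. ?w k m * visit_time (fst \<omega>) (snd \<omega>) m)) \<partial>annealed \<beta> \<pi>) =
      enn2real (\<integral>\<^sup>+\<omega>. ennreal (exp (- (\<Sum>m<grid (n k) d B. ?w k m * visit_time (fst \<omega>) (snd \<omega>) m))) \<partial>annealed \<beta> \<pi>)"
      by (rule integral_eq_nn_integral) simp
    also have "\<dots> = (\<integral>\<xi>. site_prod (?w k) (grid (n k) d B) \<xi> \<partial>W)"
      unfolding annealed_laplace[OF w] using site_prod_bounds(1)[OF w]
      by (intro enn2real_ennreal integral_nonneg_AE) auto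
    finally show ?thesis .
  qed
  then show ?thesis unfolding eq using site_prod_tendsto[OF d c] by simp
qed

end

section \<open>Existence of the limit process\<close>

text \<open>Exponentials of nonnegative variables lie in the cube, and transforms with integer
  weights are their moments; the logarithm transports equality of laws back.\<close>

lemma laplace_unique:
  fixes X :: "'a \<Rightarrow> nat \<Rightarrow> real" and X' :: "'b \<Rightarrow> nat \<Rightarrow> real"
  assumes M: "prob_space M" "prob_space M'" and J: "finite J"
    and X: "\<And>i. i \<in> J \<Longrightarrow> (\<lambda>\<omega>. X \<omega> i) \<in> borel_measurable M" "\<And>i. i \<in> J \<Longrightarrow> AE \<omega> in M. 0 \<le> X \<omega> i"
    and X': "\<And>i. i \<in> J \<Longrightarrow> (\<lambda>\<omega>. X' \<omega> i) \<in> borel_measurable M'" "\<And>i. i \<in> J \<Longrightarrow> AE \<omega> in M'. 0 \<le> X' \<omega> i"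
    and lap: "\<And>e :: nat \<Rightarrow> nat. (\<integral>\<omega>. exp (- (\<Sum>i\<in>J. real (e i) * X \<omega> i)) \<partial>M) =
      (\<integral>\<omega>. exp (- (\<Sum>i\<in>J. real (e i) * X' \<omega> i)) \<partial>M')"
  shows "distr M (PiM J (\<lambda>_. borel)) (\<lambda>\<omega>. restrict (X \<omega>) J) = distr M' (PiM J (\<lambda>_. borel)) (\<lambda>\<omega>. restrict (X' \<omega>) J)"
proof -
  \<comment> \<open>Coordinates outside \<open>J\<close> are padded with 1, whose powers do not
    affect the moments.\<close>
  define enc where "enc x i = (if i \<in> J then exp (- x i) else 1)" for x :: "nat \<Rightarrow> real" and i
  define dec where "dec y = restrict (\<lambda>i. - ln (y i)) J" for y :: "nat \<Rightarrow> real"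
  have cube: "cube_rv N (\<lambda>\<omega>. enc (Z \<omega>))"
    if N: "prob_space N" and Z: "\<And>i. i \<in> J \<Longrightarrow> (\<lambda>\<omega>. Z \<omega> i) \<in> borel_measurable N" "\<And>i. i \<in> J \<Longrightarrow> AE \<omega> in N. 0 \<le> Z \<omega> i"
    for N :: "'c measure" and Z
    unfolding cube_rv_def
  proof (intro conjI allI N)
    fix i show "(\<lambda>\<omega>. enc (Z \<omega>) i) \<in> borel_measurable N"
      unfolding enc_def using Z(1)[of i] by (cases "i \<in> J") (auto intro: measurable_compose[OF _ borel_measurable_exp])
  next
    have "AE \<omega> in N. \<forall>i\<in>J. 0 \<le> Z \<omega> i" using Z(2) J by (simp add: AE_ball_countable countable_finite)
    then show "AE \<omega> in N. enc (Z \<omega>) \<in> cube" by eventually_elim (auto simp: cube_def enc_def)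
  qed
  have mom: "(\<Prod>i<N. enc x i ^ e i) = exp (- (\<Sum>i\<in>J. real (if i < N then e i else 0) * x i))" for x N e
  proof -
    have "(\<Prod>i<N. enc x i ^ e i) = (\<Prod>i<N. if i \<in> J then exp (- (real (e i) * x i)) else 1)"
      by (intro prod.cong) (auto simp: enc_def simp flip: exp_of_nat_mult)
    also have "\<dots> = (\<Prod>i\<in>{..<N} \<inter> J. exp (- (real (e i) * x i)))"
      by (simp add: prod.inter_restrict)
    also have "\<dots> = exp (- (\<Sum>i\<in>{..<N} \<inter> J. real (e i) * x i))" by (simp add: exp_sum flip: sum_negf)
    also have "(\<Sum>i\<in>{..<N} \<inter> J. real (e i) * x i) = (\<Sum>i\<in>J. real (if i < N then e i else 0) * x i)"
      using J by (intro sum.mono_neutral_cong_left) auto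
    finally show ?thesis .
  qed
  have e: "distr M borel (\<lambda>\<omega>. enc (X \<omega>)) = distr M' borel (\<lambda>\<omega>. enc (X' \<omega>))"
    by (rule cube_moments_unique[OF cube[of M X, OF M(1) X] cube[of M' X', OF M(2) X']]) (simp_all only: mom lap)
  have dec: "dec \<in> measurable borel (PiM J (\<lambda>_. borel))"
    unfolding dec_def
    by (intro measurable_restrict borel_measurable_uminus measurable_compose[OF measurable_product_coordinates borel_measurable_ln]) simp
  have d: "distr (distr N borel (\<lambda>\<omega>. enc (Z \<omega>))) (PiM J (\<lambda>_. borel)) dec = distr N (PiM J (\<lambda>_. borel)) (\<lambda>\<omega>. restrict (Z \<omega>) J)"
    if "(\<lambda>\<omega>. enc (Z \<omega>)) \<in> borel_measurable N" for N :: "'c measure" and Z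
  proof -
    have "dec (enc x) = restrict x J" for x by (auto simp: dec_def enc_def restrict_def)
    then show ?thesis by (subst distr_distr[OF dec that]) (simp add: comp_def)
  qed
  show ?thesis
    using d[of X M, OF cube_rv_measurable[OF cube[of M X, OF M(1) X]]]
      d[of X' M', OF cube_rv_measurable[OF cube[of M' X', OF M(2) X']]] e by simp
qed

lemma laplace_unique_real:
  fixes X :: "'a \<Rightarrow> real" and X' :: "'b \<Rightarrow> real"
  assumes M: "prob_space M" "prob_space M'"
    and X: "X \<in> borel_measurable M" "AE \<omega> in M. 0 \<le> X \<omega>"
    and X': "X' \<in> borel_measurable M'" "AE \<omega> in M'. 0 \<le> X' \<omega>"
    and lap: "\<And>e :: nat. (\<integral>\<omega>. exp (- (real e * X \<omega>)) \<partial>M) = (\<integral>\<omega>. exp (- (real e * X' \<omega>)) \<partial>M')"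
  shows "distr M borel X = distr M' borel X'"
proof -
  let ?P = "PiM {0::nat} (\<lambda>_. borel :: real measure)"
  have "distr M ?P (\<lambda>\<omega>. \<lambda>i\<in>{0}. X \<omega>) = distr M' ?P (\<lambda>\<omega>. \<lambda>i\<in>{0}. X' \<omega>)"
    using laplace_unique[OF M, of "{0}" "\<lambda>\<omega> _. X \<omega>" "\<lambda>\<omega> _. X' \<omega>"] X X' lap by simp
  then have "distr (distr M ?P (\<lambda>\<omega>. \<lambda>i\<in>{0}. X \<omega>)) borel (\<lambda>x. x 0) = distr (distr M' ?P (\<lambda>\<omega>. \<lambda>i\<in>{0}. X' \<omega>)) borel (\<lambda>x. x 0)"
    by simp
  moreover have eq: "distr (distr N ?P (\<lambda>\<omega>. \<lambda>i\<in>{0}. Z \<omega>)) borel (\<lambda>x. x 0) = distr N borel Z"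
    if "Z \<in> borel_measurable N" for N :: "'c measure" and Z
    using that by (subst distr_distr) (auto simp: comp_def intro!: measurable_restrict)
  ultimately show ?thesis using eq[OF X(1)] eq[OF X'(1)] by simp
qed

text \<open>For nonnegative increments, joint transforms determine joint laws. Independence follows
  by comparison with the product of the marginal laws, stationarity by comparison with the increment
  from 0.\<close>

lemma levy_laplaceI:
  fixes S :: "'a \<Rightarrow> real \<Rightarrow> real" and \<Psi> :: "real \<Rightarrow> real"
  assumes M: "prob_space M" and meas: "\<And>t. (\<lambda>\<omega>. S \<omega> t) \<in> borel_measurable M"
    and S: "\<And>\<omega>. \<omega> \<in> space M \<Longrightarrow> S \<omega> 0 = 0" "\<And>\<omega>. \<omega> \<in> space M \<Longrightarrow> cadlag (S \<omega>)"
      "\<And>\<omega>. \<omega> \<in> space M \<Longrightarrow> mono_on {0..} (S \<omega>)"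
    and \<Psi>0: "\<Psi> 0 = 0"
    and JL: "\<And>B t c. 0 \<le> t 0 \<Longrightarrow> (\<And>i. t i \<le> t (Suc i)) \<Longrightarrow> (\<And>b. 0 \<le> c b) \<Longrightarrow>
      (\<integral>\<omega>. exp (- (\<Sum>b<B. c b * (S \<omega> (t (Suc b)) - S \<omega> (t b)))) \<partial>M) = exp (- (\<Sum>b<B. (t (Suc b) - t b) * \<Psi> (c b)))"
  shows "levy_laplace M S \<Psi>"
proof -
  interpret prob_space M by fact
  have inc: "0 \<le> S \<omega> (t (Suc i)) - S \<omega> (t i)" if "\<omega> \<in> space M" "0 \<le> t 0" "\<And>i. t i \<le> t (Suc i)" for \<omega> t and i :: nat
  proof -
    have "t 0 \<le> t i" by (rule lift_Suc_mono_le[of t]) (use that in auto)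
    then show ?thesis using that mono_onD[OF S(3)[OF that(1)], of "t i" "t (Suc i)"] by auto
  qed
  have single: "(\<integral>\<omega>. exp (- (lam * (S \<omega> (s + u) - S \<omega> s))) \<partial>M) = exp (- (u * \<Psi> lam))"
    if "0 \<le> s" "0 \<le> u" "0 \<le> lam" for s u lam
    using JL[of "\<lambda>i. s + real i * u" "\<lambda>_. lam" 1] that by (auto simp: algebra_simps mult_right_mono)
  have indep: "indep_vars (\<lambda>_. borel) (\<lambda>i \<omega>. S \<omega> (t (Suc i)) - S \<omega> (t i)) {..<n}"
    if t: "0 \<le> t 0" "\<And>i. t i \<le> t (Suc i)" for n and t :: "nat \<Rightarrow> real"
  proof (cases "n = 0")
    case True
    then show ?thesis by (auto simp: indep_vars_def indep_sets_def)
  next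
    case False
    define X where "X i \<omega> = S \<omega> (t (Suc i)) - S \<omega> (t i)" for i \<omega>
    have Xm[measurable]: "X i \<in> borel_measurable M" for i unfolding X_def using meas by (intro borel_measurable_diff) auto
    have Xp: "AE \<omega> in M. 0 \<le> X i \<omega>" for i using inc[OF _ t] by (intro AE_I2) (auto simp: X_def)
    define Q where "Q = PiM {..<n} (\<lambda>i. distr M borel (X i))"
    interpret Q: product_prob_space "\<lambda>i. distr M borel (X i)" "{..<n}"
      by (simp add: product_prob_space_def product_prob_space_axioms_def product_sigma_finite_def prob_space_distr prob_space_imp_sigma_finite)
    have Xi: "(\<integral>\<omega>. exp (- (real e * X i \<omega>)) \<partial>M) = exp (- ((t (Suc i) - t i) * \<Psi> (real e)))" for i e
    proof -
      have "t 0 \<le> t i" by (rule lift_Suc_mono_le[of t]) (use t in auto)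
      then show ?thesis using single[of "t i" "t (Suc i) - t i" "real e"] t by (simp add: X_def)
    qed
    have "distr M (PiM {..<n} (\<lambda>_. borel)) (\<lambda>\<omega>. restrict (\<lambda>i. X i \<omega>) {..<n}) =
      distr Q (PiM {..<n} (\<lambda>_. borel)) (\<lambda>x. restrict x {..<n})"
    proof (rule laplace_unique[OF M])
      show "prob_space Q" unfolding Q_def by (rule Q.prob_space_axioms)
      fix i assume i: "i \<in> {..<n}"
      show "(\<lambda>x. x i) \<in> borel_measurable Q"
        using measurable_component_singleton[OF i, of "\<lambda>i. distr M borel (X i)"] by (simp add: Q_def)
      show "AE x in Q. 0 \<le> x i" unfolding Q_def
        by (rule AE_PiM_component) (use i Xp in \<open>auto simp: prob_space_distr AE_distr_iff\<close>)
    next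
      fix e :: "nat \<Rightarrow> nat"
      have "(\<integral>\<omega>. exp (- (\<Sum>i<n. real (e i) * X i \<omega>)) \<partial>M) = exp (- (\<Sum>i<n. (t (Suc i) - t i) * \<Psi> (real (e i))))"
        unfolding X_def by (rule JL[OF t]) simp
      also have "\<dots> = (\<Prod>i<n. \<integral>\<omega>. exp (- (real (e i) * X i \<omega>)) \<partial>M)"
        by (simp add: Xi exp_sum flip: sum_negf)
      also have "\<dots> = (\<Prod>i<n. \<integral>x. exp (- (real (e i) * x)) \<partial>distr M borel (X i))"
        by (intro prod.cong refl integral_distr[symmetric]) auto
      also have "\<dots> = (\<integral>x. (\<Prod>i<n. exp (- (real (e i) * x i))) \<partial>Q)"
        unfolding Q_def
      proof (rule Q.product_integral_prod[symmetric])
        fix i assume "i \<in> {..<n}"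
        have "integrable M (\<lambda>\<omega>. exp (- (real (e i) * X i \<omega>)))"
          by (rule integrable_const_bound[of _ 1]) (use Xp[of i] in \<open>auto elim!: eventually_mono\<close>)
        then show "integrable (distr M borel (X i)) (\<lambda>x. exp (- (real (e i) * x)))"
          by (subst integrable_distr_eq) auto
      qed simp
      also have "\<dots> = (\<integral>x. exp (- (\<Sum>i<n. real (e i) * x i)) \<partial>Q)" by (simp add: exp_sum flip: sum_negf)
      finally show "(\<integral>\<omega>. exp (- (\<Sum>i<n. real (e i) * X i \<omega>)) \<partial>M) = (\<integral>x. exp (- (\<Sum>i<n. real (e i) * x i)) \<partial>Q)" .
    qed (use Xp in auto)
    also have "distr Q (PiM {..<n} (\<lambda>_. borel)) (\<lambda>x. restrict x {..<n}) = Q"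
    proof -
      have s: "sets Q = sets (PiM {..<n} (\<lambda>_. borel))" unfolding Q_def by (intro sets_PiM_cong) auto
      have "distr Q (PiM {..<n} (\<lambda>_. borel)) (\<lambda>x. restrict x {..<n}) = distr Q Q (\<lambda>x. x)"
        by (rule distr_cong[OF refl s[symmetric]]) (auto simp: Q_def space_PiM PiE_def extensional_restrict)
      then show ?thesis by simp
    qed
    finally have "distr M (PiM {..<n} (\<lambda>_. borel)) (\<lambda>\<omega>. \<lambda>i\<in>{..<n}. X i \<omega>) = (\<Pi>\<^sub>M i\<in>{..<n}. distr M borel (X i))"
      by (simp add: Q_def)
    then have "indep_vars (\<lambda>_. borel) X {..<n}"
      using False by (subst indep_vars_iff_distr_eq_PiM') auto
    then show ?thesis by (simp add: X_def[abs_def])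
  qed
  have stat: "distr M borel (\<lambda>\<omega>. S \<omega> (t + s) - S \<omega> t) = distr M borel (\<lambda>\<omega>. S \<omega> s)" if st: "0 \<le> s" "0 \<le> t" for s t
  proof (rule laplace_unique_real[OF M M])
    show "(\<lambda>\<omega>. S \<omega> (t + s) - S \<omega> t) \<in> borel_measurable M" "(\<lambda>\<omega>. S \<omega> s) \<in> borel_measurable M"
      using meas by (auto intro: borel_measurable_diff)
    show "AE \<omega> in M. 0 \<le> S \<omega> (t + s) - S \<omega> t"
      using mono_onD[OF S(3), of _ t "t + s"] st by (intro AE_I2) auto
    show "AE \<omega> in M. 0 \<le> S \<omega> s"
      using mono_onD[OF S(3), of _ 0 s] st S(1) by (intro AE_I2) auto
    fix e :: nat
    have "(\<integral>\<omega>. exp (- (real e * S \<omega> s)) \<partial>M) = (\<integral>\<omega>. exp (- (real e * (S \<omega> (0 + s) - S \<omega> 0))) \<partial>M)"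
      using S(1) by (intro Bochner_Integration.integral_cong) auto
    then show "(\<integral>\<omega>. exp (- (real e * (S \<omega> (t + s) - S \<omega> t))) \<partial>M) = (\<integral>\<omega>. exp (- (real e * S \<omega> s)) \<partial>M)"
      using single[of t s "real e"] single[of 0 s "real e"] st by simp
  qed
  have lap: "(\<integral>\<^sup>+\<omega>. ennreal (exp (- lam * S \<omega> t)) \<partial>M) = ennreal (exp (- t * \<Psi> lam))" if "0 \<le> t" "0 < lam" for t lam
  proof -
    have i: "integrable M (\<lambda>\<omega>. exp (- lam * S \<omega> t))"
    proof (rule integrable_const_bound[of _ 1])
      show "AE \<omega> in M. norm (exp (- lam * S \<omega> t)) \<le> 1"
        using mono_onD[OF S(3), of _ 0 t] that S(1) by (intro AE_I2) auto
      show "(\<lambda>\<omega>. exp (- lam * S \<omega> t)) \<in> borel_measurable M"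
        by (rule measurable_compose[OF borel_measurable_times[OF borel_measurable_const meas] borel_measurable_exp])
    qed
    have "(\<integral>\<omega>. exp (- lam * S \<omega> t) \<partial>M) = (\<integral>\<omega>. exp (- (lam * (S \<omega> (0 + t) - S \<omega> 0))) \<partial>M)"
      using S(1) by (intro Bochner_Integration.integral_cong) auto
    also have "\<dots> = exp (- t * \<Psi> lam)" using single[of 0 t lam] that by simp
    finally show ?thesis using nn_integral_eq_integral[OF i] by simp
  qed
  show ?thesis unfolding levy_laplace_def
    using M meas S(1,2) indep stat lap by auto
qed

section \<open>Dyadic grids and their joint exponents\<close>

definition "lev i = snd (prod_decode i)"
text \<open>The position of \<open>dyad i\<close> in units of 2^-N, provided
  \<open>lev i \<le> N\<close>; the natural subtraction makes it meaningless otherwise. A dyadic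
  number has an index for each of its representations, and \<open>lev\<close> belongs to the
  index.\<close>

definition "tick N i = fst (prod_decode i) * 2 ^ (N - lev i)" for N i :: nat

lemma dyad_tick: "lev i \<le> N \<Longrightarrow> dyad i = real (tick N i) / 2 ^ N"
  by (auto simp: dyad_def tick_def lev_def le_iff_add power_add)

lemma tick_le_iff: "lev i \<le> N \<Longrightarrow> lev j \<le> N \<Longrightarrow> tick N i \<le> tick N j \<longleftrightarrow> dyad i \<le> dyad j"
  by (simp add: dyad_tick divide_le_cancel)

lemma tick_encode[simp]: "tick N (prod_encode (k, N)) = k" "lev (prod_encode (k, N)) = N"
  by (simp_all add: tick_def lev_def)

lemma tick_add: "lev i \<le> N \<Longrightarrow> tick (N + m) i = tick N i * 2 ^ m"
  by (simp add: tick_def power_add[symmetric] mult.assoc)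

text \<open>The linear functional that puts weight e i on the value at time dyad i is rewritten in terms of
  the increments over the grid of mesh 1 / 2 ^ N.\<close>

definition grid_weight :: "nat set \<Rightarrow> (nat \<Rightarrow> nat) \<Rightarrow> nat \<Rightarrow> nat \<Rightarrow> real" where
  "grid_weight J e N b = (\<Sum>i\<in>J. real (e i) * of_bool (b < tick N i))"

text \<open>The sum of all ticks serves as a convenient index at or beyond every tick; the weights
  vanish from the last tick on.\<close>

definition "joint_exponent \<Psi> J e N = (\<Sum>b<(\<Sum>i\<in>J. tick N i). \<Psi> (grid_weight J e N b)) / 2 ^ N" for \<Psi> :: "real \<Rightarrow> real"

text \<open>A cell splits into \<open>2 ^ m\<close> cells of the same weight, each carrying a share
  of 2^-m.\<close>

lemma joint_exponent_refine:
  fixes \<Psi> :: "real \<Rightarrow> real"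
  assumes "\<And>i. i \<in> J \<Longrightarrow> lev i \<le> N"
  shows "joint_exponent \<Psi> J e (N + m) = joint_exponent \<Psi> J e N"
proof -
  let ?B = "\<Sum>i\<in>J. tick N i"
  have B: "(\<Sum>i\<in>J. tick (N + m) i) = ?B * 2 ^ m"
    by (simp add: assms tick_add sum_distrib_right)
  have w: "grid_weight J e (N + m) b = grid_weight J e N (b div 2 ^ m)" for b
    unfolding grid_weight_def by (intro sum.cong refl) (simp add: assms tick_add div_less_iff_less_mult)
  have "(\<Sum>b<?B * 2 ^ m. \<Psi> (grid_weight J e N (b div 2 ^ m))) =
    (\<Sum>q<?B. \<Sum>b\<in>{q * 2 ^ m..<q * 2 ^ m + 2 ^ m}. \<Psi> (grid_weight J e N (b div 2 ^ m)))"
    by (rule sum.nat_group[symmetric])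
  also have "\<dots> = (\<Sum>q<?B. 2 ^ m * \<Psi> (grid_weight J e N q))"
  proof (intro sum.cong refl)
    fix q :: nat
    have "(\<Sum>b\<in>{q * 2 ^ m..<q * 2 ^ m + 2 ^ m}. \<Psi> (grid_weight J e N (b div 2 ^ m))) =
      (\<Sum>b\<in>{q * 2 ^ m..<q * 2 ^ m + 2 ^ m}. \<Psi> (grid_weight J e N q))"
    proof (intro sum.cong refl)
      fix b assume "b \<in> {q * 2 ^ m..<q * 2 ^ m + 2 ^ m :: nat}"
      then have "b div 2 ^ m = q" by (intro div_nat_eqI) (auto simp: mult.commute)
      then show "\<Psi> (grid_weight J e N (b div 2 ^ m)) = \<Psi> (grid_weight J e N q)" by simp
    qed
    then show "(\<Sum>b\<in>{q * 2 ^ m..<q * 2 ^ m + 2 ^ m}. \<Psi> (grid_weight J e N (b div 2 ^ m))) = 2 ^ m * \<Psi> (grid_weight J e N q)"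
      by simp
  qed
  also have "\<dots> = 2 ^ m * (\<Sum>q<?B. \<Psi> (grid_weight J e N q))" by (simp add: sum_distrib_left)
  finally show ?thesis unfolding joint_exponent_def B w by (simp add: power_add)
qed

lemma sum_partial_sums:
  fixes v :: "nat \<Rightarrow> real"
  assumes J: "finite J"
  shows "(\<Sum>i\<in>J. real (e i) * (\<Sum>b<tick N i. v b)) = (\<Sum>b<(\<Sum>i\<in>J. tick N i). grid_weight J e N b * v b)"
proof -
  have "(\<Sum>b<tick N i. v b) = (\<Sum>b<(\<Sum>i\<in>J. tick N i). of_bool (b < tick N i) * v b)" if "i \<in> J" for i
  proof -
    have "tick N i \<le> (\<Sum>i\<in>J. tick N i)" using J that by (intro member_le_sum) auto
    then have "(\<Sum>b<(\<Sum>i\<in>J. tick N i). of_bool (b < tick N i) * v b) = (\<Sum>b<tick N i. of_bool (b < tick N i) * v b)"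
      by (intro sum.mono_neutral_right) auto
    then show ?thesis by simp
  qed
  then have "(\<Sum>i\<in>J. real (e i) * (\<Sum>b<tick N i. v b)) =
    (\<Sum>i\<in>J. \<Sum>b<(\<Sum>i\<in>J. tick N i). real (e i) * of_bool (b < tick N i) * v b)"
    by (intro sum.cong refl) (simp only: sum_distrib_left mult.assoc)
  also have "\<dots> = (\<Sum>b<(\<Sum>i\<in>J. tick N i). \<Sum>i\<in>J. real (e i) * of_bool (b < tick N i) * v b)" by (rule sum.swap)
  finally show ?thesis by (simp only: grid_weight_def sum_distrib_right)
qed

lemma grid_weight_nonneg: "0 \<le> grid_weight J e N b"
  unfolding grid_weight_def by (intro sum_nonneg) auto

text \<open>\<open>\<mu> N\<close> is the law of an increment over time 2^-N. Having such a root for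
  every \<open>N\<close> replaces infinite divisibility; the weak limits of the clock supply
  them.\<close>

locale subordinator_exponent =
  fixes \<Psi> :: "real \<Rightarrow> real" and \<mu> :: "nat \<Rightarrow> real measure"
  assumes prob_\<mu>: "\<And>N. prob_space (\<mu> N)" and sets_\<mu>: "\<And>N. sets (\<mu> N) = sets borel"
    and \<mu>_nonneg: "\<And>N. AE x in \<mu> N. 0 \<le> x"
    and \<mu>_laplace: "\<And>N c. 0 \<le> c \<Longrightarrow> (\<integral>x. exp (- (c * x)) \<partial>\<mu> N) = exp (- (\<Psi> c / 2 ^ N))"
begin

lemma \<Psi>_0: "\<Psi> 0 = 0"
proof -
  interpret prob_space "\<mu> 0" by (rule prob_\<mu>)
  show ?thesis using \<mu>_laplace[of 0 0] by (simp add: prob_space)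
qed

definition "Lev N = PiM (UNIV :: nat set) (\<lambda>_. \<mu> N)"

lemma prob_Lev: "prob_space (Lev N)"
  unfolding Lev_def by (rule prob_space_PiM) (rule prob_\<mu>)

lemma measurable_Lev: "(\<lambda>w. w b) \<in> borel_measurable (Lev N)"
proof -
  have "(\<lambda>w. w b) \<in> measurable (Lev N) (\<mu> N)" unfolding Lev_def by (rule measurable_component_singleton) simp
  then show ?thesis by (simp only: measurable_cong_sets[OF refl sets_\<mu>])
qed

lemma Lev_nonneg: "AE w in Lev N. \<forall>b. 0 \<le> w b"
proof -
  have "AE w in Lev N. 0 \<le> w b" for b
    unfolding Lev_def by (rule AE_PiM_component) (use prob_\<mu> \<mu>_nonneg in auto)
  then show ?thesis by (simp add: AE_all_countable)
qed

lemma Lev_laplace: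
  assumes c: "\<And>b. 0 \<le> c b"
  shows "(\<integral>w. exp (- (\<Sum>b<B. c b * w b)) \<partial>Lev N) = exp (- ((\<Sum>b<B. \<Psi> (c b)) / 2 ^ N))"
proof -
  interpret N: prob_space "\<mu> N" by (rule prob_\<mu>)
  interpret P: product_prob_space "\<lambda>_::nat. \<mu> N" UNIV
    using prob_\<mu> by (simp add: product_prob_space_def product_prob_space_axioms_def product_sigma_finite_def prob_space_imp_sigma_finite)
  have m: "(\<lambda>x. exp (- (c b * x))) \<in> borel_measurable (\<mu> N)" for b
    by (simp add: measurable_cong_sets[OF sets_\<mu> refl])
  have i: "integrable (\<mu> N) (\<lambda>x. exp (- (c b * x)))" for b
    by (rule N.integrable_const_bound[of _ 1]) (use \<mu>_nonneg[of N] c m in \<open>auto elim!: eventually_mono\<close>)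
  have nn: "(\<integral>\<^sup>+x. ennreal (exp (- (c b * x))) \<partial>\<mu> N) = ennreal (exp (- (\<Psi> (c b) / 2 ^ N)))" for b
    using nn_integral_eq_integral[OF i] \<mu>_laplace[OF c] by simp
  have e: "ennreal (exp (- (\<Sum>b<B. c b * w b))) = (\<Prod>b<B. ennreal (exp (- (c b * w b))))" for w
    by (simp add: prod_ennreal exp_sum flip: sum_negf)
  have "(\<lambda>w. exp (- (\<Sum>b<B. c b * w b))) \<in> borel_measurable (Lev N)"
    using measurable_Lev by (intro measurable_compose[OF _ borel_measurable_exp] borel_measurable_uminus
      borel_measurable_sum borel_measurable_times borel_measurable_const) auto
  then have "(\<integral>w. exp (- (\<Sum>b<B. c b * w b)) \<partial>Lev N) = enn2real (\<integral>\<^sup>+w. ennreal (exp (- (\<Sum>b<B. c b * w b))) \<partial>Lev N)"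
    by (rule integral_eq_nn_integral) simp
  also have "(\<integral>\<^sup>+w. ennreal (exp (- (\<Sum>b<B. c b * w b))) \<partial>Lev N) = (\<Prod>b<B. \<integral>\<^sup>+x. ennreal (exp (- (c b * x))) \<partial>\<mu> N)"
    unfolding e Lev_def by (rule P.nn_integral_PiM_prod) (use m in auto)
  also have "\<dots> = ennreal (exp (- ((\<Sum>b<B. \<Psi> (c b)) / 2 ^ N)))"
    unfolding nn by (simp add: prod_ennreal sum_divide_distrib exp_sum flip: sum_negf)
  finally show ?thesis by simp
qed

definition "G N w i = (\<Sum>b<tick N i. w b)" for w :: "nat \<Rightarrow> real"

lemma measurable_G: "(\<lambda>w. G N w i) \<in> borel_measurable (Lev N)"
  unfolding G_def by (intro borel_measurable_sum measurable_Lev)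

lemma measurable_G_restrict: "(\<lambda>w. restrict (G N w) J) \<in> measurable (Lev N) (PiM J (\<lambda>_. borel))"
  by (intro measurable_restrict measurable_G)

lemma G_laplace:
  assumes "finite J"
  shows "(\<integral>w. exp (- (\<Sum>i\<in>J. real (e i) * G N w i)) \<partial>Lev N) = exp (- joint_exponent \<Psi> J e N)"
  unfolding G_def sum_partial_sums[OF assms] joint_exponent_def
  by (rule Lev_laplace) (rule grid_weight_nonneg)

definition "fdd N J = distr (Lev N) (PiM J (\<lambda>_. borel)) (\<lambda>w. restrict (G N w) J)"

text \<open>Partial sums of iid increments at two levels have equal joint transforms by
  \<open>joint_exponent_refine\<close>. This is the consistency behind the projective
  family.\<close>

lemma fdd_level:
  assumes J: "finite J" and N: "\<And>i. i \<in> J \<Longrightarrow> lev i \<le> N" and N': "\<And>i. i \<in> J \<Longrightarrow> lev i \<le> N'"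
  shows "fdd N J = fdd N' J"
  unfolding fdd_def
proof (rule laplace_unique[OF prob_Lev prob_Lev J])
  show "AE w in Lev N. 0 \<le> G N w i" "AE w in Lev N'. 0 \<le> G N' w i" for i
    using Lev_nonneg[of N] Lev_nonneg[of N'] by (auto elim!: eventually_mono simp: G_def intro!: sum_nonneg)
  fix e :: "nat \<Rightarrow> nat"
  have "joint_exponent \<Psi> J e N = joint_exponent \<Psi> J e N'"
    using joint_exponent_refine[OF N, of J \<Psi> e "N' - N"] joint_exponent_refine[OF N', of J \<Psi> e "N - N'"]
    by (cases "N \<le> N'") auto
  then show "(\<integral>w. exp (- (\<Sum>i\<in>J. real (e i) * G N w i)) \<partial>Lev N) = (\<integral>w. exp (- (\<Sum>i\<in>J. real (e i) * G N' w i)) \<partial>Lev N')"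
    by (simp only: G_laplace[OF J])
qed (rule measurable_G)+

definition "P J = fdd (\<Sum>i\<in>J. lev i) J"

lemma P_eq: "finite J \<Longrightarrow> (\<And>i. i \<in> J \<Longrightarrow> lev i \<le> N) \<Longrightarrow> P J = fdd N J"
  unfolding P_def by (rule fdd_level) (auto intro: member_le_sum)

sublocale L: polish_projective "UNIV :: nat set" P
proof (unfold polish_projective_def projective_family_def, intro conjI allI impI)
  fix J H :: "nat set" assume JH: "J \<subseteq> H" "finite H"
  have J: "finite J" using JH finite_subset by auto
  have lev: "lev i \<le> (\<Sum>i\<in>H. lev i)" if "i \<in> H" for i using that JH by (intro member_le_sum) auto
  have "P J = fdd (\<Sum>i\<in>H. lev i) J" using JH lev by (intro P_eq J) auto
  also have "\<dots> = distr (P H) (PiM J (\<lambda>_. borel)) (\<lambda>f. restrict f J)"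
    unfolding P_def fdd_def using JH
    by (subst distr_distr[OF measurable_restrict_subset measurable_G_restrict]) (auto simp: comp_def Int_absorb1)
  finally show "P J = distr (P H) (PiM J (\<lambda>_. borel)) (\<lambda>f. restrict f J)" .
next
  fix J :: "nat set"
  show "prob_space (P J)" unfolding P_def fdd_def
    by (rule prob_space.prob_space_distr[OF prob_Lev measurable_G_restrict])
qed

lemma distr_lim_restrict:
  assumes "finite J" "\<And>i. i \<in> J \<Longrightarrow> lev i \<le> N"
  shows "distr L.lim (PiM J (\<lambda>_. borel)) (\<lambda>\<omega>. restrict \<omega> J) = fdd N J"
proof -
  have m: "(\<lambda>\<omega>. restrict \<omega> J) \<in> measurable L.lim (PiM J (\<lambda>_. borel))"
    unfolding measurable_cong_sets[OF L.sets_lim refl] by (rule measurable_restrict_subset) simp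
  have "distr L.lim (PiM J (\<lambda>_. borel)) (\<lambda>\<omega>. restrict \<omega> J) = P J"
  proof (rule measure_eqI)
    show "sets (distr L.lim (PiM J (\<lambda>_. borel)) (\<lambda>\<omega>. restrict \<omega> J)) = sets (P J)"
      using assms by (simp add: L.sets_P)
    fix X assume "X \<in> sets (distr L.lim (PiM J (\<lambda>_. borel)) (\<lambda>\<omega>. restrict \<omega> J))"
    then have X: "X \<in> sets (PiM J (\<lambda>_. borel))" by simp
    have "emeasure (distr L.lim (PiM J (\<lambda>_. borel)) (\<lambda>\<omega>. restrict \<omega> J)) X = emeasure L.lim (prod_emb UNIV (\<lambda>_. borel) J X)"
      using m X by (simp add: emeasure_distr prod_emb_def sets_eq_imp_space_eq[OF L.sets_lim] space_PiM)
    then show "emeasure (distr L.lim (PiM J (\<lambda>_. borel)) (\<lambda>\<omega>. restrict \<omega> J)) X = emeasure (P J) X"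
      using assms X by (simp add: L.emeasure_lim_emb)
  qed
  then show ?thesis using P_eq[OF assms] by simp
qed

lemma measurable_lim: "(\<lambda>\<omega>. \<omega> i) \<in> borel_measurable L.lim"
  unfolding measurable_cong_sets[OF L.sets_lim refl] by (rule measurable_component_singleton) simp

lemma measurable_lim_restrict: "(\<lambda>\<omega>. restrict \<omega> J) \<in> measurable L.lim (PiM J (\<lambda>_. borel))"
  unfolding measurable_cong_sets[OF L.sets_lim refl] by (rule measurable_restrict_subset) simp

lemma integral_lim:
  fixes h :: "(nat \<Rightarrow> real) \<Rightarrow> real"
  assumes J: "finite J" "\<And>i. i \<in> J \<Longrightarrow> lev i \<le> N" and h: "h \<in> borel_measurable (PiM J (\<lambda>_. borel))"
    and dep: "\<And>x. h (restrict x J) = h x"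
  shows "(\<integral>\<omega>. h \<omega> \<partial>L.lim) = (\<integral>w. h (G N w) \<partial>Lev N)"
  using integral_distr[OF measurable_lim_restrict[of J] h] integral_distr[OF measurable_G_restrict[of N J] h]
    distr_lim_restrict[OF J] by (simp add: fdd_def dep)

lemma AE_lim_mono: "AE \<omega> in L.lim. 0 \<le> \<omega> i \<and> (dyad i \<le> dyad j \<longrightarrow> \<omega> i \<le> \<omega> j)"
proof -
  let ?J = "{i, j}" and ?N = "lev i + lev j"
  let ?Q = "\<lambda>x :: nat \<Rightarrow> real. 0 \<le> x i \<and> (dyad i \<le> dyad j \<longrightarrow> x i \<le> x j)"
  have ci: "(\<lambda>x. x i) \<in> borel_measurable (PiM ?J (\<lambda>_. borel :: real measure))"
    and cj: "(\<lambda>x. x j) \<in> borel_measurable (PiM ?J (\<lambda>_. borel :: real measure))"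
    by (rule measurable_component_singleton, simp)+
  have meas: "{x \<in> space (PiM ?J (\<lambda>_. borel)). ?Q x} \<in> sets (PiM ?J (\<lambda>_. borel :: real measure))"
    by (intro sets.sets_Collect_conj sets.sets_Collect_imp sets.sets_Collect_const borel_measurable_le
      borel_measurable_const ci cj)
  have "AE w in Lev ?N. ?Q (restrict (G ?N w) ?J)"
    using Lev_nonneg
  proof eventually_elim
    case (elim w)
    have "G ?N w i \<le> G ?N w j" if "dyad i \<le> dyad j"
    proof -
      have "tick ?N i \<le> tick ?N j" using that by (simp add: tick_le_iff)
      then show ?thesis unfolding G_def using elim by (intro sum_mono2) auto
    qed
    then show ?case using elim by (auto simp: G_def intro!: sum_nonneg)
  qed
  then have "AE x in fdd ?N ?J. ?Q x"
    unfolding fdd_def by (simp only: AE_distr_iff[OF measurable_G_restrict meas])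
  then have "AE \<omega> in L.lim. ?Q (restrict \<omega> ?J)"
  proof -
    have "distr L.lim (PiM ?J (\<lambda>_. borel)) (\<lambda>\<omega>. restrict \<omega> ?J) = fdd ?N ?J"
      by (rule distr_lim_restrict) auto
    with \<open>AE x in fdd ?N ?J. ?Q x\<close> show ?thesis
      by (simp only: AE_distr_iff[OF measurable_lim_restrict meas, symmetric])
  qed
  then show ?thesis by eventually_elim auto
qed

lemma lim_laplace0:
  assumes k: "mono k" "k 0 = 0" and c: "\<And>b. 0 \<le> c b"
  shows "(\<integral>\<omega>. exp (- (\<Sum>b<B. c b * (\<omega> (prod_encode (k (Suc b), N)) - \<omega> (prod_encode (k b, N))))) \<partial>L.lim) =
    exp (- (\<Sum>b<B. (real (k (Suc b)) - real (k b)) / 2 ^ N * \<Psi> (c b)))"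
proof -
  let ?i = "\<lambda>b. prod_encode (k b, N)"
  let ?J = "?i ` {..B}"
  let ?h = "\<lambda>\<omega> :: nat \<Rightarrow> real. exp (- (\<Sum>b<B. c b * (\<omega> (?i (Suc b)) - \<omega> (?i b))))"
  have hm: "?h \<in> borel_measurable (PiM ?J (\<lambda>_. borel))"
  proof -
    have "(\<lambda>x. x (?i b)) \<in> borel_measurable (PiM ?J (\<lambda>_. borel :: real measure))" if "b \<le> B" for b
      by (rule measurable_component_singleton) (use that in auto)
    then show ?thesis
      by (intro measurable_compose[OF _ borel_measurable_exp] borel_measurable_uminus borel_measurable_sum
        borel_measurable_times borel_measurable_diff borel_measurable_const) auto
  qed
  have "(\<integral>\<omega>. ?h \<omega> \<partial>L.lim) = (\<integral>w. ?h (G N w) \<partial>Lev N)"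
    by (rule integral_lim[OF _ _ hm]) auto
  \<comment> \<open>The block containing \<open>m\<close>: the first whose right end exceeds
    \<open>m\<close>, which also skips empty blocks.\<close>
  define bl where "bl m = (LEAST b. m < k (Suc b))" for m
  have bl: "bl m = b" if "m \<in> {k b..<k (Suc b)}" for m b
    unfolding bl_def
  proof (rule Least_equality)
    fix y assume "m < k (Suc y)"
    then show "b \<le> y" using that monoD[OF k(1), of "Suc y" b] by (auto simp: not_less_eq_eq[symmetric])
  qed (use that in auto)
  have eq: "(\<Sum>b<B. c b * (G N w (?i (Suc b)) - G N w (?i b))) = (\<Sum>m<k B. c (bl m) * w m)" for w
  proof -
    have "(\<Sum>m<k B. c (bl m) * w m) = (\<Sum>b<B. \<Sum>m\<in>{k b..<k (Suc b)}. c (bl m) * w m)" by (rule sum_blocks[OF k])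
    also have "\<dots> = (\<Sum>b<B. c b * (G N w (?i (Suc b)) - G N w (?i b)))"
    proof (intro sum.cong refl)
      fix b
      have kb: "k b \<le> k (Suc b)" by (rule monoD[OF k(1)]) simp
      have "(\<Sum>m\<in>{k b..<k (Suc b)}. c (bl m) * w m) = c b * (\<Sum>m\<in>{k b..<k (Suc b)}. w m)"
        by (simp add: bl sum_distrib_left)
      also have "(\<Sum>m\<in>{k b..<k (Suc b)}. w m) = G N w (?i (Suc b)) - G N w (?i b)"
        unfolding G_def tick_encode lessThan_atLeast0 by (rule sum_diff_nat_ivl[OF _ kb, symmetric]) simp
      finally show "(\<Sum>m\<in>{k b..<k (Suc b)}. c (bl m) * w m) = c b * (G N w (?i (Suc b)) - G N w (?i b))" .
    qed
    finally show ?thesis by simp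
  qed
  have "(\<integral>w. ?h (G N w) \<partial>Lev N) = exp (- ((\<Sum>m<k B. \<Psi> (c (bl m))) / 2 ^ N))"
    unfolding eq by (rule Lev_laplace) (rule c)
  also have "(\<Sum>m<k B. \<Psi> (c (bl m))) = (\<Sum>b<B. (real (k (Suc b)) - real (k b)) * \<Psi> (c b))"
    unfolding sum_blocks[OF k]
  proof (intro sum.cong refl)
    fix b
    have "k b \<le> k (Suc b)" by (rule monoD[OF k(1)]) simp
    then show "(\<Sum>m\<in>{k b..<k (Suc b)}. \<Psi> (c (bl m))) = (real (k (Suc b)) - real (k b)) * \<Psi> (c b)"
      by (simp add: bl of_nat_diff)
  qed
  finally show ?thesis
    using \<open>(\<integral>\<omega>. ?h \<omega> \<partial>L.lim) = (\<integral>w. ?h (G N w) \<partial>Lev N)\<close> by (simp add: sum_divide_distrib)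
qed

lemma lim_laplace:
  assumes k: "mono k" and c: "\<And>b. 0 \<le> c b"
  shows "(\<integral>\<omega>. exp (- (\<Sum>b<B. c b * (\<omega> (prod_encode (k (Suc b), N)) - \<omega> (prod_encode (k b, N))))) \<partial>L.lim) =
    exp (- (\<Sum>b<B. (real (k (Suc b)) - real (k b)) / 2 ^ N * \<Psi> (c b)))"
proof -
  \<comment> \<open>A block of weight 0 from 0 to \<open>k 0\<close> is put in front, which removes
    the restriction \<open>k 0 = 0\<close>; it contributes nothing since
    \<open>\<Psi> 0 = 0\<close>.\<close>
  have m: "mono (case_nat 0 k)" by (rule monoI) (auto split: nat.split intro: monoD[OF k])
  have c0: "0 \<le> case_nat 0 c b" for b using c by (cases b) auto
  show ?thesis
    using lim_laplace0[where k = "case_nat 0 k" and c = "case_nat 0 c" and B = "Suc B" and N = N, OF m _ c0]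
    by (simp add: sum.lessThan_Suc_shift \<Psi>_0 del: sum.lessThan_Suc)
qed

text \<open>The last clause makes the values at the times 2^-n come arbitrarily close to 0, so that
  the right-continuous extension starts at 0.\<close>

definition "good \<omega> \<longleftrightarrow> (\<forall>i. 0 \<le> \<omega> i) \<and> (\<forall>i j. dyad i \<le> dyad j \<longrightarrow> \<omega> i \<le> \<omega> j) \<and>
  (\<forall>m. \<exists>n. \<omega> (prod_encode (1, n)) < 1 / (real m + 1))" for \<omega> :: "nat \<Rightarrow> real"

lemma AE_good: "AE \<omega> in L.lim. good \<omega>"
proof -
  have small: "AE \<omega> in L.lim. \<exists>n. \<omega> (prod_encode (1, n)) < 1 / (real m + 1)" for m :: nat
  proof -
    note measurable_lim[measurable]
    define A where "A = {\<omega> \<in> space L.lim. \<forall>n. 1 / (real m + 1) \<le> \<omega> (prod_encode (1, n))}"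
    have A: "A \<in> sets L.lim" unfolding A_def by measurable
    have iA: "integrable L.lim (indicat_real A)"
      by (rule L.P.integrable_const_bound[of _ 1]) (use borel_measurable_indicator[OF A] in auto)
    define q where "q = exp (- (1 / (real m + 1)))"
    have q: "q < 1" by (simp add: q_def)
    \<comment> \<open>On \<open>A\<close> the value at time 2^-n is at least 1 / (m + 1), so
      positive mass of \<open>A\<close> would keep the transform at 1 away from 1; but
      \<open>\<Psi> 1 / 2 ^ n\<close> tends to 0.\<close>
    have "exp (- (\<Psi> 1 / 2 ^ n)) \<le> 1 - (1 - q) * L.P.prob A" for n
    proof -
      have "exp (- (\<Psi> 1 / 2 ^ n)) = (\<integral>\<omega>. exp (- (\<omega> (prod_encode (1, n)) - \<omega> (prod_encode (0, n)))) \<partial>L.lim)"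
        using lim_laplace[where k = "\<lambda>b. b" and c = "\<lambda>_. 1" and B = 1 and N = n] by (simp add: mono_def)
      also have "\<dots> \<le> (\<integral>\<omega>. 1 - (1 - q) * indicat_real A \<omega> \<partial>L.lim)"
      proof (rule integral_mono_AE)
        have g: "AE \<omega> in L.lim. \<omega> (prod_encode (0, n)) = 0 \<and> \<omega> (prod_encode (0, n)) \<le> \<omega> (prod_encode (1, n))"
        proof -
          have "AE \<omega> in L.lim. \<omega> (prod_encode (0, n)) = 0"
          proof -
            have "AE w in Lev n. restrict (G n w) {prod_encode (0, n)} (prod_encode (0, n)) = 0" by (simp add: G_def)
            moreover have meas: "{x \<in> space (PiM {prod_encode (0, n)} (\<lambda>_. borel)). x (prod_encode (0, n)) = (0 :: real)} \<in>
              sets (PiM {prod_encode (0, n)} (\<lambda>_. borel))" by measurable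
            ultimately have "AE x in fdd n {prod_encode (0, n)}. x (prod_encode (0, n)) = 0"
              unfolding fdd_def by (simp only: AE_distr_iff[OF measurable_G_restrict meas])
            then have "AE \<omega> in L.lim. restrict \<omega> {prod_encode (0, n)} (prod_encode (0, n)) = 0"
              using distr_lim_restrict[of "{prod_encode (0, n)}" n, symmetric]
              by (simp only: tick_encode singleton_iff finite.intros order_refl AE_distr_iff[OF measurable_lim_restrict meas])
            then show ?thesis by simp
          qed
          moreover have "AE \<omega> in L.lim. 0 \<le> \<omega> (prod_encode (0, n)) \<and>
            (dyad (prod_encode (0, n)) \<le> dyad (prod_encode (1, n)) \<longrightarrow> \<omega> (prod_encode (0, n)) \<le> \<omega> (prod_encode (1, n)))"
            by (rule AE_lim_mono)
          ultimately show ?thesis by eventually_elim (simp add: dyad_encode)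
        qed
        show "integrable L.lim (\<lambda>\<omega>. exp (- (\<omega> (prod_encode (1, n)) - \<omega> (prod_encode (0, n)))))"
          by (rule L.P.integrable_const_bound[of _ 1]) (use g in \<open>auto elim!: eventually_mono\<close>)
        show "integrable L.lim (\<lambda>\<omega>. 1 - (1 - q) * indicat_real A \<omega>)"
          by (intro Bochner_Integration.integrable_diff L.P.integrable_const integrable_mult_right iA)
        show "AE \<omega> in L.lim. exp (- (\<omega> (prod_encode (1, n)) - \<omega> (prod_encode (0, n)))) \<le> 1 - (1 - q) * indicat_real A \<omega>"
          using g
        proof eventually_elim
          case (elim \<omega>)
          then show ?case by (cases "\<omega> \<in> A") (auto simp: A_def q_def)
        qed
      qed
      also have "\<dots> = 1 - (1 - q) * L.P.prob A"
      proof -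
        have "integrable L.lim (\<lambda>\<omega>. (1 - q) * indicat_real A \<omega>)"
          by (intro integrable_mult_right iA)
        then show ?thesis using A L.P.prob_space by simp
      qed
      finally show ?thesis .
    qed
    moreover have "(\<lambda>n. exp (- (\<Psi> 1 / 2 ^ n))) \<longlonglongrightarrow> exp (- 0)"
    proof -
      have "(\<lambda>n. \<Psi> 1 * (1/2) ^ n) \<longlonglongrightarrow> \<Psi> 1 * 0" by (intro tendsto_mult_left LIMSEQ_realpow_zero) auto
      then have "(\<lambda>n. \<Psi> 1 / 2 ^ n) \<longlonglongrightarrow> 0" by (simp add: power_divide)
      then show ?thesis by (intro tendsto_exp tendsto_minus)
    qed
    ultimately have "1 \<le> 1 - (1 - q) * L.P.prob A" by (intro tendsto_upperbound[of _ 1 sequentially]) auto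
    then have "L.P.prob A = 0" using q measure_nonneg[of L.lim A] by (simp add: mult_le_0_iff)
    then have "A \<in> null_sets L.lim" using A by (intro null_setsI) (simp_all add: L.P.emeasure_eq_measure)
    from AE_not_in[OF this] AE_space show ?thesis
      by eventually_elim (auto simp: A_def not_le)
  qed
  have "AE \<omega> in L.lim. \<forall>i j. 0 \<le> \<omega> i \<and> (dyad i \<le> dyad j \<longrightarrow> \<omega> i \<le> \<omega> j)"
    unfolding AE_all_countable using AE_lim_mono by blast
  moreover have "AE \<omega> in L.lim. \<forall>m. \<exists>n. \<omega> (prod_encode (1, n)) < 1 / (real m + 1)"
    unfolding AE_all_countable using small by blast
  ultimately show ?thesis by eventually_elim (auto simp: good_def)
qed

end

text \<open>The right-continuous modification of monotone values on the dyadics; the strict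
  inequality is what yields right continuity.\<close>

definition right_inf :: "(nat \<Rightarrow> real) \<Rightarrow> real \<Rightarrow> real" where
  "right_inf g t = Inf (g ` {i. t < dyad i})"

text \<open>A canonical dyadic approximation from strictly above, so that right limits and
  \<open>right_inf\<close> are limits along one measurable sequence of indices.\<close>

definition dyad_above :: "nat \<Rightarrow> real \<Rightarrow> nat" where
  "dyad_above n t = prod_encode (nat \<lfloor>t * 2 ^ n\<rfloor> + 1, n)"

lemma dyad_above_bounds:
  assumes "0 \<le> t"
  shows "t < dyad (dyad_above n t)" "dyad (dyad_above n t) \<le> t + (1/2) ^ n"
proof -
  define k where "k = nat \<lfloor>t * 2 ^ n\<rfloor> + 1"
  have "0 \<le> t * 2 ^ n" using assms by simp
  then have k: "real k \<le> t * 2 ^ n + 1" "t * 2 ^ n < real k" unfolding k_def by linarith+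
  have d: "dyad (dyad_above n t) = real k / 2 ^ n" by (simp only: dyad_above_def dyad_encode k_def)
  show "t < dyad (dyad_above n t)" "dyad (dyad_above n t) \<le> t + (1/2) ^ n"
    unfolding d using k by (simp_all add: field_simps)
qed

lemma dyad_above_tendsto:
  assumes "0 \<le> t" shows "(\<lambda>n. dyad (dyad_above n t)) \<longlonglongrightarrow> t"
proof (rule tendsto_sandwich[where f = "\<lambda>_. t" and h = "\<lambda>n. t + (1/2) ^ n"])
  have "(\<lambda>n. t + (1/2) ^ n) \<longlonglongrightarrow> t + 0" by (intro tendsto_intros LIMSEQ_realpow_zero) auto
  then show "(\<lambda>n. t + (1/2) ^ n) \<longlonglongrightarrow> t" by simp
  show "\<forall>\<^sub>F n in sequentially. t \<le> dyad (dyad_above n t)"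
    by (intro always_eventually allI less_imp_le dyad_above_bounds(1)[OF assms])
  show "\<forall>\<^sub>F n in sequentially. dyad (dyad_above n t) \<le> t + (1/2) ^ n"
    by (intro always_eventually allI dyad_above_bounds(2)[OF assms])
qed simp

context
  fixes g :: "nat \<Rightarrow> real"
  assumes g0: "\<And>i. 0 \<le> g i" and gm: "\<And>i j. dyad i \<le> dyad j \<Longrightarrow> g i \<le> g j"
begin

lemma right_inf_set: "g ` {i. t < dyad i} \<noteq> {}" "bdd_below (g ` {i. t < dyad i})"
proof -
  obtain i where "max 0 t < dyad i" using dyad_dense[of "max 0 t" "max 0 t + 1"] by auto
  then have "t < dyad i" by simp
  then show "g ` {i. t < dyad i} \<noteq> {}" by blast
  show "bdd_below (g ` {i. t < dyad i})" using g0 by (intro bdd_belowI[of _ 0]) auto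
qed

lemma right_inf_le: "t < dyad i \<Longrightarrow> right_inf g t \<le> g i"
  unfolding right_inf_def by (rule cInf_lower) (use right_inf_set in auto)

lemma right_inf_nonneg: "0 \<le> right_inf g t"
  unfolding right_inf_def by (rule cInf_greatest) (use right_inf_set g0 in auto)

lemma right_inf_mono: "t \<le> u \<Longrightarrow> right_inf g t \<le> right_inf g u"
  unfolding right_inf_def by (rule cInf_superset_mono) (use right_inf_set in auto)

lemma right_inf_less:
  assumes "right_inf g t < x" obtains i where "t < dyad i" "g i < x"
  using cInf_lessD[OF right_inf_set(1)] assms unfolding right_inf_def by blast

lemma right_inf_tendsto:
  assumes t: "0 \<le> t" shows "(\<lambda>n. g (dyad_above n t)) \<longlonglongrightarrow> right_inf g t"
  unfolding tendsto_iff
proof (intro allI impI)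
  fix e :: real assume "0 < e"
  then obtain i where i: "t < dyad i" "g i < right_inf g t + e" using right_inf_less[of t "right_inf g t + e"] by auto
  have "\<forall>\<^sub>F n in sequentially. dyad (dyad_above n t) < dyad i"
    using dyad_above_tendsto[OF t] i(1) by (rule order_tendstoD(2))
  then show "\<forall>\<^sub>F n in sequentially. dist (g (dyad_above n t)) (right_inf g t) < e"
  proof eventually_elim
    case (elim n)
    have "g (dyad_above n t) \<le> g i" using elim by (intro gm) auto
    moreover have "right_inf g t \<le> g (dyad_above n t)" by (rule right_inf_le[OF dyad_above_bounds(1)[OF t]])
    ultimately show ?case using i by (simp add: dist_real_def)
  qed
qed

lemma right_inf_cadlag: "cadlag (right_inf g)"
  unfolding cadlag_def
proof (intro conjI allI impI)
  fix t :: real assume "0 \<le> t"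
  show "(right_inf g \<longlongrightarrow> right_inf g t) (at_right t)"
    unfolding tendsto_iff
  proof (intro allI impI)
    fix e :: real assume "0 < e"
    then obtain i where i: "t < dyad i" "g i < right_inf g t + e" using right_inf_less[of t "right_inf g t + e"] by auto
    have "dist (right_inf g u) (right_inf g t) < e" if "t < u" "u < dyad i" for u
      using right_inf_mono[of t u] right_inf_le[of u i] that i by (simp add: dist_real_def)
    then show "\<forall>\<^sub>F u in at_right t. dist (right_inf g u) (right_inf g t) < e"
      using i by (intro eventually_at_rightI[of t "dyad i"]) auto
  qed
next
  fix t :: real assume "0 < t"
  let ?S = "right_inf g ` {..<t}"
  have bdd: "bdd_above ?S" by (rule bdd_aboveI[of _ "right_inf g t"]) (auto intro: right_inf_mono)
  have ne: "?S \<noteq> {}" by auto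
  have "(right_inf g \<longlongrightarrow> Sup ?S) (at_left t)"
    unfolding tendsto_iff
  proof (intro allI impI)
    fix e :: real assume "0 < e"
    then have "Sup ?S - e < Sup ?S" by simp
    then obtain u0 where u0: "u0 < t" "Sup ?S - e < right_inf g u0" using less_cSupD[OF ne] by blast
    have "dist (right_inf g u) (Sup ?S) < e" if "u0 < u" "u < t" for u
    proof -
      have "right_inf g u \<le> Sup ?S" by (rule cSup_upper[OF _ bdd]) (use that in auto)
      then show ?thesis using right_inf_mono[of u0 u] that u0 by (simp add: dist_real_def)
    qed
    then show "\<forall>\<^sub>F u in at_left t. dist (right_inf g u) (Sup ?S) < e"
      using u0 by (intro eventually_at_leftI[of u0]) auto
  qed
  then show "\<exists>l. (right_inf g \<longlongrightarrow> l) (at_left t)" by blast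
qed

end

context subordinator_exponent
begin

text \<open>The zero path replaces the exceptional ones, because \<open>levy_laplace\<close> demands
  a cadlag path from 0 at every sample point.\<close>

definition "gval \<omega> i = (if good \<omega> then \<omega> i else 0)"
definition "lpath \<omega> = right_inf (gval \<omega>)"

lemma gval_nonneg: "0 \<le> gval \<omega> i" and gval_mono: "dyad i \<le> dyad j \<Longrightarrow> gval \<omega> i \<le> gval \<omega> j"
  by (auto simp: gval_def good_def)

lemma path_0: "lpath \<omega> 0 = 0"
proof (rule antisym)
  show "lpath \<omega> 0 \<le> 0"
  proof (rule field_le_epsilon)
    fix e :: real assume "0 < e"
    obtain m :: nat where m: "inverse (real (Suc m)) < e" using reals_Archimedean[OF \<open>0 < e\<close>] by blast
    obtain n where n: "gval \<omega> (prod_encode (1, n)) < e"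
    proof (cases "good \<omega>")
      case True
      then obtain n where "\<omega> (prod_encode (1, n)) < 1 / (real m + 1)" unfolding good_def One_nat_def by blast
      then show ?thesis using that[of n] m True by (simp add: gval_def inverse_eq_divide add.commute)
    next
      case False
      then show ?thesis using that[of 0] \<open>0 < e\<close> by (simp add: gval_def)
    qed
    have "lpath \<omega> 0 \<le> gval \<omega> (prod_encode (1, n))"
      unfolding lpath_def by (rule right_inf_le[OF gval_nonneg gval_mono]) (simp_all add: dyad_encode)
    then show "lpath \<omega> 0 \<le> 0 + e" using n by simp
  qed
  show "0 \<le> lpath \<omega> 0" unfolding lpath_def by (rule right_inf_nonneg[OF gval_nonneg gval_mono])
qed

lemma measurable_good: "{\<omega> \<in> space L.lim. good \<omega>} \<in> sets L.lim"
  unfolding good_def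
  by (intro sets.sets_Collect_conj sets.sets_Collect_countable_All sets.sets_Collect_countable_Ex sets.sets_Collect_imp
    sets.sets_Collect_const borel_measurable_le borel_measurable_less borel_measurable_const measurable_lim)

lemma measurable_gval: "(\<lambda>\<omega>. gval \<omega> i) \<in> borel_measurable L.lim"
  unfolding gval_def by (intro measurable_If measurable_lim borel_measurable_const measurable_good)

lemma measurable_path: "(\<lambda>\<omega>. lpath \<omega> t) \<in> borel_measurable L.lim"
  unfolding lpath_def right_inf_def
  by (rule borel_measurable_cINF) (auto intro: measurable_gval right_inf_set(2)[OF gval_nonneg gval_mono])

text \<open>Arbitrary times are approached by dyadic ones from the right; the integrands converge by
  right continuity and stay in [0, 1] by monotonicity.\<close>

lemma path_laplace:
  assumes t: "0 \<le> t 0" "\<And>i. t i \<le> t (Suc i)" and c: "\<And>b. 0 \<le> c b"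
  shows "(\<integral>\<omega>. exp (- (\<Sum>b<B. c b * (lpath \<omega> (t (Suc b)) - lpath \<omega> (t b)))) \<partial>L.lim) =
    exp (- (\<Sum>b<B. (t (Suc b) - t b) * \<Psi> (c b)))"
proof -
  have t0: "0 \<le> t b" for b using lift_Suc_mono_le[of t 0 b] t by auto
  have tm: "t b \<le> t b'" if "b \<le> b'" for b b' using lift_Suc_mono_le[of t b b'] t that by auto
  define k where "k n b = nat \<lfloor>t b * 2 ^ n\<rfloor> + 1" for n b
  have km: "mono (k n)" for n
    unfolding k_def by (intro monoI add_mono nat_mono floor_mono mult_right_mono tm) auto
  have kd: "real (k n b) / 2 ^ n = dyad (dyad_above n (t b))" for n b
    by (simp only: dyad_above_def dyad_encode k_def)
  let ?h = "\<lambda>n \<omega>. exp (- (\<Sum>b<B. c b * (gval \<omega> (dyad_above n (t (Suc b))) - gval \<omega> (dyad_above n (t b)))))"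
  have "(\<integral>\<omega>. ?h n \<omega> \<partial>L.lim) = exp (- (\<Sum>b<B. (dyad (dyad_above n (t (Suc b))) - dyad (dyad_above n (t b))) * \<Psi> (c b)))" for n
  proof -
    have "(\<integral>\<omega>. ?h n \<omega> \<partial>L.lim) =
      (\<integral>\<omega>. exp (- (\<Sum>b<B. c b * (\<omega> (prod_encode (k n (Suc b), n)) - \<omega> (prod_encode (k n b, n))))) \<partial>L.lim)"
    proof (rule integral_cong_AE)
      show "AE \<omega> in L.lim. ?h n \<omega> = exp (- (\<Sum>b<B. c b * (\<omega> (prod_encode (k n (Suc b), n)) - \<omega> (prod_encode (k n b, n)))))"
        using AE_good by eventually_elim (simp add: gval_def dyad_above_def k_def)
      show "?h n \<in> borel_measurable L.lim"
        using measurable_gval by (intro measurable_compose[OF _ borel_measurable_exp] borel_measurable_uminus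
          borel_measurable_sum borel_measurable_times borel_measurable_diff borel_measurable_const) auto
      show "(\<lambda>\<omega>. exp (- (\<Sum>b<B. c b * (\<omega> (prod_encode (k n (Suc b), n)) - \<omega> (prod_encode (k n b, n)))))) \<in> borel_measurable L.lim"
        using measurable_lim by (intro measurable_compose[OF _ borel_measurable_exp] borel_measurable_uminus
          borel_measurable_sum borel_measurable_times borel_measurable_diff borel_measurable_const) auto
    qed
    also have "\<dots> = exp (- (\<Sum>b<B. (real (k n (Suc b)) - real (k n b)) / 2 ^ n * \<Psi> (c b)))"
      by (rule lim_laplace[OF km c])
    finally show ?thesis by (simp only: diff_divide_distrib kd)
  qed
  moreover have "(\<lambda>n. exp (- (\<Sum>b<B. (dyad (dyad_above n (t (Suc b))) - dyad (dyad_above n (t b))) * \<Psi> (c b)))) \<longlonglongrightarrow>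
    exp (- (\<Sum>b<B. (t (Suc b) - t b) * \<Psi> (c b)))"
    by (intro tendsto_exp tendsto_minus tendsto_sum tendsto_mult tendsto_diff tendsto_const dyad_above_tendsto t0)
  moreover have "(\<lambda>n. \<integral>\<omega>. ?h n \<omega> \<partial>L.lim) \<longlonglongrightarrow> (\<integral>\<omega>. exp (- (\<Sum>b<B. c b * (lpath \<omega> (t (Suc b)) - lpath \<omega> (t b)))) \<partial>L.lim)"
  proof (rule integral_dominated_convergence[where w = "\<lambda>_. 1"])
    show "?h n \<in> borel_measurable L.lim" for n
      using measurable_gval by (intro measurable_compose[OF _ borel_measurable_exp] borel_measurable_uminus
        borel_measurable_sum borel_measurable_times borel_measurable_diff borel_measurable_const) auto
    show "(\<lambda>\<omega>. exp (- (\<Sum>b<B. c b * (lpath \<omega> (t (Suc b)) - lpath \<omega> (t b))))) \<in> borel_measurable L.lim"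
      using measurable_path by (intro measurable_compose[OF _ borel_measurable_exp] borel_measurable_uminus
        borel_measurable_sum borel_measurable_times borel_measurable_diff borel_measurable_const) auto
    show "AE \<omega> in L.lim. (\<lambda>n. ?h n \<omega>) \<longlonglongrightarrow> exp (- (\<Sum>b<B. c b * (lpath \<omega> (t (Suc b)) - lpath \<omega> (t b))))"
      unfolding lpath_def
      by (intro AE_I2 tendsto_exp tendsto_minus tendsto_sum tendsto_mult tendsto_diff tendsto_const
        right_inf_tendsto gval_nonneg gval_mono t0)
    have kk: "dyad (dyad_above n (t b)) \<le> dyad (dyad_above n (t (Suc b)))" for n b
      unfolding kd[symmetric] using monoD[OF km, of b "Suc b" n] by (intro divide_right_mono) auto
    have "0 \<le> (\<Sum>b<B. c b * (gval \<omega> (dyad_above n (t (Suc b))) - gval \<omega> (dyad_above n (t b))))" for n \<omega>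
      using gval_mono[OF kk] c by (intro sum_nonneg mult_nonneg_nonneg) auto
    then show "AE \<omega> in L.lim. norm (?h n \<omega>) \<le> 1" for n by simp
  qed simp
  ultimately show ?thesis using LIMSEQ_unique by (metis (no_types, lifting) ext)
qed

theorem levy_exists: "levy_laplace L.lim lpath \<Psi>"
proof (rule levy_laplaceI[where \<Psi> = \<Psi>])
  show "prob_space L.lim" by (rule L.P.prob_space_axioms)
  show "(\<lambda>\<omega>. lpath \<omega> t) \<in> borel_measurable L.lim" for t by (rule measurable_path)
  show "lpath \<omega> 0 = 0" for \<omega> by (rule path_0)
  show "cadlag (lpath \<omega>)" for \<omega> unfolding lpath_def by (rule right_inf_cadlag[OF gval_nonneg gval_mono])
  show "mono_on {0..} (lpath \<omega>)" for \<omega>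
    unfolding lpath_def by (intro mono_onI right_inf_mono gval_nonneg gval_mono)
qed (use \<Psi>_0 path_laplace in auto)

end

text \<open>The laws of \<open>exp (- X k)\<close> live on a bounded interval, hence are tight. Mass
  of \<open>X k\<close> escaping to infinity would become an atom at 0, which the behaviour of
  \<open>\<phi>\<close> near 0 rules out; then \<open>- ln\<close> is the limit variable.\<close>

lemma laplace_limit_exists:
  fixes X :: "nat \<Rightarrow> 'a \<Rightarrow> real" and \<phi> :: "real \<Rightarrow> real"
  assumes M: "prob_space M" and X: "\<And>k. X k \<in> borel_measurable M" "\<And>k. AE \<omega> in M. 0 \<le> X k \<omega>"
    and conv: "\<And>c. 0 < c \<Longrightarrow> (\<lambda>k. \<integral>\<omega>. exp (- (c * X k \<omega>)) \<partial>M) \<longlonglongrightarrow> exp (- \<phi> c)"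
    and \<phi>: "(\<lambda>n. \<phi> (1 / real (Suc n))) \<longlonglongrightarrow> 0"
  obtains \<mu> where "prob_space \<mu>" "sets \<mu> = sets borel" "AE x in \<mu>. 0 \<le> x"
    "\<And>c. 0 < c \<Longrightarrow> (\<integral>x. exp (- (c * x)) \<partial>\<mu>) = exp (- \<phi> c)"
proof -
  interpret M: prob_space M by fact
  define \<nu>s where "\<nu>s k = distr M borel (\<lambda>\<omega>. exp (- X k \<omega>))" for k
  have mX: "(\<lambda>\<omega>. exp (- X k \<omega>)) \<in> borel_measurable M" for k using X(1)[of k] by measurable
  have rd: "real_distribution (\<nu>s k)" for k unfolding \<nu>s_def by (rule M.real_distribution_distr[OF mX])
  have one: "measure (\<nu>s k) {-1<..1} = 1" for k
  proof -
    interpret n: real_distribution "\<nu>s k" by (rule rd)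
    have "-1 < exp u" for u :: real using exp_gt_zero[of u] by linarith
    then have "AE \<omega> in M. exp (- X k \<omega>) \<in> {-1<..1}" using X(2)[of k] by (auto elim!: eventually_mono)
    then have "AE y in \<nu>s k. y \<in> {-1<..1}" unfolding \<nu>s_def by (subst AE_distr_iff[OF mX]) simp_all
    then show ?thesis by (subst n.prob_eq_1) auto
  qed
  have "tight \<nu>s" unfolding tight_def
  proof (intro conjI allI impI rd)
    fix \<epsilon> :: real assume "0 < \<epsilon>"
    then show "\<exists>a b. a < b \<and> (\<forall>n. 1 - \<epsilon> < measure (\<nu>s n) {a<..b})"
      by (intro exI[of _ "-1"] exI[of _ 1]) (simp add: one)
  qed
  from tight_imp_convergent_subsubsequence[OF this strict_mono_id]
  obtain s \<nu> where s: "strict_mono s" and \<nu>: "real_distribution \<nu>" and w: "weak_conv_m (\<nu>s \<circ> s) \<nu>"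
    by (auto simp: comp_def id_def)
  interpret \<nu>: real_distribution \<nu> by (rule \<nu>)
  have lim: "(\<lambda>k. \<integral>\<omega>. g (exp (- X (s k) \<omega>)) \<partial>M) \<longlonglongrightarrow> (\<integral>y. g y \<partial>\<nu>)"
    if g: "\<And>y. isCont g y" "\<And>y. norm (g y) \<le> B" for g :: "real \<Rightarrow> real" and B
  proof -
    have mg: "g \<in> borel_measurable borel" using g(1) by (intro borel_measurable_continuous_onI continuous_at_imp_continuous_on) auto
    have "(\<lambda>n. integral\<^sup>L ((\<nu>s \<circ> s) n) g) \<longlonglongrightarrow> integral\<^sup>L \<nu> g"
      by (rule weak_conv_imp_integral_bdd_continuous_conv[OF _ \<nu> w g]) (simp_all add: rd)
    then show ?thesis unfolding \<nu>s_def comp_def by (simp only: integral_distr[OF mX mg])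
  qed
  \<comment> \<open>Clamping to [0, 1] makes powers bounded and continuous on the whole line, so
    weak convergence applies to them.\<close>
  define cl where "cl y = min 1 (max 0 y)" for y :: real
  have cl: "0 \<le> cl y" "cl y \<le> 1" "isCont cl y" for y unfolding cl_def by (auto intro!: continuous_intros)
  have cl_id: "cl y = y" if "0 \<le> y" "y \<le> 1" for y using that by (simp add: cl_def)
  have mcl[measurable]: "cl \<in> borel_measurable borel" unfolding cl_def by measurable
  have AEX: "AE \<omega> in M. cl (exp (- X k \<omega>)) = exp (- X k \<omega>)" for k
    using X(2)[of k] by (auto elim!: eventually_mono intro!: cl_id)
  \<comment> \<open>A bounded continuous test of whether the limit law lives on [0, 1].\<close>
  have "(\<integral>y. min 1 \<bar>y - cl y\<bar> \<partial>\<nu>) = 0"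
  proof (rule LIMSEQ_unique)
    show "(\<lambda>k. \<integral>\<omega>. min 1 \<bar>exp (- X (s k) \<omega>) - cl (exp (- X (s k) \<omega>))\<bar> \<partial>M) \<longlonglongrightarrow> (\<integral>y. min 1 \<bar>y - cl y\<bar> \<partial>\<nu>)"
      by (rule lim[of _ 1]) (auto intro!: continuous_intros cl)
    have "(\<integral>\<omega>. min 1 \<bar>exp (- X k \<omega>) - cl (exp (- X k \<omega>))\<bar> \<partial>M) = 0" for k
      by (rule integral_eq_zero_AE) (use AEX[of k] in \<open>auto elim!: eventually_mono\<close>)
    then show "(\<lambda>k. \<integral>\<omega>. min 1 \<bar>exp (- X (s k) \<omega>) - cl (exp (- X (s k) \<omega>))\<bar> \<partial>M) \<longlonglongrightarrow> 0" by simp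
  qed
  moreover have "integrable \<nu> (\<lambda>y. min 1 \<bar>y - cl y\<bar>)" by (rule \<nu>.integrable_const_bound[of _ 1]) auto
  ultimately have "AE y in \<nu>. min 1 \<bar>y - cl y\<bar> = 0" by (subst (asm) integral_nonneg_eq_0_iff_AE) auto
  then have AEcl: "AE y in \<nu>. cl y = y"
    by eventually_elim (simp split: if_split_asm add: min_def)
  have pw: "(\<integral>y. cl y powr c \<partial>\<nu>) = exp (- \<phi> c)" if c: "0 < c" for c
  proof (rule LIMSEQ_unique)
    have "continuous_on UNIV (\<lambda>y. cl y powr c)"
      by (rule continuous_on_powr') (use c cl in \<open>auto intro!: continuous_at_imp_continuous_on\<close>)
    then have "isCont (\<lambda>y. cl y powr c) y" for y by (simp add: continuous_on_eq_continuous_at)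
    then show "(\<lambda>k. \<integral>\<omega>. cl (exp (- X (s k) \<omega>)) powr c \<partial>M) \<longlonglongrightarrow> (\<integral>y. cl y powr c \<partial>\<nu>)"
      by (rule lim[of _ 1]) (use cl c in \<open>simp add: powr_le1\<close>)
    have "(\<integral>\<omega>. cl (exp (- X k \<omega>)) powr c \<partial>M) = (\<integral>\<omega>. exp (- (c * X k \<omega>)) \<partial>M)" for k
    proof (rule integral_cong_AE)
      show "AE \<omega> in M. cl (exp (- X k \<omega>)) powr c = exp (- (c * X k \<omega>))"
        using AEX[of k] by eventually_elim (simp add: powr_def)
    qed (use X(1)[of k] in measurable)
    then show "(\<lambda>k. \<integral>\<omega>. cl (exp (- X (s k) \<omega>)) powr c \<partial>M) \<longlonglongrightarrow> exp (- \<phi> c)"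
      using LIMSEQ_subseq_LIMSEQ[OF conv[OF c] s] by (simp add: comp_def)
  qed
  \<comment> \<open>Powers with exponent tending to 0 converge to the indicator of the positive
    half-line, and their integrals \<open>exp (- \<phi> (1 / real (Suc n)))\<close> tend to
    1.\<close>
  have "(\<integral>y. indicator {0<..} y \<partial>\<nu>) = (1::real)"
  proof (rule LIMSEQ_unique)
    show "(\<lambda>n. \<integral>y. cl y powr (1 / real (Suc n)) \<partial>\<nu>) \<longlonglongrightarrow> (\<integral>y. indicator {0<..} y \<partial>\<nu>)"
    proof (rule integral_dominated_convergence[where w = "\<lambda>_. 1"])
      show "AE y in \<nu>. (\<lambda>n. cl y powr (1 / real (Suc n))) \<longlonglongrightarrow> indicator {0<..} y"
      proof (rule AE_I2)
        fix y
        show "(\<lambda>n. cl y powr (1 / real (Suc n))) \<longlonglongrightarrow> indicator {0<..} y"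
        proof (cases "0 < y")
          case True
          then have "0 < cl y" by (simp add: cl_def)
          moreover have "(\<lambda>n. 1 / real (Suc n)) \<longlonglongrightarrow> 0" using LIMSEQ_Suc[OF lim_1_over_n] by simp
          ultimately have "(\<lambda>n. cl y powr (1 / real (Suc n))) \<longlonglongrightarrow> cl y powr 0" by (intro tendsto_powr tendsto_const) auto
          then show ?thesis using True \<open>0 < cl y\<close> by simp
        qed (simp add: cl_def)
      qed
    qed (use cl in \<open>auto simp: powr_le1\<close>)
    show "(\<lambda>n. \<integral>y. cl y powr (1 / real (Suc n)) \<partial>\<nu>) \<longlonglongrightarrow> 1"
      using tendsto_exp[OF tendsto_minus[OF \<phi>]] by (simp add: pw del: of_nat_Suc)
  qed
  then have "measure \<nu> {0<..} = 1" by simp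
  then have "AE y in \<nu>. y \<in> {0<..}" by (subst (asm) \<nu>.prob_eq_1) auto
  then have AE: "AE y in \<nu>. 0 < y \<and> y \<le> 1 \<and> cl y = y" using AEcl
  proof eventually_elim
    case (elim y) then show ?case using cl(2)[of y] by simp
  qed
  have ml: "(\<lambda>y. - ln y) \<in> measurable \<nu> borel" by measurable
  show ?thesis
  proof
    show "prob_space (distr \<nu> borel (\<lambda>y. - ln y))" by (rule \<nu>.prob_space_distr[OF ml])
    have "AE y in \<nu>. 0 \<le> - ln y" using AE by eventually_elim simp
    then show "AE x in distr \<nu> borel (\<lambda>y. - ln y). 0 \<le> x" by (subst AE_distr_iff[OF ml]) auto
    fix c :: real assume c: "0 < c"
    have "(\<integral>x. exp (- (c * x)) \<partial>distr \<nu> borel (\<lambda>y. - ln y)) = (\<integral>y. exp (- (c * - ln y)) \<partial>\<nu>)"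
      by (rule integral_distr[OF ml]) measurable
    also have "\<dots> = (\<integral>y. cl y powr c \<partial>\<nu>)"
    proof (rule integral_cong_AE)
      show "AE y in \<nu>. exp (- (c * - ln y)) = cl y powr c"
        using AE by eventually_elim (auto simp: powr_def)
    qed measurable
    finally show "(\<integral>x. exp (- (c * x)) \<partial>distr \<nu> borel (\<lambda>y. - ln y)) = exp (- \<phi> c)" using pw[OF c] by simp
  qed simp
qed

context rtrw_limit
begin

lemma Psi_le_F: 
  assumes "0 \<le> c" shows "Psi c \<le> F 1 c"
proof -
  have g: "(\<lambda>j. \<upsilon> * r ^ j * F 1 c) sums (\<upsilon> * (1 / (1 - r)) * F 1 c)"
    using \<upsilon>_bounds by (intro sums_mult2 sums_mult geometric_sums) auto
  have s: "summable (\<lambda>j. \<upsilon> * r ^ j * (F (Suc j) c - F j c))"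
    using F_increment[OF assms order_refl] \<upsilon>_bounds
    by (intro summable_comparison_test'[OF sums_summable[OF g]]) (simp add: mult_left_mono)
  have "Psi c \<le> (\<Sum>j. \<upsilon> * r ^ j * F 1 c)"
    unfolding Psi_def using F_increment[OF assms order_refl] \<upsilon>_bounds
    by (intro suminf_le s sums_summable[OF g] mult_left_mono) auto
  also have "\<dots> = F 1 c" using sums_unique[OF g] \<upsilon>_bounds \<upsilon>_eq by simp
  finally show ?thesis .
qed

text \<open>The first term of the series. With \<open>Psi_le_F\<close> it transfers the two-sided
  power bounds from \<open>f 1\<close> to \<open>Psi\<close>.\<close>

lemma Psi_ge_F:
  assumes "0 \<le> c" shows "\<upsilon>\<^sup>2 * F 1 c \<le> Psi c"
proof -
  have "(\<Sum>j<1. F (Suc j) c * r ^ j) \<le> (\<Sum>j. F (Suc j) c * r ^ j)"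
    using F_bounds(1)[OF assms] \<upsilon>_bounds summable_F[OF assms]
    by (intro sum_le_suminf) (auto simp: mult.commute)
  then show ?thesis unfolding Psi_eq[OF assms] by (intro mult_left_mono) auto
qed

lemma levy_laplace_exists:
  assumes \<alpha>: "0 < \<alpha>" and f1: "\<And>lam. 0 < lam \<Longrightarrow> f 1 lam \<le> C * lam powr \<alpha>"
  shows "\<exists>(M :: (nat \<Rightarrow> real) measure) S. levy_laplace M S Psi"
proof -
  have C: "0 \<le> C" using F_bounds[of 1 1] f1[of 1] by (auto simp: F_def)
  have "\<exists>\<mu>. prob_space \<mu> \<and> sets \<mu> = sets borel \<and> (AE x in \<mu>. 0 \<le> x) \<and>
     (\<forall>c>0. (\<integral>x. exp (- (c * x)) \<partial>\<mu>) = exp (- (Psi c / 2 ^ N)))" for N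
  proof -
    \<comment> \<open>The law at mesh 2^-N is obtained as a weak limit of the rescaled clock at the
      end of the first block of that mesh.\<close>
    define X where "X k \<omega> = clock (fst \<omega>) (snd \<omega>) (grid (n k) (2 ^ N) 1) / a k" for k \<omega>
    have pos: "0 \<le> clock (fst \<omega>) (snd \<omega>) m" if "\<forall>m. 0 < visit_time (fst \<omega>) (snd \<omega>) m" for \<omega> m
      unfolding clock_visit_time using that by (intro sum_nonneg less_imp_le) auto
    obtain \<mu> where "prob_space \<mu>" "sets \<mu> = sets borel" "AE x in \<mu>. 0 \<le> x"
      "\<And>c. 0 < c \<Longrightarrow> (\<integral>x. exp (- (c * x)) \<partial>\<mu>) = exp (- (Psi c / 2 ^ N))"
    proof (rule laplace_limit_exists[of "annealed \<beta> \<pi>" X "\<lambda>c. Psi c / 2 ^ N"])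
      show "prob_space (annealed \<beta> \<pi>)" by (rule ann.prob_space_axioms)
      show "X k \<in> borel_measurable (annealed \<beta> \<pi>)" for k
        unfolding X_def by (intro borel_measurable_divide measurable_clock borel_measurable_const)
      show "AE \<omega> in annealed \<beta> \<pi>. 0 \<le> X k \<omega>" for k
        using annealed_clock_pos by eventually_elim (auto simp: X_def intro!: divide_nonneg_nonneg pos less_imp_le[OF a_pos])
      show "(\<lambda>k. \<integral>\<omega>. exp (- (c * X k \<omega>)) \<partial>annealed \<beta> \<pi>) \<longlonglongrightarrow> exp (- (Psi c / 2 ^ N))" if "0 < c" for c
      proof -
        have [simp]: "clock \<eta> \<xi> 0 = 0" for \<eta> \<xi> by (simp add: clock_def)
        show ?thesis using clock_laplace_tendsto[of "2 ^ N" "\<lambda>_. c" c 1] that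
          by (simp add: X_def grid_0)
      qed
      show "(\<lambda>n. Psi (1 / real (Suc n)) / 2 ^ N) \<longlonglongrightarrow> 0"
      proof (rule tendsto_sandwich[where f = "\<lambda>_. 0" and h = "\<lambda>n. C * (1 / real (Suc n)) powr \<alpha>"])
        have "Psi (1 / real (Suc n)) / 2 ^ N \<le> C * (1 / real (Suc n)) powr \<alpha>" for n
        proof -
          have "Psi (1 / real (Suc n)) / 2 ^ N \<le> Psi (1 / real (Suc n))"
            using mult_right_mono[of 1 "2 ^ N" "Psi (1 / real (Suc n))"] Psi_nonneg[of "1 / real (Suc n)"]
            by (simp add: divide_le_eq mult.commute del: of_nat_Suc)
          also have "\<dots> \<le> f 1 (1 / real (Suc n))" using Psi_le_F[of "1 / real (Suc n)"] by (simp add: F_def del: of_nat_Suc)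
          also have "\<dots> \<le> C * (1 / real (Suc n)) powr \<alpha>" by (rule f1) simp
          finally show ?thesis .
        qed
        then show "\<forall>\<^sub>F n in sequentially. Psi (1 / real (Suc n)) / 2 ^ N \<le> C * (1 / real (Suc n)) powr \<alpha>" by simp
        show "\<forall>\<^sub>F n in sequentially. 0 \<le> Psi (1 / real (Suc n)) / 2 ^ N" using Psi_nonneg by simp
        have "(\<lambda>n. 1 / real (Suc n)) \<longlonglongrightarrow> 0" using LIMSEQ_Suc[OF lim_1_over_n] by simp
        then have "(\<lambda>n. C * (1 / real (Suc n)) powr \<alpha>) \<longlonglongrightarrow> C * 0"
          by (intro tendsto_mult tendsto_const tendsto_zero_powrI[OF _ _ _ \<alpha>]) auto
        then show "(\<lambda>n. C * (1 / real (Suc n)) powr \<alpha>) \<longlonglongrightarrow> 0" by simp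
      qed simp
    qed blast
    then show ?thesis by blast
  qed
  then obtain \<mu> where \<mu>: "\<And>N. prob_space (\<mu> N)" "\<And>N. sets (\<mu> N) = sets borel" "\<And>N. AE x in \<mu> N. 0 \<le> x"
     "\<And>N c. 0 < c \<Longrightarrow> (\<integral>x. exp (- (c * x)) \<partial>\<mu> N) = exp (- (Psi c / 2 ^ N))" by metis
  interpret S: subordinator_exponent Psi \<mu>
  proof (rule subordinator_exponent.intro)
    show "(\<integral>x. exp (- (c * x)) \<partial>\<mu> N) = exp (- (Psi c / 2 ^ N))" if "0 \<le> c" for c N
      using that \<mu>(4)[of c N] Psi_0 prob_space.prob_space[OF \<mu>(1)] by (cases "c = 0") auto
  qed (rule \<mu>)+
  show ?thesis using S.levy_exists by blast
qed

end

section \<open>Paths of the limit process\<close>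

lemma cadlag_dyad_tendsto:
  assumes "cadlag x" "0 \<le> t"
  shows "(\<lambda>n. x (dyad (dyad_above n t))) \<longlonglongrightarrow> x t"
proof -
  have "(x \<longlongrightarrow> x t) (at_right t)" using assms by (simp add: cadlag_def)
  moreover have "filterlim (\<lambda>n. dyad (dyad_above n t)) (at_right t) sequentially"
    unfolding filterlim_at using dyad_above_tendsto[OF assms(2)] dyad_above_bounds(1)[OF assms(2)]
    by (auto intro!: always_eventually simp: less_imp_neq[THEN not_sym])
  ultimately show ?thesis by (rule filterlim_compose)
qed

text \<open>Right continuity extends the weak inequalities from dyadic to all times; two dyadic
  points between \<open>u\<close> and \<open>v\<close> preserve the strict one.\<close>

lemma increasing_path_dyad:
  assumes x: "cadlag x" "x 0 = 0" and inc: "\<And>i j. dyad i < dyad j \<Longrightarrow> x (dyad i) < x (dyad j)"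
    and unb: "\<And>m. \<exists>n. real m < x (real n)"
  shows "increasing_path x"
proof (rule increasing_path.intro)
  have right: "x t \<le> x (dyad i)" if "0 \<le> t" "t < dyad i" for t i
  proof (rule tendsto_upperbound[OF cadlag_dyad_tendsto[OF x(1) that(1)]])
    have "\<forall>\<^sub>F n in sequentially. dyad (dyad_above n t) < dyad i"
      using order_tendstoD(2)[OF dyad_above_tendsto[OF that(1)] that(2)] .
    then show "\<forall>\<^sub>F n in sequentially. x (dyad (dyad_above n t)) \<le> x (dyad i)"
      by eventually_elim (intro less_imp_le inc)
  qed simp
  have left: "x (dyad i) \<le> x t" if "dyad i < t" for t i
  proof (rule tendsto_lowerbound[OF cadlag_dyad_tendsto[OF x(1)]])
    show t: "0 \<le> t" using that dyad_nonneg[of i] by linarith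
    have "dyad i < dyad (dyad_above n t)" for n using dyad_above_bounds(1)[OF t, of n] that by linarith
    then show "\<forall>\<^sub>F n in sequentially. x (dyad i) \<le> x (dyad (dyad_above n t))"
      by (intro always_eventually allI less_imp_le inc)
  qed simp
  fix u v :: real assume uv: "0 \<le> u" "u < v"
  obtain i where i: "u < dyad i" "dyad i < v" using dyad_dense[OF uv] by blast
  obtain j where j: "dyad i < dyad j" "dyad j < v" using dyad_dense[OF dyad_nonneg i(2)] by blast
  show "x u < x v" using right[OF uv(1) i(1)] inc[OF j(1)] left[OF j(2)] by linarith
next
  fix M :: real
  obtain m :: nat where "M < real m" using reals_Archimedean2 by blast
  moreover obtain n where "real m < x (real n)" using unb by blast
  ultimately show "\<exists>t\<ge>0. M < x t" by (intro exI[of _ "real n"]) auto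
qed (rule x)

text \<open>Lets the single level \<open>N\<close> serve all indices below \<open>N\<close>, as in
  the moments on the cube.\<close>

lemma lev_le: "lev i \<le> i"
  using le_prod_encode_2[of "snd (prod_decode i)" "fst (prod_decode i)"] by (simp add: lev_def)

section \<open>Almost sure path properties of the limit\<close>

locale levy_subordinator =
  fixes M :: "'a measure" and S :: "'a \<Rightarrow> real \<Rightarrow> real" and \<Psi> :: "real \<Rightarrow> real"
  assumes levy: "levy_laplace M S \<Psi>" and \<Psi>_top: "filterlim \<Psi> at_top at_top" and \<Psi>_zero: "\<Psi> 0 = 0"
begin

sublocale prob_space M using levy by (simp add: levy_laplace_def)

lemma measurable_S: "(\<lambda>\<omega>. S \<omega> t) \<in> borel_measurable M"
  and S_0: "\<omega> \<in> space M \<Longrightarrow> S \<omega> 0 = 0" and S_cadlag: "\<omega> \<in> space M \<Longrightarrow> cadlag (S \<omega>)"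
  and S_indep: "0 \<le> t' 0 \<Longrightarrow> (\<And>i. t' i \<le> t' (Suc i)) \<Longrightarrow>
        indep_vars (\<lambda>_. borel) (\<lambda>i \<omega>. S \<omega> (t' (Suc i)) - S \<omega> (t' i)) {..<n}"
  and S_stationary: "0 \<le> s \<Longrightarrow> 0 \<le> t \<Longrightarrow> distr M borel (\<lambda>\<omega>. S \<omega> (t + s) - S \<omega> t) = distr M borel (\<lambda>\<omega>. S \<omega> s)"
  and S_laplace: "0 \<le> t \<Longrightarrow> 0 < lam \<Longrightarrow> (\<integral>\<^sup>+\<omega>. ennreal (exp (- lam * S \<omega> t)) \<partial>M) = ennreal (exp (- t * \<Psi> lam))"
  using levy by (auto simp: levy_laplace_def)

text \<open>Exponential Markov inequality for \<open>- S \<omega> t\<close>.\<close>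

lemma S_lower_tail:
  assumes "0 \<le> t" "0 < lam" shows "prob {\<omega>\<in>space M. S \<omega> t \<le> x} \<le> exp (lam * x - t * \<Psi> lam)"
proof -
  have m: "{\<omega>\<in>space M. S \<omega> t \<le> x} \<in> sets M" using measurable_S[of t] by measurable
  have "ennreal (prob {\<omega>\<in>space M. S \<omega> t \<le> x}) = (\<integral>\<^sup>+\<omega>. indicator {\<omega>\<in>space M. S \<omega> t \<le> x} \<omega> \<partial>M)"
    using m by (simp add: emeasure_eq_measure)
  also have "\<dots> \<le> (\<integral>\<^sup>+\<omega>. ennreal (exp (lam * x)) * ennreal (exp (- lam * S \<omega> t)) \<partial>M)"
  proof (rule nn_integral_mono)
    fix \<omega>
    have "1 \<le> exp (lam * x + - lam * S \<omega> t)" if "S \<omega> t \<le> x" using mult_left_mono[OF that, of lam] assms by (simp del: exp_add)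
    then show "indicator {\<omega>\<in>space M. S \<omega> t \<le> x} \<omega> \<le> ennreal (exp (lam * x)) * ennreal (exp (- lam * S \<omega> t))"
      by (simp only: ennreal_mult'[symmetric] exp_ge_zero exp_add[symmetric]) (auto simp: indicator_def)
  qed
  also have "\<dots> = ennreal (exp (lam * x)) * (\<integral>\<^sup>+\<omega>. ennreal (exp (- lam * S \<omega> t)) \<partial>M)"
    using measurable_S[of t] by (intro nn_integral_cmult) measurable
  also have "\<dots> = ennreal (exp (lam * x - t * \<Psi> lam))"
    by (simp only: S_laplace[OF assms] ennreal_mult'[symmetric] exp_ge_zero exp_add[symmetric]) simp
  finally show ?thesis by simp
qed

text \<open>At level 0 the tail bound is \<open>exp (- t * \<Psi> lam)\<close>; growth of the
  exponent sends it to 0 as \<open>lam\<close> grows.\<close>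

lemma AE_S_pos: assumes "0 < t" shows "AE \<omega> in M. 0 < S \<omega> t"
proof -
  have "((\<lambda>lam. exp (- (t * \<Psi> lam))) \<longlongrightarrow> 0) at_top"
    by (rule filterlim_compose[OF exp_at_bot]) (simp add: filterlim_uminus_at_top[symmetric]
      filterlim_tendsto_pos_mult_at_top[OF tendsto_const assms \<Psi>_top])
  moreover have "\<forall>\<^sub>F lam in at_top. prob {\<omega>\<in>space M. S \<omega> t \<le> 0} \<le> exp (- (t * \<Psi> lam))"
    using eventually_gt_at_top[of 0] by eventually_elim (use S_lower_tail[of t _ 0] assms in auto)
  ultimately have "prob {\<omega>\<in>space M. S \<omega> t \<le> 0} \<le> 0" by (rule tendsto_lowerbound) simp
  then have "prob {\<omega>\<in>space M. S \<omega> t \<le> 0} = 0" using measure_nonneg[of M] by (meson antisym)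
  moreover have "{\<omega>\<in>space M. S \<omega> t \<le> 0} \<in> sets M" using measurable_S[of t] by measurable
  ultimately have "AE \<omega> in M. \<not> S \<omega> t \<le> 0" by (subst (asm) prob_Collect_eq_0) (auto simp: pred_def)
  then show ?thesis by eventually_elim simp
qed

lemma AE_increment_pos:
  assumes "0 \<le> u" "u < t" shows "AE \<omega> in M. S \<omega> u < S \<omega> t"
proof -
  have m: "(\<lambda>\<omega>. S \<omega> t - S \<omega> u) \<in> borel_measurable M" by (intro borel_measurable_diff measurable_S)
  have "AE x in distr M borel (\<lambda>\<omega>. S \<omega> (t - u)). 0 < x"
    using AE_S_pos[of "t - u"] assms by (subst AE_distr_iff[OF measurable_S]) auto
  then have "AE x in distr M borel (\<lambda>\<omega>. S \<omega> t - S \<omega> u). 0 < x"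
    using S_stationary[of "t - u" u] assms by (simp only: add_diff_inverse diff_add_cancel add_diff_cancel_left' add.commute[of u] le_diff_eq)
  then have "AE \<omega> in M. 0 < S \<omega> t - S \<omega> u" by (subst (asm) AE_distr_iff[OF m]) auto
  then show ?thesis by eventually_elim simp
qed

text \<open>For one \<open>lam\<close> with positive exponent the lower tail at a fixed level decays
  exponentially in time.\<close>

lemma AE_unbounded: "AE \<omega> in M. \<exists>n. real m < S \<omega> (real n)"
proof -
  obtain lam where lam: "0 < lam" "0 < \<Psi> lam"
    using eventually_conj[OF filterlim_at_top_dense[THEN iffD1, rule_format, OF \<Psi>_top, of 0] eventually_gt_at_top[of 0]]
    by (auto dest: eventually_happens)
  let ?B = "{\<omega>\<in>space M. \<forall>n. S \<omega> (real n) \<le> real m}"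
  have B: "?B \<in> sets M" using measurable_S by measurable
  have "prob ?B \<le> 0"
  proof (rule tendsto_lowerbound)
    have "prob ?B \<le> exp (lam * real m - real n * \<Psi> lam)" for n
    proof -
      have "{\<omega>\<in>space M. S \<omega> (real n) \<le> real m} \<in> sets M" using measurable_S[of "real n"] by measurable
      then have "prob ?B \<le> prob {\<omega>\<in>space M. S \<omega> (real n) \<le> real m}" by (intro finite_measure_mono) auto
      also have "\<dots> \<le> exp (lam * real m - real n * \<Psi> lam)" by (rule S_lower_tail) (use lam in auto)
      finally show ?thesis .
    qed
    then show "\<forall>\<^sub>F n in sequentially. prob ?B \<le> exp (lam * real m - real n * \<Psi> lam)" by simp
    show "(\<lambda>n. exp (lam * real m - real n * \<Psi> lam)) \<longlonglongrightarrow> 0" using lam by real_asymp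
  qed simp
  then have "prob ?B = 0" using measure_nonneg[of M] by (meson antisym)
  then have "AE \<omega> in M. \<not> (\<forall>n. S \<omega> (real n) \<le> real m)" using B by (subst (asm) prob_Collect_eq_0) (auto simp: pred_def)
  then show ?thesis by eventually_elim (auto simp: not_le)
qed

lemma AE_increasing_path: "AE \<omega> in M. increasing_path (S \<omega>)"
proof -
  have "AE \<omega> in M. \<forall>m. \<exists>n. real m < S \<omega> (real n)" using AE_unbounded by (simp add: AE_all_countable)
  moreover have "AE \<omega> in M. \<forall>i j. dyad i < dyad j \<longrightarrow> S \<omega> (dyad i) < S \<omega> (dyad j)"
    unfolding AE_all_countable using AE_increment_pos[OF dyad_nonneg] by (auto simp: AE_impI)
  moreover have "AE \<omega> in M. \<omega> \<in> space M" by simp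
  ultimately show ?thesis
    by eventually_elim (intro increasing_path_dyad S_cadlag S_0; blast)
qed

lemma laplace_increments:
  assumes c: "\<And>b. 0 \<le> c b"
  shows "(\<integral>\<omega>. exp (- (\<Sum>b<B. c b * (S \<omega> (real (Suc b) / 2 ^ N) - S \<omega> (real b / 2 ^ N)))) \<partial>M) =
    exp (- ((\<Sum>b<B. \<Psi> (c b)) / 2 ^ N))"
proof -
  let ?D = "\<lambda>b \<omega>. S \<omega> (real (Suc b) / 2 ^ N) - S \<omega> (real b / 2 ^ N)"
  have mD: "?D b \<in> borel_measurable M" for b by (intro borel_measurable_diff measurable_S)
  have DAE: "AE \<omega> in M. 0 \<le> ?D b \<omega>" for b
    using AE_increment_pos[of "real b / 2 ^ N" "real (Suc b) / 2 ^ N"] by (auto simp: divide_strict_right_mono elim!: eventually_mono)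
  have mE: "(\<lambda>\<omega>. exp (- (c b * ?D b \<omega>))) \<in> borel_measurable M" for b
    by (intro measurable_compose[OF _ borel_measurable_exp] borel_measurable_uminus borel_measurable_times borel_measurable_const mD)
  have "indep_vars (\<lambda>_. borel) ?D {..<B}"
    by (rule S_indep[of "\<lambda>b. real b / 2 ^ N" B]) (auto intro: divide_right_mono)
  then have ind: "indep_vars (\<lambda>_. borel) (\<lambda>b \<omega>. exp (- (c b * ?D b \<omega>))) {..<B}"
    by (rule indep_vars_compose2[where Y = "\<lambda>b x. exp (- (c b * x))"]) simp
  have int: "integrable M (\<lambda>\<omega>. exp (- (c b * ?D b \<omega>)))" for b
  proof (rule integrable_const_bound[of _ 1])
    show "AE \<omega> in M. norm (exp (- (c b * ?D b \<omega>))) \<le> 1" using DAE[of b] by eventually_elim (use c in simp)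
  qed (rule mE)
  have one: "(\<integral>\<omega>. exp (- (c b * ?D b \<omega>)) \<partial>M) = exp (- (\<Psi> (c b) / 2 ^ N))" for b
  proof (cases "c b = 0")
    case False
    then have cb: "0 < c b" using c[of b] by simp
    have st: "distr M borel (?D b) = distr M borel (\<lambda>\<omega>. S \<omega> (1 / 2 ^ N))"
      using S_stationary[of "1 / 2 ^ N" "real b / 2 ^ N"] by (simp add: add_divide_distrib add.commute)
    have "(\<integral>\<omega>. exp (- (c b * ?D b \<omega>)) \<partial>M) = (\<integral>x. exp (- (c b * x)) \<partial>distr M borel (?D b))"
      by (rule integral_distr[OF mD, symmetric]) measurable
    also have "\<dots> = (\<integral>\<omega>. exp (- (c b * S \<omega> (1 / 2 ^ N))) \<partial>M)"
      unfolding st by (rule integral_distr[OF measurable_S]) measurable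
    also have "\<dots> = exp (- (\<Psi> (c b) / 2 ^ N))"
    proof (rule integral_eq_nn_integral[THEN trans])
      show "(\<lambda>\<omega>. exp (- (c b * S \<omega> (1 / 2 ^ N)))) \<in> borel_measurable M"
        by (intro measurable_compose[OF _ borel_measurable_exp] borel_measurable_uminus borel_measurable_times borel_measurable_const measurable_S)
      show "enn2real (\<integral>\<^sup>+\<omega>. ennreal (exp (- (c b * S \<omega> (1 / 2 ^ N)))) \<partial>M) = exp (- (\<Psi> (c b) / 2 ^ N))"
        using S_laplace[of "1 / 2 ^ N" "c b"] cb by simp
    qed simp
    finally show ?thesis .
  qed (simp add: \<Psi>_zero prob_space)
  have "(\<integral>\<omega>. exp (- (\<Sum>b<B. c b * ?D b \<omega>)) \<partial>M) = (\<integral>\<omega>. (\<Prod>b<B. exp (- (c b * ?D b \<omega>))) \<partial>M)"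
    by (simp add: exp_sum sum_negf[symmetric])
  also have "\<dots> = (\<Prod>b<B. \<integral>\<omega>. exp (- (c b * ?D b \<omega>)) \<partial>M)"
    by (rule indep_vars_lebesgue_integral[OF _ ind int]) simp
  also have "\<dots> = exp (- ((\<Sum>b<B. \<Psi> (c b)) / 2 ^ N))"
    unfolding one by (simp add: exp_sum[symmetric] sum_negf sum_divide_distrib)
  finally show ?thesis .
qed

text \<open>The exponent is written in the same form as the limit of the moments of the clock code,
  so the two can be matched directly.\<close>

lemma exp_moments:
  "(\<integral>\<omega>. (\<Prod>i<N. exp (- S \<omega> (dyad i)) ^ e i) \<partial>M) = exp (- joint_exponent \<Psi> {..<N} e N)"
proof -
  let ?D = "\<lambda>b \<omega>. S \<omega> (real (Suc b) / 2 ^ N) - S \<omega> (real b / 2 ^ N)"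
  have "(\<integral>\<omega>. (\<Prod>i<N. exp (- S \<omega> (dyad i)) ^ e i) \<partial>M) =
    (\<integral>\<omega>. exp (- (\<Sum>b<(\<Sum>i<N. tick N i). grid_weight {..<N} e N b * ?D b \<omega>)) \<partial>M)"
  proof (rule Bochner_Integration.integral_cong[OF refl])
    fix \<omega> assume \<omega>: "\<omega> \<in> space M"
    have "S \<omega> (dyad i) = (\<Sum>b<tick N i. ?D b \<omega>)" if "i < N" for i
      using sum_lessThan_telescope[of "\<lambda>b. S \<omega> (real b / 2 ^ N)" "tick N i"] lev_le[of i] that
      by (simp add: dyad_tick[of i N] S_0[OF \<omega>])
    then have "(\<Prod>i<N. exp (- S \<omega> (dyad i)) ^ e i) = exp (- (\<Sum>i<N. real (e i) * (\<Sum>b<tick N i. ?D b \<omega>)))"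
      by (simp add: exp_of_nat_mult[symmetric] exp_sum[symmetric] sum_negf)
    then show "(\<Prod>i<N. exp (- S \<omega> (dyad i)) ^ e i) =
        exp (- (\<Sum>b<(\<Sum>i<N. tick N i). grid_weight {..<N} e N b * ?D b \<omega>))"
      by (simp add: sum_partial_sums)
  qed
  then show ?thesis
    unfolding joint_exponent_def laplace_increments[OF grid_weight_nonneg] .
qed

end

section \<open>Convergence in distribution\<close>

lemma walk_nearest_neighbour:
  assumes "\<And>i. \<bar>\<xi> i\<bar> \<le> 1"
  shows "\<bar>walk \<xi> i - walk \<xi> j\<bar> \<le> \<bar>int i - int j\<bar>"
proof -
  have *: "\<bar>walk \<xi> (m + d) - walk \<xi> m\<bar> \<le> int d" for m d
  proof (induction d)
    case (Suc d) then show ?case using assms[of "m + d"] by (simp add: walk_def)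
  qed simp
  show ?thesis
  proof (cases "i \<le> j")
    case True then show ?thesis using *[of i "j - i"] by simp
  next
    case False then show ?thesis using *[of j "i - j"] by simp
  qed
qed

lemma (in biased_walk) AE_nearest_neighbour: "AE \<xi> in W. \<forall>i j. \<bar>walk \<xi> i - walk \<xi> j\<bar> \<le> \<bar>int i - int j\<bar>"
proof -
  have "AE \<xi> in W. \<bar>\<xi> i\<bar> \<le> 1" for i
    unfolding walk_law_def
    by (rule AE_PiM_component) (auto simp: prob_space_measure_pmf AE_measure_pmf_iff step_pmf_def)
  then have "AE \<xi> in W. \<forall>i. \<bar>\<xi> i\<bar> \<le> 1" by (simp add: AE_all_countable)
  then show ?thesis by eventually_elim (intro allI walk_nearest_neighbour; blast)
qed

text \<open>By right continuity a passage above \<open>t\<close> before \<open>x\<close> happens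
  already at a dyadic time, a countable condition. Paths that never pass contribute the constant
  \<open>Inf {}\<close>.\<close>

lemma measurable_cont_inv:
  assumes m: "\<And>t. (\<lambda>\<omega>. S \<omega> t) \<in> borel_measurable M" and c: "\<And>\<omega>. \<omega> \<in> space M \<Longrightarrow> cadlag (S \<omega>)"
  shows "(\<lambda>\<omega>. cont_inv (S \<omega>) t) \<in> borel_measurable M"
proof (rule borel_measurable_iff_less[THEN iffD2], intro allI)
  fix x
  have ex: "\<exists>i. dyad i < y \<and> t < S \<omega> (dyad i)" if "\<omega> \<in> space M" "0 \<le> u" "u < y" "t < S \<omega> u" for \<omega> u y
  proof -
    have "\<forall>\<^sub>F n in sequentially. t < S \<omega> (dyad (dyad_above n u))"
      using cadlag_dyad_tendsto[OF c[OF that(1)] that(2)] that(4) by (rule order_tendstoD(1))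
    moreover have "\<forall>\<^sub>F n in sequentially. dyad (dyad_above n u) < y"
      using dyad_above_tendsto[OF that(2)] that(3) by (rule order_tendstoD(2))
    ultimately have "\<forall>\<^sub>F n in sequentially. \<exists>i. dyad i < y \<and> t < S \<omega> (dyad i)" by eventually_elim blast
    then show ?thesis by (simp add: eventually_const)
  qed
  have ne: "{s. 0 \<le> s \<and> t < S \<omega> s} = {} \<longleftrightarrow> \<not> (\<exists>i. t < S \<omega> (dyad i))" if "\<omega> \<in> space M" for \<omega>
  proof
    assume "{s. 0 \<le> s \<and> t < S \<omega> s} = {}"
    then show "\<not> (\<exists>i. t < S \<omega> (dyad i))" using dyad_nonneg by blast
  next
    assume n: "\<not> (\<exists>i. t < S \<omega> (dyad i))"
    have False if "0 \<le> u" "t < S \<omega> u" for u using ex[OF \<open>\<omega> \<in> space M\<close> that(1) _ that(2), of "u + 1"] n by auto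
    then show "{s. 0 \<le> s \<and> t < S \<omega> s} = {}" by blast
  qed
  have lt: "cont_inv (S \<omega>) t < x \<longleftrightarrow> (\<exists>i. dyad i < x \<and> t < S \<omega> (dyad i))"
    if "\<omega> \<in> space M" "\<exists>i. t < S \<omega> (dyad i)" for \<omega>
  proof -
    have "cont_inv (S \<omega>) t < x \<longleftrightarrow> (\<exists>s\<in>{s. 0 \<le> s \<and> t < S \<omega> s}. s < x)"
      unfolding cont_inv_def by (rule cInf_less_iff) (use ne[OF that(1)] that(2) in \<open>auto intro!: bdd_belowI[of _ 0]\<close>)
    also have "\<dots> \<longleftrightarrow> (\<exists>i. dyad i < x \<and> t < S \<omega> (dyad i))"
    proof
      assume "\<exists>s\<in>{s. 0 \<le> s \<and> t < S \<omega> s}. s < x"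
      then obtain s where "0 \<le> s" "t < S \<omega> s" "s < x" by blast
      then show "\<exists>i. dyad i < x \<and> t < S \<omega> (dyad i)" by (intro ex[OF that(1)])
    next
      assume "\<exists>i. dyad i < x \<and> t < S \<omega> (dyad i)"
      then obtain i where "dyad i < x" "t < S \<omega> (dyad i)" by blast
      then show "\<exists>s\<in>{s. 0 \<le> s \<and> t < S \<omega> s}. s < x" by (intro bexI[of _ "dyad i"]) (auto simp: dyad_nonneg)
    qed
    finally show ?thesis .
  qed
  have "{\<omega> \<in> space M. cont_inv (S \<omega>) t < x} = {\<omega> \<in> space M. (\<exists>i. t < S \<omega> (dyad i)) \<and> (\<exists>i. dyad i < x \<and> t < S \<omega> (dyad i)) \<or>
      \<not> (\<exists>i. t < S \<omega> (dyad i)) \<and> Inf {} < x}"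
  proof (intro Collect_cong conj_cong refl)
    fix \<omega> assume "\<omega> \<in> space M"
    then show "cont_inv (S \<omega>) t < x \<longleftrightarrow> (\<exists>i. t < S \<omega> (dyad i)) \<and> (\<exists>i. dyad i < x \<and> t < S \<omega> (dyad i)) \<or>
      \<not> (\<exists>i. t < S \<omega> (dyad i)) \<and> Inf {} < x"
    proof (cases "\<exists>i. t < S \<omega> (dyad i)")
      case False
      then have "cont_inv (S \<omega>) t = Inf {}" unfolding cont_inv_def by (intro arg_cong[where f = Inf] iffD2[OF ne[OF \<open>\<omega> \<in> space M\<close>]])
      with False show ?thesis by auto
    qed (use lt in auto)
  qed
  also have "\<dots> \<in> sets M" using m by measurable
  finally show "{\<omega> \<in> space M. cont_inv (S \<omega>) t < x} \<in> sets M" .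
qed

lemma measurable_path_space:
  assumes "\<And>t. (\<lambda>\<omega>. fst (Z \<omega>) t) \<in> borel_measurable M" "\<And>t. (\<lambda>\<omega>. snd (Z \<omega>) t) \<in> borel_measurable M"
  shows "Z \<in> measurable M path_space"
  unfolding path_space_def
proof (rule measurable_pair)
  have "(\<lambda>\<omega> t. fst (Z \<omega>) t) \<in> measurable M (PiM UNIV (\<lambda>_. borel))"
    by (rule measurable_PiM_single') (use assms in auto)
  then show "fst \<circ> Z \<in> measurable M (PiM UNIV (\<lambda>_. borel))" by (simp add: comp_def)
  have "(\<lambda>\<omega> t. snd (Z \<omega>) t) \<in> measurable M (PiM UNIV (\<lambda>_. borel))"
    by (rule measurable_PiM_single') (use assms in auto)
  then show "snd \<circ> Z \<in> measurable M (PiM UNIV (\<lambda>_. borel))" by (simp add: comp_def)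
qed

context rtrw_env
begin

lemma measurable_rescaled: "rescaled m b \<in> measurable (annealed \<beta> \<pi>) path_space"
proof (rule measurable_path_space)
  fix t
  show "(\<lambda>\<omega>. fst (rescaled m b \<omega>) t) \<in> borel_measurable (annealed \<beta> \<pi>)"
    unfolding rescaled_def clock_t_def fst_conv
    by (intro borel_measurable_divide measurable_clock borel_measurable_const)
  have inv: "(\<lambda>\<omega>. clock_inv (fst \<omega>) (snd \<omega>) (b * t)) \<in> measurable (annealed \<beta> \<pi>) (count_space UNIV)"
    unfolding clock_inv_def
  proof (rule measurable_Sup_nat)
    fix i
    have "{\<omega> \<in> space (annealed \<beta> \<pi>). clock (fst \<omega>) (snd \<omega>) i \<le> b * t} \<in> sets (annealed \<beta> \<pi>)"
      by (rule borel_measurable_le[OF measurable_clock borel_measurable_const])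
    then show "Measurable.pred (annealed \<beta> \<pi>) (\<lambda>\<omega>. i \<in> {k. clock (fst \<omega>) (snd \<omega>) k \<le> b * t})"
      by (simp add: pred_def)
  qed
  have "(\<lambda>\<omega>. real_of_int (walk (snd \<omega>) (clock_inv (fst \<omega>) (snd \<omega>) (b * t)))) \<in> borel_measurable (annealed \<beta> \<pi>)"
    by (rule measurable_compose_countable[OF measurable_ann_W[OF measurable_real_walk] inv])
  then show "(\<lambda>\<omega>. snd (rescaled m b \<omega>) t) \<in> borel_measurable (annealed \<beta> \<pi>)"
    unfolding rescaled_def rtrw_def snd_conv by (intro borel_measurable_divide borel_measurable_const)
qed

text \<open>The first holding time realizes the annealed single-visit transform as that of an almost
  surely positive variable, which makes the transform at 1 strictly less than 1.\<close>

lemma lapm_first: 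
  assumes s: "0 \<le> s"
  shows "lapm s 1 = (\<integral>\<omega>. exp (- (s * visit_time (fst \<omega>) (snd \<omega>) 0)) \<partial>annealed \<beta> \<pi>)"
proof -
  have V: "{m. m = 0 \<and> walk \<xi> m = 0} = {0}" for \<xi> by auto
  have "(\<integral>\<^sup>+\<omega>. ennreal (exp (- (s * visit_time (fst \<omega>) (snd \<omega>) 0))) \<partial>annealed \<beta> \<pi>) = ennreal (\<integral>\<xi>. site_prod (\<lambda>_. s) 1 \<xi> \<partial>W)"
    using annealed_laplace[of "\<lambda>_. s" 1] s by simp
  also have "(\<integral>\<xi>. site_prod (\<lambda>_. s) 1 \<xi> \<partial>W) = lapm s 1"
    by (simp add: site_prod_def lapm_mom V lessThan_Suc)
  finally have *: "(\<integral>\<^sup>+\<omega>. ennreal (exp (- (s * visit_time (fst \<omega>) (snd \<omega>) 0))) \<partial>annealed \<beta> \<pi>) = ennreal (lapm s 1)" .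
  show ?thesis
  proof (rule integral_eq_nn_integral[THEN trans, symmetric])
    show "(\<lambda>\<omega>. exp (- (s * visit_time (fst \<omega>) (snd \<omega>) 0))) \<in> borel_measurable (annealed \<beta> \<pi>)"
      by (intro measurable_compose[OF _ borel_measurable_exp] borel_measurable_uminus borel_measurable_times borel_measurable_const measurable_visit_time)
  qed (use lapm_bounds(1)[OF s, of 1] in \<open>simp_all add: *\<close>)
qed

lemma integrable_lapm_first: 
  assumes "0 \<le> s" shows "integrable (annealed \<beta> \<pi>) (\<lambda>\<omega>. exp (- (s * visit_time (fst \<omega>) (snd \<omega>) 0)))"
proof (rule ann.integrable_const_bound[of _ 1])
  show "AE \<omega> in annealed \<beta> \<pi>. norm (exp (- (s * visit_time (fst \<omega>) (snd \<omega>) 0))) \<le> 1"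
    using annealed_clock_pos by eventually_elim (use assms in \<open>auto intro: mult_nonneg_nonneg less_imp_le\<close>)
qed (intro measurable_compose[OF _ borel_measurable_exp] borel_measurable_uminus borel_measurable_times borel_measurable_const measurable_visit_time)

lemma lapm_antimono:
  assumes "0 \<le> s" "s \<le> t" shows "lapm t l \<le> lapm s l"
  unfolding lapm_def
proof (rule integral_mono_AE)
  show "AE \<mu> in \<pi>. lap \<mu> t ^ l \<le> lap \<mu> s ^ l"
    using AE_pos_law by eventually_elim (use assms in \<open>auto intro!: power_mono lap_mono lap_bounds\<close>)
qed (use mom_integrable[of "\<lambda>_. s" "{..<l}"] mom_integrable[of "\<lambda>_. t" "{..<l}"] assms in auto)

lemma lapm_first_less_1: "lapm 1 1 < 1"
proof (rule ccontr)
  let ?v = "\<lambda>\<omega>. visit_time (fst \<omega>) (snd \<omega>) 0"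
  assume "\<not> lapm 1 1 < 1"
  then have "lapm 1 1 = 1" using lapm_bounds(2)[of 1 1] by simp
  then have "(\<integral>\<omega>. 1 - exp (- (1 * ?v \<omega>)) \<partial>annealed \<beta> \<pi>) = 0"
    using integrable_lapm_first[of 1] lapm_first[of 1] by (subst Bochner_Integration.integral_diff) (auto simp: ann.prob_space)
  moreover have "AE \<omega> in annealed \<beta> \<pi>. 0 \<le> 1 - exp (- (1 * ?v \<omega>))"
    using annealed_clock_pos by eventually_elim (auto intro: less_imp_le)
  moreover have "integrable (annealed \<beta> \<pi>) (\<lambda>\<omega>. 1 - exp (- (1 * ?v \<omega>)))"
    by (intro Bochner_Integration.integrable_diff integrable_lapm_first) auto
  ultimately have "AE \<omega> in annealed \<beta> \<pi>. 1 - exp (- (1 * ?v \<omega>)) = 0"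
    using integral_nonneg_eq_0_iff_AE by blast
  then have "AE \<omega> in annealed \<beta> \<pi>. False"
    using annealed_clock_pos by eventually_elim (metis diff_eq_eq add_0 exp_eq_one_iff mult_1 neg_equal_0_iff_equal less_irrefl)
  then show False by simp
qed

end

locale rtrw_stable_limit = rtrw_limit \<beta> \<pi> n a f for \<beta> \<pi> n a f +
  fixes \<alpha> c1 C1 :: real
  assumes \<alpha>: "0 < \<alpha>" and c1: "0 < c1"
    and f1: "\<And>lam. 0 < lam \<Longrightarrow> c1 * lam powr \<alpha> \<le> f 1 lam" "\<And>lam. 0 < lam \<Longrightarrow> f 1 lam \<le> C1 * lam powr \<alpha>"
begin

lemma Psi_lower: assumes "0 < c" shows "\<upsilon>\<^sup>2 * (c1 * c powr \<alpha>) \<le> Psi c"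
proof -
  have "\<upsilon>\<^sup>2 * (c1 * c powr \<alpha>) \<le> \<upsilon>\<^sup>2 * F 1 c"
    using f1(1)[OF assms] assms by (intro mult_left_mono) (auto simp: F_def)
  also have "\<dots> \<le> Psi c" by (rule Psi_ge_F) (use assms in simp)
  finally show ?thesis .
qed

lemma Psi_pos: "0 < c \<Longrightarrow> 0 < Psi c"
  using Psi_lower[of c] c1 \<upsilon>_bounds by (intro less_le_trans[OF _ Psi_lower]) auto

lemma Psi_top: "filterlim Psi at_top at_top"
proof (rule filterlim_at_top_mono)
  have "0 < \<upsilon>\<^sup>2 * c1" using c1 \<upsilon>_bounds by simp
  then show "filterlim (\<lambda>c. \<upsilon>\<^sup>2 * c1 * c powr \<alpha>) at_top at_top"
    using \<alpha> by real_asymp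
  show "\<forall>\<^sub>F c in at_top. \<upsilon>\<^sup>2 * c1 * c powr \<alpha> \<le> Psi c"
    using eventually_gt_at_top[of 0] by eventually_elim (use Psi_lower in \<open>simp add: mult.assoc\<close>)
qed

text \<open>If \<open>a k < 1\<close>, monotonicity bounds the transform at \<open>1 / a k\<close>
  by its value below 1 at argument 1, and \<open>n k\<close> times minus its logarithm would exceed
  the limit \<open>f 1 1\<close> for large \<open>k\<close>.\<close>

lemma eventually_a_ge_1: "\<forall>\<^sub>F k in sequentially. 1 \<le> a k"
proof -
  let ?q = "lapm 1 1"
  have q: "0 < ?q" "?q < 1" using lapm_pos[of 1 1] lapm_first_less_1 by auto
  have "filterlim (\<lambda>k. real (n k) * - ln ?q) at_top sequentially"
    using q by (intro filterlim_at_top_mult_tendsto_pos[OF tendsto_const]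
      filterlim_compose[OF filterlim_real_sequentially n_top]) simp
  then have "\<forall>\<^sub>F k in sequentially. f 1 1 + 1 \<le> real (n k) * - ln ?q" by (simp add: filterlim_at_top)
  moreover have "\<forall>\<^sub>F k in sequentially. - real (n k) * ln (laplace_moment \<pi> (a k) 1 1) < f 1 1 + 1"
    by (rule order_tendstoD(2)[OF f_lim]) auto
  ultimately show ?thesis
  proof eventually_elim
    case (elim k)
    show ?case
    proof (rule ccontr)
      assume "\<not> 1 \<le> a k"
      then have "1 \<le> 1 / a k" using a_pos[of k] by simp
      then have le: "laplace_moment \<pi> (a k) 1 1 \<le> ?q" and pos: "0 < laplace_moment \<pi> (a k) 1 1"
        using lapm_antimono[of 1 "1 / a k" 1] lapm_pos[of "1 / a k" 1] a_pos[of k]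
        by (auto simp: laplace_moment_eq lapm_def)
      have "ln (laplace_moment \<pi> (a k) 1 1) \<le> ln ?q" using le pos q by simp
      then have "real (n k) * - ln ?q \<le> - real (n k) * ln (laplace_moment \<pi> (a k) 1 1)"
        by (simp add: mult_left_mono)
      then show False using elim by linarith
    qed
  qed
qed

lemma clock_mono:
  assumes "\<forall>m. 0 < visit_time \<eta> \<xi> m" shows "mono (clock \<eta> \<xi>)"
  unfolding clock_visit_time by (intro monoI sum_mono2) (use assms in \<open>auto intro: less_imp_le\<close>)

lemma clock_0: "clock \<eta> \<xi> 0 = 0"
  by (simp add: clock_def)

text \<open>A clock bounded by \<open>m\<close> with probability p would keep the transform of the
  rescaled clock at time \<open>B\<close> above \<open>p * exp (- m)\<close> for every
  \<open>B\<close>, as scaling by \<open>a k \<ge> 1\<close> only shrinks it; yet the limit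
  \<open>exp (- (B * Psi 1))\<close> tends to 0 in \<open>B\<close>.\<close>

lemma AE_clock_unbounded: "AE \<omega> in annealed \<beta> \<pi>. \<forall>M. \<exists>j. M < clock (fst \<omega>) (snd \<omega>) j"
proof -
  have "AE \<omega> in annealed \<beta> \<pi>. \<exists>j. real m < clock (fst \<omega>) (snd \<omega>) j" for m
  proof -
    let ?Bm = "{\<omega> \<in> space (annealed \<beta> \<pi>). \<forall>j. clock (fst \<omega>) (snd \<omega>) j \<le> real m}"
    have B: "?Bm \<in> sets (annealed \<beta> \<pi>)" using measurable_clock by measurable
    have ub: "ann.prob ?Bm * exp (- real m) \<le> exp (- (real B * Psi 1))" for B
    proof -
      let ?I = "\<lambda>k \<omega>. exp (- (\<Sum>b<B. 1 * ((clock (fst \<omega>) (snd \<omega>) (grid (n k) 1 (Suc b)) -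
          clock (fst \<omega>) (snd \<omega>) (grid (n k) 1 b)) / a k)))"
      have I: "?I k \<omega> = exp (- (clock (fst \<omega>) (snd \<omega>) (grid (n k) 1 B) / a k))" for k \<omega>
        using sum_lessThan_telescope[of "\<lambda>b. clock (fst \<omega>) (snd \<omega>) (grid (n k) 1 b)" B]
        by (simp add: sum_divide_distrib[symmetric] grid_0 clock_0)
      have lim: "(\<lambda>k. \<integral>\<omega>. ?I k \<omega> \<partial>annealed \<beta> \<pi>) \<longlonglongrightarrow> exp (- (real B * Psi 1))"
        using clock_laplace_tendsto[of 1 "\<lambda>_. 1" 1 B] by simp
      have "ann.prob ?Bm * exp (- real m) \<le> (\<integral>\<omega>. ?I k \<omega> \<partial>annealed \<beta> \<pi>)" if ak: "1 \<le> a k" for k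
      proof -
        have "ann.prob ?Bm * exp (- real m) = (\<integral>\<omega>. indicator ?Bm \<omega> * exp (- real m) \<partial>annealed \<beta> \<pi>)"
          using B by simp
        also have "\<dots> \<le> (\<integral>\<omega>. ?I k \<omega> \<partial>annealed \<beta> \<pi>)"
          unfolding I
        proof (rule integral_mono_AE)
          show "integrable (annealed \<beta> \<pi>) (\<lambda>\<omega>. indicator ?Bm \<omega> * exp (- real m))"
            using B by (intro integrable_mult_left integrable_real_indicator) (simp_all add: ann.emeasure_eq_measure)
          show "integrable (annealed \<beta> \<pi>) (\<lambda>\<omega>. exp (- (clock (fst \<omega>) (snd \<omega>) (grid (n k) 1 B) / a k)))"
          proof (rule ann.integrable_const_bound[of _ 1])
            show "AE \<omega> in annealed \<beta> \<pi>. norm (exp (- (clock (fst \<omega>) (snd \<omega>) (grid (n k) 1 B) / a k))) \<le> 1"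
              using annealed_clock_pos
            proof eventually_elim
              case (elim \<omega>)
              then show ?case
                using monoD[OF clock_mono[OF elim], of 0 "grid (n k) 1 B"] a_pos[of k] by (simp add: clock_0)
            qed
          qed (intro measurable_compose[OF _ borel_measurable_exp] borel_measurable_uminus borel_measurable_divide borel_measurable_const measurable_clock)
          show "AE \<omega> in annealed \<beta> \<pi>. indicator ?Bm \<omega> * exp (- real m) \<le> exp (- (clock (fst \<omega>) (snd \<omega>) (grid (n k) 1 B) / a k))"
          proof (rule AE_I2)
            fix \<omega>
            have "clock (fst \<omega>) (snd \<omega>) (grid (n k) 1 B) / a k \<le> real m" if "\<omega> \<in> ?Bm"
            proof -
              have "clock (fst \<omega>) (snd \<omega>) (grid (n k) 1 B) \<le> real m * 1" using that by simp
              also have "\<dots> \<le> real m * a k" using ak by (intro mult_left_mono) auto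
              finally show ?thesis using ak by (simp add: divide_le_eq)
            qed
            then show "indicator ?Bm \<omega> * exp (- real m) \<le> exp (- (clock (fst \<omega>) (snd \<omega>) (grid (n k) 1 B) / a k))"
              by (auto simp: indicator_def)
          qed
        qed
        finally show ?thesis .
      qed
      then have "\<forall>\<^sub>F k in sequentially. ann.prob ?Bm * exp (- real m) \<le> (\<integral>\<omega>. ?I k \<omega> \<partial>annealed \<beta> \<pi>)"
        using eventually_a_ge_1 by (auto elim: eventually_mono)
      then show ?thesis by (intro tendsto_lowerbound[OF lim]) auto
    qed
    have "(\<lambda>B. exp (- (real B * p))) \<longlonglongrightarrow> 0" if "0 < p" for p using that by real_asymp
    from this[OF Psi_pos[OF zero_less_one]] have "(\<lambda>B. exp (- (real B * Psi 1))) \<longlonglongrightarrow> 0" .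
    then have "ann.prob ?Bm * exp (- real m) \<le> 0" by (rule tendsto_lowerbound) (use ub in auto)
    then have "ann.prob ?Bm = 0" using measure_nonneg[of "annealed \<beta> \<pi>" ?Bm] by (simp add: mult_le_0_iff)
    then have "AE \<omega> in annealed \<beta> \<pi>. \<not> (\<forall>j. clock (fst \<omega>) (snd \<omega>) j \<le> real m)"
      using B by (subst (asm) ann.prob_Collect_eq_0) (auto simp: pred_def)
    then show ?thesis by eventually_elim (auto simp: not_le)
  qed
  then have "AE \<omega> in annealed \<beta> \<pi>. \<forall>m. \<exists>j. real m < clock (fst \<omega>) (snd \<omega>) j" by (simp add: AE_all_countable)
  then show ?thesis by eventually_elim (meson reals_Archimedean2 less_trans)
qed

lemma distr_annealed_snd: "distr (annealed \<beta> \<pi>) W snd = W"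
proof (rule measure_eqI)
  fix A assume "A \<in> sets (distr (annealed \<beta> \<pi>) W snd)"
  then have A: "A \<in> sets W" by simp
  have "emeasure (distr (annealed \<beta> \<pi>) W snd) A = emeasure (hold_law \<pi> \<Otimes>\<^sub>M W) (space (hold_law \<pi>) \<times> A)"
    using A sets.sets_into_space[OF A] unfolding annealed_eq
    by (subst emeasure_distr[OF measurable_snd]) (auto simp: space_pair_measure intro!: arg_cong2[where f = emeasure])
  also have "\<dots> = emeasure W A"
    by (subst W.emeasure_pair_measure_Times) (use A hold.emeasure_space_1 in auto)
  finally show "emeasure (distr (annealed \<beta> \<pi>) W snd) A = emeasure W A" .
qed simp

definition "good_env \<omega> \<longleftrightarrow> unbounded_clock (clock (fst \<omega>) (snd \<omega>)) \<and>
  (\<forall>i j. \<bar>walk (snd \<omega>) i - walk (snd \<omega>) j\<bar> \<le> \<bar>int i - int j\<bar>)"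

lemma AE_good_env: "AE \<omega> in annealed \<beta> \<pi>. good_env \<omega>"
proof -
  have "AE \<xi> in distr (annealed \<beta> \<pi>) W snd. \<forall>i j. \<bar>walk \<xi> i - walk \<xi> j\<bar> \<le> \<bar>int i - int j\<bar>"
    unfolding distr_annealed_snd by (rule AE_nearest_neighbour)
  then have "AE \<omega> in annealed \<beta> \<pi>. \<forall>i j. \<bar>walk (snd \<omega>) i - walk (snd \<omega>) j\<bar> \<le> \<bar>int i - int j\<bar>"
    by (rule AE_distrD[OF measurable_ann_W[OF measurable_ident], unfolded id_def])
  with AE_clock_unbounded annealed_clock_pos show ?thesis
    by eventually_elim (simp add: good_env_def unbounded_clock.intro clock_0 clock_mono)
qed

text \<open>The exponential compresses the half-line into [0, 1], so that the values at all dyadic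
  times form a point of the cube.\<close>

definition "clock_code k \<omega> i = exp (- (clock (fst \<omega>) (snd \<omega>) (nat \<lfloor>real (n k) * dyad i\<rfloor>) / a k))"

lemma clock_code_moments:
  "(\<lambda>k. \<integral>\<omega>. (\<Prod>i<N. clock_code k \<omega> i ^ e i) \<partial>annealed \<beta> \<pi>) \<longlonglongrightarrow> exp (- joint_exponent Psi {..<N} e N)"
proof -
  let ?v = "\<lambda>k \<omega> b. (clock (fst \<omega>) (snd \<omega>) (grid (n k) (2 ^ N) (Suc b)) - clock (fst \<omega>) (snd \<omega>) (grid (n k) (2 ^ N) b)) / a k"
  have "(\<Prod>i<N. clock_code k \<omega> i ^ e i) = exp (- (\<Sum>b<(\<Sum>i<N. tick N i). grid_weight {..<N} e N b * ?v k \<omega> b))" for k \<omega>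
  proof -
    have "clock (fst \<omega>) (snd \<omega>) (nat \<lfloor>real (n k) * dyad i\<rfloor>) / a k = (\<Sum>b<tick N i. ?v k \<omega> b)" if "i < N" for i
    proof -
      have "nat \<lfloor>real (n k) * dyad i\<rfloor> = grid (n k) (2 ^ N) (tick N i)"
        using grid_eq_floor[of "2 ^ N" "n k" "tick N i"] lev_le[of i] that by (simp add: dyad_tick[of i N])
      then show ?thesis
        using sum_lessThan_telescope[of "\<lambda>b. clock (fst \<omega>) (snd \<omega>) (grid (n k) (2 ^ N) b)" "tick N i"]
        by (simp add: sum_divide_distrib[symmetric] grid_0 clock_0)
    qed
    then have "(\<Prod>i<N. clock_code k \<omega> i ^ e i) = exp (- (\<Sum>i<N. real (e i) * (\<Sum>b<tick N i. ?v k \<omega> b)))"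
      by (simp add: clock_code_def exp_of_nat_mult[symmetric] exp_sum[symmetric] sum_negf)
    then show ?thesis by (simp add: sum_partial_sums)
  qed
  moreover have "grid_weight {..<N} e N b \<le> (\<Sum>i<N. real (e i))" for b
    unfolding grid_weight_def by (intro sum_mono) auto
  ultimately show ?thesis
    using clock_laplace_tendsto[of "2 ^ N" "grid_weight {..<N} e N" "\<Sum>i<N. real (e i)" "\<Sum>i<N. tick N i"]
    by (simp add: grid_weight_nonneg joint_exponent_def)
qed

text \<open>The deterministic core: along any sequence of good samples, codes and walk errors alone
  force M1 convergence of the clock and uniform convergence of the walk at its inverse.\<close>

lemma rescaled_tendsto:
  assumes q: "\<And>j. j \<le> q j" and good: "\<And>j. good_env (w j)"
    and s: "increasing_path s" "cadlag s"
    and code: "\<And>i. (\<lambda>j. clock_code (q j) (w j) i) \<longlonglongrightarrow> exp (- s (dyad i))"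
    and err: "(\<lambda>j. walk_error (n (q j)) (snd (w j))) \<longlonglongrightarrow> 0"
    and h: "M1U_continuous h"
  shows "(\<lambda>j. h (rescaled (n (q j)) (a (q j)) (w j))) \<longlonglongrightarrow> h (s, \<lambda>t. \<upsilon> * cont_inv s t)"
proof -
  interpret s: increasing_path s by (rule s)
  let ?c = "\<lambda>j. clock (fst (w j)) (snd (w j))" and ?N = "\<lambda>j. n (q j)" and ?a = "\<lambda>j. a (q j)"
  have q_top: "filterlim q at_top sequentially"
    by (rule filterlim_at_top_mono[OF filterlim_ident]) (use q in auto)
  have N_top: "filterlim ?N at_top sequentially" by (rule filterlim_compose[OF n_top q_top])
  have c: "unbounded_clock (?c j)" for j using good[of j] by (simp add: good_env_def)
  have conv: "(\<lambda>j. ?c j (nat \<lfloor>real (?N j) * dyad i\<rfloor>) / ?a j) \<longlonglongrightarrow> s (dyad i)" for i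
    using tendsto_minus[OF tendsto_ln[OF code[of i]]] by (simp add: clock_code_def)
  have walk: "(\<lambda>j. real_of_int (walk (snd (w j)) (nat \<lfloor>real (?N j) * dyad i\<rfloor>)) / real (?N j)) \<longlonglongrightarrow> \<upsilon> * dyad i" for i
  proof -
    let ?d = "\<lambda>j. \<bar>real_of_int (walk (snd (w j)) (nat \<lfloor>real (?N j) * dyad i\<rfloor>)) / real (?N j) - \<upsilon> * dyad i\<bar>"
    \<comment> \<open>One term of the series bounds one dyadic time; once the truncation by 1 is
      eventually inactive, convergence of the truncated distance is convergence itself.\<close>
    have "(\<lambda>j. (1/2) ^ Suc i * min 1 (?d j)) \<longlonglongrightarrow> 0"
    proof (rule tendsto_sandwich[OF _ _ tendsto_const err])
      show "\<forall>\<^sub>F j in sequentially. (1/2) ^ Suc i * min 1 (?d j) \<le> walk_error (?N j) (snd (w j))"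
        unfolding walk_error_def by (intro always_eventually allI walk_error_terms(2))
    qed (auto intro!: always_eventually)
    from tendsto_mult_left[OF this, of "2 ^ Suc i"] have m: "(\<lambda>j. min 1 (?d j)) \<longlonglongrightarrow> 0"
      by (simp add: mult.assoc[symmetric] power_mult_distrib[symmetric] del: power_Suc)
    then have "\<forall>\<^sub>F j in sequentially. min 1 (?d j) < 1" by (rule order_tendstoD(2)) simp
    then have "\<forall>\<^sub>F j in sequentially. min 1 (?d j) = ?d j" by eventually_elim auto
    then have "?d \<longlonglongrightarrow> 0" using m by (simp cong: tendsto_cong)
    then show ?thesis by (simp add: tendsto_rabs_zero_iff LIM_zero_iff)
  qed
  have U: "U_conv (\<lambda>j t. real_of_int (walk (snd (w j)) (Sup {i. ?c j i \<le> ?a j * t})) / real (?N j)) (\<lambda>t. \<upsilon> * cont_inv s t)"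
    by (rule s.U_conv_inverse[OF conv c N_top a_pos walk]) (use good in \<open>simp add: good_env_def\<close>)
  have x0: "?c j (nat \<lfloor>real (?N j) * 0\<rfloor>) / ?a j = 0" for j by (simp add: clock_0)
  have cad1: "cadlag (\<lambda>t. ?c j (nat \<lfloor>real (?N j) * t\<rfloor>) / ?a j)" for j
  proof (rule cadlag_compose_nat[where F = "\<lambda>m. ?c j m / ?a j"])
    show "mono_on {0..} (\<lambda>t. nat \<lfloor>real (?N j) * t\<rfloor>)" by (rule nat_floor_mono) simp
    show "\<forall>\<^sub>F u in at_right t. nat \<lfloor>real (?N j) * u\<rfloor> = nat \<lfloor>real (?N j) * t\<rfloor>" for t
      using floor_right_const[of "real (?N j)" t] by (auto elim: eventually_mono)
  qed
  have mono1: "mono_on {0..} (\<lambda>t. ?c j (nat \<lfloor>real (?N j) * t\<rfloor>) / ?a j)" for j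
    using mono_onD[OF nat_floor_mono[of "real (?N j)"]] a_pos[of "q j"]
    by (intro mono_onI divide_right_mono monoD[OF unbounded_clock.c_mono[OF c]]) auto
  have M1: "M1_conv (\<lambda>j t. ?c j (nat \<lfloor>real (?N j) * t\<rfloor>) / ?a j) s"
    by (rule M1_conv_monotone[OF mono1 cad1 x0 s.s_mono s(2) s.s0 conv])
  have cad2: "cadlag (\<lambda>t. real_of_int (walk (snd (w j)) (Sup {i. ?c j i \<le> ?a j * t})) / real (?N j))" for j
    using unbounded_clock.cadlag_cinv[OF c[of j] a_pos[of "q j"], of "\<lambda>m. real_of_int (walk (snd (w j)) m) / real (?N j)"]
    by (simp add: unbounded_clock.cinv_def[OF c[of j]])
  have "(\<lambda>j. h ((\<lambda>t. ?c j (nat \<lfloor>real (?N j) * t\<rfloor>) / ?a j),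
      (\<lambda>t. real_of_int (walk (snd (w j)) (Sup {i. ?c j i \<le> ?a j * t})) / real (?N j))))
      \<longlonglongrightarrow> h (s, \<lambda>t. \<upsilon> * cont_inv s t)"
    by (intro h[unfolded M1U_continuous_def, rule_format] conjI allI M1 U cad1 cad2 s(2) s.cadlag_cont_inv)
  then show ?thesis by (simp add: rescaled_def clock_t_def rtrw_def clock_inv_def)
qed

theorem rescaled_conv_dist:
  assumes levy: "levy_laplace M Y Psi"
  shows "conv_dist_M1U (\<lambda>k. annealed \<beta> \<pi>) (\<lambda>k. rescaled (n k) (a k)) M (\<lambda>\<omega>. (Y \<omega>, \<lambda>t. \<upsilon> * cont_inv (Y \<omega>) t))"
  unfolding conv_dist_M1U_def
proof (intro allI impI, elim conjE)
  fix h :: "(real \<Rightarrow> real) \<times> (real \<Rightarrow> real) \<Rightarrow> real"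
  assume h: "h \<in> borel_measurable path_space" "bounded (range h)" "M1U_continuous h"
  interpret S: levy_subordinator M Y Psi by unfold_locales (use levy Psi_top in auto)
  obtain B where B: "\<And>x. \<bar>h x\<bar> \<le> B" using h(2) by (auto simp: bounded_iff)
  have mZ: "(\<lambda>\<omega>. (Y \<omega>, \<lambda>t. \<upsilon> * cont_inv (Y \<omega>) t)) \<in> measurable M path_space"
    by (rule measurable_path_space) (auto intro!: S.measurable_S borel_measurable_times measurable_cont_inv S.S_cadlag)
  show "(\<lambda>k. \<integral>\<omega>. h (rescaled (n k) (a k) \<omega>) \<partial>annealed \<beta> \<pi>) \<longlonglongrightarrow> (\<integral>\<omega>. h (Y \<omega>, \<lambda>t. \<upsilon> * cont_inv (Y \<omega>) t) \<partial>M)"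
  proof (rule asymptotic_continuous_mapping[where A = clock_code and ?A0.0 = "\<lambda>\<omega> i. exp (- Y \<omega> (dyad i))"
        and e = "\<lambda>k \<omega>. walk_error (n k) (snd \<omega>)" and good = "\<lambda>k. good_env"
        and ?good0.0 = "\<lambda>\<omega>. \<omega> \<in> space M \<and> increasing_path (Y \<omega>)" and B = B])
    show "cube_rv (annealed \<beta> \<pi>) (clock_code k)" for k
      unfolding cube_rv_def
    proof (intro conjI allI)
      show "(\<lambda>\<omega>. clock_code k \<omega> i) \<in> borel_measurable (annealed \<beta> \<pi>)" for i
        unfolding clock_code_def
        by (intro measurable_compose[OF _ borel_measurable_exp] borel_measurable_uminus borel_measurable_divide borel_measurable_const measurable_clock)
      show "AE \<omega> in annealed \<beta> \<pi>. clock_code k \<omega> \<in> cube"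
        using annealed_clock_pos
      proof eventually_elim
        case (elim \<omega>)
        then show ?case
          using monoD[OF clock_mono[OF elim], of 0] a_pos[of k] by (simp add: clock_0 cube_def clock_code_def)
      qed
    qed (rule ann.prob_space_axioms)
    show "cube_rv M (\<lambda>\<omega> i. exp (- Y \<omega> (dyad i)))"
      unfolding cube_rv_def
    proof (intro conjI allI)
      show "(\<lambda>\<omega>. exp (- Y \<omega> (dyad i))) \<in> borel_measurable M" for i
        by (intro measurable_compose[OF _ borel_measurable_exp] borel_measurable_uminus S.measurable_S)
      show "AE \<omega> in M. (\<lambda>i. exp (- Y \<omega> (dyad i))) \<in> cube"
        using S.AE_increasing_path
      proof eventually_elim
        case (elim \<omega>)
        then show ?case
          using mono_onD[OF increasing_path.s_mono[OF elim], of 0] increasing_path.s0[OF elim]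
          by (simp add: cube_def dyad_nonneg)
      qed
    qed (rule S.prob_space_axioms)
    show "(\<lambda>k. \<integral>\<omega>. (\<Prod>i<N. clock_code k \<omega> i ^ e i) \<partial>annealed \<beta> \<pi>)
        \<longlonglongrightarrow> (\<integral>\<omega>. (\<Prod>i<N. exp (- Y \<omega> (dyad i)) ^ e i) \<partial>M)" for N e
      unfolding S.exp_moments by (rule clock_code_moments)
    show "(\<lambda>\<omega>. walk_error (n k) (snd \<omega>)) \<in> borel_measurable (annealed \<beta> \<pi>)" for k
      by (rule measurable_ann_W[OF measurable_walk_error])
    show "0 \<le> walk_error (n k) (snd \<omega>)" "walk_error (n k) (snd \<omega>) \<le> 1" for k \<omega>
      unfolding walk_error_def by (rule walk_error_terms)+
    have "(\<integral>\<omega>. walk_error (n k) (snd \<omega>) \<partial>annealed \<beta> \<pi>) = (\<integral>\<xi>. walk_error (n k) \<xi> \<partial>W)" for k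
      using integral_distr[OF measurable_ann_W[OF measurable_ident] measurable_walk_error[of "n k"]]
      by (simp add: distr_annealed_snd id_def)
    then show "(\<lambda>k. \<integral>\<omega>. walk_error (n k) (snd \<omega>) \<partial>annealed \<beta> \<pi>) \<longlonglongrightarrow> 0"
      using walk_error_tendsto[OF n_top] by simp
    show "(\<lambda>\<omega>. h (rescaled (n k) (a k) \<omega>)) \<in> borel_measurable (annealed \<beta> \<pi>)" for k
      by (rule measurable_compose[OF measurable_rescaled h(1)])
    show "(\<lambda>\<omega>. h (Y \<omega>, \<lambda>t. \<upsilon> * cont_inv (Y \<omega>) t)) \<in> borel_measurable M"
      by (rule measurable_compose[OF mZ h(1)])
    show "AE \<omega> in annealed \<beta> \<pi>. good_env \<omega>" by (rule AE_good_env)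
    show "AE \<omega> in M. \<omega> \<in> space M \<and> increasing_path (Y \<omega>)" using S.AE_increasing_path AE_space by eventually_elim blast
    show "(\<lambda>j. h (rescaled (n (q j)) (a (q j)) (w j))) \<longlonglongrightarrow> h (Y v, \<lambda>t. \<upsilon> * cont_inv (Y v) t)"
      if v: "v \<in> space M \<and> increasing_path (Y v)" and q: "\<And>j. j \<le> q j" and g: "\<And>j. good_env (w j)"
        and A: "(\<lambda>j. clock_code (q j) (w j)) \<longlonglongrightarrow> (\<lambda>i. exp (- Y v (dyad i)))"
        and e: "(\<lambda>j. walk_error (n (q j)) (snd (w j))) \<longlonglongrightarrow> 0" for q w v
    proof (rule rescaled_tendsto[OF q g _ _ _ e h(3)])
      show "(\<lambda>j. clock_code (q j) (w j) i) \<longlonglongrightarrow> exp (- Y v (dyad i))" for i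
        using continuous_on_tendsto_compose[OF continuous_on_product_coordinates[of i] A] by simp
    qed (use v S.S_cadlag in auto)
  qed (rule B)+
qed

end

section \<open>Scaling of the exponent\<close>

lemma levy_laplace_cong:
  assumes "\<And>lam. 0 < lam \<Longrightarrow> \<psi> lam = \<phi> lam"
  shows "levy_laplace M S \<psi> \<longleftrightarrow> levy_laplace M S \<phi>"
  using assms by (simp add: levy_laplace_def)

text \<open>Along multiples of n the limit is divided by the multiplier, while regular variation of
  \<open>a\<close> rescales the argument. Comparing multipliers p and q ties the values at x and y
  whenever their ratio to the power \<alpha> is compared with a rational.\<close>

lemma (in rtrw_env) regularly_varying_scaling:
  fixes a f :: "_ \<Rightarrow> real"
  assumes \<alpha>: "0 < \<alpha>" and a: "\<And>n. 0 < n \<Longrightarrow> 0 < a n"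
    and ratio: "\<And>p. 0 < p \<Longrightarrow> (\<lambda>n. a (p * n) / a n) \<longlonglongrightarrow> real p powr (1 / \<alpha>)"
    and lim: "\<And>lam. 0 < lam \<Longrightarrow> (\<lambda>n. - real n * ln (laplace_moment \<pi> (a n) lam l)) \<longlonglongrightarrow> f lam"
    and f: "\<And>lam. 0 < lam \<Longrightarrow> 0 \<le> f lam" and lam: "0 < lam"
  shows "f lam = f 1 * lam powr \<alpha>"
proof -
  have multiple: "(\<lambda>n. - real n * ln (lapm (lam / a (p * n)) l)) \<longlonglongrightarrow> f lam / real p" if "0 < p" "0 < lam" for p lam
  proof -
    have "filterlim (\<lambda>n. p * n) sequentially sequentially"
      by (rule filterlim_subseq) (use that in \<open>auto simp: strict_mono_def\<close>)
    from filterlim_compose[OF lim[OF that(2)] this]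
    have "(\<lambda>n. - real (p * n) * ln (lapm (lam / a (p * n)) l) / real p) \<longlonglongrightarrow> f lam / real p"
      unfolding laplace_moment_eq lapm_def using that by (intro tendsto_divide tendsto_const) auto
    then show ?thesis using that by simp
  qed
  \<comment> \<open>The strict inequality says that \<open>x / a (p * n) < y / a (q * n)\<close> for
    large \<open>n\<close>; the transform is decreasing, and the limits along \<open>p * n\<close>
    and \<open>q * n\<close> are \<open>f x / p\<close> and \<open>f y / q\<close>.\<close>
  have compare: "f x * real q \<le> f y * real p" if xy: "0 < x" "0 < y" and pq: "0 < p" "0 < q" and less: "x powr \<alpha> * real q < y powr \<alpha> * real p" for x y p q
  proof -
    have "(x powr \<alpha> * real q) powr (1 / \<alpha>) < (y powr \<alpha> * real p) powr (1 / \<alpha>)"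
      using less xy pq \<alpha> by (intro powr_less_mono2) auto
    then have "x * real q powr (1 / \<alpha>) < y * real p powr (1 / \<alpha>)"
      using xy pq \<alpha> by (simp add: powr_mult powr_powr)
    moreover have "(\<lambda>n. y * (a (p * n) / a n) - x * (a (q * n) / a n)) \<longlonglongrightarrow> y * real p powr (1 / \<alpha>) - x * real q powr (1 / \<alpha>)"
      by (intro tendsto_diff tendsto_mult tendsto_const ratio pq)
    ultimately have "\<forall>\<^sub>F n in sequentially. 0 < y * (a (p * n) / a n) - x * (a (q * n) / a n)"
      by (intro order_tendstoD(1)) auto
    then have ev: "\<forall>\<^sub>F n in sequentially. - real n * ln (lapm (x / a (p * n)) l) \<le> - real n * ln (lapm (y / a (q * n)) l)"
      using eventually_gt_at_top[of 0]
    proof eventually_elim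
      case (elim n)
      have pos: "0 < a n" "0 < a (p * n)" "0 < a (q * n)" using elim pq by (auto intro!: a)
      have "x * a (q * n) / a n < y * a (p * n) / a n" using elim(1) by simp
      then have "x * a (q * n) < y * a (p * n)" using pos(1) by (simp add: divide_less_cancel)
      then have "x / a (p * n) \<le> y / a (q * n)" using pos by (simp add: divide_simps mult.commute)
      then have "lapm (y / a (q * n)) l \<le> lapm (x / a (p * n)) l" using pos xy by (intro lapm_antimono) auto
      moreover have "0 < lapm (y / a (q * n)) l" using pos xy by (intro lapm_pos) auto
      ultimately show ?case by (simp add: mult_left_mono)
    qed
    have "f x / real p \<le> f y / real q"
      using tendsto_le[OF _ multiple multiple ev] xy pq by simp
    then show ?thesis using pq by (simp add: field_simps)
  qed
  have half: "f x * y powr \<alpha> \<le> f y * x powr \<alpha>" if xy: "0 < x" "0 < y" for x y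
  proof -
    define X Y where "X = x powr \<alpha>" and "Y = y powr \<alpha>"
    have XY: "0 < X" "0 < Y" using xy by (auto simp: X_def Y_def)
    have "f x * Y \<le> f y * X + f y * Y / real (Suc n)" for n
    proof -
      \<comment> \<open>\<open>?p\<close> is the least integer above \<open>X * ?q / Y\<close>, so
        \<open>?p / ?q\<close> exceeds \<open>X / Y\<close> by at most \<open>1 / ?q\<close>, an
        error that disappears as \<open>n\<close> grows.\<close>
      let ?q = "Suc n" let ?p = "nat \<lfloor>X * real ?q / Y\<rfloor> + 1"
      have p: "X * real ?q / Y < real ?p" "real ?p \<le> X * real ?q / Y + 1" using XY by (simp_all add: floor_less_iff) linarith+
      then have "X * real ?q < Y * real ?p" using XY by (simp add: divide_less_eq mult.commute)
      then have "f x * real ?q \<le> f y * real ?p" by (intro compare xy) (auto simp: X_def Y_def)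
      also have "\<dots> \<le> f y * (X * real ?q / Y + 1)" by (intro mult_left_mono p f xy)
      finally have "f x * real ?q * (Y / real ?q) \<le> f y * (X * real ?q / Y + 1) * (Y / real ?q)"
        using XY by (intro mult_right_mono) auto
      moreover have "f y * (X * real ?q / Y + 1) * (Y / real ?q) = f y * X + f y * Y / real ?q"
        using XY by (simp add: field_simps del: of_nat_Suc)
      ultimately show ?thesis by simp
    qed
    moreover have "(\<lambda>n. f y * X + f y * Y / real (Suc n)) \<longlonglongrightarrow> f y * X + 0"
      by (intro tendsto_add tendsto_const LIMSEQ_Suc[OF lim_const_over_n])
    ultimately have "f x * Y \<le> f y * X + 0" by (intro tendsto_lowerbound[where F = sequentially]) auto
    then show ?thesis by (simp add: X_def Y_def)
  qed
  show ?thesis using half[OF lam, of 1] half[of 1, OF _ lam] by simp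
qed

context rtrw_stable_limit
begin

lemma Psi_eq_f: "0 < c \<Longrightarrow> Psi c = \<upsilon>\<^sup>2 * (\<Sum>j. f (Suc j) c * (1 - \<upsilon>) ^ j)"
  by (simp add: Psi_eq F_def \<upsilon>_eq)

lemma stable_subordinator_levy:
  assumes levy: "levy_laplace M Y Psi"
    and f: "\<And>l lam. 1 \<le> l \<Longrightarrow> 0 < lam \<Longrightarrow> f l lam = f l 1 * lam powr \<alpha>"
  shows "stable_subordinator \<alpha> M Y"
proof -
  interpret S: levy_subordinator M Y Psi by unfold_locales (use levy Psi_top in auto)
  have "Psi lam = Psi 1 * lam powr \<alpha>" if "0 < lam" for lam
  proof -
    have s: "summable (\<lambda>j. r ^ j * f (Suc j) 1)" using summable_F[of 1] by (simp add: F_def)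
    have "(\<Sum>j. F (Suc j) lam * r ^ j) = (\<Sum>j. lam powr \<alpha> * (r ^ j * f (Suc j) 1))"
      using f[OF _ that] that by (intro suminf_cong) (simp add: F_def mult_ac)
    also have "\<dots> = lam powr \<alpha> * (\<Sum>j. F (Suc j) 1 * r ^ j)"
      by (subst suminf_mult[OF s]) (simp add: F_def mult.commute)
    finally show ?thesis using that by (simp add: Psi_eq)
  qed
  then have "levy_laplace M Y (\<lambda>lam. Psi 1 * lam powr \<alpha>)"
    using levy levy_laplace_cong[of Psi "\<lambda>lam. Psi 1 * lam powr \<alpha>"] by blast
  moreover have "AE \<omega> in M. mono_on {0..} (Y \<omega>)"
    using S.AE_increasing_path by eventually_elim (rule increasing_path.s_mono)
  ultimately show ?thesis using Psi_pos[OF zero_less_one] unfolding stable_subordinator_def by blast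
qed

end

lemma slowly_varying_ratio:
  assumes L: "slowly_varying L" and "0 < \<alpha>" "0 < p"
  shows "(\<lambda>n. (real (p * n) powr (1 / \<alpha>) * L (real (p * n))) / (real n powr (1 / \<alpha>) * L (real n))) \<longlonglongrightarrow> real p powr (1 / \<alpha>)"
proof (rule Lim_transform_eventually)
  have "((\<lambda>x. L (real p * x) / L x) \<longlongrightarrow> 1) at_top" using L \<open>0 < p\<close> by (simp add: slowly_varying_def)
  from filterlim_compose[OF this filterlim_real_sequentially]
  have "(\<lambda>n. real p powr (1 / \<alpha>) * (L (real p * real n) / L (real n))) \<longlonglongrightarrow> real p powr (1 / \<alpha>) * 1"
    by (intro tendsto_mult tendsto_const)
  then show "(\<lambda>n. real p powr (1 / \<alpha>) * (L (real p * real n) / L (real n))) \<longlonglongrightarrow> real p powr (1 / \<alpha>)" by simp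
  show "\<forall>\<^sub>F n in sequentially. real p powr (1 / \<alpha>) * (L (real p * real n) / L (real n)) =
      (real (p * n) powr (1 / \<alpha>) * L (real (p * n))) / (real n powr (1 / \<alpha>) * L (real n))"
    using eventually_gt_at_top[of 0] by eventually_elim (simp add: powr_mult)
qed

text \<open>The convergence clause speaks of every process with the given exponent; the existence
  clause, proved on a concrete path space, keeps it from being vacuous.\<close>

theorem theorem1:
  fixes \<beta> \<alpha> :: real and f :: "nat \<Rightarrow> real \<Rightarrow> real" and \<pi> :: "real measure measure"
    and L :: "real \<Rightarrow> real" and nk :: "nat \<Rightarrow> nat"
  defines "\<upsilon> \<equiv> (\<beta> - 1) / (\<beta> + 1)"
    and "a \<equiv> (\<lambda>n::nat. real n powr (1 / \<alpha>) * L (real n))"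
    and "\<psi> \<equiv> (\<lambda>lam. ((\<beta> - 1) / (\<beta> + 1))\<^sup>2 * (\<Sum>l. f (Suc l) lam * (1 - (\<beta> - 1) / (\<beta> + 1)) ^ l))"
  assumes "\<beta> > 1" and "0 < \<alpha>" and "\<alpha> < 1"
    and "sets \<pi> = sets (prob_algebra borel)" and "prob_space \<pi>"
    and "AE \<mu> in \<pi>. emeasure \<mu> {..0} = 0"
    and "\<exists>c C. 0 < c \<and> 0 < C \<and> (\<forall>lam>0. c * lam powr \<alpha> \<le> f 1 lam \<and> f 1 lam \<le> C * lam powr \<alpha>)"
    and "slowly_varying L"
    and "strict_mono nk"
    and "\<forall>l\<ge>1. \<forall>lam>0.
           (\<lambda>k. - real (nk k) * ln (laplace_moment \<pi> (a (nk k)) lam l)) \<longlonglongrightarrow> f l lam"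
  shows "(\<exists>(M :: (nat \<Rightarrow> real) measure) S. levy_laplace M S \<psi>)
    \<and> (\<forall>(M :: (nat \<Rightarrow> real) measure) S. levy_laplace M S \<psi> \<longrightarrow>
         conv_dist_M1U (\<lambda>k. annealed \<beta> \<pi>) (\<lambda>k. rescaled (nk k) (a (nk k)))
           M (\<lambda>\<omega>. (S \<omega>, \<lambda>t. \<upsilon> * cont_inv (S \<omega>) t)))
    \<and> ((\<forall>l\<ge>1. \<forall>lam>0.
           (\<lambda>n. - real n * ln (laplace_moment \<pi> (a n) lam l)) \<longlonglongrightarrow> f l lam) \<longrightarrow>
         (\<exists>g :: nat \<Rightarrow> real. (\<exists>l\<ge>1. g l \<noteq> 0) \<and> (\<forall>l\<ge>1. \<forall>lam>0. f l lam = g l * lam powr \<alpha>))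
         \<and> (\<forall>(M :: (nat \<Rightarrow> real) measure) S. levy_laplace M S \<psi> \<longrightarrow> stable_subordinator \<alpha> M S))"
proof -
  obtain c C where c: "0 < c" and fc: "\<And>lam. 0 < lam \<Longrightarrow> c * lam powr \<alpha> \<le> f 1 lam"
    "\<And>lam. 0 < lam \<Longrightarrow> f 1 lam \<le> C * lam powr \<alpha>"
    using assms(10) by blast
  have L: "0 < x \<Longrightarrow> 0 < L x" for x using \<open>slowly_varying L\<close> by (simp add: slowly_varying_def)
  have a_pos: "0 < a n" if "0 < n" for n using that L[of "real n"] by (simp add: a_def)
  \<comment> \<open>\<open>nk 0\<close> may be 0, where \<open>a\<close> vanishes; the locale asks
    for positive indices throughout and is therefore instantiated along
    \<open>Suc k\<close>.\<close>
  have nk: "0 < nk (Suc k)" for k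
    using strict_mono_less[OF \<open>strict_mono nk\<close>, of 0 "Suc k"] by linarith
  have "rtrw_env \<beta> \<pi>"
    by (intro rtrw_env.intro biased_walk.intro trap_env.intro) fact+
  then have "rtrw_limit \<beta> \<pi> (\<lambda>k. nk (Suc k)) (\<lambda>k. a (nk (Suc k))) f"
  proof (intro rtrw_limit.intro rtrw_limit_axioms.intro nk a_pos)
    show "filterlim (\<lambda>k. nk (Suc k)) at_top sequentially"
      using filterlim_subseq[OF \<open>strict_mono nk\<close>] by (simp add: filterlim_sequentially_Suc)
    show "(\<lambda>k. - real (nk (Suc k)) * ln (laplace_moment \<pi> (a (nk (Suc k))) lam l)) \<longlonglongrightarrow> f l lam"
      if "1 \<le> l" "0 < lam" for l lam
      using assms(13) that by (intro LIMSEQ_Suc[where f = "\<lambda>k. - real (nk k) * ln (laplace_moment \<pi> (a (nk k)) lam l)"]) blast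
  qed
  then interpret R: rtrw_stable_limit \<beta> \<pi> "\<lambda>k. nk (Suc k)" "\<lambda>k. a (nk (Suc k))" f \<alpha> c C
    by (rule rtrw_stable_limit.intro) (intro rtrw_stable_limit_axioms.intro \<open>0 < \<alpha>\<close> c fc)
  have \<upsilon>: "R.\<upsilon> = \<upsilon>" by (simp add: R.\<upsilon>_def \<upsilon>_def)
  have "R.Psi lam = \<psi> lam" if "0 < lam" for lam using R.Psi_eq_f[OF that] by (simp add: \<upsilon> \<psi>_def \<upsilon>_def)
  then have levy: "levy_laplace M S \<psi> \<longleftrightarrow> levy_laplace M S R.Psi" for M :: "(nat \<Rightarrow> real) measure" and S
    by (intro levy_laplace_cong) simp
  \<comment> \<open>Dropping the first index does not change limits, so the shifted convergence
    gives back the original one.\<close>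
  have conv: "conv_dist_M1U (\<lambda>k. annealed \<beta> \<pi>) (\<lambda>k. rescaled (nk k) (a (nk k))) M (\<lambda>\<omega>. (S \<omega>, \<lambda>t. \<upsilon> * cont_inv (S \<omega>) t))"
    if "levy_laplace M S \<psi>" for M :: "(nat \<Rightarrow> real) measure" and S
    using R.rescaled_conv_dist[OF that[unfolded levy]] unfolding conv_dist_M1U_def \<upsilon>
    by (blast intro: LIMSEQ_imp_Suc)
  have full: "f l lam = f l 1 * lam powr \<alpha>" if l: "1 \<le> l" and lam: "0 < lam"
    and lim: "\<forall>l\<ge>1. \<forall>lam>0. (\<lambda>n. - real n * ln (laplace_moment \<pi> (a n) lam l)) \<longlonglongrightarrow> f l lam" for l lam
  proof (rule R.regularly_varying_scaling[OF \<open>0 < \<alpha>\<close> a_pos _ _ _ lam])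
    show "(\<lambda>n. a (p * n) / a n) \<longlonglongrightarrow> real p powr (1 / \<alpha>)" if "0 < p" for p
      unfolding a_def by (rule slowly_varying_ratio) (use assms that in auto)
    show "0 \<le> f l x" if "0 < x" for x using R.F_bounds(1)[of x l] that l by (simp add: R.F_def)
  qed (use lim l in auto)
  have "f 1 1 \<noteq> 0" using fc(1)[of 1] c by simp
  have "\<exists>g. (\<exists>l\<ge>1. g l \<noteq> 0) \<and> (\<forall>l\<ge>1. \<forall>lam>0. f l lam = g l * lam powr \<alpha>)"
    if "\<forall>l\<ge>1. \<forall>lam>0. (\<lambda>n. - real n * ln (laplace_moment \<pi> (a n) lam l)) \<longlonglongrightarrow> f l lam"
    by (intro exI[of _ "\<lambda>l. f l 1"] conjI exI[of _ 1] allI impI full that \<open>f 1 1 \<noteq> 0\<close> order_refl)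
  moreover have "\<exists>(M :: (nat \<Rightarrow> real) measure) S. levy_laplace M S \<psi>"
    unfolding levy by (rule R.levy_laplace_exists[OF \<open>0 < \<alpha>\<close> fc(2)])
  moreover have "stable_subordinator \<alpha> M S" if "levy_laplace M S \<psi>"
    "\<forall>l\<ge>1. \<forall>lam>0. (\<lambda>n. - real n * ln (laplace_moment \<pi> (a n) lam l)) \<longlonglongrightarrow> f l lam" for M :: "(nat \<Rightarrow> real) measure" and S
    using R.stable_subordinator_levy[OF that(1)[unfolded levy]] full[OF _ _ that(2)] by blast
  ultimately show ?thesis using conv by blast
qed

end
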